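(* Assume (NE), and for $\sharp\in\{cy,ra\}$ assume (ER$\sharp$). Fix an arbitrary $\boldsymbol\zeta\in\mathbb R^M$ and write $r^\sharp=r^\sharp_{\boldsymbol\zeta}$, $\rho^\sharp_+=\rho^\sharp_{+,\boldsymbol\zeta}$, with all maps and fluxes taken at $\boldsymbol\zeta$, and $\rho^\sharp_+(X)=\mathrm{Tr}(\rho^\sharp_+X)$. Then: 1) for all $j$, $\partial_{\alpha_j}r^{cy}(\alpha)|_{\alpha=0}=\beta_jT\rho^{cy}_+(\Phi^{cy}_j)$ and $\partial_{\alpha_j}r^{ra}(\alpha)|_{\alpha=0}=\beta_j\frac TM\rho^{ra}_+(\Phi_j)$; 2) for all $j,k$, $$\partial_{\alpha_k}\partial_{\alpha_j}r^{cy}(\alpha)|_{\alpha=0}=\beta_j\beta_kT^2\sum_{n=0}^\infty\rho^{cy}_+\Big(\varphi^{cy}_j\circ(\mathcal L_{cy}^* )^n\big(\Phi^{cy}_k-\rho^{cy}_+(\Phi^{cy}_k)\big)+\varphi^{cy}_k\circ(\mathcal L_{cy}^* )^n\big(\Phi^{cy}_j-\rho^{cy}_+(\Phi^{cy}_j)\big)\Big)$$ $$+\delta_{k>j}\beta_j\beta_kT^2\rho^{cy}_+\big(\mathcal L_1^*\circ\cdots\circ\mathcal L_{j-1}^*\circ\varphi_j\circ\mathcal L_{j+1}^*\circ\cdots\circ\mathcal L_{k-1}^*(\Phi_k)\big)+\delta_{j>k}\beta_j\beta_kT^2\rho^{cy}_+\big(\mathcal L_1^*\circ\cdots\circ\mathcal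 L_{k-1}^*\circ\varphi_k\circ\mathcal L_{k+1}^*\circ\cdots\circ\mathcal L_{j-1}^*(\Phi_j)\big)$$ $$+\delta_{jk}\beta_j^2T\rho^{cy}_+\big(\mathcal L_1^*\circ\cdots\circ\mathcal L_{j-1}^*(\mathcal D_j(H'_{\mathcal S},H'_{\mathcal S}))\big),$$ and $$\partial_{\alpha_k}\partial_{\alpha_j}r^{ra}(\alpha)|_{\alpha=0}=\beta_j\beta_k\Big(\frac TM\Big)^2\sum_{n=0}^\infty\rho^{ra}_+\Big(\varphi_j\circ(\mathcal L_{ra}^* )^n\big(\Phi_k-\rho^{ra}_+(\Phi_k)\big)+\varphi_k\circ(\mathcal L_{ra}^* )^n\big(\Phi_j-\rho^{ra}_+(\Phi_j)\big)\Big)+\delta_{jk}\beta_j^2\frac TM\rho^{ra}_+\big(\mathcal D_j(H'_{\mathcal S},H'_{\mathcal S})\big).$$ Here constants $c$ inside operator arguments stand for $c\,\mathrm{Id}$.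
   Context: Setting: finite-dimensional $\mathcal H_{\mathcal S},\mathcal H_{\mathcal E_j}$ ($j=1..M$, $M\ge2$), self-adjoint $H_{\mathcal S},H_{\mathcal E_j}$, self-adjoint $V_j$ on $\mathcal H_{\mathcal S}\otimes\mathcal H_{\mathcal E_j}$, $\tau_j>0$, $T=\sum_j\tau_j$, $U_j=e^{-i\tau_j(H_{\mathcal S}\otimes\mathrm{Id}+\mathrm{Id}\otimes H_{\mathcal E_j}+V_j)}$. Fix $\beta_{\rm ref}>0$; for $\boldsymbol\zeta\in\mathbb R^M$, $\beta_j=\beta_{\rm ref}-\zeta_j$, $\rho_{\mathcal E_j}$ the Gibbs state of $H_{\mathcal E_j}$ at $\beta_j$; $\mathcal L_j(\rho)=\mathrm{Tr}_{\mathcal H_{\mathcal E_j}}(U_j(\rho\otimes\rho_{\mathcal E_j})U_j^* )$ with dual $\mathcal L_j^*(X)=\mathrm{Tr}_{\mathcal H_{\mathcal E_j}}((\mathrm{Id}\otimes\rho_{\mathcal E_j})U_j^*(X\otimes\mathrm{Id})U_j)$; $\mathcal L_{cy}=\mathcal L_M\circ\cdots\circ\mathcal L_1$, $\mathcal L_{ra}=\frac1M\sum_j\mathcal L_j$. Primitive: for some $n$, products of $n$ Kraus operators span all operators. (ER$\sharp$): $\mathcal L_{\sharp,\boldsymbol\zeta}$ primitive for some $\boldsymbol\zeta$; $\rho^\sharp_{+,\boldsymbol\zeta}$ is then its unique invariant state. (NE): there is $\zeta\mapsto\rho_{+,\zeta}$ (states) with $U_j(\rho_{+,\zeta}\otimes\rho_{\mathcal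 E_j,\zeta})U_j^*=\rho_{+,\zeta}\otimes\rho_{\mathcal E_j,\zeta}$ for all $j$, $\zeta\in\mathbb R$ ($\rho_{\mathcal E_j,\zeta}$ Gibbs at $\beta_{\rm ref}-\zeta$); $H'_{\mathcal S}=-\beta_{\rm ref}^{-1}\log\rho_{+,0}$. Fluxes $\Phi_j=-\frac1T\mathrm{Tr}_{\mathcal H_{\mathcal E_j}}\big((\mathrm{Id}\otimes\rho_{\mathcal E_j})(U_j^*(\mathrm{Id}\otimes H_{\mathcal E_j})U_j-\mathrm{Id}\otimes H_{\mathcal E_j})\big)$, $\Phi^{cy}_j=\mathcal L_1^*\circ\cdots\circ\mathcal L_{j-1}^*(\Phi_j)$. Maps $\varphi_j(X)=\frac1T(\mathcal L_j^*(XH'_{\mathcal S})-\mathcal L_j^*(X)H'_{\mathcal S})$, $\varphi^{cy}_j=\mathcal L_1^*\circ\cdots\circ\mathcal L_{j-1}^*\circ\varphi_j\circ\mathcal L_{j+1}^*\circ\cdots\circ\mathcal L_M^*$. Dissipation $\mathcal D_j(X,Y)=\frac1T(\mathcal L_j^*(X^*Y)-\mathcal L_j^*(X^* )Y-X^*\mathcal L_j^*(Y)+X^*Y)$. Deformed maps $\mathcal L_j^{[\alpha]*}(X)=\mathrm{Tr}_{\mathcal H_{\mathcal E_j}}((\mathrm{Id}\otimes\rho_{\mathcal E_j}^{1-\alpha_j})U_j^*(X\otimes\rho_{\mathcal E_j}^{\alpha_j})U_j)$, $\mathcal L_{cy}^{[\alpha]*}=\mathcal L_1^{[\alpha]*}\circ\cdots\circ\mathcal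 L_M^{[\alpha]*}$, $\mathcal L_{ra}^{[\alpha]*}=\frac1M\sum_j\mathcal L_j^{[\alpha]*}$; $r^\sharp_{\boldsymbol\zeta}(\alpha)$ is the spectral radius of $\mathcal L_{\sharp,\boldsymbol\zeta}^{[\alpha]*}$. *)

theory Defs
  imports Complex_Main "HOL-Analysis.Derivative" "Jordan_Normal_Form.Matrix"
begin

definition mtrace :: "complex mat \<Rightarrow> complex" where
  "mtrace A = (\<Sum>i<dim_row A. A $$ (i,i))"

definition adj :: "complex mat \<Rightarrow> complex mat" where
  "adj A = mat (dim_col A) (dim_row A) (\<lambda>(i,j). cnj (A $$ (j,i)))"

definition hermitian_mat :: "nat \<Rightarrow> complex mat \<Rightarrow> bool" where
  "hermitian_mat d A \<longleftrightarrow> A \<in> carrier_mat d d \<and> adj A = A"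

text \<open>Tensor (Kronecker) product; index (i,k) of C^a (x) C^b is encoded as i*b+k.\<close>
definition kron :: "complex mat \<Rightarrow> complex mat \<Rightarrow> complex mat" where
  "kron A B = mat (dim_row A * dim_row B) (dim_col A * dim_col B)
     (\<lambda>(i,j). A $$ (i div dim_row B, j div dim_col B) * B $$ (i mod dim_row B, j mod dim_col B))"

definition ptrace2 :: "nat \<Rightarrow> complex mat \<Rightarrow> complex mat" where
  "ptrace2 e C = mat (dim_row C div e) (dim_col C div e)
     (\<lambda>(i,j). \<Sum>k<e. C $$ (i*e+k, j*e+k))"

definition matexp :: "complex mat \<Rightarrow> complex mat" where
  "matexp A = mat (dim_row A) (dim_col A)
     (\<lambda>(i,j). \<Sum>k. (A ^\<^sub>m k) $$ (i,j) / of_nat (fact k))"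

text \<open>Logarithm of a positive definite matrix: the unique self-adjoint L with exp L = rho.\<close>
definition matlog :: "nat \<Rightarrow> complex mat \<Rightarrow> complex mat" where
  "matlog d \<rho> = (THE L. hermitian_mat d L \<and> matexp L = \<rho>)"

definition mat_rpow :: "nat \<Rightarrow> complex mat \<Rightarrow> real \<Rightarrow> complex mat" where
  "mat_rpow d \<rho> a = matexp (complex_of_real a \<cdot>\<^sub>m matlog d \<rho>)"

definition gibbs :: "real \<Rightarrow> complex mat \<Rightarrow> complex mat" where
  "gibbs \<beta> H = (1 / mtrace (matexp (complex_of_real (-\<beta>) \<cdot>\<^sub>m H)))
                  \<cdot>\<^sub>m matexp (complex_of_real (-\<beta>) \<cdot>\<^sub>m H)"

definition is_state :: "nat \<Rightarrow> complex mat \<Rightarrow> bool" where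
  "is_state d \<rho> \<longleftrightarrow> hermitian_mat d \<rho> \<and> mtrace \<rho> = 1 \<and>
     (\<forall>v :: nat \<Rightarrow> complex. let q = (\<Sum>i<d. \<Sum>j<d. cnj (v i) * \<rho> $$ (i,j) * v j)
        in Im q = 0 \<and> Re q \<ge> 0)"

definition msum :: "nat \<Rightarrow> (nat \<Rightarrow> complex mat) \<Rightarrow> nat list \<Rightarrow> complex mat" where
  "msum d F js = foldr (\<lambda>j A. F j + A) js (0\<^sub>m d d)"

definition spec_rad :: "nat \<Rightarrow> (complex mat \<Rightarrow> complex mat) \<Rightarrow> real" where
  "spec_rad d L = Max {cmod l | l. \<exists>X \<in> carrier_mat d d. X \<noteq> 0\<^sub>m d d \<and> L X = l \<cdot>\<^sub>m X}"

definition is_kraus :: "nat \<Rightarrow> (complex mat \<Rightarrow> complex mat) \<Rightarrow> complex mat list \<Rightarrow> bool" where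
  "is_kraus d L Ks \<longleftrightarrow> set Ks \<subseteq> carrier_mat d d \<and>
     (\<forall>\<rho> \<in> carrier_mat d d. L \<rho> = foldr (\<lambda>K A. K * \<rho> * adj K + A) Ks (0\<^sub>m d d))"

definition kprod :: "nat \<Rightarrow> complex mat list \<Rightarrow> nat list \<Rightarrow> complex mat" where
  "kprod d Ks w = foldr (\<lambda>i P. Ks ! i * P) w (1\<^sub>m d)"

definition primitive :: "nat \<Rightarrow> (complex mat \<Rightarrow> complex mat) \<Rightarrow> bool" where
  "primitive d L \<longleftrightarrow> (\<exists>Ks. is_kraus d L Ks \<and> (\<exists>n.
     \<forall>A \<in> carrier_mat d d. \<exists>c :: nat list \<Rightarrow> complex. \<forall>i<d. \<forall>j<d.
       A $$ (i,j) = (\<Sum>w \<in> {w. length w = n \<and> set w \<subseteq> {..<length Ks}}. c w * kprod d Ks w $$ (i,j))))"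

text \<open>The unique invariant state (meaningful when it is unique).\<close>
definition inv_state :: "nat \<Rightarrow> (complex mat \<Rightarrow> complex mat) \<Rightarrow> complex mat" where
  "inv_state d L = (THE \<rho>. is_state d \<rho> \<and> L \<rho> = \<rho>)"

record qsys =
  sdim :: nat
  edim :: "nat \<Rightarrow> nat"
  hamS :: "complex mat"
  hamE :: "nat \<Rightarrow> complex mat"
  coupl :: "nat \<Rightarrow> complex mat"
  tau :: "nat \<Rightarrow> real"
  nenv :: nat                      \<comment> \<open>M; environments indexed 1..M\<close>
  beta_ref :: real

definition well_formed :: "qsys \<Rightarrow> bool" where
  "well_formed S \<longleftrightarrow> nenv S \<ge> 2 \<and> sdim S > 0 \<and> beta_ref S > 0 \<and>
     hermitian_mat (sdim S) (hamS S) \<and>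
     (\<forall>j \<in> {1..nenv S}. edim S j > 0 \<and> hermitian_mat (edim S j) (hamE S j) \<and>
        hermitian_mat (sdim S * edim S j) (coupl S j) \<and> tau S j > 0)"

definition Ttot :: "qsys \<Rightarrow> real" where
  "Ttot S = (\<Sum>j=1..nenv S. tau S j)"

definition Uj :: "qsys \<Rightarrow> nat \<Rightarrow> complex mat" where
  "Uj S j = matexp ((- \<i> * complex_of_real (tau S j)) \<cdot>\<^sub>m
      (kron (hamS S) (1\<^sub>m (edim S j)) + kron (1\<^sub>m (sdim S)) (hamE S j) + coupl S j))"

definition betaj :: "qsys \<Rightarrow> (nat \<Rightarrow> real) \<Rightarrow> nat \<Rightarrow> real" where
  "betaj S \<zeta> j = beta_ref S - \<zeta> j"

definition rhoE :: "qsys \<Rightarrow> (nat \<Rightarrow> real) \<Rightarrow> nat \<Rightarrow> complex mat" where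
  "rhoE S \<zeta> j = gibbs (betaj S \<zeta> j) (hamE S j)"

definition Lj :: "qsys \<Rightarrow> (nat \<Rightarrow> real) \<Rightarrow> nat \<Rightarrow> complex mat \<Rightarrow> complex mat" where
  "Lj S \<zeta> j \<rho> = ptrace2 (edim S j) (Uj S j * kron \<rho> (rhoE S \<zeta> j) * adj (Uj S j))"

definition Ljd :: "qsys \<Rightarrow> (nat \<Rightarrow> real) \<Rightarrow> nat \<Rightarrow> complex mat \<Rightarrow> complex mat" where
  "Ljd S \<zeta> j X = ptrace2 (edim S j)
     (kron (1\<^sub>m (sdim S)) (rhoE S \<zeta> j) * adj (Uj S j) * kron X (1\<^sub>m (edim S j)) * Uj S j)"

definition Ljd_def :: "qsys \<Rightarrow> (nat \<Rightarrow> real) \<Rightarrow> real \<Rightarrow> nat \<Rightarrow> complex mat \<Rightarrow> complex mat" where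
  "Ljd_def S \<zeta> a j X = ptrace2 (edim S j)
     (kron (1\<^sub>m (sdim S)) (mat_rpow (edim S j) (rhoE S \<zeta> j) (1 - a)) * adj (Uj S j)
      * kron X (mat_rpow (edim S j) (rhoE S \<zeta> j) a) * Uj S j)"

definition Lcy :: "qsys \<Rightarrow> (nat \<Rightarrow> real) \<Rightarrow> complex mat \<Rightarrow> complex mat" where
  "Lcy S \<zeta> = foldr (\<lambda>j g. g \<circ> Lj S \<zeta> j) [1..<nenv S + 1] id"

definition Lra :: "qsys \<Rightarrow> (nat \<Rightarrow> real) \<Rightarrow> complex mat \<Rightarrow> complex mat" where
  "Lra S \<zeta> \<rho> = (1 / of_nat (nenv S)) \<cdot>\<^sub>m msum (sdim S) (\<lambda>j. Lj S \<zeta> j \<rho>) [1..<nenv S + 1]"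

definition compL :: "qsys \<Rightarrow> (nat \<Rightarrow> real) \<Rightarrow> nat \<Rightarrow> nat \<Rightarrow> complex mat \<Rightarrow> complex mat" where
  "compL S \<zeta> a b = foldr (\<lambda>j g. Ljd S \<zeta> j \<circ> g) [a..<b] id"

definition Lcy_dual :: "qsys \<Rightarrow> (nat \<Rightarrow> real) \<Rightarrow> complex mat \<Rightarrow> complex mat" where
  "Lcy_dual S \<zeta> = compL S \<zeta> 1 (nenv S + 1)"

definition Lra_dual :: "qsys \<Rightarrow> (nat \<Rightarrow> real) \<Rightarrow> complex mat \<Rightarrow> complex mat" where
  "Lra_dual S \<zeta> X = (1 / of_nat (nenv S)) \<cdot>\<^sub>m msum (sdim S) (\<lambda>j. Ljd S \<zeta> j X) [1..<nenv S + 1]"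

definition Lcy_deform :: "qsys \<Rightarrow> (nat \<Rightarrow> real) \<Rightarrow> (nat \<Rightarrow> real) \<Rightarrow> complex mat \<Rightarrow> complex mat" where
  "Lcy_deform S \<zeta> \<alpha> = foldr (\<lambda>j g. Ljd_def S \<zeta> (\<alpha> j) j \<circ> g) [1..<nenv S + 1] id"

definition Lra_deform :: "qsys \<Rightarrow> (nat \<Rightarrow> real) \<Rightarrow> (nat \<Rightarrow> real) \<Rightarrow> complex mat \<Rightarrow> complex mat" where
  "Lra_deform S \<zeta> \<alpha> X = (1 / of_nat (nenv S)) \<cdot>\<^sub>m
      msum (sdim S) (\<lambda>j. Ljd_def S \<zeta> (\<alpha> j) j X) [1..<nenv S + 1]"

definition r_cy :: "qsys \<Rightarrow> (nat \<Rightarrow> real) \<Rightarrow> (nat \<Rightarrow> real) \<Rightarrow> real" where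
  "r_cy S \<zeta> \<alpha> = spec_rad (sdim S) (Lcy_deform S \<zeta> \<alpha>)"

definition r_ra :: "qsys \<Rightarrow> (nat \<Rightarrow> real) \<Rightarrow> (nat \<Rightarrow> real) \<Rightarrow> real" where
  "r_ra S \<zeta> \<alpha> = spec_rad (sdim S) (Lra_deform S \<zeta> \<alpha>)"

definition ER_cy :: "qsys \<Rightarrow> bool" where
  "ER_cy S \<longleftrightarrow> (\<exists>\<zeta>. primitive (sdim S) (Lcy S \<zeta>))"

definition ER_ra :: "qsys \<Rightarrow> bool" where
  "ER_ra S \<longleftrightarrow> (\<exists>\<zeta>. primitive (sdim S) (Lra S \<zeta>))"

definition NE :: "qsys \<Rightarrow> (real \<Rightarrow> complex mat) \<Rightarrow> bool" where
  "NE S \<rho>p \<longleftrightarrow> (\<forall>z. is_state (sdim S) (\<rho>p z) \<and>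
     (\<forall>j \<in> {1..nenv S}.
        Uj S j * kron (\<rho>p z) (gibbs (beta_ref S - z) (hamE S j)) * adj (Uj S j)
          = kron (\<rho>p z) (gibbs (beta_ref S - z) (hamE S j))))"

definition Hprime :: "qsys \<Rightarrow> (real \<Rightarrow> complex mat) \<Rightarrow> complex mat" where
  "Hprime S \<rho>p = complex_of_real (- 1 / beta_ref S) \<cdot>\<^sub>m matlog (sdim S) (\<rho>p 0)"

definition Phi :: "qsys \<Rightarrow> (nat \<Rightarrow> real) \<Rightarrow> nat \<Rightarrow> complex mat" where
  "Phi S \<zeta> j = complex_of_real (- 1 / Ttot S) \<cdot>\<^sub>m ptrace2 (edim S j)
     (kron (1\<^sub>m (sdim S)) (rhoE S \<zeta> j) *
       (adj (Uj S j) * kron (1\<^sub>m (sdim S)) (hamE S j) * Uj S j - kron (1\<^sub>m (sdim S)) (hamE S j)))"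

definition Phi_cy :: "qsys \<Rightarrow> (nat \<Rightarrow> real) \<Rightarrow> nat \<Rightarrow> complex mat" where
  "Phi_cy S \<zeta> j = compL S \<zeta> 1 j (Phi S \<zeta> j)"

definition phij :: "qsys \<Rightarrow> (nat \<Rightarrow> real) \<Rightarrow> complex mat \<Rightarrow> nat \<Rightarrow> complex mat \<Rightarrow> complex mat" where
  "phij S \<zeta> H j X = complex_of_real (1 / Ttot S) \<cdot>\<^sub>m
     (Ljd S \<zeta> j (X * H) - Ljd S \<zeta> j X * H)"

definition phij_cy :: "qsys \<Rightarrow> (nat \<Rightarrow> real) \<Rightarrow> complex mat \<Rightarrow> nat \<Rightarrow> complex mat \<Rightarrow> complex mat" where
  "phij_cy S \<zeta> H j = compL S \<zeta> 1 j \<circ> phij S \<zeta> H j \<circ> compL S \<zeta> (j+1) (nenv S + 1)"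

definition Dj :: "qsys \<Rightarrow> (nat \<Rightarrow> real) \<Rightarrow> nat \<Rightarrow> complex mat \<Rightarrow> complex mat \<Rightarrow> complex mat" where
  "Dj S \<zeta> j X Y = complex_of_real (1 / Ttot S) \<cdot>\<^sub>m
     (Ljd S \<zeta> j (adj X * Y) - Ljd S \<zeta> j (adj X) * Y - adj X * Ljd S \<zeta> j Y + adj X * Y)"

definition unitv :: "nat \<Rightarrow> nat \<Rightarrow> real" where
  "unitv j = (\<lambda>i. if i = j then 1 else 0)"

definition pderiv_at :: "((nat \<Rightarrow> real) \<Rightarrow> real) \<Rightarrow> nat \<Rightarrow> (nat \<Rightarrow> real) \<Rightarrow> real" where
  "pderiv_at f j \<alpha> = deriv (\<lambda>t. f (\<lambda>i. \<alpha> i + t * unitv j i)) 0"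

end

theory Submission
  imports Defs "Jordan_Normal_Form.Schur_Decomposition" "Jordan_Normal_Form.Spectral_Radius"
begin

text \<open>At zero deformation the maps are unital and completely positive. Primitivity at one \<open>\<zeta>\<close>
  gives a Doeblin minorisation of the cycle map at every \<open>\<zeta>\<close>, because changing \<open>\<zeta>\<close> changes the
  Gibbs states only up to multiplicative constants; hence 1 is a simple isolated eigenvalue and
  the powers of the map converge to the invariant state. For small \<open>\<alpha>\<close> the spectral radius is the
  perturbed eigenvalue (its eigenvector stays positive definite), so its derivatives come from
  second order perturbation theory, with the resolvent written as a Neumann series. By (NE),
  \<open>U\<^sub>j\<close> commutes with \<open>f (H' + H_E)\<close>, so deforming site \<open>j\<close> by \<open>a\<close> turns \<open>X \<mapsto> L X\<close> into
  \<open>X \<mapsto> L (X exp (a \<beta>\<^sub>j H')) exp (- a \<beta>\<^sub>j H')\<close>, whose derivatives in \<open>a\<close> are the maps \<open>\<phi>\<^sub>j\<close> and,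
  at the identity, the dissipation of \<open>H'\<close>.\<close>

section \<open>Matrices, traces and tensor products\<close>

text \<open>The spectral radius is a maximum of moduli, so it cannot be differentiated directly. The
  eigenvalue near 1 is instead defined by a scalar equation: \<open>rsv\<close> adds the rank-one
  map \<open>Y \<mapsto> tr(\<rho> Y) 1\<close> to \<open>z - A\<close>, which makes it invertible
  at \<open>z = 1\<close>, and the solution \<open>X\<close> of \<open>rsv X = 1\<close> is an
  eigenvector exactly when \<open>tr(\<rho> X) = 1\<close>. Preservation of adjoints makes this
  equation real, so it can be solved over the reals. The inverse function theorem supplies one
  derivative; the second comes from the quotient formula for the first. Two points shape the
  algebra. (NE) yields a one-sided twist by powers of \<open>exp H'\<close>, whose second derivative
  contains \<open>L(H') H'\<close> twice, while the dissipation contains \<open>L(H') H'\<close> and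
  \<open>H' L(H')\<close>; they agree because \<open>H'\<close> commutes with \<open>L(H')\<close>.
  And (NE) provides states without asserting full rank, so \<open>H'\<close> is a genuine logarithm
  only once ergodicity has shown that the state at \<open>\<zeta> = 0\<close> is faithful. Some
  \<open>\<beta>\<^sub>j\<close> may vanish, hence convergence of the series is proved apart from
  the formula scaled by \<open>\<beta>\<^sub>j \<beta>\<^sub>k\<close>.\<close>

lemma mmul_index:
  assumes "A \<in> carrier_mat n m" "B \<in> carrier_mat m p" "i < n" "j < p"
  shows "(A * B) $$ (i,j) = (\<Sum>k<m. A $$ (i,k) * B $$ (k,j))"
  using assms by (auto simp: scalar_prod_def atLeast0LessThan intro!: sum.cong)

text \<open>Matrix products stay closed under simplification; entries are opened only through
  \<open>mmul_index\<close>, whose plain sums can be swapped and collapsed.\<close>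

declare index_mult_mat(1) [simp del]

lemma adj_dim [simp]: "dim_row (adj A) = dim_col A" "dim_col (adj A) = dim_row A"
  by (auto simp: adj_def)

lemma adj_carrier [simp]: "adj A \<in> carrier_mat n m \<longleftrightarrow> A \<in> carrier_mat m n"
  unfolding carrier_mat_def by auto

lemma adj_index [simp]: "i < dim_col A \<Longrightarrow> j < dim_row A \<Longrightarrow> adj A $$ (i,j) = cnj (A $$ (j,i))"
  by (simp add: adj_def)

lemma adj_adj [simp]: "adj (adj A) = A"
  by (rule eq_matI) auto

lemma adj_mult:
  assumes "A \<in> carrier_mat n m" "B \<in> carrier_mat m p"
  shows "adj (A * B) = adj B * adj A"
proof (rule eq_matI)
  fix i j assume "i < dim_row (adj B * adj A)" "j < dim_col (adj B * adj A)"
  with assms have ij: "i < p" "j < n" by auto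
  then show "adj (A * B) $$ (i,j) = (adj B * adj A) $$ (i,j)"
    using assms mmul_index[of "adj B" p m "adj A" n i j] mmul_index[OF assms ij(2,1)]
    by (auto simp: mult.commute intro!: sum.cong)
qed (use assms in auto)

lemma adj_add: "A \<in> carrier_mat n m \<Longrightarrow> B \<in> carrier_mat n m \<Longrightarrow> adj (A + B) = adj A + adj B"
  by (rule eq_matI) auto

lemma adj_minus: "A \<in> carrier_mat n m \<Longrightarrow> B \<in> carrier_mat n m \<Longrightarrow> adj (A - B) = adj A - adj B"
  by (rule eq_matI) auto

lemma adj_smult: "adj (c \<cdot>\<^sub>m A) = cnj c \<cdot>\<^sub>m adj A"
  by (rule eq_matI) auto

lemma adj_one [simp]: "adj (1\<^sub>m n) = 1\<^sub>m n"
  by (rule eq_matI) auto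

lemma adj_zero [simp]: "adj (0\<^sub>m n m) = 0\<^sub>m m n"
  by (rule eq_matI) auto

text \<open>Cutting \<open>{..<a*b}\<close> into blocks of length \<open>b\<close> splits a tensor
  index into its two components; the entrywise computations with \<open>kron\<close> and
  \<open>ptrace2\<close> rest on it.\<close>

lemma sum_kron: "(\<Sum>k<a*b. f k) = (\<Sum>i<a. \<Sum>j<(b::nat). f (i*b+j))"
proof -
  have "sum f {m*b..<m*b+b} = (\<Sum>j<b. f (m*b+j))" for m
    using sum.shift_bounds_nat_ivl[of f 0 "m*b" b] by (simp add: atLeast0LessThan add.commute)
  then show ?thesis using sum.nat_group[of f b a] by simp
qed

lemma kron_dim [simp]:
  "dim_row (kron A B) = dim_row A * dim_row B" "dim_col (kron A B) = dim_col A * dim_col B"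
  by (auto simp: kron_def)

lemma kron_carrier [intro, simp]:
  "A \<in> carrier_mat n m \<Longrightarrow> B \<in> carrier_mat p q \<Longrightarrow> kron A B \<in> carrier_mat (n*p) (m*q)"
  unfolding carrier_mat_def by auto

lemma idx_lt: "i < a \<Longrightarrow> j < b \<Longrightarrow> i * b + j < a * (b::nat)"
proof -
  assume "i < a" "j < b"
  then have "i*b + j < (i+1)*b" by simp
  also have "\<dots> \<le> a*b" using \<open>i < a\<close> by (intro mult_right_mono) auto
  finally show ?thesis .
qed

lemma div_lt: "k < a * b \<Longrightarrow> k div b < (a::nat)"
  using less_mult_imp_div_less by blast

lemma mod_lt: "k < a * b \<Longrightarrow> k mod b < (b::nat)"
  by (metis less_nat_zero_code mod_less_divisor mult_0_right neq0_conv)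

lemma kron_index0:
  assumes "k < dim_row A * dim_row B" "l < dim_col A * dim_col B"
  shows "kron A B $$ (k,l) = A $$ (k div dim_row B, l div dim_col B) * B $$ (k mod dim_row B, l mod dim_col B)"
  using assms by (simp add: kron_def)

lemma kron_index:
  assumes "A \<in> carrier_mat n m" "B \<in> carrier_mat p q" "i < n" "k < p" "j < m" "l < q"
  shows "kron A B $$ (i*p+k, j*q+l) = A $$ (i,j) * B $$ (k,l)"
proof -
  have d: "dim_row A = n" "dim_col A = m" "dim_row B = p" "dim_col B = q" using assms by auto
  show ?thesis
    using idx_lt[OF assms(3,4)] idx_lt[OF assms(5,6)] assms(3-)
    by (subst kron_index0) (auto simp: d)
qed

text \<open>Every index below \<open>n*p\<close> is \<open>(a div p)*p + a mod p\<close>, so tensor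
  matrices may be compared on paired indices, where \<open>kron_index\<close> applies.\<close>

lemma kron_eqI:
  assumes "A \<in> carrier_mat (n*p) (m*q)" "B \<in> carrier_mat (n*p) (m*q)"
    and "\<And>i k j l. i < n \<Longrightarrow> k < p \<Longrightarrow> j < m \<Longrightarrow> l < q \<Longrightarrow> A $$ (i*p+k, j*q+l) = B $$ (i*p+k, j*q+l)"
  shows "A = B"
proof (rule eq_matI)
  fix a b assume "a < dim_row B" "b < dim_col B"
  then have ab: "a < n*p" "b < m*q" using assms(2) by auto
  show "A $$ (a,b) = B $$ (a,b)"
    using assms(3)[OF div_lt[OF ab(1)] mod_lt[OF ab(1)] div_lt[OF ab(2)] mod_lt[OF ab(2)]]
    by simp
qed (use assms in auto)

lemma kron_mult:
  assumes "A \<in> carrier_mat a b" "B \<in> carrier_mat p q" "C \<in> carrier_mat b c" "D \<in> carrier_mat q r"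
  shows "kron A B * kron C D = kron (A * C) (B * D)"
proof (rule kron_eqI[of _ a p c r])
  fix i k j l assume h: "i < a" "k < p" "j < c" "l < r"
  have "(kron A B * kron C D) $$ (i*p+k, j*r+l)
      = (\<Sum>x<b. \<Sum>y<q. (A $$ (i,x) * C $$ (x,j)) * (B $$ (k,y) * D $$ (y,l)))"
    by (subst mmul_index[of _ "a*p" "b*q" _ "c*r"])
       (use assms h in \<open>auto simp: idx_lt sum_kron kron_index[OF assms(1,2)] kron_index[OF assms(3,4)] intro!: sum.cong\<close>)
  also have "\<dots> = kron (A*C) (B*D) $$ (i*p+k, j*r+l)"
    using assms h
    by (subst kron_index[of _ a c _ p r])
       (auto simp: mmul_index[OF assms(1,3)] mmul_index[OF assms(2,4)] sum_product intro!: sum.cong)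
  finally show "(kron A B * kron C D) $$ (i*p+k, j*r+l) = kron (A*C) (B*D) $$ (i*p+k, j*r+l)" .
qed (use assms in auto)

lemma adj_kron: "adj (kron A B) = kron (adj A) (adj B)"
proof (rule kron_eqI[of _ "dim_col A" "dim_col B" "dim_row A" "dim_row B"])
  fix i k j l assume h: "i < dim_col A" "k < dim_col B" "j < dim_row A" "l < dim_row B"
  show "adj (kron A B) $$ (i*dim_col B+k, j*dim_row B+l) = kron (adj A) (adj B) $$ (i*dim_col B+k, j*dim_row B+l)"
    using h by (subst kron_index[of _ "dim_col A" "dim_row A" _ "dim_col B" "dim_row B"])
      (auto simp: idx_lt kron_index[of A "dim_row A" "dim_col A" B "dim_row B" "dim_col B"])
qed (auto intro!: carrier_matI)

lemma kron_one: "kron (1\<^sub>m n) (1\<^sub>m m) = 1\<^sub>m (n*m)"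
proof (rule kron_eqI[of _ n m n m])
  fix i k j l assume h: "i < n" "k < m" "j < n" "l < m"
  have "i*m+k = j*m+l \<longleftrightarrow> i = j \<and> k = l"
  proof
    assume e: "i*m+k = j*m+l"
    have "(i*m+k) div m = i" "(j*m+l) div m = j" using h by auto
    then show "i = j \<and> k = l" using e by auto
  qed auto
  then show "kron (1\<^sub>m n) (1\<^sub>m m) $$ (i*m+k, j*m+l) = (1\<^sub>m (n*m) :: complex mat) $$ (i*m+k, j*m+l)"
    using h by (subst kron_index[of _ n n _ m m]) (auto simp: idx_lt)
qed auto

lemma kron_add_left:
  assumes "A \<in> carrier_mat a b" "B \<in> carrier_mat a b" "C \<in> carrier_mat p q"
  shows "kron (A + B) C = kron A C + kron B C"
  by (rule kron_eqI[of _ a p b q])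
     (use assms in \<open>auto simp: idx_lt kron_index[of _ a b _ p q] distrib_right right_diff_distrib minus_carrier_mat mult.assoc\<close>)

lemma kron_smult_left:
  assumes "A \<in> carrier_mat a b" "C \<in> carrier_mat p q"
  shows "kron (c \<cdot>\<^sub>m A) C = c \<cdot>\<^sub>m kron A C"
  by (rule kron_eqI[of _ a p b q])
     (use assms in \<open>auto simp: idx_lt kron_index[of _ a b _ p q] distrib_right right_diff_distrib minus_carrier_mat mult.assoc\<close>)

lemma kron_smult_right:
  assumes "A \<in> carrier_mat a b" "C \<in> carrier_mat p q"
  shows "kron A (c \<cdot>\<^sub>m C) = c \<cdot>\<^sub>m kron A C"
  by (rule kron_eqI[of _ a p b q])
     (use assms in \<open>auto simp: idx_lt kron_index[of _ a b _ p q] distrib_right right_diff_distrib minus_carrier_mat mult.assoc\<close>)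

lemma kron_minus_right:
  assumes "A \<in> carrier_mat a b" "B \<in> carrier_mat p q" "C \<in> carrier_mat p q"
  shows "kron A (B - C) = kron A B - kron A C"
  by (rule kron_eqI[of _ a p b q])
     (use assms in \<open>auto simp: idx_lt kron_index[of _ a b _ p q] distrib_right right_diff_distrib minus_carrier_mat mult.assoc\<close>)

lemma ptrace2_carrier:
  assumes "C \<in> carrier_mat (n*e) (m*e)" "e > 0"
  shows "ptrace2 e C \<in> carrier_mat n m"
  using assms by (auto simp: ptrace2_def)

lemma ptrace2_index:
  assumes "C \<in> carrier_mat (n*e) (m*e)" "i < n" "j < m" "e > 0"
  shows "ptrace2 e C $$ (i,j) = (\<Sum>k<e. C $$ (i*e+k, j*e+k))"
  using assms by (auto simp: ptrace2_def)

lemma ptrace2_add: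
  assumes "C \<in> carrier_mat (n*e) (m*e)" "D \<in> carrier_mat (n*e) (m*e)" "e > 0"
  shows "ptrace2 e (C + D) = ptrace2 e C + ptrace2 e D"
proof -
  have "C + D \<in> carrier_mat (n*e) (m*e)" using assms by simp
  then show ?thesis
    using assms ptrace2_carrier[of C n e m] ptrace2_carrier[of D n e m] ptrace2_carrier[of "C+D" n e m]
    by (intro eq_matI) (auto simp: ptrace2_index[of _ n e m] idx_lt sum.distrib)
qed

lemma ptrace2_minus:
  assumes "C \<in> carrier_mat (n*e) (m*e)" "D \<in> carrier_mat (n*e) (m*e)" "e > 0"
  shows "ptrace2 e (C - D) = ptrace2 e C - ptrace2 e D"
proof -
  have "C - D \<in> carrier_mat (n*e) (m*e)" using assms by (simp add: minus_carrier_mat)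
  then show ?thesis
    using assms ptrace2_carrier[of C n e m] ptrace2_carrier[of D n e m] ptrace2_carrier[of "C-D" n e m]
    by (intro eq_matI) (auto simp: ptrace2_index[of _ n e m] idx_lt sum_subtractf)
qed

lemma ptrace2_smult:
  assumes "C \<in> carrier_mat (n*e) (m*e)" "e > 0"
  shows "ptrace2 e (c \<cdot>\<^sub>m C) = c \<cdot>\<^sub>m ptrace2 e C"
proof -
  have "c \<cdot>\<^sub>m C \<in> carrier_mat (n*e) (m*e)" using assms by simp
  then show ?thesis
    using assms ptrace2_carrier[of C n e m] ptrace2_carrier[of "c \<cdot>\<^sub>m C" n e m]
    by (intro eq_matI) (auto simp: ptrace2_index[of _ n e m] idx_lt sum_distrib_left)
qed

lemma adj_ptrace2:
  assumes "C \<in> carrier_mat (n*e) (m*e)" "e > 0"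
  shows "adj (ptrace2 e C) = ptrace2 e (adj C)"
proof -
  have "adj C \<in> carrier_mat (m*e) (n*e)" using assms by simp
  then show ?thesis
    using assms ptrace2_carrier[of C n e m] ptrace2_carrier[of "adj C" m e n]
    by (intro eq_matI) (auto simp: ptrace2_index[of _ n e m] ptrace2_index[of _ m e n] idx_lt)
qed

lemma ptrace2_kron:
  assumes "A \<in> carrier_mat n m" "B \<in> carrier_mat e e" "e > 0"
  shows "ptrace2 e (kron A B) = mtrace B \<cdot>\<^sub>m A"
proof -
  have "kron A B \<in> carrier_mat (n*e) (m*e)" using assms by simp
  then show ?thesis
    using assms ptrace2_carrier[of "kron A B" n e m]
    by (intro eq_matI) (auto simp: ptrace2_index[of _ n e m] idx_lt kron_index[of _ n m _ e e]
        mtrace_def sum_distrib_left mult.commute)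
qed

text \<open>The identity on the second factor forces equal environment indices, which leaves a
  product over the system index alone.\<close>

lemma ptrace2_mult_left:
  assumes "X \<in> carrier_mat p n" "C \<in> carrier_mat (n*e) (m*e)" "e > 0"
  shows "ptrace2 e (kron X (1\<^sub>m e) * C) = X * ptrace2 e C"
proof -
  have c: "kron X (1\<^sub>m e) * C \<in> carrier_mat (p*e) (m*e)" "kron X (1\<^sub>m e) \<in> carrier_mat (p*e) (n*e)" using assms by auto
  have "ptrace2 e (kron X (1\<^sub>m e) * C) $$ (i,j) = (X * ptrace2 e C) $$ (i,j)" if "i < p" "j < m" for i j
  proof -
    have "ptrace2 e (kron X (1\<^sub>m e) * C) $$ (i,j)
        = (\<Sum>k<e. \<Sum>x<n. \<Sum>y<e. X $$ (i,x) * (if k = y then 1 else 0) * C $$ (x*e+y, j*e+k))"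
      using that assms c
      by (auto simp: ptrace2_index[OF c(1)] mmul_index[OF c(2) assms(2)] idx_lt sum_kron kron_index[of _ p n _ e e] intro!: sum.cong)
    also have "\<dots> = (\<Sum>k<e. \<Sum>x<n. \<Sum>y<e. if y = k then X $$ (i,x) * C $$ (x*e+k, j*e+k) else 0)"
      by (intro sum.cong refl) auto
    also have "\<dots> = (\<Sum>k<e. \<Sum>x<n. X $$ (i,x) * C $$ (x*e+k, j*e+k))"
      by (intro sum.cong refl) (simp add: sum.delta)
    also have "\<dots> = (\<Sum>x<n. X $$ (i,x) * (\<Sum>k<e. C $$ (x*e+k, j*e+k)))"
      by (subst sum.swap) (simp add: sum_distrib_left)
    also have "\<dots> = (X * ptrace2 e C) $$ (i,j)"
      using that assms by (subst mmul_index[OF assms(1) ptrace2_carrier[OF assms(2,3)]]) (auto simp: ptrace2_index[OF assms(2)])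
    finally show ?thesis .
  qed
  then show ?thesis
    using assms ptrace2_carrier[OF c(1)] ptrace2_carrier[OF assms(2)] by (intro eq_matI) auto
qed

text \<open>Adjoints exchange the two sides, so this is \<open>ptrace2_mult_left\<close> for
  \<open>adj Y\<close> and \<open>adj C\<close>.\<close>

lemma ptrace2_mult_right:
  assumes "Y \<in> carrier_mat m p" "C \<in> carrier_mat (n*e) (m*e)" "e > 0"
  shows "ptrace2 e (C * kron Y (1\<^sub>m e)) = ptrace2 e C * Y"
proof -
  have k: "kron Y (1\<^sub>m e) \<in> carrier_mat (m*e) (p*e)" using assms by auto
  have "adj (ptrace2 e (C * kron Y (1\<^sub>m e))) = adj (ptrace2 e C * Y)"
    using assms k ptrace2_carrier[OF assms(2,3)]
    by (simp add: adj_ptrace2[of _ n e p] adj_mult[OF assms(2) k] adj_kron ptrace2_mult_left[of _ p m]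
        adj_mult[of _ n m _ p] adj_ptrace2[OF assms(2,3)])
  then show ?thesis by (metis adj_adj)
qed

text \<open>A partial trace is cyclic for factors acting on the traced space alone. Powers of Gibbs
  states and environment Hamiltonians are moved around products by this rule, although they need not
  commute with what they cross.\<close>

lemma ptrace2_cyc:
  assumes "B \<in> carrier_mat e e" "C \<in> carrier_mat (n*e) (m*e)" "e > 0"
  shows "ptrace2 e (kron (1\<^sub>m n) B * C) = ptrace2 e (C * kron (1\<^sub>m m) B)"
proof -
  have c: "kron (1\<^sub>m n) B * C \<in> carrier_mat (n*e) (m*e)" "kron (1\<^sub>m n) B \<in> carrier_mat (n*e) (n*e)"
     "C * kron (1\<^sub>m m) B \<in> carrier_mat (n*e) (m*e)" "kron (1\<^sub>m m) B \<in> carrier_mat (m*e) (m*e)" using assms by auto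
  have "ptrace2 e (kron (1\<^sub>m n) B * C) $$ (i,j) = ptrace2 e (C * kron (1\<^sub>m m) B) $$ (i,j)" if "i < n" "j < m" for i j
  proof -
    have "ptrace2 e (kron (1\<^sub>m n) B * C) $$ (i,j)
        = (\<Sum>k<e. \<Sum>x<n. \<Sum>y<e. (if i = x then 1 else 0) * B $$ (k,y) * C $$ (x*e+y, j*e+k))"
      using that assms c
      by (auto simp: ptrace2_index[OF c(1)] mmul_index[OF c(2) assms(2)] idx_lt sum_kron kron_index[of _ n n _ e e] intro!: sum.cong)
    also have "\<dots> = (\<Sum>k<e. \<Sum>x<n. if x = i then (\<Sum>y<e. B $$ (k,y) * C $$ (i*e+y, j*e+k)) else 0)"
      by (intro sum.cong refl) auto
    also have "\<dots> = (\<Sum>k<e. \<Sum>y<e. B $$ (k,y) * C $$ (i*e+y, j*e+k))"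
      using that by (simp add: sum.delta)
    finally have 1: "ptrace2 e (kron (1\<^sub>m n) B * C) $$ (i,j) = (\<Sum>k<e. \<Sum>y<e. B $$ (k,y) * C $$ (i*e+y, j*e+k))" .
    have "ptrace2 e (C * kron (1\<^sub>m m) B) $$ (i,j)
        = (\<Sum>k<e. \<Sum>x<m. \<Sum>y<e. C $$ (i*e+k, x*e+y) * ((if x = j then 1 else 0) * B $$ (y,k)))"
      using that assms c
      by (auto simp: ptrace2_index[OF c(3)] mmul_index[OF assms(2) c(4)] idx_lt sum_kron kron_index[of _ m m _ e e] intro!: sum.cong)
    also have "\<dots> = (\<Sum>k<e. \<Sum>x<m. if x = j then (\<Sum>y<e. C $$ (i*e+k, j*e+y) * B $$ (y,k)) else 0)"
      by (intro sum.cong refl) auto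
    also have "\<dots> = (\<Sum>k<e. \<Sum>y<e. C $$ (i*e+k, j*e+y) * B $$ (y,k))"
      using that by (simp add: sum.delta)
    also have "\<dots> = (\<Sum>y<e. \<Sum>k<e. C $$ (i*e+k, j*e+y) * B $$ (y,k))" by (rule sum.swap)
    also have "\<dots> = (\<Sum>k<e. \<Sum>y<e. B $$ (k,y) * C $$ (i*e+y, j*e+k))"
      by (intro sum.cong refl) (simp add: mult.commute)
    finally show ?thesis using 1 by simp
  qed
  then show ?thesis
    using assms ptrace2_carrier[OF c(1)] ptrace2_carrier[OF c(3)] by (intro eq_matI) auto
qed

lemma mtrace_cyc:
  assumes "A \<in> carrier_mat n m" "B \<in> carrier_mat m n"
  shows "mtrace (A * B) = mtrace (B * A)"
proof -
  have "mtrace (A * B) = (\<Sum>i<n. \<Sum>k<m. A $$ (i,k) * B $$ (k,i))"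
    using assms by (auto simp: mtrace_def mmul_index[OF assms] intro!: sum.cong)
  also have "\<dots> = (\<Sum>k<m. \<Sum>i<n. B $$ (k,i) * A $$ (i,k))"
    by (subst sum.swap) (simp add: mult.commute)
  also have "\<dots> = mtrace (B * A)"
    using assms by (auto simp: mtrace_def mmul_index[OF assms(2,1)] intro!: sum.cong)
  finally show ?thesis .
qed

lemma mtrace_add: "A \<in> carrier_mat n n \<Longrightarrow> B \<in> carrier_mat n n \<Longrightarrow> mtrace (A + B) = mtrace A + mtrace B"
  by (auto simp: mtrace_def sum.distrib)

lemma mtrace_minus: "A \<in> carrier_mat n n \<Longrightarrow> B \<in> carrier_mat n n \<Longrightarrow> mtrace (A - B) = mtrace A - mtrace B"
  by (auto simp: mtrace_def sum_subtractf)

lemma mtrace_smult: "A \<in> carrier_mat n n \<Longrightarrow> mtrace (c \<cdot>\<^sub>m A) = c * mtrace A"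
  by (auto simp: mtrace_def sum_distrib_left)

lemma mtrace_adj: "A \<in> carrier_mat n n \<Longrightarrow> mtrace (adj A) = cnj (mtrace A)"
  by (auto simp: mtrace_def)

lemma mtrace_ptrace2:
  assumes "C \<in> carrier_mat (n*e) (n*e)" "e > 0"
  shows "mtrace (ptrace2 e C) = mtrace C"
  using assms ptrace2_carrier[OF assms] by (auto simp: mtrace_def ptrace2_index[OF assms(1)] sum_kron)

text \<open>From here on \<open>$\<close> is free for the entries of \<open>Matrix.vec\<close>
  vectors.\<close>

unbundle no vec_syntax

section \<open>Spectral calculus and logarithms\<close>

text \<open>The trace is the sum of the diagonal of a Schur form, and these diagonal entries are
  eigenvalues, so one of them is nonzero. A nonzero eigenvalue is what the deflation below needs to
  force orthogonality.\<close>

lemma trace_nonzero_eigenvalue: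
  assumes A: "A \<in> carrier_mat n n" and tr: "mtrace A \<noteq> 0"
  shows "\<exists>v m. m \<noteq> 0 \<and> v \<in> carrier_vec n \<and> v \<noteq> 0\<^sub>v n \<and> A *\<^sub>v v = m \<cdot>\<^sub>v v"
proof -
  obtain es where es: "char_poly A = (\<Prod> a \<leftarrow> es. [:- a, 1:])"
    using char_poly_factorized[OF A] by blast
  from schur_decomposition_exists[OF A es]
  obtain B where B: "B \<in> carrier_mat n n" "upper_triangular B" "similar_mat A B" by blast
  obtain P Q where PQ: "P \<in> carrier_mat n n" "Q \<in> carrier_mat n n" "Q * P = 1\<^sub>m n" "A = P * B * Q"
    using B(3) A by (auto simp: similar_mat_def similar_mat_wit_def Let_def)
  have "mtrace A = mtrace (B * Q * P)"
    using PQ B mtrace_cyc[of P n n "B * Q"] by simp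
  also have "\<dots> = mtrace B" using PQ B by simp
  finally have "(\<Sum>i<n. B $$ (i,i)) \<noteq> 0" using tr B by (auto simp: mtrace_def)
  then obtain i where i: "i < n" "B $$ (i,i) \<noteq> 0" by (metis (no_types, lifting) lessThan_iff sum.neutral)
  have "eigenvalue A (B $$ (i,i))"
    using i B eigenvalue_root_char_poly[OF A] char_poly_similar[OF B(3)]
      char_poly_upper_triangular[OF B(1,2)]
    by (auto simp: poly_prod_list diag_mat_def prod_list_zero_iff image_iff)
  then show ?thesis using i A unfolding eigenvalue_def eigenvector_def by auto
qed

lemma sum_cmod_pos:
  assumes "w \<in> carrier_vec n" "w \<noteq> 0\<^sub>v n"
  shows "(\<Sum>i<n. (cmod (w $ i))\<^sup>2) > 0"
proof -
  obtain i where "i < n" "w $ i \<noteq> 0" using assms by (metis eq_vecI carrier_vecD index_zero_vec)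
  then show ?thesis by (intro sum_pos2[of _ i]) auto
qed

lemma cnj_mult_self: "cnj z * z = complex_of_real ((cmod z)\<^sup>2)"
  by (metis complex_norm_square mult.commute)

lemma hermitian_form_swap:
  assumes "hermitian_mat n A"
  shows "(\<Sum>i<n. cnj (u i) * (\<Sum>j<n. A $$ (i,j) * v j)) = (\<Sum>j<n. cnj (\<Sum>i<n. A $$ (j,i) * u i) * v j)"
proof -
  have h: "A $$ (i,j) = cnj (A $$ (j,i))" if "i < n" "j < n" for i j
  proof -
    have "adj A $$ (i,j) = cnj (A $$ (j,i))" using assms that by (intro adj_index) (auto simp: hermitian_mat_def)
    then show ?thesis using assms by (simp add: hermitian_mat_def)
  qed
  have "cnj (u i) * (A $$ (i,j) * v j) = cnj (A $$ (j,i) * u i) * v j" if "i < n" "j < n" for i j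
    unfolding h[OF that] by simp
  then have "(\<Sum>i<n. cnj (u i) * (\<Sum>j<n. A $$ (i,j) * v j)) = (\<Sum>i<n. \<Sum>j<n. cnj (A $$ (j,i) * u i) * v j)"
    unfolding sum_distrib_left by (intro sum.cong refl) simp
  also have "\<dots> = (\<Sum>j<n. \<Sum>i<n. cnj (A $$ (j,i) * u i) * v j)" by (rule sum.swap)
  finally show ?thesis by (simp add: sum_distrib_right)
qed

text \<open>Deflation: the eigenvectors already found are moved into the kernel of a Hermitian
  matrix \<open>B c\<close>, and an eigenvector of \<open>B c\<close> for a nonzero eigenvalue is
  automatically orthogonal to that kernel.\<close>

lemma orthonormal_eigenvectors:
  assumes A: "hermitian_mat n A" and "K \<le> n"
  shows "\<exists>V f. (\<forall>k<K. \<forall>i<n. (\<Sum>j<n. A $$ (i,j) * V j k) = complex_of_real (f k) * V i k)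
    \<and> (\<forall>k<K. \<forall>l<K. (\<Sum>i<n. cnj (V i k) * V i l) = (if k = l then 1 else 0 :: complex))"
  using \<open>K \<le> n\<close>
proof (induction K)
  case 0
  then show ?case by auto
next
  case (Suc K)
  from Suc.prems have "K \<le> n" by simp
  from Suc.IH[OF this] obtain V f where Vf: "\<forall>k<K. \<forall>i<n. (\<Sum>j<n. A $$ (i,j) * V j k) = complex_of_real (f k) * V i k"
    "\<forall>k<K. \<forall>l<K. (\<Sum>i<n. cnj (V i k) * V i l) = (if k = l then 1 else 0 :: complex)"
    by blast
  have V: "(\<Sum>j<n. A $$ (i,j) * V j k) = complex_of_real (f k) * V i k" if "k < K" "i < n" for k i
    using Vf(1) that by blast
  have on: "(\<Sum>i<n. cnj (V i k) * V i l) = (if k = l then 1 else 0 :: complex)" if "k < K" "l < K" for k l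
    using Vf(2) that by blast
  have Ac: "A \<in> carrier_mat n n" using A by (auto simp: hermitian_mat_def)
  have hA: "A $$ (i,j) = cnj (A $$ (j,i))" if "i < n" "j < n" for i j
  proof -
    have "adj A $$ (i,j) = cnj (A $$ (j,i))" using Ac that by (intro adj_index) auto
    then show ?thesis using A by (simp add: hermitian_mat_def)
  qed
  \<comment> \<open>On the span of the vectors found so far the subtracted terms cancel both
    \<open>A\<close> and the shift by \<open>c\<close>; on the orthogonal complement
    \<open>B c\<close> is \<open>A\<close> shifted by \<open>c\<close>.\<close>
  define B where "B c = mat n n (\<lambda>(i,j). A $$ (i,j) + (if i = j then complex_of_real c else 0)
      - (\<Sum>k<K. complex_of_real (f k + c) * V i k * cnj (V j k)))" for c :: real
  have Bc: "B c \<in> carrier_mat n n" for c by (simp add: B_def)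
  have trB: "mtrace (B c) = mtrace A - (\<Sum>k<K. complex_of_real (f k)) + of_nat (n - K) * complex_of_real c" for c
  proof -
    have "(\<Sum>i<n. \<Sum>k<K. complex_of_real (f k + c) * V i k * cnj (V i k)) =
          (\<Sum>k<K. complex_of_real (f k + c) * (\<Sum>i<n. cnj (V i k) * V i k))"
      by (subst sum.swap) (simp add: sum_distrib_left mult_ac)
    also have "\<dots> = (\<Sum>k<K. complex_of_real (f k + c))" by (intro sum.cong) (auto simp: on)
    also have "\<dots> = (\<Sum>k<K. complex_of_real (f k)) + of_nat K * complex_of_real c" by (simp add: sum.distrib)
    finally show ?thesis using Ac Suc.prems
      by (simp add: mtrace_def B_def sum.distrib sum_subtractf of_nat_diff algebra_simps)
  qed
  \<comment> \<open>Raising \<open>c\<close> from 0 to 1 changes the trace by \<open>n - K\<close>,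
    which is positive, so it cannot vanish for both values.\<close>
  have "mtrace (B 0) \<noteq> 0 \<or> mtrace (B 1) \<noteq> 0" using trB[of 0] trB[of 1] Suc.prems by auto
  then obtain c where c: "mtrace (B c) \<noteq> 0" by blast
  from trace_nonzero_eigenvalue[OF Bc c] obtain v m where
    m: "m \<noteq> 0" and v: "v \<in> carrier_vec n" "v \<noteq> 0\<^sub>v n" and ev: "B c *\<^sub>v v = m \<cdot>\<^sub>v v" by blast
  have ev': "(\<Sum>j<n. B c $$ (i,j) * v $ j) = m * v $ i" if "i < n" for i
  proof -
    have "(B c *\<^sub>v v) $ i = m * v $ i" using that v ev by simp
    then show ?thesis using that v Bc[of c] by (simp add: scalar_prod_def atLeast0LessThan)
  qed
  have hB: "hermitian_mat n (B c)"
    unfolding hermitian_mat_def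
  proof (intro conjI Bc eq_matI)
    fix i j assume ij: "i < dim_row (B c)" "j < dim_col (B c)"
    then have ij': "i < n" "j < n" by (auto simp: B_def)
    show "adj (B c) $$ (i,j) = B c $$ (i,j)"
      using ij' hA[OF ij'] by (simp add: B_def mult_ac)
  qed (auto simp: B_def)
  have BV: "(\<Sum>j<n. B c $$ (i,j) * V j k) = 0" if "i < n" "k < K" for i k
  proof -
    have "(\<Sum>j<n. (\<Sum>l<K. complex_of_real (f l + c) * V i l * cnj (V j l)) * V j k)
       = (\<Sum>l<K. complex_of_real (f l + c) * V i l * (\<Sum>j<n. cnj (V j l) * V j k))"
      unfolding sum_distrib_right sum_distrib_left by (subst sum.swap) (simp add: mult_ac)
    also have "\<dots> = (\<Sum>l<K. if l = k then complex_of_real (f l + c) * V i l else 0)"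
      using that by (intro sum.cong refl) (auto simp: on)
    also have "\<dots> = complex_of_real (f k + c) * V i k" using that by (simp add: sum.delta)
    finally have 1: "(\<Sum>j<n. (\<Sum>l<K. complex_of_real (f l + c) * V i l * cnj (V j l)) * V j k) = complex_of_real (f k + c) * V i k" .
    have 2: "(\<Sum>j<n. (if i = j then complex_of_real c else 0) * V j k) = complex_of_real c * V i k"
    proof -
      have "(\<Sum>j<n. (if i = j then complex_of_real c else 0) * V j k) = (\<Sum>j<n. if j = i then complex_of_real c * V i k else 0)"
        by (intro sum.cong) auto
      then show ?thesis using that by (simp add: sum.delta)
    qed
    have "(\<Sum>j<n. B c $$ (i,j) * V j k) = (\<Sum>j<n. A $$ (i,j) * V j k + (if i = j then complex_of_real c else 0) * V j k
       - (\<Sum>l<K. complex_of_real (f l + c) * V i l * cnj (V j l)) * V j k)"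
      using that by (intro sum.cong refl) (simp add: B_def algebra_simps)
    also have "\<dots> = 0" unfolding sum_subtractf sum.distrib 1 2 using V[OF that(2,1)] by (simp add: algebra_simps)
    finally show ?thesis .
  qed
  \<comment> \<open>Hermitian symmetry moves \<open>B c\<close> onto the earlier vector, where it
    vanishes; dividing by \<open>m\<close>, which is not 0, gives orthogonality.\<close>
  have orth: "(\<Sum>i<n. cnj (V i k) * v $ i) = 0" if "k < K" for k
  proof -
    have "m * (\<Sum>i<n. cnj (V i k) * v $ i) = (\<Sum>i<n. cnj (V i k) * (\<Sum>j<n. B c $$ (i,j) * v $ j))"
      unfolding sum_distrib_left[of m] by (intro sum.cong refl) (simp add: ev' mult.left_commute)
    also have "\<dots> = (\<Sum>j<n. cnj (\<Sum>i<n. B c $$ (j,i) * V i k) * v $ j)" by (rule hermitian_form_swap[OF hB])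
    also have "\<dots> = 0" by (intro sum.neutral ballI) (simp only: lessThan_iff BV that complex_cnj_zero mult_zero_left)
    finally show ?thesis using m by simp
  qed
  have Av: "(\<Sum>j<n. A $$ (i,j) * v $ j) = (m - complex_of_real c) * v $ i" if "i < n" for i
  proof -
    have "(\<Sum>j<n. (\<Sum>l<K. complex_of_real (f l + c) * V i l * cnj (V j l)) * v $ j)
       = (\<Sum>l<K. complex_of_real (f l + c) * V i l * (\<Sum>j<n. cnj (V j l) * v $ j))"
      unfolding sum_distrib_right sum_distrib_left by (subst sum.swap) (simp add: mult_ac)
    also have "\<dots> = 0" by (intro sum.neutral) (auto simp: orth)
    finally have 1: "(\<Sum>j<n. (\<Sum>l<K. complex_of_real (f l + c) * V i l * cnj (V j l)) * v $ j) = 0" .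
    have 2: "(\<Sum>j<n. (if i = j then complex_of_real c else 0) * v $ j) = complex_of_real c * v $ i"
    proof -
      have "(\<Sum>j<n. (if i = j then complex_of_real c else 0) * v $ j) = (\<Sum>j<n. if j = i then complex_of_real c * v $ i else 0)"
        by (intro sum.cong) auto
      then show ?thesis using that by (simp add: sum.delta)
    qed
    have "m * v $ i = (\<Sum>j<n. A $$ (i,j) * v $ j + (if i = j then complex_of_real c else 0) * v $ j
       - (\<Sum>l<K. complex_of_real (f l + c) * V i l * cnj (V j l)) * v $ j)"
      unfolding ev'[OF that, symmetric] using that by (intro sum.cong refl) (simp add: B_def algebra_simps)
    then show ?thesis unfolding sum_subtractf sum.distrib 1 2 by (simp add: algebra_simps)
  qed
  define N where "N = (\<Sum>i<n. (cmod (v $ i))\<^sup>2)"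
  have N: "N > 0" unfolding N_def by (rule sum_cmod_pos[OF v])
  have NC: "(\<Sum>i<n. cnj (v $ i) * v $ i) = complex_of_real N" by (simp add: N_def cnj_mult_self)
  define mu where "mu = m - complex_of_real c"
  \<comment> \<open>Reality of the eigenvalue: the Hermitian form of \<open>A\<close> at
    \<open>v\<close> is evaluated from both sides.\<close>
  have "mu * complex_of_real N = (\<Sum>i<n. cnj (v $ i) * (\<Sum>j<n. A $$ (i,j) * v $ j))"
    unfolding NC[symmetric] sum_distrib_left[of mu] by (intro sum.cong refl) (simp add: Av mu_def mult.left_commute)
  also have "\<dots> = (\<Sum>j<n. cnj (\<Sum>i<n. A $$ (j,i) * v $ i) * v $ j)" by (rule hermitian_form_swap[OF A])
  also have "\<dots> = (\<Sum>j<n. cnj (mu * v $ j) * v $ j)" by (intro sum.cong refl) (simp add: Av mu_def)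
  also have "\<dots> = cnj mu * complex_of_real N" unfolding NC[symmetric] by (simp add: sum_distrib_left mult_ac)
  finally have "mu = cnj mu" using N by simp
  then have mu: "mu = complex_of_real (Re mu)" by (simp add: complex_eq_iff)
  define s where "s = complex_of_real (1 / sqrt N)"
  have ss: "s * s * complex_of_real N = 1" "cnj s = s"
    using N by (auto simp: s_def simp flip: of_real_mult)
  define V' where "V' i k = (if k = K then s * v $ i else V i k)" for i k
  define f' where "f' = f(K := Re mu)"
  have "(\<Sum>j<n. A $$ (i,j) * V' j k) = complex_of_real (f' k) * V' i k" if "k < Suc K" "i < n" for k i
  proof (cases "k = K")
    case True
    have "(\<Sum>j<n. A $$ (i,j) * V' j k) = s * (\<Sum>j<n. A $$ (i,j) * v $ j)"
      using True by (simp add: V'_def sum_distrib_left mult_ac)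
    also have "\<dots> = s * (mu * v $ i)" using Av[OF that(2)] by (simp add: mu_def)
    finally show ?thesis using True mu by (simp add: V'_def f'_def)
  next
    case False
    then show ?thesis using that V[of k i] by (simp add: V'_def f'_def)
  qed
  moreover have "(\<Sum>i<n. cnj (V' i k) * V' i l) = (if k = l then 1 else 0)" if "k < Suc K" "l < Suc K" for k l
  proof -
    have o1: "(\<Sum>i<n. cnj (V i k) * (s * v $ i)) = 0" if "k < K" for k
      using orth[OF that] by (simp add: mult.left_commute flip: sum_distrib_left)
    have o2: "(\<Sum>i<n. cnj (s * v $ i) * V i k) = 0" if "k < K" for k
    proof -
      have "(\<Sum>i<n. cnj (s * v $ i) * V i k) = cnj (\<Sum>i<n. cnj (V i k) * (s * v $ i))"
        by (simp add: mult_ac)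
      then show ?thesis using o1[OF that] by simp
    qed
    have o3: "(\<Sum>i<n. cnj (s * v $ i) * (s * v $ i)) = 1"
    proof -
      have "(\<Sum>i<n. cnj (s * v $ i) * (s * v $ i)) = s * s * (\<Sum>i<n. cnj (v $ i) * v $ i)"
        using ss(2) by (simp add: sum_distrib_left mult_ac)
      then show ?thesis using NC ss(1) by simp
    qed
    show ?thesis
      using that o1[of k] o2[of l] o3 on[of k l]
      by (cases "k = K"; cases "l = K") (auto simp: V'_def simp del: complex_cnj_mult)
  qed
  ultimately show ?case by blast
qed

definition unitary_mat :: "nat \<Rightarrow> complex mat \<Rightarrow> bool" where
  "unitary_mat n P \<longleftrightarrow> P \<in> carrier_mat n n \<and> adj P * P = 1\<^sub>m n \<and> P * adj P = 1\<^sub>m n"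

text \<open>Functional calculus in a fixed eigenbasis: all functions of one Hermitian matrix share
  \<open>P\<close>, so their products, exponentials and logarithms reduce to pointwise identities.
  The values are complex so that unitaries are covered as well.\<close>

definition sdf :: "nat \<Rightarrow> complex mat \<Rightarrow> (nat \<Rightarrow> complex) \<Rightarrow> complex mat" where
  "sdf n P f = P * mat_diag n f * adj P"

lemma unitary_carrier [simp]: "unitary_mat n P \<Longrightarrow> P \<in> carrier_mat n n"
  by (simp add: unitary_mat_def)

lemma sdf_carrier [simp]: "unitary_mat n P \<Longrightarrow> sdf n P f \<in> carrier_mat n n"
  unfolding sdf_def by (intro mult_carrier_mat[of _ n n]) (auto simp: unitary_mat_def)

lemma sq_mult_carrier [simp]: "A \<in> carrier_mat n n \<Longrightarrow> B \<in> carrier_mat n n \<Longrightarrow> A * B \<in> carrier_mat n n"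
  by (rule mult_carrier_mat)

lemma unitary_cancel:
  assumes "unitary_mat n P" "X \<in> carrier_mat n m"
  shows "adj P * (P * X) = X" "P * (adj P * X) = X"
  using assms assoc_mult_mat[of "adj P" n n P n X m] assoc_mult_mat[of P n n "adj P" n X m]
  by (auto simp: unitary_mat_def)

theorem spectral_hermitian:
  assumes A: "hermitian_mat n A"
  obtains P f where "unitary_mat n P" "A = sdf n P (\<lambda>i. complex_of_real (f i))"
proof -
  obtain V f where Vf: "\<forall>k<n. \<forall>i<n. (\<Sum>j<n. A $$ (i,j) * V j k) = complex_of_real (f k) * V i k"
    "\<forall>k<n. \<forall>l<n. (\<Sum>i<n. cnj (V i k) * V i l) = (if k = l then 1 else 0 :: complex)"
    using orthonormal_eigenvectors[OF A order_refl] by blast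
  have V: "(\<Sum>j<n. A $$ (i,j) * V j k) = complex_of_real (f k) * V i k" if "k < n" "i < n" for k i
    using Vf(1) that by blast
  have on: "(\<Sum>i<n. cnj (V i k) * V i l) = (if k = l then 1 else 0 :: complex)" if "k < n" "l < n" for k l
    using Vf(2) that by blast
  have Ac: "A \<in> carrier_mat n n" using A by (auto simp: hermitian_mat_def)
  define P where "P = mat n n (\<lambda>(i,k). V i k)"
  have P: "P \<in> carrier_mat n n" by (simp add: P_def)
  have 1: "adj P * P = 1\<^sub>m n"
  proof (rule eq_matI)
    fix i j assume "i < dim_row (1\<^sub>m n :: complex mat)" "j < dim_col (1\<^sub>m n :: complex mat)"
    then show "(adj P * P) $$ (i,j) = 1\<^sub>m n $$ (i,j)"
      using on[of i j] P by (subst mmul_index[of _ n n _ n]) (auto simp: P_def)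
  qed (use P in auto)
  have 2: "P * adj P = 1\<^sub>m n" using mat_mult_left_right_inverse[OF _ _ 1] P by simp
  let ?D = "mat_diag n (\<lambda>i. complex_of_real (f i))"
  have AP: "A * P = P * ?D"
  proof (rule eq_matI)
    fix i j assume "i < dim_row (P * ?D)" "j < dim_col (P * ?D)"
    then have ij: "i < n" "j < n" using P by (auto simp: mat_diag_def)
    have Pi: "P $$ (k,l) = V k l" if "k < n" "l < n" for k l using that by (simp add: P_def)
    show "(A * P) $$ (i,j) = (P * ?D) $$ (i,j)"
      using V[OF ij(2,1)] mmul_index[OF Ac P ij] ij by (simp add: mat_diag_mult_right[OF P] Pi mult.commute)
  qed (use P Ac in \<open>auto simp: mat_diag_def\<close>)
  have "A = A * (P * adj P)" using Ac 2 by simp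
  also have "\<dots> = A * P * adj P" using Ac P by (intro assoc_mult_mat[symmetric]) auto
  finally have "A = sdf n P (\<lambda>i. complex_of_real (f i))" using AP by (simp add: sdf_def)
  then show thesis using that[of P f] 1 2 P by (auto simp: unitary_mat_def)
qed

lemma sdf_mult:
  assumes "unitary_mat n P"
  shows "sdf n P f * sdf n P g = sdf n P (\<lambda>i. f i * g i)"
proof -
  have P: "P \<in> carrier_mat n n" using assms by simp
  have "sdf n P f * sdf n P g = P * (mat_diag n f * mat_diag n g * adj P)"
    unfolding sdf_def using P
    by (simp add: assoc_mult_mat[of _ n n _ n _ n] unitary_cancel[OF assms, of _ n] del: mat_diag_diag)
  then show ?thesis
    unfolding mat_diag_diag sdf_def using P by (simp add: assoc_mult_mat[of _ n n _ n _ n])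
qed

lemma sdf_one: "unitary_mat n P \<Longrightarrow> sdf n P (\<lambda>i. 1) = 1\<^sub>m n"
  using right_mult_one_mat[of P n n] by (simp add: sdf_def unitary_mat_def)

lemma sdf_index:
  assumes "unitary_mat n P" "i < n" "j < n"
  shows "sdf n P f $$ (i,j) = (\<Sum>k<n. P $$ (i,k) * f k * cnj (P $$ (j,k)))"
  using assms mat_diag_mult_right[of P n n f] unfolding sdf_def unitary_mat_def
  by (subst mmul_index[of _ n n _ n]) (auto intro!: sum.cong)

lemma sdf_smult: "unitary_mat n P \<Longrightarrow> c \<cdot>\<^sub>m sdf n P f = sdf n P (\<lambda>i. c * f i)"
  by (intro eq_matI) (auto simp: sdf_index sum_distrib_left carrier_matD[OF sdf_carrier] mult_ac)

lemma sdf_add: "unitary_mat n P \<Longrightarrow> sdf n P f + sdf n P g = sdf n P (\<lambda>i. f i + g i)"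
  by (intro eq_matI) (auto simp: sdf_index sum.distrib carrier_matD[OF sdf_carrier] algebra_simps)

lemma sdf_minus: "unitary_mat n P \<Longrightarrow> sdf n P f - sdf n P g = sdf n P (\<lambda>i. f i - g i)"
  by (intro eq_matI) (auto simp: sdf_index sum_subtractf carrier_matD[OF sdf_carrier] algebra_simps)

lemma sdf_cong: "unitary_mat n P \<Longrightarrow> (\<And>i. i < n \<Longrightarrow> f i = g i) \<Longrightarrow> sdf n P f = sdf n P g"
  by (intro eq_matI) (auto simp: sdf_index carrier_matD[OF sdf_carrier])

lemma adj_sdf: "unitary_mat n P \<Longrightarrow> adj (sdf n P f) = sdf n P (\<lambda>i. cnj (f i))"
  by (intro eq_matI) (auto simp: sdf_index carrier_matD[OF sdf_carrier] mult_ac)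

lemma mtrace_sdf:
  assumes "unitary_mat n P" shows "mtrace (sdf n P f) = (\<Sum>i<n. f i)"
proof -
  have P: "P \<in> carrier_mat n n" using assms by simp
  have "mtrace (sdf n P f) = mtrace (adj P * (P * mat_diag n f))"
    unfolding sdf_def using P mtrace_cyc[of "P * mat_diag n f" n n "adj P"] by simp
  also have "adj P * (P * mat_diag n f) = mat_diag n f"
    by (rule unitary_cancel[OF assms, of _ n]) simp
  finally show ?thesis by (simp add: mtrace_def mat_diag_def)
qed

text \<open>Tensor products of functions stay inside the calculus, with the joint index split by
  \<open>div\<close> and \<open>mod\<close>. This makes functions of \<open>H' + H_E\<close> on the
  composite space available.\<close>

lemma kron_sdf:
  assumes "unitary_mat n P" "unitary_mat m Q"
  shows "unitary_mat (n*m) (kron P Q)"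
    and "kron (sdf n P f) (sdf m Q g) = sdf (n*m) (kron P Q) (\<lambda>k. f (k div m) * g (k mod m))"
proof -
  have P: "P \<in> carrier_mat n n" "adj P \<in> carrier_mat n n" "adj P * P = 1\<^sub>m n" "P * adj P = 1\<^sub>m n"
    and Q: "Q \<in> carrier_mat m m" "adj Q \<in> carrier_mat m m" "adj Q * Q = 1\<^sub>m m" "Q * adj Q = 1\<^sub>m m"
    using assms by (auto simp: unitary_mat_def)
  show "unitary_mat (n*m) (kron P Q)"
    using P Q by (auto simp: unitary_mat_def adj_kron kron_mult[of _ n n _ m m _ n _ m] kron_one)
  have D: "kron (mat_diag n f) (mat_diag m g) = mat_diag (n*m) (\<lambda>k. f (k div m) * g (k mod m))"
  proof (rule kron_eqI[of _ n m n m])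
    fix i k j l assume h: "i < n" "k < m" "j < n" "l < m"
    have e: "i*m+k = j*m+l \<longleftrightarrow> i = j \<and> k = l"
    proof
      assume e: "i*m+k = j*m+l"
      have "(i*m+k) div m = i" "(j*m+l) div m = j" using h by auto
      then show "i = j \<and> k = l" using e by auto
    qed auto
    show "kron (mat_diag n f) (mat_diag m g) $$ (i*m+k, j*m+l)
       = mat_diag (n*m) (\<lambda>k. f (k div m) * g (k mod m)) $$ (i*m+k, j*m+l)"
      using h e by (subst kron_index[of _ n n _ m m]) (auto simp: idx_lt mat_diag_def)
  qed auto
  show "kron (sdf n P f) (sdf m Q g) = sdf (n*m) (kron P Q) (\<lambda>k. f (k div m) * g (k mod m))"
    unfolding sdf_def D[symmetric] adj_kron using P Q
    by (simp add: kron_mult[of _ n n _ m m _ n _ m])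
qed

text \<open>In the eigenbasis, commutation with the function \<open>f\<close> says
  \<open>M (i,j) * (f j - f i) = 0\<close>. A nonzero entry thus joins two indices on which
  \<open>f\<close>, and therefore \<open>g\<close>, takes the same value.\<close>

lemma sdf_intertwine:
  assumes P: "unitary_mat n P" and V: "V \<in> carrier_mat n n"
    and comm: "V * sdf n P f = sdf n P f * V"
    and lev: "\<And>i j. i < n \<Longrightarrow> j < n \<Longrightarrow> f i = f j \<Longrightarrow> g i = g j"
  shows "V * sdf n P g = sdf n P g * V"
proof -
  have c: "P \<in> carrier_mat n n" using P by simp
  have c1: "adj P * P = 1\<^sub>m n" "P * adj P = 1\<^sub>m n" using P by (auto simp: unitary_mat_def)
  note as = assoc_mult_mat[of _ n n _ n _ n] unitary_cancel[OF P, of _ n]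
  define M where "M = adj P * V * P"
  have M: "M \<in> carrier_mat n n" using c V by (simp add: M_def)
  have VM: "V = P * M * adj P"
    using c V by (simp add: M_def as c1)
  have l: "V * sdf n P h = P * (M * mat_diag n h) * adj P" for h
    unfolding VM sdf_def using c M by (simp add: as)
  have r: "sdf n P h * V = P * (mat_diag n h * M) * adj P" for h
    unfolding VM sdf_def using c M by (simp add: as)
  have canc: "X = Y" if "P * X * adj P = P * Y * adj P" "X \<in> carrier_mat n n" "Y \<in> carrier_mat n n" for X Y
  proof -
    have e: "adj P * (P * Z * adj P) * P = Z" if "Z \<in> carrier_mat n n" for Z
      using c that by (simp add: as c1)
    have "X = adj P * (P * X * adj P) * P" by (rule e[OF that(2), symmetric])
    also have "\<dots> = Y" unfolding that(1) by (rule e[OF that(3)])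
    finally show ?thesis .
  qed
  have "M * mat_diag n f = mat_diag n f * M"
    by (rule canc) (use comm[unfolded l r] M in simp_all)
  then have e: "(M * mat_diag n f) $$ (i,j) = (mat_diag n f * M) $$ (i,j)" for i j by simp
  have "M $$ (i,j) * g j = g i * M $$ (i,j)" if "i < n" "j < n" for i j
  proof -
    have "M $$ (i,j) * f j = f i * M $$ (i,j)"
      using e[of i j] that by (simp add: mat_diag_mult_left[OF M] mat_diag_mult_right[OF M])
    then have "M $$ (i,j) = 0 \<or> f i = f j" by auto
    then show ?thesis using lev[OF that] by auto
  qed
  then have "M * mat_diag n g = mat_diag n g * M"
    using M by (intro eq_matI) (auto simp: mat_diag_mult_left[OF M] mat_diag_mult_right[OF M])
  then show ?thesis unfolding l r by (rule arg_cong)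
qed

lemma sdf_pow: "unitary_mat n P \<Longrightarrow> sdf n P f ^\<^sub>m k = sdf n P (\<lambda>i. f i ^ k)"
proof (induction k)
  case 0
  then show ?case using sdf_one[of n P] carrier_matD[OF sdf_carrier, of n P f] by simp
next
  case (Suc k)
  then show ?case by (simp add: sdf_mult mult.commute)
qed

text \<open>Powers act on the eigenvalues, so each entry of the matrix series is a finite
  combination of scalar exponential series.\<close>

lemma matexp_sdf:
  assumes "unitary_mat n P"
  shows "matexp (sdf n P f) = sdf n P (\<lambda>i. exp (f i))"
proof (rule eq_matI)
  fix i j assume "i < dim_row (sdf n P (\<lambda>i. exp (f i)))" "j < dim_col (sdf n P (\<lambda>i. exp (f i)))"
  then have ij: "i < n" "j < n" using carrier_matD[OF sdf_carrier[OF assms]] by auto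
  have "(\<lambda>k. P $$ (i,l) * (f l ^ k / of_nat (fact k)) * cnj (P $$ (j,l))) sums (P $$ (i,l) * exp (f l) * cnj (P $$ (j,l)))" for l
    using sums_mult2[OF sums_mult[OF exp_converges[of "f l"]], of "P $$ (i,l)" "cnj (P $$ (j,l))"]
    by (simp add: scaleR_conv_of_real divide_inverse mult_ac)
  then have "(\<lambda>k. \<Sum>l<n. P $$ (i,l) * (f l ^ k / of_nat (fact k)) * cnj (P $$ (j,l))) sums (\<Sum>l<n. P $$ (i,l) * exp (f l) * cnj (P $$ (j,l)))"
    by (intro sums_sum)
  then have "(\<lambda>k. (sdf n P f ^\<^sub>m k) $$ (i,j) / of_nat (fact k)) sums (sdf n P (\<lambda>i. exp (f i)) $$ (i,j))"
    using ij by (simp add: sdf_pow[OF assms] sdf_index[OF assms] sum_divide_distrib mult_ac)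
  then show "matexp (sdf n P f) $$ (i,j) = sdf n P (\<lambda>i. exp (f i)) $$ (i,j)"
    using ij carrier_matD[OF sdf_carrier[OF assms]] by (simp add: matexp_def sums_iff)
qed (use carrier_matD[OF sdf_carrier[OF assms]] in \<open>auto simp: matexp_def\<close>)

lemma hermitian_sdf: "unitary_mat n P \<Longrightarrow> hermitian_mat n (sdf n P (\<lambda>i. complex_of_real (f i)))"
  by (simp add: hermitian_mat_def adj_sdf)

text \<open>Since exp is injective on the reals, a Hermitian logarithm commutes with everything that
  commutes with its exponential; this makes it unique.\<close>
lemma matlog_sdf:
  assumes P: "unitary_mat n P"
  shows "matlog n (sdf n P (\<lambda>i. complex_of_real (exp (h i)))) = sdf n P (\<lambda>i. complex_of_real (h i))"
  unfolding matlog_def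
proof (rule the_equality)
  show "hermitian_mat n (sdf n P (\<lambda>i. complex_of_real (h i))) \<and>
    matexp (sdf n P (\<lambda>i. complex_of_real (h i))) = sdf n P (\<lambda>i. complex_of_real (exp (h i)))"
    using hermitian_sdf[OF P] matexp_sdf[OF P] by (auto simp: exp_of_real)
next
  fix L assume L: "hermitian_mat n L \<and> matexp L = sdf n P (\<lambda>i. complex_of_real (exp (h i)))"
  obtain Q g where Q: "unitary_mat n Q" "L = sdf n Q (\<lambda>i. complex_of_real (g i))"
    using spectral_hermitian L by blast
  have e: "sdf n Q (\<lambda>i. complex_of_real (exp (g i))) = sdf n P (\<lambda>i. complex_of_real (exp (h i)))"
    using L matexp_sdf[OF Q(1)] Q(2) by (simp add: exp_of_real)
  have PQ: "P \<in> carrier_mat n n" "Q \<in> carrier_mat n n" using P Q by auto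
  have u: "adj P * P = 1\<^sub>m n" "P * adj P = 1\<^sub>m n" "adj Q * Q = 1\<^sub>m n" "Q * adj Q = 1\<^sub>m n"
    using P Q by (auto simp: unitary_mat_def)
  note as = assoc_mult_mat[of _ n n _ n _ n] unitary_cancel[OF P, of _ n] unitary_cancel[OF Q(1), of _ n]
  \<comment> \<open>The change of basis between the two spectral decompositions; \<open>red\<close>
    turns an equality between a function in the basis \<open>Q\<close> and one in the basis
    \<open>P\<close> into an intertwining relation for \<open>M\<close>.\<close>
  define M where "M = adj Q * P"
  have M: "M \<in> carrier_mat n n" using PQ by (simp add: M_def)
  have red: "sdf n Q a = sdf n P b \<longleftrightarrow> mat_diag n a * M = M * mat_diag n b" for a b
  proof
    assume "sdf n Q a = sdf n P b"
    then have "adj Q * sdf n Q a * P = adj Q * sdf n P b * P" by simp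
    then show "mat_diag n a * M = M * mat_diag n b"
      using PQ by (simp add: sdf_def M_def as u right_mult_one_mat[of _ n n] left_mult_one_mat[of _ n n])
  next
    assume "mat_diag n a * M = M * mat_diag n b"
    then have "Q * (mat_diag n a * M) * adj P = Q * (M * mat_diag n b) * adj P" by simp
    then show "sdf n Q a = sdf n P b"
      using PQ by (simp add: sdf_def M_def as u right_mult_one_mat[of _ n n] left_mult_one_mat[of _ n n])
  qed
  have 1: "mat_diag n (\<lambda>i. complex_of_real (exp (g i))) * M = M * mat_diag n (\<lambda>i. complex_of_real (exp (h i)))"
    using e red by blast
  have "complex_of_real (g i) * M $$ (i,j) = M $$ (i,j) * complex_of_real (h j)" if "i < n" "j < n" for i j
  proof -
    have "complex_of_real (exp (g i)) * M $$ (i,j) = M $$ (i,j) * complex_of_real (exp (h j))"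
      using arg_cong[OF 1, of "\<lambda>X. X $$ (i,j)"] that by (simp add: mat_diag_mult_left[OF M] mat_diag_mult_right[OF M])
    then have "M $$ (i,j) = 0 \<or> g i = h j" by (metis mult.commute mult_cancel_right of_real_eq_iff exp_inj_iff)
    then show ?thesis by auto
  qed
  then have "mat_diag n (\<lambda>i. complex_of_real (g i)) * M = M * mat_diag n (\<lambda>i. complex_of_real (h i))"
    using M by (intro eq_matI) (auto simp: mat_diag_mult_left[OF M] mat_diag_mult_right[OF M])
  then show "L = sdf n P (\<lambda>i. complex_of_real (h i))" using red Q(2) by blast
qed

section \<open>Positive maps and their ergodicity\<close>

text \<open>The vector is a function on \<open>nat\<close>, as in \<open>is_state\<close>; only its
  values below \<open>d\<close> enter.\<close>

definition qf :: "nat \<Rightarrow> complex mat \<Rightarrow> (nat \<Rightarrow> complex) \<Rightarrow> complex" where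
  "qf d X v = (\<Sum>i<d. \<Sum>j<d. cnj (v i) * X $$ (i,j) * v j)"

definition psd :: "nat \<Rightarrow> complex mat \<Rightarrow> bool" where
  "psd d X \<longleftrightarrow> hermitian_mat d X \<and> (\<forall>v. Re (qf d X v) \<ge> 0)"

lemma hermitian_carrier: "hermitian_mat d X \<Longrightarrow> X \<in> carrier_mat d d"
  by (simp add: hermitian_mat_def)

lemma psd_hermitian: "psd d X \<Longrightarrow> hermitian_mat d X"
  by (simp add: psd_def)

lemma psd_carrier [simp]: "psd d X \<Longrightarrow> X \<in> carrier_mat d d"
  by (simp add: psd_def hermitian_mat_def)

lemma hermitian_index:
  assumes "hermitian_mat d X" "i < d" "j < d"
  shows "cnj (X $$ (i,j)) = X $$ (j,i)"
proof -
  have "adj X $$ (j,i) = cnj (X $$ (i,j))" using assms by (intro adj_index) (auto simp: hermitian_mat_def)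
  then show ?thesis using assms by (simp add: hermitian_mat_def)
qed

lemma cnj_qf:
  assumes "X \<in> carrier_mat d d" shows "cnj (qf d X v) = qf d (adj X) v"
proof -
  have "cnj (qf d X v) = (\<Sum>i<d. \<Sum>j<d. v i * cnj (X $$ (i,j)) * cnj (v j))"
    by (simp add: qf_def)
  also have "\<dots> = (\<Sum>j<d. \<Sum>i<d. v i * cnj (X $$ (i,j)) * cnj (v j))" by (rule sum.swap)
  also have "\<dots> = qf d (adj X) v" unfolding qf_def using assms
    by (intro sum.cong refl) (simp add: mult_ac)
  finally show ?thesis .
qed

lemma hermitian_qf_real: "hermitian_mat d X \<Longrightarrow> Im (qf d X v) = 0"
  using cnj_qf[of X d v] by (simp add: hermitian_mat_def complex_eq_iff)

lemma qf_add: "X \<in> carrier_mat d d \<Longrightarrow> Y \<in> carrier_mat d d \<Longrightarrow> qf d (X + Y) v = qf d X v + qf d Y v"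
  by (simp add: qf_def distrib_left distrib_right sum.distrib)

lemma qf_minus: "X \<in> carrier_mat d d \<Longrightarrow> Y \<in> carrier_mat d d \<Longrightarrow> qf d (X - Y) v = qf d X v - qf d Y v"
  by (simp add: qf_def left_diff_distrib right_diff_distrib sum_subtractf)

lemma qf_smult: "X \<in> carrier_mat d d \<Longrightarrow> qf d (c \<cdot>\<^sub>m X) v = c * qf d X v"
  by (simp add: qf_def sum_distrib_left mult_ac)

lemma qf_one: "qf d (1\<^sub>m d) v = complex_of_real (\<Sum>i<d. (cmod (v i))\<^sup>2)"
proof -
  have "qf d (1\<^sub>m d) v = (\<Sum>i<d. \<Sum>j<d. if j = i then cnj (v i) * v i else 0)"
    unfolding qf_def by (intro sum.cong refl) auto
  then show ?thesis by (simp add: sum.delta cnj_mult_self)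
qed

lemma hermitian_add: "hermitian_mat d X \<Longrightarrow> hermitian_mat d Y \<Longrightarrow> hermitian_mat d (X + Y)"
  by (auto simp: hermitian_mat_def adj_add)

lemma hermitian_minus: "hermitian_mat d X \<Longrightarrow> hermitian_mat d Y \<Longrightarrow> hermitian_mat d (X - Y)"
  by (auto simp: hermitian_mat_def adj_minus[of _ d d] minus_carrier_mat)

lemma hermitian_smult: "hermitian_mat d X \<Longrightarrow> hermitian_mat d (complex_of_real c \<cdot>\<^sub>m X)"
  by (auto simp: hermitian_mat_def adj_smult)

lemma hermitian_one [simp]: "hermitian_mat d (1\<^sub>m d)"
  by (simp add: hermitian_mat_def)

lemma psd_add: "psd d X \<Longrightarrow> psd d Y \<Longrightarrow> psd d (X + Y)"
  by (auto simp: psd_def hermitian_add qf_add hermitian_carrier)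

lemma psd_smult: "psd d X \<Longrightarrow> c \<ge> 0 \<Longrightarrow> psd d (complex_of_real c \<cdot>\<^sub>m X)"
  by (auto simp: psd_def hermitian_smult qf_smult hermitian_carrier)

lemma psd_one [simp]: "psd d (1\<^sub>m d)"
  by (auto simp: psd_def qf_one sum_nonneg)

lemma psd_zero [simp]: "psd d (0\<^sub>m d d)"
  by (auto simp: psd_def qf_def hermitian_mat_def)

lemma qf_gram:
  assumes "B \<in> carrier_mat m d"
  shows "qf d (adj B * B) v = complex_of_real (\<Sum>r<m. (cmod (\<Sum>j<d. B $$ (r,j) * v j))\<^sup>2)"
proof -
  have "qf d (adj B * B) v = (\<Sum>i<d. \<Sum>j<d. \<Sum>r<m. cnj (B $$ (r,i) * v i) * (B $$ (r,j) * v j))"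
    unfolding qf_def using assms
    by (intro sum.cong refl) (auto simp: mmul_index[of "adj B" d m B d] sum_distrib_left sum_distrib_right mult_ac)
  also have "\<dots> = (\<Sum>i<d. \<Sum>r<m. \<Sum>j<d. cnj (B $$ (r,i) * v i) * (B $$ (r,j) * v j))"
    by (rule sum.cong[OF refl], rule sum.swap)
  also have "\<dots> = (\<Sum>r<m. \<Sum>i<d. \<Sum>j<d. cnj (B $$ (r,i) * v i) * (B $$ (r,j) * v j))" by (rule sum.swap)
  also have "\<dots> = (\<Sum>r<m. cnj (\<Sum>j<d. B $$ (r,j) * v j) * (\<Sum>j<d. B $$ (r,j) * v j))"
    by (simp only: sum_product cnj_sum)
  finally show ?thesis unfolding of_real_sum by (simp only: cnj_mult_self)
qed

lemma psd_gram: "B \<in> carrier_mat m d \<Longrightarrow> psd d (adj B * B)"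
  by (auto simp: psd_def hermitian_mat_def adj_mult[of "adj B" d m B d] qf_gram sum_nonneg)

lemma sdf_psd:
  assumes P: "unitary_mat d P" and f: "\<And>i. i < d \<Longrightarrow> f i \<ge> 0"
  shows "psd d (sdf d P (\<lambda>i. complex_of_real (f i)))"
proof -
  let ?B = "sdf d P (\<lambda>i. complex_of_real (sqrt (f i)))"
  have "psd d (adj ?B * ?B)" using P by (intro psd_gram[of _ d]) simp
  also have "adj ?B * ?B = sdf d P (\<lambda>i. complex_of_real (sqrt (f i)) * complex_of_real (sqrt (f i)))"
    using P by (simp add: adj_sdf sdf_mult)
  also have "\<dots> = sdf d P (\<lambda>i. complex_of_real (f i))"
    using P f by (intro sdf_cong) (auto simp flip: of_real_mult)
  finally show ?thesis .
qed

text \<open>Column \<open>k\<close> of \<open>P\<close> is a unit eigenvector, so testing a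
  quadratic form on it reads off a single eigenvalue. Both non-negativity and strict positivity of
  spectra are obtained this way.\<close>

lemma qf_sdf_column:
  assumes P: "unitary_mat d P" and k: "k < d"
  shows "qf d (sdf d P f) (\<lambda>i. P $$ (i,k)) = f k"
proof -
  have c: "P \<in> carrier_mat d d" using P by simp
  have on: "(\<Sum>i<d. cnj (P $$ (i,l)) * P $$ (i,m)) = (if l = m then 1 else 0)" if "l < d" "m < d" for l m
  proof -
    have "(adj P * P) $$ (l,m) = (1\<^sub>m d) $$ (l,m)" using P by (simp add: unitary_mat_def)
    then show ?thesis using c that by (simp add: mmul_index[of "adj P" d d P d])
  qed
  have "qf d (sdf d P f) (\<lambda>i. P $$ (i,k)) = (\<Sum>i<d. \<Sum>j<d. \<Sum>l<d. f l * (cnj (P $$ (i,k)) * P $$ (i,l)) * (cnj (P $$ (j,l)) * P $$ (j,k)))"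
    unfolding qf_def using P by (intro sum.cong refl) (auto simp: sdf_index sum_distrib_left sum_distrib_right mult_ac)
  also have "\<dots> = (\<Sum>i<d. \<Sum>l<d. \<Sum>j<d. f l * (cnj (P $$ (i,k)) * P $$ (i,l)) * (cnj (P $$ (j,l)) * P $$ (j,k)))"
    by (rule sum.cong[OF refl], rule sum.swap)
  also have "\<dots> = (\<Sum>l<d. \<Sum>i<d. \<Sum>j<d. f l * (cnj (P $$ (i,k)) * P $$ (i,l)) * (cnj (P $$ (j,l)) * P $$ (j,k)))"
    by (rule sum.swap)
  also have "\<dots> = (\<Sum>l<d. f l * (\<Sum>i<d. cnj (P $$ (i,k)) * P $$ (i,l)) * (\<Sum>j<d. cnj (P $$ (j,l)) * P $$ (j,k)))"
    by (simp add: sum_distrib_left sum_distrib_right mult_ac)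
  also have "\<dots> = (\<Sum>l<d. if l = k then f k else 0)"
    using k by (intro sum.cong refl) (auto simp: on)
  finally show ?thesis using k by (simp add: sum.delta)
qed

lemma psd_spectral:
  assumes "psd d X"
  obtains P f where "unitary_mat d P" "X = sdf d P (\<lambda>i. complex_of_real (f i))" "\<And>i. i < d \<Longrightarrow> f i \<ge> 0"
proof -
  obtain P f where P: "unitary_mat d P" "X = sdf d P (\<lambda>i. complex_of_real (f i))"
    using spectral_hermitian psd_hermitian[OF assms] by blast
  have "f i \<ge> 0" if "i < d" for i
  proof -
    have "Re (qf d X (\<lambda>l. P $$ (l,i))) = f i" using qf_sdf_column[OF P(1) that] P(2) by simp
    moreover have "Re (qf d X (\<lambda>l. P $$ (l,i))) \<ge> 0" using assms by (simp add: psd_def)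
    ultimately show ?thesis by simp
  qed
  then show thesis using that P by blast
qed

lemma psd_root:
  assumes "psd d X"
  obtains B where "hermitian_mat d B" "X = B * B"
proof -
  obtain P f where P: "unitary_mat d P" "X = sdf d P (\<lambda>i. complex_of_real (f i))" "\<And>i. i < d \<Longrightarrow> f i \<ge> 0"
    using psd_spectral[OF assms] by blast
  let ?B = "sdf d P (\<lambda>i. complex_of_real (sqrt (f i)))"
  have "?B * ?B = X" unfolding P(2) sdf_mult[OF P(1)]
    using P(1,3) by (intro sdf_cong) (auto simp flip: of_real_mult)
  then show thesis using that[OF hermitian_sdf[OF P(1)]] by metis
qed

lemma psd_gramE:
  assumes "psd d X"
  obtains B where "B \<in> carrier_mat d d" "X = adj B * B"
  using psd_root[OF assms] unfolding hermitian_mat_def by metis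

lemma psd_conj:
  assumes "psd d X" "C \<in> carrier_mat d e"
  shows "psd e (adj C * X * C)"
proof -
  obtain B where B: "B \<in> carrier_mat d d" "X = adj B * B" using psd_gramE[OF assms(1)] .
  have c: "adj C \<in> carrier_mat e d" "adj B \<in> carrier_mat d d" "B * C \<in> carrier_mat d e" using B assms by auto
  have "adj C * X * C = adj (B * C) * (B * C)"
    unfolding B(2) adj_mult[OF B(1) assms(2)]
    using assoc_mult_mat[OF c(1) _ assms(2), of "adj B * B" ] assoc_mult_mat[OF c(2) B(1) assms(2)]
      assoc_mult_mat[OF c(1,2,3)] B(1) by simp
  then show ?thesis using psd_gram[OF c(3)] by simp
qed

lemma psd_kron:
  assumes "psd d X" "psd e Y"
  shows "psd (d*e) (kron X Y)"
proof -
  obtain B where B: "B \<in> carrier_mat d d" "X = adj B * B" using psd_gramE[OF assms(1)] .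
  obtain C where C: "C \<in> carrier_mat e e" "Y = adj C * C" using psd_gramE[OF assms(2)] .
  have "kron X Y = adj (kron B C) * kron B C"
    using B C kron_mult[of "adj B" d d "adj C" e e B d C e] by (simp add: adj_kron)
  then show ?thesis using psd_gram[of "kron B C" "d*e" "d*e"] B C by simp
qed

lemma psd_ptrace2:
  assumes "psd (d*e) C" "e > 0"
  shows "psd d (ptrace2 e C)"
  unfolding psd_def
proof (intro conjI allI)
  have C: "C \<in> carrier_mat (d*e) (d*e)" using assms by simp
  show "hermitian_mat d (ptrace2 e C)"
    using assms adj_ptrace2[OF C] ptrace2_carrier[OF C] by (simp add: psd_def hermitian_mat_def)
  fix v
  \<comment> \<open>These are the vectors \<open>v \<otimes> e_k\<close> over the environment basis:
    the form of the partial trace at \<open>v\<close> is the sum of the forms of \<open>C\<close> on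
    them.\<close>
  have *: "qf (d*e) C (\<lambda>x. if x mod e = k then v (x div e) else 0) = (\<Sum>i<d. \<Sum>j<d. cnj (v i) * C $$ (i*e+k,j*e+k) * v j)"
    if k: "k < e" for k
  proof -
    have "qf (d*e) C (\<lambda>x. if x mod e = k then v (x div e) else 0)
       = (\<Sum>i<d. \<Sum>a<e. \<Sum>j<d. \<Sum>b<e. if b = k then if a = k then cnj (v i) * C $$ (i*e+a,j*e+b) * v j else 0 else 0)"
      unfolding qf_def sum_kron by (intro sum.cong refl) auto
    also have "\<dots> = (\<Sum>i<d. \<Sum>a<e. if a = k then (\<Sum>j<d. cnj (v i) * C $$ (i*e+k,j*e+k) * v j) else 0)"
      using k by (intro sum.cong refl) (auto simp: sum.delta)
    also have "\<dots> = (\<Sum>i<d. \<Sum>j<d. cnj (v i) * C $$ (i*e+k,j*e+k) * v j)"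
      using k by (simp add: sum.delta)
    finally show ?thesis .
  qed
  have "qf d (ptrace2 e C) v = (\<Sum>i<d. \<Sum>j<d. \<Sum>k<e. cnj (v i) * C $$ (i*e+k,j*e+k) * v j)"
    unfolding qf_def using assms(2) by (intro sum.cong refl) (simp add: ptrace2_index[OF C] sum_distrib_left sum_distrib_right)
  also have "\<dots> = (\<Sum>i<d. \<Sum>k<e. \<Sum>j<d. cnj (v i) * C $$ (i*e+k,j*e+k) * v j)"
    by (rule sum.cong[OF refl], rule sum.swap)
  also have "\<dots> = (\<Sum>k<e. \<Sum>i<d. \<Sum>j<d. cnj (v i) * C $$ (i*e+k,j*e+k) * v j)" by (rule sum.swap)
  also have "\<dots> = (\<Sum>k<e. qf (d*e) C (\<lambda>x. if x mod e = k then v (x div e) else 0))"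
    by (intro sum.cong refl) (simp add: *)
  finally show "Re (qf d (ptrace2 e C) v) \<ge> 0"
    using assms(1) by (simp add: psd_def sum_nonneg)
qed

lemma psd_trace: "psd d X \<Longrightarrow> Im (mtrace X) = 0 \<and> Re (mtrace X) \<ge> 0"
proof -
  assume "psd d X"
  then obtain P f where "unitary_mat d P" "X = sdf d P (\<lambda>i. complex_of_real (f i))" "\<And>i. i < d \<Longrightarrow> f i \<ge> 0"
    using psd_spectral by blast
  then show ?thesis by (auto simp: mtrace_sdf intro: sum_nonneg simp flip: of_real_sum)
qed

text \<open>With \<open>Y = adj B * B\<close>, cyclicity produces the trace of
  \<open>B * X * adj B\<close>, which is positive semidefinite.\<close>

lemma psd_trace_mult:
  assumes "psd d X" "psd d Y"
  shows "Im (mtrace (X * Y)) = 0" "Re (mtrace (X * Y)) \<ge> 0"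
proof -
  obtain B where B: "B \<in> carrier_mat d d" "Y = adj B * B" using psd_gramE[OF assms(2)] .
  have X: "X \<in> carrier_mat d d" using assms by simp
  have "mtrace (X * Y) = mtrace ((X * adj B) * B)" using B X by (simp add: assoc_mult_mat[of _ d d _ d _ d])
  also have "\<dots> = mtrace (B * (X * adj B))" using B X by (intro mtrace_cyc[of _ d d]) auto
  also have "B * (X * adj B) = adj (adj B) * X * adj B" using B X by (simp add: assoc_mult_mat[of _ d d _ d _ d])
  finally have "mtrace (X * Y) = mtrace (adj (adj B) * X * adj B)" .
  moreover have "psd d (adj (adj B) * X * adj B)" using assms B by (intro psd_conj[of d]) auto
  ultimately show "Im (mtrace (X * Y)) = 0" "Re (mtrace (X * Y)) \<ge> 0" using psd_trace by metis+
qed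

lemma unitary_entry_le:
  assumes "unitary_mat d P" "i < d" "k < d"
  shows "cmod (P $$ (i,k)) \<le> 1"
proof -
  have c: "P \<in> carrier_mat d d" using assms by simp
  have "(P * adj P) $$ (i,i) = (\<Sum>l<d. complex_of_real ((cmod (P $$ (i,l)))\<^sup>2))"
    unfolding mmul_index[OF c adj_carrier[THEN iffD2, OF c] assms(2,2)]
    using carrier_matD[OF c] assms complex_norm_square by (intro sum.cong refl) auto
  then have "complex_of_real (\<Sum>l<d. (cmod (P $$ (i,l)))\<^sup>2) = 1"
    using assms by (simp add: unitary_mat_def)
  then have "(\<Sum>l<d. (cmod (P $$ (i,l)))\<^sup>2) = 1" by (metis of_real_eq_1_iff)
  moreover have "(cmod (P $$ (i,k)))\<^sup>2 \<le> (\<Sum>l<d. (cmod (P $$ (i,l)))\<^sup>2)"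
    using assms by (intro member_le_sum) auto
  ultimately show ?thesis by (simp add: power_le_one_iff)
qed

text \<open>The eigenvalues are non-negative and the entries of a unitary have modulus at most 1.
  Order bounds therefore control entries, and convergence can be handled entrywise without an
  operator norm.\<close>

lemma psd_entry_le_trace:
  assumes "psd d X" "i < d" "j < d"
  shows "cmod (X $$ (i,j)) \<le> Re (mtrace X)"
proof -
  obtain P f where P: "unitary_mat d P" "X = sdf d P (\<lambda>i. complex_of_real (f i))" "\<And>i. i < d \<Longrightarrow> f i \<ge> 0"
    using psd_spectral[OF assms(1)] by blast
  have "cmod (X $$ (i,j)) \<le> (\<Sum>k<d. cmod (P $$ (i,k) * complex_of_real (f k) * cnj (P $$ (j,k))))"
    unfolding P(2) sdf_index[OF P(1) assms(2,3)] by (rule norm_sum)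
  also have "\<dots> \<le> (\<Sum>k<d. f k)"
  proof (rule sum_mono)
    fix k assume k: "k \<in> {..<d}"
    have "cmod (P $$ (i,k)) * cmod (P $$ (j,k)) \<le> 1 * 1"
      using k assms unitary_entry_le[OF P(1)] by (intro mult_mono) auto
    then have "(cmod (P $$ (i,k)) * cmod (P $$ (j,k))) * f k \<le> 1 * f k"
      using P(3) k by (intro mult_right_mono) auto
    then show "cmod (P $$ (i,k) * complex_of_real (f k) * cnj (P $$ (j,k))) \<le> f k"
      using P(3) k by (simp add: norm_mult mult_ac)
  qed
  also have "\<dots> = Re (mtrace X)" by (simp add: P(2) mtrace_sdf[OF P(1)])
  finally show ?thesis .
qed

text \<open>The traces of \<open>X\<close> and of its negative are both non-negative, so the trace
  is 0, and it bounds every entry.\<close>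

lemma psd_antisym:
  assumes "psd d X" "psd d (- 1 \<cdot>\<^sub>m X)"
  shows "X = 0\<^sub>m d d"
proof -
  have "Re (mtrace X) = 0"
    using psd_trace[OF assms(1)] psd_trace[OF assms(2)] mtrace_smult[of X d "-1"] assms(1) by simp
  then show ?thesis using psd_entry_le_trace[OF assms(1)] psd_carrier[OF assms(1)] by (intro eq_matI) auto
qed

lemma hermitian_bounded:
  assumes "hermitian_mat d X"
  obtains c where "c > 0" "psd d (complex_of_real c \<cdot>\<^sub>m 1\<^sub>m d - X)" "psd d (X - complex_of_real (-c) \<cdot>\<^sub>m 1\<^sub>m d)"
proof -
  obtain P f where P: "unitary_mat d P" "X = sdf d P (\<lambda>i. complex_of_real (f i))"
    using spectral_hermitian[OF assms] by blast
  define c where "c = 1 + (\<Sum>i<d. \<bar>f i\<bar>)"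
  have c: "c > 0" by (auto simp: c_def intro!: add_pos_nonneg sum_nonneg)
  have f: "\<bar>f i\<bar> \<le> c" if "i < d" for i
    using member_le_sum[of i "{..<d}" "\<lambda>i. \<bar>f i\<bar>"] that by (auto simp: c_def)
  have one: "complex_of_real a \<cdot>\<^sub>m 1\<^sub>m d = sdf d P (\<lambda>i. complex_of_real a)" for a
    using sdf_smult[OF P(1), of "complex_of_real a" "\<lambda>i. 1"] sdf_one[OF P(1)] by simp
  have "psd d (complex_of_real c \<cdot>\<^sub>m 1\<^sub>m d - X)" "psd d (X - complex_of_real (-c) \<cdot>\<^sub>m 1\<^sub>m d)"
    unfolding one P(2) sdf_minus[OF P(1)] of_real_diff[symmetric]
    using f by (force intro!: sdf_psd[OF P(1)])+
  then show thesis using that c by blast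
qed

text \<open>Entries within \<open>e\<close> of those of the identity change the quadratic form by at
  most \<open>e * d * |v|^2\<close>, by the inequality between geometric and arithmetic mean;
  \<open>e * d \<le> 1/2\<close> leaves half of the identity.\<close>

lemma near_one_psd:
  assumes X: "hermitian_mat d X" and near: "\<And>i j. i < d \<Longrightarrow> j < d \<Longrightarrow> cmod (X $$ (i,j) - 1\<^sub>m d $$ (i,j)) \<le> e"
    and e: "e * real d \<le> 1 / 2"
  shows "psd d (X - complex_of_real (1/2) \<cdot>\<^sub>m 1\<^sub>m d)"
  unfolding psd_def
proof (intro conjI allI)
  show h: "hermitian_mat d (X - complex_of_real (1/2) \<cdot>\<^sub>m 1\<^sub>m d)"
    using X by (intro hermitian_minus hermitian_smult) auto
  fix v
  define N where "N = (\<Sum>i<d. (cmod (v i))\<^sup>2)"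
  have Xc: "X \<in> carrier_mat d d" using X by (simp add: hermitian_mat_def)
  have e0: "e \<ge> 0" if "d > 0" using near[OF that that] norm_ge_zero order_trans by blast
  have near': "cmod ((X - 1\<^sub>m d) $$ (i,j)) \<le> e" if "i < d" "j < d" for i j
    using near[OF that] that Xc by simp
  have "cmod (qf d (X - 1\<^sub>m d) v) \<le> (\<Sum>i<d. \<Sum>j<d. cmod (v i) * e * cmod (v j))"
    unfolding qf_def
  proof (intro order_trans[OF norm_sum] sum_mono order_trans[OF norm_sum])
    fix i j assume "i \<in> {..<d}" "j \<in> {..<d}"
    then have "cmod (v i) * cmod ((X - 1\<^sub>m d) $$ (i,j)) * cmod (v j) \<le> cmod (v i) * e * cmod (v j)"
      using near' by (intro mult_right_mono mult_left_mono norm_ge_zero) auto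
    then show "cmod (cnj (v i) * (X - 1\<^sub>m d) $$ (i,j) * v j) \<le> cmod (v i) * e * cmod (v j)"
      by (simp only: norm_mult complex_mod_cnj)
  qed
  also have "\<dots> \<le> (\<Sum>i<d. \<Sum>j<d. e * ((cmod (v i))\<^sup>2 / 2 + (cmod (v j))\<^sup>2 / 2))"
  proof (intro sum_mono)
    fix i j assume "i \<in> {..<d}" "j \<in> {..<d}"
    then have "e \<ge> 0" using e0 by auto
    moreover have "cmod (v i) * cmod (v j) \<le> (cmod (v i))\<^sup>2 / 2 + (cmod (v j))\<^sup>2 / 2"
      using sum_squares_bound[of "cmod (v i)" "cmod (v j)"] by (simp add: power2_eq_square)
    ultimately have "e * (cmod (v i) * cmod (v j)) \<le> e * ((cmod (v i))\<^sup>2 / 2 + (cmod (v j))\<^sup>2 / 2)"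
      by (intro mult_left_mono)
    then show "cmod (v i) * e * cmod (v j) \<le> e * ((cmod (v i))\<^sup>2 / 2 + (cmod (v j))\<^sup>2 / 2)"
      by (simp only: mult_ac)
  qed
  also have "\<dots> = e * real d * N"
    unfolding sum_distrib_left[symmetric] sum.distrib sum_divide_distrib[symmetric] N_def[symmetric]
    by (simp add: N_def sum_distrib_left[symmetric])
  also have "\<dots> \<le> 1/2 * N" using e by (intro mult_right_mono) (auto simp: N_def sum_nonneg)
  finally have 1: "cmod (qf d (X - 1\<^sub>m d) v) \<le> 1/2 * N" .
  have "qf d (X - complex_of_real (1/2) \<cdot>\<^sub>m 1\<^sub>m d) v = qf d (X - 1\<^sub>m d) v + complex_of_real (N / 2)"
    using Xc by (simp add: qf_minus qf_smult qf_one N_def)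
  then show "Re (qf d (X - complex_of_real (1/2) \<cdot>\<^sub>m 1\<^sub>m d) v) \<ge> 0"
    using 1 abs_Re_le_cmod[of "qf d (X - 1\<^sub>m d) v"] by simp
qed

lemma is_state_iff: "is_state d \<rho> \<longleftrightarrow> psd d \<rho> \<and> mtrace \<rho> = 1"
  using hermitian_qf_real[of d \<rho>] by (auto simp: is_state_def psd_def Let_def qf_def)

section \<open>Linear and positive maps on matrices, and the contraction of order intervals\<close>

definition linmap :: "nat \<Rightarrow> (complex mat \<Rightarrow> complex mat) \<Rightarrow> bool" where
  "linmap d A \<longleftrightarrow> (\<forall>X\<in>carrier_mat d d. A X \<in> carrier_mat d d)
     \<and> (\<forall>X\<in>carrier_mat d d. \<forall>Y\<in>carrier_mat d d. A (X + Y) = A X + A Y)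
     \<and> (\<forall>X\<in>carrier_mat d d. \<forall>c. A (c \<cdot>\<^sub>m X) = c \<cdot>\<^sub>m A X)"

definition posmap :: "nat \<Rightarrow> (complex mat \<Rightarrow> complex mat) \<Rightarrow> bool" where
  "posmap d A \<longleftrightarrow> linmap d A \<and> (\<forall>X\<in>carrier_mat d d. A (adj X) = adj (A X))
     \<and> (\<forall>X. psd d X \<longrightarrow> psd d (A X))"

lemma linmap_carrier [simp]: "linmap d A \<Longrightarrow> X \<in> carrier_mat d d \<Longrightarrow> A X \<in> carrier_mat d d"
  by (simp add: linmap_def)

lemma linmap_add: "linmap d A \<Longrightarrow> X \<in> carrier_mat d d \<Longrightarrow> Y \<in> carrier_mat d d \<Longrightarrow> A (X + Y) = A X + A Y"
  by (simp add: linmap_def)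

lemma linmap_smult: "linmap d A \<Longrightarrow> X \<in> carrier_mat d d \<Longrightarrow> A (c \<cdot>\<^sub>m X) = c \<cdot>\<^sub>m A X"
  by (simp add: linmap_def)

lemma mat_minus_as_add: "X \<in> carrier_mat n m \<Longrightarrow> Y \<in> carrier_mat n m \<Longrightarrow> X - Y = X + (- 1 :: complex) \<cdot>\<^sub>m Y"
  by (intro eq_matI) auto

lemma linmap_minus: "linmap d A \<Longrightarrow> X \<in> carrier_mat d d \<Longrightarrow> Y \<in> carrier_mat d d \<Longrightarrow> A (X - Y) = A X - A Y"
  by (simp add: mat_minus_as_add[of _ d d] linmap_add linmap_smult)

lemma posmap_linmap: "posmap d A \<Longrightarrow> linmap d A"
  by (simp add: posmap_def)

lemma posmap_psd: "posmap d A \<Longrightarrow> psd d X \<Longrightarrow> psd d (A X)"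
  by (simp add: posmap_def)

lemma posmap_hermitian: "posmap d A \<Longrightarrow> hermitian_mat d X \<Longrightarrow> hermitian_mat d (A X)"
  by (auto simp: posmap_def linmap_def hermitian_mat_def)

lemma linmap_id [simp]: "linmap d id" "linmap d (\<lambda>X. X)"
  by (auto simp: linmap_def)

lemma linmap_comp: "linmap d A \<Longrightarrow> linmap d B \<Longrightarrow> linmap d (A \<circ> B)"
  by (auto simp: linmap_def)

lemma posmap_id [simp]: "posmap d id"
  by (auto simp: posmap_def)

lemma posmap_comp: "posmap d A \<Longrightarrow> posmap d B \<Longrightarrow> posmap d (A \<circ> B)"
  by (auto simp: posmap_def linmap_comp linmap_carrier)

lemma linmap_funpow: "linmap d A \<Longrightarrow> linmap d (A ^^ n)"
  by (induction n) (auto intro: linmap_comp simp: id_def)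

lemma posmap_funpow: "posmap d A \<Longrightarrow> posmap d (A ^^ n)"
  by (induction n) (auto intro: posmap_comp simp: id_def[symmetric])

text \<open>The induction runs over the finite set of entries of \<open>Y\<close> that are kept,
  adding one matrix unit at a time.\<close>

lemma functional_expand:
  fixes F :: "complex mat \<Rightarrow> complex"
  assumes add: "\<And>X Y. X \<in> carrier_mat d d \<Longrightarrow> Y \<in> carrier_mat d d \<Longrightarrow> F (X + Y) = F X + F Y"
    and sm: "\<And>X c. X \<in> carrier_mat d d \<Longrightarrow> F (c \<cdot>\<^sub>m X) = c * F X"
    and Y: "Y \<in> carrier_mat d d"
  shows "F Y = (\<Sum>a<d. \<Sum>b<d. Y $$ (a,b) * F (mat d d (\<lambda>ij. if ij = (a,b) then 1 else 0)))"
proof -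
  define E where "E a = mat d d (\<lambda>ij. if ij = a then 1 else 0 :: complex)" for a
  have *: "F (mat d d (\<lambda>ij. if ij \<in> S then Y $$ ij else 0)) = (\<Sum>a\<in>S. Y $$ a * F (E a))" if "finite S" for S
    using that
  proof (induction S)
    case empty
    have "F (0 \<cdot>\<^sub>m 0\<^sub>m d d) = 0" by (subst sm) auto
    also have "0 \<cdot>\<^sub>m 0\<^sub>m d d = mat d d (\<lambda>ij. if ij \<in> {} then Y $$ ij else 0)" by (intro eq_matI) auto
    finally show ?case by simp
  next
    case (insert a S)
    have "mat d d (\<lambda>ij. if ij \<in> insert a S then Y $$ ij else 0)
       = Y $$ a \<cdot>\<^sub>m E a + mat d d (\<lambda>ij. if ij \<in> S then Y $$ ij else 0)"
      using insert.hyps by (intro eq_matI) (auto simp: E_def)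
    then show ?case using insert by (simp add: add sm E_def)
  qed
  have "Y = mat d d (\<lambda>ij. if ij \<in> {..<d} \<times> {..<d} then Y $$ ij else 0)"
    using Y by (intro eq_matI) auto
  then have "F Y = (\<Sum>a\<in>{..<d} \<times> {..<d}. Y $$ a * F (E a))" using *[of "{..<d} \<times> {..<d}"] by simp
  then show ?thesis by (simp add: sum.cartesian_product E_def case_prod_unfold)
qed

lemma linmap_expand:
  assumes "linmap d A" "Y \<in> carrier_mat d d" "i < d" "j < d"
  shows "A Y $$ (i,j) = (\<Sum>a<d. \<Sum>b<d. Y $$ (a,b) * A (mat d d (\<lambda>ij. if ij = (a,b) then 1 else 0)) $$ (i,j))"
  by (rule functional_expand[where F = "\<lambda>Y. A Y $$ (i,j)"])
     (use assms in \<open>auto simp: linmap_add linmap_smult carrier_matD[OF linmap_carrier[OF assms(1)]]\<close>)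

text \<open>An order interval between multiples of the identity; its length \<open>b - a\<close>
  plays the part of an oscillation seminorm.\<close>

definition between :: "nat \<Rightarrow> real \<Rightarrow> complex mat \<Rightarrow> real \<Rightarrow> bool" where
  "between d a X b \<longleftrightarrow> psd d (X - complex_of_real a \<cdot>\<^sub>m 1\<^sub>m d) \<and> psd d (complex_of_real b \<cdot>\<^sub>m 1\<^sub>m d - X)"

text \<open>The traces of \<open>X - a\<close> and \<open>b - X\<close> are non-negative with sum
  \<open>d * (b - a)\<close>, so the first is at most this sum and bounds the entries.\<close>

lemma between_entry:
  assumes "between d a X b" "X \<in> carrier_mat d d" "i < d" "j < d"
  shows "cmod (X $$ (i,j) - complex_of_real a * 1\<^sub>m d $$ (i,j)) \<le> real d * (b - a)"
proof -
  let ?Y = "X - complex_of_real a \<cdot>\<^sub>m 1\<^sub>m d" and ?Z = "complex_of_real b \<cdot>\<^sub>m 1\<^sub>m d - X"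
  have Y: "psd d ?Y" and Z: "psd d ?Z" using assms by (auto simp: between_def)
  have tr1: "mtrace (1\<^sub>m d :: complex mat) = of_nat d" by (simp add: mtrace_def)
  have "mtrace ?Y + mtrace ?Z = complex_of_real (real d * (b - a))"
    using assms(2) by (simp add: mtrace_minus[of _ d] mtrace_smult[of _ d] tr1 algebra_simps)
  then have "Re (mtrace ?Y) + Re (mtrace ?Z) = real d * (b - a)" by (metis Re_complex_of_real plus_complex.simps(1))
  then have "Re (mtrace ?Y) \<le> real d * (b - a)" using psd_trace[OF Z] by linarith
  moreover have "cmod (?Y $$ (i,j)) \<le> Re (mtrace ?Y)" by (rule psd_entry_le_trace[OF Y assms(3,4)])
  ultimately show ?thesis using assms by simp
qed

lemma between_map:
  assumes A: "posmap d A" "A (1\<^sub>m d) = 1\<^sub>m d" and X: "between d a X b" "X \<in> carrier_mat d d"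
  shows "between d a (A X) b"
proof -
  have "A (X - complex_of_real a \<cdot>\<^sub>m 1\<^sub>m d) = A X - complex_of_real a \<cdot>\<^sub>m 1\<^sub>m d"
    "A (complex_of_real b \<cdot>\<^sub>m 1\<^sub>m d - X) = complex_of_real b \<cdot>\<^sub>m 1\<^sub>m d - A X"
    using A(2) X(2) posmap_linmap[OF A(1)] by (auto simp: linmap_minus linmap_smult)
  moreover have "psd d (A (X - complex_of_real a \<cdot>\<^sub>m 1\<^sub>m d))" "psd d (A (complex_of_real b \<cdot>\<^sub>m 1\<^sub>m d - X))"
    using X(1) by (auto simp: between_def intro: posmap_psd[OF A(1)])
  ultimately show ?thesis by (simp add: between_def)
qed

text \<open>The minorisation applied to \<open>X - a\<close> and to \<open>b - X\<close> raises the
  lower end by \<open>e\<close> times one trace and lowers the upper end by \<open>e\<close> times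
  the other. The two traces add up to \<open>d * (b - a)\<close>, which is the origin of the factor
  \<open>1 - e * d\<close>.\<close>

lemma between_contract:
  assumes A: "linmap d A" "A (1\<^sub>m d) = 1\<^sub>m d"
    and D: "\<And>Y. psd d Y \<Longrightarrow> psd d (A Y - (complex_of_real e * mtrace Y) \<cdot>\<^sub>m 1\<^sub>m d)"
    and X: "between d a X b" "X \<in> carrier_mat d d"
  shows "\<exists>a' b'. between d a' (A X) b' \<and> b' - a' = (1 - e * real d) * (b - a)"
proof -
  let ?Y = "X - complex_of_real a \<cdot>\<^sub>m 1\<^sub>m d" and ?Z = "complex_of_real b \<cdot>\<^sub>m 1\<^sub>m d - X"
  define y z where "y = Re (mtrace ?Y)" and "z = Re (mtrace ?Z)"
  have Y: "psd d ?Y" and Z: "psd d ?Z" using X by (auto simp: between_def)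
  have tr1: "mtrace (1\<^sub>m d :: complex mat) = of_nat d" by (simp add: mtrace_def)
  have "mtrace ?Y + mtrace ?Z = complex_of_real (real d * (b - a))"
    using X(2) by (simp add: mtrace_minus[of _ d] mtrace_smult[of _ d] tr1 algebra_simps)
  then have yz: "y + z = real d * (b - a)" unfolding y_def z_def by (metis Re_complex_of_real plus_complex.simps(1))
  have ty: "mtrace ?Y = complex_of_real y" and tz: "mtrace ?Z = complex_of_real z"
    using psd_trace[OF Y] psd_trace[OF Z] by (auto simp: y_def z_def complex_eq_iff)
  have AX: "A X \<in> carrier_mat d d" using A X by simp
  have "A ?Y = A X - complex_of_real a \<cdot>\<^sub>m 1\<^sub>m d" "A ?Z = complex_of_real b \<cdot>\<^sub>m 1\<^sub>m d - A X"
    using A X(2) by (auto simp: linmap_minus linmap_smult)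
  then have "psd d (A X - complex_of_real a \<cdot>\<^sub>m 1\<^sub>m d - (complex_of_real e * complex_of_real y) \<cdot>\<^sub>m 1\<^sub>m d)"
     "psd d (complex_of_real b \<cdot>\<^sub>m 1\<^sub>m d - A X - (complex_of_real e * complex_of_real z) \<cdot>\<^sub>m 1\<^sub>m d)"
    using D[OF Y] D[OF Z] unfolding ty tz by simp_all
  moreover have "A X - complex_of_real a \<cdot>\<^sub>m 1\<^sub>m d - (complex_of_real e * complex_of_real y) \<cdot>\<^sub>m 1\<^sub>m d
      = A X - complex_of_real (a + e * y) \<cdot>\<^sub>m 1\<^sub>m d"
    using AX by (intro eq_matI) auto
  moreover have "complex_of_real b \<cdot>\<^sub>m 1\<^sub>m d - A X - (complex_of_real e * complex_of_real z) \<cdot>\<^sub>m 1\<^sub>m d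
      = complex_of_real (b - e * z) \<cdot>\<^sub>m 1\<^sub>m d - A X"
    using AX by (intro eq_matI) auto
  ultimately have "psd d (A X - complex_of_real (a + e * y) \<cdot>\<^sub>m 1\<^sub>m d)" "psd d (complex_of_real (b - e * z) \<cdot>\<^sub>m 1\<^sub>m d - A X)"
    by simp_all
  moreover have "(b - e * z) - (a + e * y) = (1 - e * real d) * (b - a)"
  proof -
    have "e * (y + z) = e * (real d * (b - a))" using yz by simp
    then show ?thesis by (simp add: algebra_simps)
  qed
  ultimately show ?thesis unfolding between_def by blast
qed

lemma hermitian_parts:
  assumes "X \<in> carrier_mat d d"
  obtains Y Z where "hermitian_mat d Y" "hermitian_mat d Z" "X = Y + \<i> \<cdot>\<^sub>m Z"
proof
  show "hermitian_mat d ((1/2) \<cdot>\<^sub>m (X + adj X))" "hermitian_mat d ((1/(2*\<i>)) \<cdot>\<^sub>m (X - adj X))"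
    using assms by (auto simp: hermitian_mat_def algebra_simps intro!: eq_matI)
  show "X = (1/2) \<cdot>\<^sub>m (X + adj X) + \<i> \<cdot>\<^sub>m ((1/(2*\<i>)) \<cdot>\<^sub>m (X - adj X))"
    using assms by (intro eq_matI) (auto simp: field_simps)
qed

text \<open>Each block of \<open>n\<close> steps contracts the enclosing interval by
  \<open>q\<close>, and positivity with unitality keeps the iterates inside it between blocks. The
  entries are therefore Cauchy, and their limit is a multiple of the identity.\<close>

lemma hermitian_limit:
  assumes d: "d > 0" and A: "posmap d A" "A (1\<^sub>m d) = 1\<^sub>m d" and e: "e > 0"
    and D: "\<And>Y. psd d Y \<Longrightarrow> psd d ((A ^^ n) Y - (complex_of_real e * mtrace Y) \<cdot>\<^sub>m 1\<^sub>m d)"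
    and Y: "hermitian_mat d Y"
  shows "\<exists>l. \<forall>i<d. \<forall>j<d. (\<lambda>N. (A ^^ N) Y $$ (i,j)) \<longlonglongrightarrow> complex_of_real l * 1\<^sub>m d $$ (i,j)"
proof -
  note lin = posmap_linmap[OF A(1)]
  have Yc: "(A ^^ N) Y \<in> carrier_mat d d" for N using hermitian_carrier[OF Y] linmap_funpow[OF lin] by simp
  have one: "(A ^^ N) (1\<^sub>m d) = 1\<^sub>m d" for N by (induction N) (auto simp: A)
  define q where "q = 1 - e * real d"
  have q1: "q < 1" using e d by (simp add: q_def)
  \<comment> \<open>The minorisation at the identity reads \<open>q * 1 \<ge> 0\<close>. Together
    with \<open>q < 1\<close> this is what makes the powers of \<open>q\<close> tend to 0.\<close>
  have q0: "q \<ge> 0"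
  proof -
    have tr1: "mtrace (1\<^sub>m d :: complex mat) = of_nat d" by (simp add: mtrace_def)
    have "1\<^sub>m d - (complex_of_real e * of_nat d) \<cdot>\<^sub>m 1\<^sub>m d = (complex_of_real q) \<cdot>\<^sub>m 1\<^sub>m d"
      by (intro eq_matI) (auto simp: q_def)
    then have "psd d (complex_of_real q \<cdot>\<^sub>m 1\<^sub>m d)" using D[OF psd_one] by (simp add: one tr1)
    then have "Re (mtrace (complex_of_real q \<cdot>\<^sub>m 1\<^sub>m d)) \<ge> 0" using psd_trace by blast
    then show ?thesis using d by (simp add: mtrace_smult[of _ d] tr1 zero_le_mult_iff)
  qed
  obtain c where "c > 0" "psd d (complex_of_real c \<cdot>\<^sub>m 1\<^sub>m d - Y)" "psd d (Y - complex_of_real (-c) \<cdot>\<^sub>m 1\<^sub>m d)"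
    using hermitian_bounded[OF Y] .
  then have b0: "between d (-c) Y c" by (simp add: between_def)
  have step: "\<exists>a b. between d a ((A ^^ (n*k)) Y) b \<and> b - a = q ^ k * (2*c)" for k
  proof (induction k)
    case 0
    show ?case using b0 by (intro exI[of _ "-c"] exI[of _ c]) auto
  next
    case (Suc k)
    then obtain a b where ab: "between d a ((A ^^ (n*k)) Y) b" "b - a = q ^ k * (2*c)" by blast
    have "(A ^^ (n * Suc k)) Y = (A ^^ n) ((A ^^ (n*k)) Y)" by (simp add: funpow_add)
    then show ?case
      using between_contract[OF linmap_funpow[OF lin] one D ab(1) Yc] ab(2) by (simp add: q_def mult_ac)
  qed
  have after: "\<exists>a b. (\<forall>N\<ge>n*k. between d a ((A ^^ N) Y) b) \<and> b - a = q ^ k * (2*c)" for k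
  proof -
    obtain a b where ab: "between d a ((A ^^ (n*k)) Y) b" "b - a = q ^ k * (2*c)" using step by blast
    have "between d a ((A ^^ N) Y) b" if "N \<ge> n*k" for N
      using that by (induction N rule: dec_induct) (auto simp: ab between_map[OF A] Yc)
    then show ?thesis using ab by blast
  qed
  \<comment> \<open>The entrywise error given by \<open>between_entry\<close> for an interval of
    length \<open>q ^ k * (2*c)\<close>.\<close>
  define K where "K k = real d * (q ^ k * (2*c))" for k
  have Klim: "K \<longlonglongrightarrow> 0" unfolding K_def
    using q0 q1 by (auto intro!: tendsto_mult_right_zero tendsto_mult_left_zero LIMSEQ_power_zero)
  \<comment> \<open>The scalar is the lower end of an interval that contains all iterates from time
    \<open>n*k\<close> on.\<close>
  have ex: "\<exists>a. \<forall>N\<ge>n*k. \<forall>i<d. \<forall>j<d. cmod ((A ^^ N) Y $$ (i,j) - complex_of_real a * 1\<^sub>m d $$ (i,j)) \<le> K k" for k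
  proof -
    obtain a b where ab: "\<And>N. N \<ge> n*k \<Longrightarrow> between d a ((A ^^ N) Y) b" "b - a = q ^ k * (2*c)"
      using after[of k] by blast
    show ?thesis using between_entry[OF ab(1) Yc] unfolding K_def ab(2) by blast
  qed
  then have "\<exists>al. \<forall>k. \<forall>N\<ge>n*k. \<forall>i<d. \<forall>j<d. cmod ((A ^^ N) Y $$ (i,j) - complex_of_real (al k) * 1\<^sub>m d $$ (i,j)) \<le> K k"
    by (intro choice allI)
  then obtain al where al: "\<And>k N i j. N \<ge> n*k \<Longrightarrow> i < d \<Longrightarrow> j < d \<Longrightarrow> cmod ((A ^^ N) Y $$ (i,j) - complex_of_real (al k) * 1\<^sub>m d $$ (i,j)) \<le> K k"
    by blast
  have "Cauchy (\<lambda>N. (A ^^ N) Y $$ (i,j))" if ij: "i < d" "j < d" for i j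
  proof (rule metric_CauchyI)
    fix r :: real assume "r > 0"
    then have "eventually (\<lambda>k. K k < r/2) sequentially" using order_tendstoD(2)[OF Klim, of "r/2"] by simp
    then obtain k where k: "K k < r/2" by (metis eventually_sequentially order_refl)
    show "\<exists>M. \<forall>m\<ge>M. \<forall>p\<ge>M. dist ((A ^^ m) Y $$ (i,j)) ((A ^^ p) Y $$ (i,j)) < r"
    proof (intro exI allI impI)
      fix m p assume "m \<ge> n*k" "p \<ge> n*k"
      then have "dist ((A ^^ m) Y $$ (i,j)) (complex_of_real (al k) * 1\<^sub>m d $$ (i,j)) < r/2"
        "dist ((A ^^ p) Y $$ (i,j)) (complex_of_real (al k) * 1\<^sub>m d $$ (i,j)) < r/2"
        using al[of k _ i j] ij k unfolding dist_norm by (meson le_less_trans)+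
      then show "dist ((A ^^ m) Y $$ (i,j)) ((A ^^ p) Y $$ (i,j)) < r" by (rule dist_triangle_half_l)
    qed
  qed
  then have "\<exists>L. (\<lambda>N. (A ^^ N) Y $$ (i,j)) \<longlonglongrightarrow> L" if "i < d" "j < d" for i j
    using that by (simp add: Cauchy_convergent_iff convergent_def)
  then obtain L where L: "\<And>i j. i < d \<Longrightarrow> j < d \<Longrightarrow> (\<lambda>N. (A ^^ N) Y $$ (i,j)) \<longlonglongrightarrow> L i j" by metis
  have Lal: "cmod (L i j - complex_of_real (al k) * 1\<^sub>m d $$ (i,j)) \<le> K k" if "i < d" "j < d" for i j k
  proof (rule Lim_bounded)
    show "(\<lambda>N. cmod ((A ^^ N) Y $$ (i,j) - complex_of_real (al k) * 1\<^sub>m d $$ (i,j))) \<longlonglongrightarrow> cmod (L i j - complex_of_real (al k) * 1\<^sub>m d $$ (i,j))"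
      by (intro tendsto_norm tendsto_diff L that tendsto_const)
  qed (use al that in blast)
  have z: "x = 0" if "\<And>k. cmod x \<le> 2 * K k" for x
  proof -
    have "(\<lambda>k. 2 * K k) \<longlonglongrightarrow> 2 * 0" by (intro tendsto_mult tendsto_const Klim)
    then have "cmod x \<le> 0" using that by (intro LIMSEQ_le_const[of "\<lambda>k. 2 * K k"]) auto
    then show ?thesis by simp
  qed
  have K0: "K k \<ge> 0" for k using Lal[OF d d] norm_ge_zero order_trans by blast
  have Loff: "L i j = 0" if "i < d" "j < d" "i \<noteq> j" for i j
  proof (rule z)
    fix k show "cmod (L i j) \<le> 2 * K k" using Lal[OF that(1,2), of k] that K0[of k] by simp
  qed
  have Ldiag: "L i i = L 0 0" if "i < d" for i
  proof -
    have "cmod (L i i - L 0 0) \<le> 2 * K k" for k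
      using Lal[OF that that, of k] Lal[OF d d, of k] norm_triangle_ineq4[of "L i i - complex_of_real (al k)" "L 0 0 - complex_of_real (al k)"] that d
      by simp
    then show ?thesis using z[of "L i i - L 0 0"] by simp
  qed
  have "L 0 0 = complex_of_real (Re (L 0 0))"
  proof -
    have "Im ((A ^^ N) Y $$ (0,0)) = 0" for N
      using hermitian_index[OF posmap_hermitian[OF posmap_funpow[OF A(1)] Y] d d, of N] by (simp add: complex_eq_iff)
    then have "Im (L 0 0) = 0" using tendsto_Im[OF L[OF d d]] by (simp add: LIMSEQ_const_iff)
    then show ?thesis by (simp add: complex_eq_iff)
  qed
  then have "complex_of_real (Re (L 0 0)) * 1\<^sub>m d $$ (i,j) = L i j" if "i < d" "j < d" for i j
    using Loff[of i j] Ldiag[of i] that by (cases "i = j") auto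
  then show ?thesis using L by (intro exI[of _ "Re (L 0 0)"]) simp
qed

text \<open>The iterates of \<open>Y\<close> tend to a scalar \<open>l Y\<close>, and
  \<open>l\<close> is a positive unital functional that is invariant under \<open>A\<close>. Its
  density matrix is the stationary state.\<close>

theorem doeblin_ergodic:
  assumes d: "d > 0" and A: "posmap d A" "A (1\<^sub>m d) = 1\<^sub>m d" and e: "e > 0"
    and D: "\<And>Y. psd d Y \<Longrightarrow> psd d ((A ^^ n) Y - (complex_of_real e * mtrace Y) \<cdot>\<^sub>m 1\<^sub>m d)"
  obtains \<rho> where "is_state d \<rho>" "\<And>Y. Y \<in> carrier_mat d d \<Longrightarrow> mtrace (\<rho> * A Y) = mtrace (\<rho> * Y)"
    "\<And>Y i j. Y \<in> carrier_mat d d \<Longrightarrow> i < d \<Longrightarrow> j < d \<Longrightarrow> (\<lambda>N. (A ^^ N) Y $$ (i,j)) \<longlonglongrightarrow> mtrace (\<rho> * Y) * 1\<^sub>m d $$ (i,j)"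
proof -
  note lin = posmap_linmap[OF A(1)] and linN = linmap_funpow[OF posmap_linmap[OF A(1)]]
  have one: "(A ^^ N) (1\<^sub>m d) = 1\<^sub>m d" for N by (induction N) (auto simp: A)
  have "\<exists>l. \<forall>i<d. \<forall>j<d. (\<lambda>N. (A ^^ N) Y $$ (i,j)) \<longlonglongrightarrow> l * 1\<^sub>m d $$ (i,j)" if Y: "Y \<in> carrier_mat d d" for Y
  proof -
    obtain Y1 Y2 where h: "hermitian_mat d Y1" "hermitian_mat d Y2" and Ye: "Y = Y1 + \<i> \<cdot>\<^sub>m Y2" using hermitian_parts[OF Y] .
    obtain l1 where l1: "\<And>i j. i < d \<Longrightarrow> j < d \<Longrightarrow> (\<lambda>N. (A ^^ N) Y1 $$ (i,j)) \<longlonglongrightarrow> complex_of_real l1 * 1\<^sub>m d $$ (i,j)"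
      using hermitian_limit[OF d A e D h(1)] by blast
    obtain l2 where l2: "\<And>i j. i < d \<Longrightarrow> j < d \<Longrightarrow> (\<lambda>N. (A ^^ N) Y2 $$ (i,j)) \<longlonglongrightarrow> complex_of_real l2 * 1\<^sub>m d $$ (i,j)"
      using hermitian_limit[OF d A e D h(2)] by blast
    note hc = h[THEN hermitian_carrier]
    have "(A ^^ N) Y $$ (i,j) = (A ^^ N) Y1 $$ (i,j) + \<i> * (A ^^ N) Y2 $$ (i,j)" if "i < d" "j < d" for N i j
      unfolding Ye using that hc carrier_matD[OF linmap_carrier[OF linN]] by (simp add: linmap_add[OF linN] linmap_smult[OF linN])
    then have "(\<lambda>N. (A ^^ N) Y $$ (i,j)) \<longlonglongrightarrow> (complex_of_real l1 + \<i> * complex_of_real l2) * 1\<^sub>m d $$ (i,j)" if "i < d" "j < d" for i j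
      using tendsto_add[OF l1[OF that] tendsto_mult[OF tendsto_const l2[OF that], of \<i>]] that by (simp add: algebra_simps)
    then show ?thesis by blast
  qed
  then obtain l where l: "\<And>Y i j. Y \<in> carrier_mat d d \<Longrightarrow> i < d \<Longrightarrow> j < d \<Longrightarrow> (\<lambda>N. (A ^^ N) Y $$ (i,j)) \<longlonglongrightarrow> l Y * 1\<^sub>m d $$ (i,j)"
    by metis
  have l0: "(\<lambda>N. (A ^^ N) Y $$ (0,0)) \<longlonglongrightarrow> l Y" if "Y \<in> carrier_mat d d" for Y
    using l[OF that d d] d by simp
  note cD = carrier_matD[OF linmap_carrier[OF linN]]
  have ladd: "l (X + Y) = l X + l Y" if "X \<in> carrier_mat d d" "Y \<in> carrier_mat d d" for X Y
  proof (rule LIMSEQ_unique[OF l0])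
    show "(\<lambda>N. (A ^^ N) (X + Y) $$ (0,0)) \<longlonglongrightarrow> l X + l Y"
      using tendsto_add[OF l0[OF that(1)] l0[OF that(2)]] that d by (simp add: linmap_add[OF linN] cD)
  qed (use that in simp)
  have lsm: "l (c \<cdot>\<^sub>m X) = c * l X" if "X \<in> carrier_mat d d" for X c
  proof (rule LIMSEQ_unique[OF l0])
    show "(\<lambda>N. (A ^^ N) (c \<cdot>\<^sub>m X) $$ (0,0)) \<longlonglongrightarrow> c * l X"
      using tendsto_mult[OF tendsto_const l0[OF that], of c] that d by (simp add: linmap_smult[OF linN] cD)
  qed (use that in simp)
  have l1: "l (1\<^sub>m d) = 1"
    using l0[of "1\<^sub>m d"] d by (simp add: one LIMSEQ_const_iff)
  have lA: "l (A Y) = l Y" if "Y \<in> carrier_mat d d" for Y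
  proof (rule LIMSEQ_unique[OF l0])
    show "(\<lambda>N. (A ^^ N) (A Y) $$ (0,0)) \<longlonglongrightarrow> l Y"
      using LIMSEQ_Suc[OF l0[OF that]] by (simp add: funpow_swap1)
  qed (use that lin in simp)
  have lpos: "Im (l Y) = 0 \<and> Re (l Y) \<ge> 0" if "psd d Y" for Y
  proof -
    have *: "Im ((A ^^ N) Y $$ (0,0)) = 0 \<and> Re ((A ^^ N) Y $$ (0,0)) \<ge> 0" for N
    proof -
      have p: "psd d ((A ^^ N) Y)" using posmap_psd[OF posmap_funpow[OF A(1)] that] .
      have "qf d ((A ^^ N) Y) (\<lambda>i. if i = 0 then 1 else 0) = (\<Sum>i<d. \<Sum>j<d. if j = 0 then if i = 0 then (A ^^ N) Y $$ (i,j) else 0 else 0)"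
        unfolding qf_def by (intro sum.cong refl) auto
      also have "\<dots> = (\<Sum>i<d. if i = 0 then (A ^^ N) Y $$ (0,0) else 0)"
        using d by (intro sum.cong refl) (auto simp: sum.delta)
      also have "\<dots> = (A ^^ N) Y $$ (0,0)"
        using d by (simp add: sum.delta)
      finally show ?thesis using p hermitian_qf_real[of d "(A ^^ N) Y"] unfolding psd_def by metis
    qed
    have c: "Y \<in> carrier_mat d d" using that by simp
    show ?thesis
      using tendsto_Im[OF l0[OF c]] tendsto_Re[OF l0[OF c]] *
      by (auto simp: LIMSEQ_const_iff intro: LIMSEQ_le_const)
  qed
  define E where "E a b = mat d d (\<lambda>ij. if ij = (a,b) then 1 else 0 :: complex)" for a b
  \<comment> \<open>The indices are transposed because the trace pairs entry \<open>(i,j)\<close> of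
    \<open>\<rho>\<close> with entry \<open>(j,i)\<close> of \<open>Y\<close>.\<close>
  define \<rho> where "\<rho> = mat d d (\<lambda>(i,j). l (E j i))"
  have \<rho>c: "\<rho> \<in> carrier_mat d d" by (simp add: \<rho>_def)
  have lexp: "l Y = (\<Sum>a<d. \<Sum>b<d. Y $$ (a,b) * l (E a b))" if "Y \<in> carrier_mat d d" for Y
    unfolding E_def by (rule functional_expand[OF ladd lsm that])
  have tr: "mtrace (\<rho> * Y) = l Y" if "Y \<in> carrier_mat d d" for Y
  proof -
    have "mtrace (\<rho> * Y) = (\<Sum>i<d. \<Sum>k<d. l (E k i) * Y $$ (k,i))"
    proof -
      have "(\<rho> * Y) $$ (i,i) = (\<Sum>k<d. l (E k i) * Y $$ (k,i))" if "i < d" for i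
        using that by (subst mmul_index[OF \<rho>c \<open>Y \<in> carrier_mat d d\<close>]) (auto simp: \<rho>_def)
      then show ?thesis using \<rho>c by (auto simp: mtrace_def)
    qed
    also have "\<dots> = (\<Sum>k<d. \<Sum>i<d. l (E k i) * Y $$ (k,i))" by (rule sum.swap)
    finally show ?thesis by (simp add: lexp[OF that] mult.commute)
  qed
  \<comment> \<open>Positivity of \<open>\<rho>\<close> is inherited from positivity of
    \<open>l\<close> on the rank-one matrices \<open>v v^*\<close>.\<close>
  have qr: "qf d \<rho> v = l (mat d d (\<lambda>(i,j). v i * cnj (v j)))" for v
  proof -
    have "qf d \<rho> v = (\<Sum>i<d. \<Sum>j<d. v j * cnj (v i) * l (E j i))"
      unfolding qf_def by (intro sum.cong refl) (simp add: \<rho>_def mult_ac)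
    also have "\<dots> = (\<Sum>j<d. \<Sum>i<d. v j * cnj (v i) * l (E j i))" by (rule sum.swap)
    finally show ?thesis by (simp add: lexp)
  qed
  have outer: "psd d (mat d d (\<lambda>(i,j). v i * cnj (v j)))" for v
  proof -
    let ?B = "mat 1 d (\<lambda>(i,j). cnj (v j))"
    have "psd d (adj ?B * ?B)" by (rule psd_gram[of _ 1]) simp
    also have "adj ?B * ?B = mat d d (\<lambda>(i,j). v i * cnj (v j))"
    proof (rule eq_matI)
      fix i j assume "i < dim_row (mat d d (\<lambda>(i,j). v i * cnj (v j)))" "j < dim_col (mat d d (\<lambda>(i,j). v i * cnj (v j)))"
      then show "(adj ?B * ?B) $$ (i,j) = mat d d (\<lambda>(i,j). v i * cnj (v j)) $$ (i,j)"
        by (subst mmul_index[of _ d 1 _ d]) auto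
    qed auto
    finally show ?thesis .
  qed
  have "cnj (\<rho> $$ (j,i)) = \<rho> $$ (i,j)" if "i < d" "j < d" for i j
  proof -
    have re: "cnj (l Y) = l Y" if "hermitian_mat d Y" for Y
    proof -
      have "cnj ((A ^^ N) Y $$ (0,0)) = (A ^^ N) Y $$ (0,0)" for N
        using hermitian_index[OF posmap_hermitian[OF posmap_funpow[OF A(1)] that] d d, of N] by simp
      then have "(\<lambda>N. (A ^^ N) Y $$ (0,0)) \<longlonglongrightarrow> cnj (l Y)"
        using tendsto_cnj[OF l0[OF hermitian_carrier[OF that]]] by simp
      then show ?thesis using LIMSEQ_unique l0[OF hermitian_carrier[OF that]] by blast
    qed
    have lad: "l (adj Y) = cnj (l Y)" if Y: "Y \<in> carrier_mat d d" for Y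
    proof -
      obtain Y1 Y2 where h: "hermitian_mat d Y1" "hermitian_mat d Y2" and Ye: "Y = Y1 + \<i> \<cdot>\<^sub>m Y2" using hermitian_parts[OF Y] .
      note hc = h[THEN hermitian_carrier]
      have "adj Y = Y1 + (-\<i>) \<cdot>\<^sub>m Y2" using h hc unfolding Ye by (simp add: adj_add[of _ d d] adj_smult hermitian_mat_def)
      then have "l (adj Y) = l Y1 + (-\<i>) * l Y2" using hc by (simp only: ladd lsm smult_carrier_mat)
      moreover have "cnj (l Y) = cnj (l Y1) + (-\<i>) * cnj (l Y2)" using hc unfolding Ye by (simp add: ladd lsm)
      ultimately show ?thesis using re[OF h(1)] re[OF h(2)] by simp
    qed
    have "adj (E i j) = E j i" unfolding E_def by (intro eq_matI) auto
    moreover have "E i j \<in> carrier_mat d d" by (simp add: E_def)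
    ultimately have "l (E j i) = cnj (l (E i j))" using lad by metis
    then show ?thesis using that by (simp add: \<rho>_def)
  qed
  then have "hermitian_mat d \<rho>" using \<rho>c by (auto simp: hermitian_mat_def intro!: eq_matI)
  then have "psd d \<rho>" using lpos[OF outer] by (simp add: psd_def qr)
  moreover have "mtrace \<rho> = 1" using tr[of "1\<^sub>m d"] l1 \<rho>c by simp
  ultimately have "is_state d \<rho>" by (simp add: is_state_iff)
  moreover have "mtrace (\<rho> * A Y) = mtrace (\<rho> * Y)" if "Y \<in> carrier_mat d d" for Y
    using that lin by (simp add: tr lA)
  ultimately show thesis using that[of \<rho>] l tr by simp
qed

section \<open>Primitivity and invariant states\<close>

definition mv :: "nat \<Rightarrow> complex mat \<Rightarrow> (nat \<Rightarrow> complex) \<Rightarrow> nat \<Rightarrow> complex" where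
  "mv d A v = (\<lambda>i. \<Sum>j<d. A $$ (i,j) * v j)"

definition vcol :: "nat \<Rightarrow> (nat \<Rightarrow> complex) \<Rightarrow> complex mat" where
  "vcol d v = mat d 1 (\<lambda>(i,j). v i)"

lemma vcol_carrier [simp]: "vcol d v \<in> carrier_mat d 1" "vcol d v \<in> carrier_mat d (Suc 0)"
  by (simp_all add: vcol_def)

lemma mult_vcol:
  assumes "C \<in> carrier_mat e d" shows "C * vcol d v = vcol e (mv d C v)"
proof (rule eq_matI)
  fix i j assume "i < dim_row (vcol e (mv d C v))" "j < dim_col (vcol e (mv d C v))"
  then show "(C * vcol d v) $$ (i,j) = vcol e (mv d C v) $$ (i,j)"
    using assms by (subst mmul_index[OF assms vcol_carrier(1)]) (auto simp: vcol_def mv_def)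
qed (use assms in \<open>auto simp: vcol_def\<close>)

lemma qf_vcol:
  assumes X: "X \<in> carrier_mat d d"
  shows "qf d X v = (adj (vcol d v) * X * vcol d v) $$ (0,0)"
proof -
  have c: "adj (vcol d v) \<in> carrier_mat 1 d" by simp
  have r: "(adj (vcol d v) * X) $$ (0,j) = (\<Sum>i<d. cnj (v i) * X $$ (i,j))" if "j < d" for j
    using that X by (subst mmul_index[OF c X]) (auto simp: vcol_def)
  have "(adj (vcol d v) * X * vcol d v) $$ (0,0) = (\<Sum>j<d. (\<Sum>i<d. cnj (v i) * X $$ (i,j)) * v j)"
    using r mult_carrier_mat[OF c X] by (subst mmul_index[of _ 1 d _ 1]) (auto simp: vcol_def)
  also have "\<dots> = (\<Sum>i<d. \<Sum>j<d. cnj (v i) * X $$ (i,j) * v j)"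
    unfolding sum_distrib_right by (rule sum.swap)
  finally show ?thesis by (simp add: qf_def)
qed

lemma qf_conj:
  assumes X: "X \<in> carrier_mat d d" and C: "C \<in> carrier_mat d d"
  shows "qf d (adj C * X * C) v = qf d X (mv d C v)"
proof -
  have V: "vcol d v \<in> carrier_mat d 1" "adj (vcol d v) \<in> carrier_mat 1 d" by simp_all
  have "adj (vcol d v) * (adj C * X * C) * vcol d v = adj (vcol d (mv d C v)) * X * vcol d (mv d C v)"
    unfolding mult_vcol[OF C, symmetric] adj_mult[OF C V(1)]
    using V X C
    by (simp add: assoc_mult_mat[of _ 1 d _ d _ d] assoc_mult_mat[of _ 1 d _ d _ 1] assoc_mult_mat[of _ d d _ d _ d]
        assoc_mult_mat[of _ d d _ d _ 1] mult_carrier_mat[of _ 1 d] mult_carrier_mat[of _ d d _ 1])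
  then show ?thesis using X C by (simp add: qf_vcol)
qed

lemma qf_kraus:
  assumes "set Ks \<subseteq> carrier_mat d d" "X \<in> carrier_mat d d"
  shows "foldr (\<lambda>K A. K * X * adj K + A) Ks (0\<^sub>m d d) \<in> carrier_mat d d"
    "qf d (foldr (\<lambda>K A. K * X * adj K + A) Ks (0\<^sub>m d d)) v = (\<Sum>i<length Ks. qf d X (mv d (adj (Ks ! i)) v))"
proof -
  have "foldr (\<lambda>K A. K * X * adj K + A) Ks (0\<^sub>m d d) \<in> carrier_mat d d \<and>
    qf d (foldr (\<lambda>K A. K * X * adj K + A) Ks (0\<^sub>m d d)) v = sum_list (map (\<lambda>K. qf d X (mv d (adj K) v)) Ks)"
    using assms(1)
  proof (induction Ks)
    case Nil
    then show ?case by (simp add: qf_def)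
  next
    case (Cons K Ks)
    then have K: "K \<in> carrier_mat d d" "K * X * adj K \<in> carrier_mat d d" using assms(2) by simp_all
    have "qf d (K * X * adj K) v = qf d X (mv d (adj K) v)"
      using qf_conj[OF assms(2), of "adj K" v] K(1) by simp
    then show ?case using Cons K by (simp add: qf_add)
  qed
  then show "foldr (\<lambda>K A. K * X * adj K + A) Ks (0\<^sub>m d d) \<in> carrier_mat d d"
    "qf d (foldr (\<lambda>K A. K * X * adj K + A) Ks (0\<^sub>m d d)) v = (\<Sum>i<length Ks. qf d X (mv d (adj (Ks ! i)) v))"
    by (auto simp: sum_list_sum_nth atLeast0LessThan)
qed

abbreviation words :: "nat \<Rightarrow> nat \<Rightarrow> nat list set" where
  "words m n \<equiv> {w. length w = n \<and> set w \<subseteq> {..<m}}"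

lemma finite_words: "finite (words m n)"
  using finite_lists_length_eq[of "{..<m}" n] by (simp add: conj_commute)

lemma sum_words_Suc: "(\<Sum>w\<in>words m (Suc n). f w) = (\<Sum>i<m. \<Sum>w\<in>words m n. f (i # w))"
proof -
  have "words m (Suc n) = (\<lambda>(i,w). i # w) ` ({..<m} \<times> words m n)"
    by (auto simp: length_Suc_conv image_iff)
  then have "(\<Sum>w\<in>words m (Suc n). f w) = (\<Sum>x\<in>{..<m} \<times> words m n. f (fst x # snd x))"
    by (simp add: sum.reindex inj_on_def case_prod_unfold)
  then show ?thesis by (simp add: sum.cartesian_product case_prod_unfold)
qed

lemma kprod_carrier: "set Ks \<subseteq> carrier_mat d d \<Longrightarrow> set w \<subseteq> {..<length Ks} \<Longrightarrow> kprod d Ks w \<in> carrier_mat d d"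
proof (induction w)
  case Nil
  then show ?case by (simp add: kprod_def)
next
  case (Cons a w)
  have "Ks ! a \<in> carrier_mat d d" using Cons.prems by (auto dest!: nth_mem)
  then show ?case using Cons by (simp add: kprod_def)
qed

lemma mv_mult:
  assumes "C \<in> carrier_mat d d" "D \<in> carrier_mat d d" "i < d"
  shows "mv d (C * D) v i = mv d C (mv d D v) i"
proof -
  have "mv d (C * D) v i = (\<Sum>j<d. \<Sum>k<d. C $$ (i,k) * (D $$ (k,j) * v j))"
    unfolding mv_def using assms by (intro sum.cong refl) (simp only: mmul_index[OF assms(1,2,3)] lessThan_iff sum_distrib_right mult.assoc)
  also have "\<dots> = (\<Sum>k<d. \<Sum>j<d. C $$ (i,k) * (D $$ (k,j) * v j))" by (rule sum.swap)
  finally show ?thesis by (simp add: mv_def sum_distrib_left)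
qed

lemma qf_cong: "(\<And>i. i < d \<Longrightarrow> v i = w i) \<Longrightarrow> qf d X v = qf d X w"
  unfolding qf_def by (intro sum.cong refl) auto

text \<open>Iterating a Kraus form gives a Kraus form indexed by words of length \<open>n\<close>.
  The first letter of a word belongs to the outermost application, which matches the order of the
  product in \<open>kprod\<close>.\<close>

lemma qf_kraus_pow:
  assumes K: "is_kraus d L Ks" and X: "X \<in> carrier_mat d d"
  shows "(L ^^ n) X \<in> carrier_mat d d \<and> (\<forall>v. qf d ((L ^^ n) X) v = (\<Sum>w\<in>words (length Ks) n. qf d X (mv d (adj (kprod d Ks w)) v)))"
proof (induction n)
  case 0
  have "qf d X v = qf d X (mv d (adj (kprod d Ks [])) v)" for v
  proof (rule qf_cong)
    fix i assume i: "i < d"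
    have "mv d (adj (kprod d Ks [])) v i = (\<Sum>j<d. if j = i then v i else 0)"
      unfolding mv_def kprod_def using i by (intro sum.cong refl) auto
    then show "v i = mv d (adj (kprod d Ks [])) v i" using i by (simp add: sum.delta)
  qed
  moreover have "words (length Ks) 0 = {[]}" by auto
  ultimately show ?case using X by simp
next
  case (Suc n)
  have sub: "set Ks \<subseteq> carrier_mat d d" and L: "\<And>\<rho>. \<rho> \<in> carrier_mat d d \<Longrightarrow> L \<rho> = foldr (\<lambda>K A. K * \<rho> * adj K + A) Ks (0\<^sub>m d d)"
    using K by (auto simp: is_kraus_def)
  let ?Y = "(L ^^ n) X"
  have Y: "?Y \<in> carrier_mat d d" using Suc by blast
  have LS: "(L ^^ Suc n) X = foldr (\<lambda>K A. K * ?Y * adj K + A) Ks (0\<^sub>m d d)" using L[OF Y] by simp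
  have "qf d ((L ^^ Suc n) X) v = (\<Sum>w\<in>words (length Ks) (Suc n). qf d X (mv d (adj (kprod d Ks w)) v))" for v
  proof -
    have "qf d ((L ^^ Suc n) X) v = (\<Sum>i<length Ks. \<Sum>w\<in>words (length Ks) n. qf d X (mv d (adj (kprod d Ks w)) (mv d (adj (Ks ! i)) v)))"
      unfolding LS qf_kraus(2)[OF sub Y] using Suc by simp
    also have "\<dots> = (\<Sum>i<length Ks. \<Sum>w\<in>words (length Ks) n. qf d X (mv d (adj (kprod d Ks (i # w))) v))"
    proof (intro sum.cong refl qf_cong)
      fix i w j assume "i \<in> {..<length Ks}" "w \<in> words (length Ks) n" and j: "j < d"
      then have c: "Ks ! i \<in> carrier_mat d d" "kprod d Ks w \<in> carrier_mat d d" using sub kprod_carrier[OF sub] by auto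
      then show "mv d (adj (kprod d Ks w)) (mv d (adj (Ks ! i)) v) j = mv d (adj (kprod d Ks (i # w))) v j"
        using mv_mult[of "adj (kprod d Ks w)" d "adj (Ks ! i)" j v] j adj_mult[OF c] by (simp add: kprod_def)
    qed
    finally show ?thesis by (simp add: sum_words_Suc)
  qed
  then show ?case using qf_kraus(1)[OF sub Y] LS by simp
qed

lemma cauchy_schwarz_cmod:
  "(cmod (\<Sum>i\<in>I. f i * g i))\<^sup>2 \<le> (\<Sum>i\<in>I. (cmod (f i))\<^sup>2) * (\<Sum>i\<in>I. (cmod (g i))\<^sup>2)"
proof -
  have "cmod (\<Sum>i\<in>I. f i * g i) \<le> (\<Sum>i\<in>I. cmod (f i) * cmod (g i))"
    using norm_sum[of "\<lambda>i. f i * g i" I] by (simp add: norm_mult)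
  then have "(cmod (\<Sum>i\<in>I. f i * g i))\<^sup>2 \<le> (\<Sum>i\<in>I. cmod (f i) * cmod (g i))\<^sup>2" by (intro power_mono) auto
  also have "\<dots> \<le> (\<Sum>i\<in>I. (cmod (f i))\<^sup>2) * (\<Sum>i\<in>I. (cmod (g i))\<^sup>2)" by (rule Cauchy_Schwarz_ineq_sum)
  finally show ?thesis .
qed

text \<open>Spanning makes the rank-one matrix \<open>b u^*\<close> a combination of the
  \<open>KW w\<close>. Its pairing with \<open>b\<close> and \<open>u\<close> is
  \<open>|b|^2 |u|^2\<close>, and Cauchy-Schwarz bounds the square of this by the squared
  coefficients times the sum on the right. The coefficients of the finitely many matrix units serve
  all \<open>u\<close> and \<open>b\<close>, which makes \<open>e\<close> uniform.\<close>

lemma spanning_lower_bound: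
  fixes KW :: "'w \<Rightarrow> complex mat"
  assumes fin: "finite W"
    and span: "\<And>A. A \<in> carrier_mat d d \<Longrightarrow> \<exists>c. \<forall>i<d. \<forall>j<d. A $$ (i,j) = (\<Sum>w\<in>W. c w * KW w $$ (i,j))"
  shows "\<exists>e>0. \<forall>u b. e * (\<Sum>i<d. (cmod (u i))\<^sup>2) * (\<Sum>i<d. (cmod (b i))\<^sup>2)
     \<le> (\<Sum>w\<in>W. (cmod (\<Sum>i<d. \<Sum>j<d. cnj (b i) * KW w $$ (i,j) * u j))\<^sup>2)"
proof -
  let ?E = "\<lambda>a. mat d d (\<lambda>ij. if ij = a then 1 else 0 :: complex)"
  have "\<exists>c. \<forall>i<d. \<forall>j<d. ?E a $$ (i,j) = (\<Sum>w\<in>W. c w * KW w $$ (i,j))" for a by (rule span) simp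
  then have "\<exists>C. \<forall>a. \<forall>i<d. \<forall>j<d. ?E a $$ (i,j) = (\<Sum>w\<in>W. C a w * KW w $$ (i,j))"
    by (intro choice allI)
  then obtain C where C: "\<And>a i j. i < d \<Longrightarrow> j < d \<Longrightarrow> ?E a $$ (i,j) = (\<Sum>w\<in>W. C a w * KW w $$ (i,j))" by blast
  let ?D = "{..<d} \<times> {..<d}"
  \<comment> \<open>The total squared size of the coefficients of the matrix units; the summand 1
    secures \<open>G > 0\<close>, so that \<open>inverse G\<close> can serve as the
    constant.\<close>
  define G where "G = 1 + (\<Sum>w\<in>W. \<Sum>a\<in>?D. (cmod (C a w))\<^sup>2)"
  have G: "G > 0" unfolding G_def by (intro add_pos_nonneg sum_nonneg) auto
  have "inverse G * (\<Sum>i<d. (cmod (u i))\<^sup>2) * (\<Sum>i<d. (cmod (b i))\<^sup>2)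
     \<le> (\<Sum>w\<in>W. (cmod (\<Sum>i<d. \<Sum>j<d. cnj (b i) * KW w $$ (i,j) * u j))\<^sup>2)" for u b
  proof -
    define g where "g w = (\<Sum>a\<in>?D. (b (fst a) * cnj (u (snd a))) * C a w)" for w
    define X where "X w = (\<Sum>i<d. \<Sum>j<d. cnj (b i) * KW w $$ (i,j) * u j)" for w
    define nu nb where "nu = (\<Sum>i<d. (cmod (u i))\<^sup>2)" and "nb = (\<Sum>i<d. (cmod (b i))\<^sup>2)"
    have nn: "nu \<ge> 0" "nb \<ge> 0" by (auto simp: nu_def nb_def sum_nonneg)
    have ent: "b i * cnj (u j) = (\<Sum>w\<in>W. g w * KW w $$ (i,j))" if "i < d" "j < d" for i j
    proof -
      have "(\<Sum>w\<in>W. g w * KW w $$ (i,j)) = (\<Sum>w\<in>W. \<Sum>a\<in>?D. b (fst a) * cnj (u (snd a)) * (C a w * KW w $$ (i,j)))"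
        unfolding g_def sum_distrib_right by (simp only: mult.assoc)
      also have "\<dots> = (\<Sum>a\<in>?D. \<Sum>w\<in>W. b (fst a) * cnj (u (snd a)) * (C a w * KW w $$ (i,j)))" by (rule sum.swap)
      also have "\<dots> = (\<Sum>a\<in>?D. b (fst a) * cnj (u (snd a)) * ?E a $$ (i,j))"
        by (simp add: C[OF that] sum_distrib_left)
      also have "\<dots> = (\<Sum>a\<in>?D. if a = (i,j) then b i * cnj (u j) else 0)"
        using that by (intro sum.cong refl) auto
      finally show ?thesis using that by (simp add: sum.delta)
    qed
    have "complex_of_real (nu * nb) = (\<Sum>i<d. \<Sum>j<d. cnj (b i) * (b i * cnj (u j)) * u j)"
    proof -
      have "(\<Sum>i<d. \<Sum>j<d. cnj (b i) * (b i * cnj (u j)) * u j) = (\<Sum>i<d. cnj (b i) * b i) * (\<Sum>j<d. cnj (u j) * u j)"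
        unfolding sum_product by (intro sum.cong refl) (simp only: mult_ac)
      also have "\<dots> = complex_of_real (nu * nb)"
        unfolding cnj_mult_self nu_def nb_def of_real_sum[symmetric] of_real_mult[symmetric] by (simp only: mult.commute)
      finally show ?thesis by simp
    qed
    also have "\<dots> = (\<Sum>i<d. \<Sum>j<d. \<Sum>w\<in>W. g w * (cnj (b i) * KW w $$ (i,j) * u j))"
      by (intro sum.cong refl) (simp add: ent sum_distrib_left sum_distrib_right mult_ac)
    also have "\<dots> = (\<Sum>i<d. \<Sum>w\<in>W. \<Sum>j<d. g w * (cnj (b i) * KW w $$ (i,j) * u j))"
      by (rule sum.cong[OF refl], rule sum.swap)
    also have "\<dots> = (\<Sum>w\<in>W. \<Sum>i<d. \<Sum>j<d. g w * (cnj (b i) * KW w $$ (i,j) * u j))" by (rule sum.swap)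
    also have "\<dots> = (\<Sum>w\<in>W. g w * X w)" by (simp add: X_def sum_distrib_left)
    finally have e: "complex_of_real (nu * nb) = (\<Sum>w\<in>W. g w * X w)" .
    have "(nu * nb)\<^sup>2 = (cmod (complex_of_real (nu * nb)))\<^sup>2" by (simp only: norm_of_real power2_abs)
    also have "\<dots> = (cmod (\<Sum>w\<in>W. g w * X w))\<^sup>2" unfolding e ..
    also have "\<dots> \<le> (\<Sum>w\<in>W. (cmod (g w))\<^sup>2) * (\<Sum>w\<in>W. (cmod (X w))\<^sup>2)" by (rule cauchy_schwarz_cmod)
    also have "\<dots> \<le> (nu * nb * G) * (\<Sum>w\<in>W. (cmod (X w))\<^sup>2)"
    proof (intro mult_right_mono sum_nonneg)
      have "(cmod (g w))\<^sup>2 \<le> nu * nb * (\<Sum>a\<in>?D. (cmod (C a w))\<^sup>2)" for w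
      proof -
        have "(cmod (g w))\<^sup>2 \<le> (\<Sum>a\<in>?D. (cmod (b (fst a) * cnj (u (snd a))))\<^sup>2) * (\<Sum>a\<in>?D. (cmod (C a w))\<^sup>2)"
          unfolding g_def by (rule cauchy_schwarz_cmod)
        also have "(\<Sum>a\<in>?D. (cmod (b (fst a) * cnj (u (snd a))))\<^sup>2) = nb * nu"
          unfolding nu_def nb_def sum_product by (simp add: norm_mult power_mult_distrib sum.cartesian_product case_prod_unfold)
        also have "\<dots> = nu * nb" by (rule mult.commute)
        finally show ?thesis .
      qed
      then have "(\<Sum>w\<in>W. (cmod (g w))\<^sup>2) \<le> (\<Sum>w\<in>W. nu * nb * (\<Sum>a\<in>?D. (cmod (C a w))\<^sup>2))" by (rule sum_mono)
      also have "\<dots> = nu * nb * (G - 1)" by (simp add: G_def sum_distrib_left)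
      also have "\<dots> \<le> nu * nb * G" using nn by (intro mult_left_mono) auto
      finally show "(\<Sum>w\<in>W. (cmod (g w))\<^sup>2) \<le> nu * nb * G" .
    qed auto
    finally have fin: "(nu * nb) * (nu * nb) \<le> (nu * nb) * (G * (\<Sum>w\<in>W. (cmod (X w))\<^sup>2))"
      by (simp add: power2_eq_square mult_ac)
    have "nu * nb \<le> G * (\<Sum>w\<in>W. (cmod (X w))\<^sup>2)"
    proof (cases "nu * nb = 0")
      case True
      show ?thesis unfolding True using G by (intro mult_nonneg_nonneg sum_nonneg) auto
    next
      case False
      then have "nu * nb > 0" using nn by (metis mult_nonneg_nonneg order_le_less)
      then show ?thesis using fin mult_le_cancel_left_pos by blast
    qed
    then have "nu * nb / G \<le> (\<Sum>w\<in>W. (cmod (X w))\<^sup>2)" using G by (simp add: divide_le_eq mult.commute)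
    then show ?thesis unfolding X_def nu_def nb_def by (simp add: divide_inverse mult_ac)
  qed
  then show ?thesis using G by (intro exI[of _ "inverse G"]) auto
qed

text \<open>\<open>L\<close> acts on states, \<open>A\<close> on observables; the trace is used as a
  bilinear pairing, without an adjoint on either argument.\<close>

definition trace_dual :: "nat \<Rightarrow> (complex mat \<Rightarrow> complex mat) \<Rightarrow> (complex mat \<Rightarrow> complex mat) \<Rightarrow> bool" where
  "trace_dual d L A \<longleftrightarrow> (\<forall>X\<in>carrier_mat d d. L X \<in> carrier_mat d d) \<and>
     (\<forall>X\<in>carrier_mat d d. \<forall>Y\<in>carrier_mat d d. mtrace (L X * Y) = mtrace (X * A Y))"

lemma trace_dual_pow:
  assumes "trace_dual d L A" "linmap d A" "X \<in> carrier_mat d d" "Y \<in> carrier_mat d d"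
  shows "(L ^^ n) X \<in> carrier_mat d d" "mtrace ((L ^^ n) X * Y) = mtrace (X * (A ^^ n) Y)"
proof -
  have c: "(L ^^ n) X \<in> carrier_mat d d" for n using assms by (induction n) (auto simp: trace_dual_def)
  show "(L ^^ n) X \<in> carrier_mat d d" by (rule c)
  show "mtrace ((L ^^ n) X * Y) = mtrace (X * (A ^^ n) Y)" using assms(4)
  proof (induction n arbitrary: Y)
    case (Suc n)
    have "mtrace ((L ^^ Suc n) X * Y) = mtrace ((L ^^ n) X * A Y)" using assms(1) c Suc.prems by (simp add: trace_dual_def)
    also have "\<dots> = mtrace (X * (A ^^ n) (A Y))" using Suc assms(2) by simp
    finally show ?case by (simp add: funpow_swap1)
  qed simp
qed

lemma outer_psd: "psd d (vcol d u * adj (vcol d u))"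
  using psd_gram[of "adj (vcol d u)" 1 d] by simp

lemma qf_outer: "qf d (vcol d u * adj (vcol d u)) v = complex_of_real ((cmod (\<Sum>i<d. cnj (u i) * v i))\<^sup>2)"
proof -
  have c: "adj (vcol d u) \<in> carrier_mat 1 d" by simp
  show ?thesis using qf_gram[OF c, of v] by (simp add: vcol_def)
qed

lemma mtrace_outer:
  assumes "Z \<in> carrier_mat d d"
  shows "mtrace (vcol d u * adj (vcol d u) * Z) = qf d Z u"
proof -
  have c1: "adj (vcol d u) \<in> carrier_mat 1 d" by simp
  note c = c1 mult_carrier_mat[OF c1 assms]
  have "mtrace (vcol d u * adj (vcol d u) * Z) = mtrace (vcol d u * (adj (vcol d u) * Z))"
    using assoc_mult_mat[OF vcol_carrier(1) c(1) assms] by simp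
  also have "\<dots> = mtrace (adj (vcol d u) * Z * vcol d u)" by (rule mtrace_cyc[OF vcol_carrier(1) c(2)])
  also have "\<dots> = qf d Z u" using c carrier_matD[OF vcol_carrier(1)] by (simp add: mtrace_def qf_vcol[OF assms])
  finally show ?thesis .
qed

lemma mtrace_mult_gram:
  assumes "Z \<in> carrier_mat d d" "B \<in> carrier_mat d d"
  shows "mtrace (Z * (adj B * B)) = (\<Sum>r<d. qf d Z (\<lambda>j. cnj (B $$ (r,j))))"
proof -
  have "mtrace (Z * (adj B * B)) = mtrace ((Z * adj B) * B)" using assms by (simp add: assoc_mult_mat[of _ d d _ d _ d])
  also have "\<dots> = mtrace (B * (Z * adj B))" using assms by (intro mtrace_cyc[of _ d d]) auto
  also have "\<dots> = (\<Sum>r<d. qf d Z (\<lambda>j. cnj (B $$ (r,j))))"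
  proof -
    have "(B * (Z * adj B)) $$ (r,r) = qf d Z (\<lambda>j. cnj (B $$ (r,j)))" if r: "r < d" for r
    proof -
      have "(B * (Z * adj B)) $$ (r,r) = (\<Sum>k<d. B $$ (r,k) * (\<Sum>l<d. Z $$ (k,l) * cnj (B $$ (r,l))))"
      proof -
        have ZB: "Z * adj B \<in> carrier_mat d d" using assms by simp
        have "(Z * adj B) $$ (k,r) = (\<Sum>l<d. Z $$ (k,l) * cnj (B $$ (r,l)))" if "k < d" for k
          using that assms r by (subst mmul_index[of _ d d _ d]) auto
        then show ?thesis by (simp add: mmul_index[OF assms(2) ZB r r])
      qed
      then show ?thesis by (simp add: qf_def sum_distrib_left mult_ac)
    qed
    then show ?thesis using assms by (simp add: mtrace_def)
  qed
  finally show ?thesis .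
qed

lemma mtrace_gram:
  assumes "B \<in> carrier_mat d d"
  shows "Re (mtrace (adj B * B)) = (\<Sum>r<d. \<Sum>j<d. (cmod (B $$ (r,j)))\<^sup>2)"
proof -
  have "mtrace (adj B * B) = (\<Sum>r<d. qf d (1\<^sub>m d) (\<lambda>j. cnj (B $$ (r,j))))"
    using mtrace_mult_gram[of "1\<^sub>m d" d B] assms by simp
  then show ?thesis by (simp add: qf_one)
qed

lemma primitive_doeblin:
  assumes prim: "primitive d L" and dual: "trace_dual d L A" and pos: "posmap d A"
  shows "\<exists>n e. e > 0 \<and> (\<forall>Y. psd d Y \<longrightarrow> psd d ((A ^^ n) Y - (complex_of_real e * mtrace Y) \<cdot>\<^sub>m 1\<^sub>m d))"
proof -
  obtain Ks n where K: "is_kraus d L Ks" and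
    span: "\<And>A. A \<in> carrier_mat d d \<Longrightarrow> \<exists>c :: nat list \<Rightarrow> complex. \<forall>i<d. \<forall>j<d.
       A $$ (i,j) = (\<Sum>w \<in> words (length Ks) n. c w * kprod d Ks w $$ (i,j))"
    using prim unfolding primitive_def by blast
  obtain e where e: "e > 0" and lb: "\<And>u b. e * (\<Sum>i<d. (cmod (u i))\<^sup>2) * (\<Sum>i<d. (cmod (b i))\<^sup>2)
     \<le> (\<Sum>w\<in>words (length Ks) n. (cmod (\<Sum>i<d. \<Sum>j<d. cnj (b i) * kprod d Ks w $$ (i,j) * u j))\<^sup>2)"
    using spanning_lower_bound[OF finite_words span] by blast
  have "psd d ((A ^^ n) Y - (complex_of_real e * mtrace Y) \<cdot>\<^sub>m 1\<^sub>m d)" if Y: "psd d Y" for Y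
    unfolding psd_def
  proof (intro conjI allI)
    have AY: "psd d ((A ^^ n) Y)" by (rule posmap_psd[OF posmap_funpow[OF pos] Y])
    have tY: "mtrace Y = complex_of_real (Re (mtrace Y))" using psd_trace[OF Y] by (simp add: complex_eq_iff)
    have sc: "complex_of_real e * mtrace Y = complex_of_real (e * Re (mtrace Y))" by (subst tY) simp
    show "hermitian_mat d ((A ^^ n) Y - (complex_of_real e * mtrace Y) \<cdot>\<^sub>m 1\<^sub>m d)"
      unfolding sc using AY by (intro hermitian_minus hermitian_smult) (auto simp: psd_def)
    fix u
    obtain B where B: "B \<in> carrier_mat d d" "Y = adj B * B" using psd_gramE[OF Y] .
    let ?O = "vcol d u * adj (vcol d u)"
    have O: "?O \<in> carrier_mat d d" using outer_psd by simp
    define N where "N = (\<Sum>i<d. (cmod (u i))\<^sup>2)"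
    have "qf d ((A ^^ n) Y) u = mtrace (?O * (A ^^ n) Y)" using AY by (simp add: mtrace_outer)
    also have "\<dots> = mtrace ((L ^^ n) ?O * Y)"
      using trace_dual_pow(2)[OF dual posmap_linmap[OF pos] O psd_carrier[OF Y], of n] by simp
    also have "\<dots> = (\<Sum>r<d. qf d ((L ^^ n) ?O) (\<lambda>j. cnj (B $$ (r,j))))"
      unfolding B(2) by (rule mtrace_mult_gram) (use qf_kraus_pow[OF K O] B in auto)
    finally have q: "qf d ((A ^^ n) Y) u = (\<Sum>r<d. qf d ((L ^^ n) ?O) (\<lambda>j. cnj (B $$ (r,j))))" .
    have row: "e * N * (\<Sum>j<d. (cmod (B $$ (r,j)))\<^sup>2) \<le> Re (qf d ((L ^^ n) ?O) (\<lambda>j. cnj (B $$ (r,j))))" if "r < d" for r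
    proof -
      let ?b = "\<lambda>j. cnj (B $$ (r,j))"
      have "cmod (\<Sum>i<d. cnj (u i) * mv d (adj (kprod d Ks w)) ?b i) = cmod (\<Sum>i<d. \<Sum>j<d. cnj (?b i) * kprod d Ks w $$ (i,j) * u j)"
        if "w \<in> words (length Ks) n" for w
      proof -
        have kc: "kprod d Ks w \<in> carrier_mat d d" using that K by (intro kprod_carrier) (auto simp: is_kraus_def)
        have "(\<Sum>i<d. cnj (u i) * mv d (adj (kprod d Ks w)) ?b i) = (\<Sum>i<d. \<Sum>j<d. cnj (cnj (?b j) * kprod d Ks w $$ (j,i) * u i))"
          unfolding mv_def sum_distrib_left using kc by (intro sum.cong refl) auto
        also have "\<dots> = (\<Sum>j<d. \<Sum>i<d. cnj (cnj (?b j) * kprod d Ks w $$ (j,i) * u i))" by (rule sum.swap)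
        also have "\<dots> = cnj (\<Sum>j<d. \<Sum>i<d. cnj (?b j) * kprod d Ks w $$ (j,i) * u i)" by simp
        finally show ?thesis by (simp only: complex_mod_cnj)
      qed
      then have "(\<Sum>w\<in>words (length Ks) n. (cmod (\<Sum>i<d. cnj (u i) * mv d (adj (kprod d Ks w)) ?b i))\<^sup>2)
          = (\<Sum>w\<in>words (length Ks) n. (cmod (\<Sum>i<d. \<Sum>j<d. cnj (?b i) * kprod d Ks w $$ (i,j) * u j))\<^sup>2)"
        by (intro sum.cong refl) (simp only:)
      then have "Re (qf d ((L ^^ n) ?O) ?b) = (\<Sum>w\<in>words (length Ks) n. (cmod (\<Sum>i<d. \<Sum>j<d. cnj (?b i) * kprod d Ks w $$ (i,j) * u j))\<^sup>2)"
        using qf_kraus_pow[OF K O, of n] by (simp only: qf_outer Re_sum Re_complex_of_real)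
      then show ?thesis using lb[of u ?b] by (simp add: N_def)
    qed
    have "e * N * Re (mtrace Y) = (\<Sum>r<d. e * N * (\<Sum>j<d. (cmod (B $$ (r,j)))\<^sup>2))"
      unfolding B(2) mtrace_gram[OF B(1)] by (simp add: sum_distrib_left)
    also have "\<dots> \<le> Re (qf d ((A ^^ n) Y) u)" unfolding q Re_sum by (intro sum_mono row) auto
    finally show "Re (qf d ((A ^^ n) Y - (complex_of_real e * mtrace Y) \<cdot>\<^sub>m 1\<^sub>m d) u) \<ge> 0"
      unfolding sc using AY by (simp add: qf_minus qf_smult qf_one N_def mult_ac)
  qed
  then show ?thesis using e by blast
qed

section \<open>Comparison of positive maps, transfer of the minorisation, and faithfulness\<close>

definition dominates :: "nat \<Rightarrow> real \<Rightarrow> (complex mat \<Rightarrow> complex mat) \<Rightarrow> (complex mat \<Rightarrow> complex mat) \<Rightarrow> bool" where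
  "dominates d k A B \<longleftrightarrow> (\<forall>X. psd d X \<longrightarrow> psd d (A X - complex_of_real k \<cdot>\<^sub>m B X))"

text \<open>\<open>A B - k l A' B' = (A - k A') B + k A' (B - l B')\<close>, and both summands
  preserve positivity.\<close>

lemma dominates_comp:
  assumes "dominates d k A A'" "dominates d l B B'" "posmap d B" "posmap d A'" "posmap d A" "posmap d B'" "k \<ge> 0"
  shows "dominates d (k * l) (A \<circ> B) (A' \<circ> B')"
  unfolding dominates_def
proof (intro allI impI)
  fix X assume X: "psd d X"
  have BX: "psd d (B X)" and B'X: "psd d (B' X)" using posmap_psd[OF assms(3) X] posmap_psd[OF assms(6) X] by auto
  note lin = assms(3-6)[THEN posmap_linmap]
  have "psd d (A (B X) - complex_of_real k \<cdot>\<^sub>m A' (B X))" using assms(1) BX by (simp add: dominates_def)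
  moreover have "psd d (complex_of_real k \<cdot>\<^sub>m A' (B X - complex_of_real l \<cdot>\<^sub>m B' X))"
    using assms(2,7) X by (intro psd_smult posmap_psd[OF assms(4)]) (auto simp: dominates_def)
  moreover have "A (B X) - complex_of_real k \<cdot>\<^sub>m A' (B X) + complex_of_real k \<cdot>\<^sub>m A' (B X - complex_of_real l \<cdot>\<^sub>m B' X)
     = (A \<circ> B) X - complex_of_real (k * l) \<cdot>\<^sub>m (A' \<circ> B') X"
    using lin BX B'X carrier_matD[OF linmap_carrier[OF lin(3) psd_carrier[OF BX]]]
      carrier_matD[OF linmap_carrier[OF lin(2) psd_carrier[OF BX]]] carrier_matD[OF linmap_carrier[OF lin(2) psd_carrier[OF B'X]]]
    by (intro eq_matI) (auto simp: linmap_minus linmap_smult algebra_simps)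
  ultimately show "psd d ((A \<circ> B) X - complex_of_real (k * l) \<cdot>\<^sub>m (A' \<circ> B') X)" using psd_add by metis
qed

lemma dominates_funpow:
  assumes "dominates d k A B" "posmap d A" "posmap d B" "k \<ge> 0"
  shows "dominates d (k ^ n) (A ^^ n) (B ^^ n)"
proof (induction n)
  case 0
  have "psd d (X - 1 \<cdot>\<^sub>m X)" if "psd d X" for X
  proof -
    have "X - 1 \<cdot>\<^sub>m X = 0\<^sub>m d d" using psd_carrier[OF that] by (intro eq_matI) auto
    then show ?thesis by simp
  qed
  then show ?case by (simp add: dominates_def)
next
  case (Suc n)
  show ?case
    using dominates_comp[OF assms(1) Suc posmap_funpow[OF assms(2)] assms(3,2) posmap_funpow[OF assms(3)] assms(4)] by (simp add: comp_def)
qed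

text \<open>Domination survives powers with the constant \<open>k ^ n\<close>, so
  \<open>A ^^ n\<close> inherits the lower bound of \<open>B ^^ n\<close> with
  \<open>k ^ n * e\<close> in place of \<open>e\<close>.\<close>

lemma doeblin_transfer:
  assumes D: "e > 0 \<and> (\<forall>Y. psd d Y \<longrightarrow> psd d ((B ^^ n) Y - (complex_of_real e * mtrace Y) \<cdot>\<^sub>m 1\<^sub>m d))"
    and dom: "dominates d k A B" and pos: "posmap d A" "posmap d B" and k: "k > 0"
  shows "\<exists>n e. e > 0 \<and> (\<forall>Y. psd d Y \<longrightarrow> psd d ((A ^^ n) Y - (complex_of_real e * mtrace Y) \<cdot>\<^sub>m 1\<^sub>m d))"
proof (intro exI conjI allI impI)
  show "k ^ n * e > 0" using D k by simp
  fix Y assume Y: "psd d Y"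
  have "psd d ((A ^^ n) Y - complex_of_real (k ^ n) \<cdot>\<^sub>m (B ^^ n) Y)"
    using dominates_funpow[OF dom pos] k Y by (simp add: dominates_def)
  moreover have "psd d (complex_of_real (k ^ n) \<cdot>\<^sub>m ((B ^^ n) Y - (complex_of_real e * mtrace Y) \<cdot>\<^sub>m 1\<^sub>m d))"
    using D Y k by (intro psd_smult) auto
  moreover have "(A ^^ n) Y - complex_of_real (k ^ n) \<cdot>\<^sub>m (B ^^ n) Y
     + complex_of_real (k ^ n) \<cdot>\<^sub>m ((B ^^ n) Y - (complex_of_real e * mtrace Y) \<cdot>\<^sub>m 1\<^sub>m d)
     = (A ^^ n) Y - (complex_of_real (k ^ n * e) * mtrace Y) \<cdot>\<^sub>m 1\<^sub>m d"
    using carrier_matD[OF psd_carrier[OF posmap_psd[OF posmap_funpow[OF pos(1)] Y]]]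
      carrier_matD[OF psd_carrier[OF posmap_psd[OF posmap_funpow[OF pos(2)] Y]]]
    by (intro eq_matI) (auto simp: algebra_simps)
  ultimately show "psd d ((A ^^ n) Y - (complex_of_real (k ^ n * e) * mtrace Y) \<cdot>\<^sub>m 1\<^sub>m d)" using psd_add by metis
qed

text \<open>Pairing with the matrix unit at \<open>(j,i)\<close> returns the entry
  \<open>(i,j)\<close>.\<close>

lemma trace_pairing_inj:
  assumes "X \<in> carrier_mat d d" "Y \<in> carrier_mat d d"
    and "\<And>Z. Z \<in> carrier_mat d d \<Longrightarrow> mtrace (X * Z) = mtrace (Y * Z)"
  shows "X = Y"
proof (rule eq_matI)
  fix i j assume "i < dim_row Y" "j < dim_col Y"
  then have ij: "i < d" "j < d" using assms by auto
  let ?E = "mat d d (\<lambda>ab. if ab = (j,i) then 1 else 0 :: complex)"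
  have "mtrace (X * ?E) = X $$ (i,j)" if X: "X \<in> carrier_mat d d" for X
  proof -
    have "(X * ?E) $$ (a,a) = (if a = i then X $$ (i,j) else 0)" if "a < d" for a
    proof -
      have "(X * ?E) $$ (a,a) = (\<Sum>k<d. if k = j then if a = i then X $$ (i,j) else 0 else 0)"
        unfolding mmul_index[OF X mat_carrier that that] using that ij by (intro sum.cong refl) auto
      then show ?thesis using ij by (simp add: sum.delta)
    qed
    then show ?thesis using X ij by (simp add: mtrace_def sum.delta)
  qed
  then show "X $$ (i,j) = Y $$ (i,j)" using assms by (metis mat_carrier)
qed (use assms in auto)

lemma state_psd: "is_state d \<rho> \<Longrightarrow> psd d \<rho>"
  by (simp add: is_state_iff)

text \<open>The ergodic state is the only invariant one: for an invariant \<open>\<sigma>\<close>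
  the pairing with \<open>Y\<close> equals the pairing with \<open>(A ^^ N) Y\<close> for every
  \<open>N\<close>, and the limit in \<open>N\<close> is \<open>mtrace (\<rho> * Y)\<close>. This
  resolves the definite description in \<open>inv_state\<close>.\<close>

theorem inv_state_ergodic:
  assumes d: "d > 0" and A: "posmap d A" "A (1\<^sub>m d) = 1\<^sub>m d" and dual: "trace_dual d L A"
    and D: "\<exists>n e. e > 0 \<and> (\<forall>Y. psd d Y \<longrightarrow> psd d ((A ^^ n) Y - (complex_of_real e * mtrace Y) \<cdot>\<^sub>m 1\<^sub>m d))"
  shows "is_state d (inv_state d L)"
    "\<And>Y. Y \<in> carrier_mat d d \<Longrightarrow> mtrace (inv_state d L * A Y) = mtrace (inv_state d L * Y)"
    "\<And>Y i j. Y \<in> carrier_mat d d \<Longrightarrow> i < d \<Longrightarrow> j < d \<Longrightarrow>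
       (\<lambda>N. (A ^^ N) Y $$ (i,j)) \<longlonglongrightarrow> mtrace (inv_state d L * Y) * 1\<^sub>m d $$ (i,j)"
proof -
  obtain n e where e: "e > 0" and D': "\<And>Y. psd d Y \<Longrightarrow> psd d ((A ^^ n) Y - (complex_of_real e * mtrace Y) \<cdot>\<^sub>m 1\<^sub>m d)"
    using D by blast
  obtain \<rho> where st: "is_state d \<rho>" and inv: "\<And>Y. Y \<in> carrier_mat d d \<Longrightarrow> mtrace (\<rho> * A Y) = mtrace (\<rho> * Y)"
    and lim: "\<And>Y i j. Y \<in> carrier_mat d d \<Longrightarrow> i < d \<Longrightarrow> j < d \<Longrightarrow> (\<lambda>N. (A ^^ N) Y $$ (i,j)) \<longlonglongrightarrow> mtrace (\<rho> * Y) * 1\<^sub>m d $$ (i,j)"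
    using doeblin_ergodic[OF d A e D'] by blast
  have \<rho>: "\<rho> \<in> carrier_mat d d" using state_psd[OF st] by simp
  note lin = posmap_linmap[OF A(1)]
  have "inv_state d L = \<rho>"
    unfolding inv_state_def
  proof (rule the_equality)
    have "L \<rho> = \<rho>"
      using dual \<rho> inv by (intro trace_pairing_inj[of _ d]) (auto simp: trace_dual_def)
    then show "is_state d \<rho> \<and> L \<rho> = \<rho>" using st by simp
  next
    fix \<sigma> assume \<sigma>: "is_state d \<sigma> \<and> L \<sigma> = \<sigma>"
    have sc: "\<sigma> \<in> carrier_mat d d" using \<sigma> state_psd by force
    have fx: "(L ^^ N) \<sigma> = \<sigma>" for N using \<sigma> by (induction N) auto
    show "\<sigma> = \<rho>"
    proof (rule trace_pairing_inj[OF sc \<rho>])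
      fix Y :: "complex mat" assume Y: "Y \<in> carrier_mat d d"
      have exp: "mtrace (\<sigma> * Z) = (\<Sum>i<d. \<Sum>k<d. \<sigma> $$ (i,k) * Z $$ (k,i))" if "Z \<in> carrier_mat d d" for Z
        using sc that by (auto simp: mtrace_def mmul_index[OF sc that])
      have "(\<lambda>N. \<Sum>i<d. \<Sum>k<d. \<sigma> $$ (i,k) * (A ^^ N) Y $$ (k,i)) \<longlonglongrightarrow> (\<Sum>i<d. \<Sum>k<d. \<sigma> $$ (i,k) * (mtrace (\<rho> * Y) * 1\<^sub>m d $$ (k,i)))"
        by (intro tendsto_sum tendsto_mult tendsto_const lim[OF Y]) auto
      moreover have "(\<Sum>i<d. \<Sum>k<d. \<sigma> $$ (i,k) * (A ^^ N) Y $$ (k,i)) = mtrace (\<sigma> * Y)" for N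
        using exp[OF linmap_carrier[OF linmap_funpow[OF lin] Y]] trace_dual_pow(2)[OF dual lin sc Y, of N] fx by simp
      ultimately have "mtrace (\<sigma> * Y) = (\<Sum>i<d. \<Sum>k<d. \<sigma> $$ (i,k) * (mtrace (\<rho> * Y) * 1\<^sub>m d $$ (k,i)))"
        by (simp add: LIMSEQ_const_iff)
      also have "\<dots> = mtrace (\<sigma> * (mtrace (\<rho> * Y) \<cdot>\<^sub>m 1\<^sub>m d))" by (simp add: exp)
      also have "\<dots> = mtrace (\<rho> * Y) * mtrace \<sigma>"
        using sc mult_smult_distrib[OF sc, of "1\<^sub>m d" d] by (simp add: mtrace_smult)
      finally show "mtrace (\<sigma> * Y) = mtrace (\<rho> * Y)" using \<sigma> by (simp add: is_state_def)
    qed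
  qed
  then show "is_state d (inv_state d L)"
    "\<And>Y. Y \<in> carrier_mat d d \<Longrightarrow> mtrace (inv_state d L * A Y) = mtrace (inv_state d L * Y)"
    "\<And>Y i j. Y \<in> carrier_mat d d \<Longrightarrow> i < d \<Longrightarrow> j < d \<Longrightarrow>
       (\<lambda>N. (A ^^ N) Y $$ (i,j)) \<longlonglongrightarrow> mtrace (inv_state d L * Y) * 1\<^sub>m d $$ (i,j)"
    using st inv lim by auto
qed

text \<open>In the pairing of \<open>\<sigma>\<close> with \<open>v v^*\<close> the matrix may be
  replaced by its image under \<open>A ^^ n\<close>, which dominates \<open>e * |v|^2\<close> times
  the identity.\<close>

lemma invariant_state_faithful:
  assumes D: "\<exists>n e. e > 0 \<and> (\<forall>Y. psd d Y \<longrightarrow> psd d ((A ^^ n) Y - (complex_of_real e * mtrace Y) \<cdot>\<^sub>m 1\<^sub>m d))"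
    and dual: "trace_dual d L A" and A: "linmap d A" and \<sigma>: "is_state d \<sigma>" "L \<sigma> = \<sigma>"
  shows "\<exists>e>0. \<forall>v. e * (\<Sum>i<d. (cmod (v i))\<^sup>2) \<le> Re (qf d \<sigma> v)"
proof -
  obtain n e where e: "e > 0" and D': "\<And>Y. psd d Y \<Longrightarrow> psd d ((A ^^ n) Y - (complex_of_real e * mtrace Y) \<cdot>\<^sub>m 1\<^sub>m d)"
    using D by blast
  have sp: "psd d \<sigma>" "mtrace \<sigma> = 1" using \<sigma> by (auto simp: is_state_iff)
  have fx: "(L ^^ N) \<sigma> = \<sigma>" for N using \<sigma> by (induction N) auto
  have "e * (\<Sum>i<d. (cmod (v i))\<^sup>2) \<le> Re (qf d \<sigma> v)" for v
  proof -
    let ?O = "vcol d v * adj (vcol d v)"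
    have O: "psd d ?O" by (rule outer_psd)
    have AO: "(A ^^ n) ?O \<in> carrier_mat d d" using linmap_carrier[OF linmap_funpow[OF A]] O by simp
    have s: "\<sigma> \<in> carrier_mat d d" using sp by simp
    have tO: "mtrace ?O = complex_of_real (\<Sum>i<d. (cmod (v i))\<^sup>2)"
      using mtrace_outer[of "1\<^sub>m d" d v] right_mult_one_mat[OF psd_carrier[OF O]] by (simp add: qf_one)
    have "qf d \<sigma> v = mtrace (?O * \<sigma>)" using s by (simp add: mtrace_outer)
    also have "\<dots> = mtrace (\<sigma> * ?O)" by (rule mtrace_cyc[OF psd_carrier[OF O] s])
    also have "\<dots> = mtrace (\<sigma> * (A ^^ n) ?O)"
      using trace_dual_pow(2)[OF dual A s psd_carrier[OF O], of n] fx by simp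
    also have "\<dots> = mtrace (\<sigma> * ((A ^^ n) ?O - (complex_of_real e * mtrace ?O) \<cdot>\<^sub>m 1\<^sub>m d)) + complex_of_real e * mtrace ?O"
      using s AO sp(2) mult_minus_distrib_mat[OF s AO, of "(complex_of_real e * mtrace ?O) \<cdot>\<^sub>m 1\<^sub>m d"] mult_smult_distrib[OF s, of "1\<^sub>m d" d "complex_of_real e * mtrace ?O"]
      by (simp add: mtrace_minus[of _ d] mtrace_smult[of _ d])
    finally have "Re (qf d \<sigma> v) \<ge> Re (complex_of_real e * mtrace ?O)"
      using psd_trace_mult(2)[OF sp(1) D'[OF O]] by simp
    then show ?thesis unfolding tO by (simp flip: of_real_mult)
  qed
  then show ?thesis using e by blast
qed

text \<open>Functions of (z,s,t) built from the coordinates by field operations and exp. The class is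
  closed under partial derivatives, which spares all bookkeeping of differentiability orders.\<close>
inductive sm :: "(real \<times> real \<times> real) set \<Rightarrow> (real \<times> real \<times> real \<Rightarrow> complex) \<Rightarrow> bool"
  for U where
  sm_const: "sm U (\<lambda>p. c)"
| sm_z: "sm U (\<lambda>p. complex_of_real (fst p))"
| sm_s: "sm U (\<lambda>p. complex_of_real (fst (snd p)))"
| sm_t: "sm U (\<lambda>p. complex_of_real (snd (snd p)))"
| sm_add: "sm U f \<Longrightarrow> sm U g \<Longrightarrow> sm U (\<lambda>p. f p + g p)"
| sm_mult: "sm U f \<Longrightarrow> sm U g \<Longrightarrow> sm U (\<lambda>p. f p * g p)"
| sm_inverse: "sm U f \<Longrightarrow> (\<And>p. p \<in> U \<Longrightarrow> f p \<noteq> 0) \<Longrightarrow> sm U (\<lambda>p. inverse (f p))"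
| sm_exp: "sm U f \<Longrightarrow> sm U (\<lambda>p. exp (f p))"

text \<open>The Frechet derivative whose partial derivatives in \<open>z\<close>, \<open>s\<close>,
  \<open>t\<close> are \<open>a\<close>, \<open>b\<close>, \<open>c\<close>. Keeping the three
  together gives the chain rule along arbitrary curves.\<close>

definition tri :: "complex \<Rightarrow> complex \<Rightarrow> complex \<Rightarrow> real \<times> real \<times> real \<Rightarrow> complex" where
  "tri a b c = (\<lambda>h. complex_of_real (fst h) * a + complex_of_real (fst (snd h)) * b + complex_of_real (snd (snd h)) * c)"

lemma sm_deriv:
  assumes "sm U f"
  shows "\<exists>fz fs ft. sm U fz \<and> sm U fs \<and> sm U ft \<and> (\<forall>p\<in>U. (f has_derivative tri (fz p) (fs p) (ft p)) (at p))"
  using assms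
proof induction
  case (sm_const c)
  have *: "((\<lambda>p. c) has_derivative tri 0 0 0) (at p)" for p by (simp add: tri_def)
  show ?case
    by (rule exI[of _ "\<lambda>p. 0"], rule exI[of _ "\<lambda>p. 0"], rule exI[of _ "\<lambda>p. 0"]) (intro conjI ballI sm.sm_const *)
next
  case sm_z
  have *: "((\<lambda>p. complex_of_real (fst p)) has_derivative tri 1 0 0) (at p)" for p
    unfolding tri_def by (auto intro!: derivative_eq_intros)
  show ?case
    by (rule exI[of _ "\<lambda>p. 1"], rule exI[of _ "\<lambda>p. 0"], rule exI[of _ "\<lambda>p. 0"]) (intro conjI ballI sm.sm_const *)
next
  case sm_s
  have *: "((\<lambda>p. complex_of_real (fst (snd p))) has_derivative tri 0 1 0) (at p)" for p
    unfolding tri_def by (auto intro!: derivative_eq_intros)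
  show ?case
    by (rule exI[of _ "\<lambda>p. 0"], rule exI[of _ "\<lambda>p. 1"], rule exI[of _ "\<lambda>p. 0"]) (intro conjI ballI sm.sm_const *)
next
  case sm_t
  have *: "((\<lambda>p. complex_of_real (snd (snd p))) has_derivative tri 0 0 1) (at p)" for p
    unfolding tri_def by (auto intro!: derivative_eq_intros)
  show ?case
    by (rule exI[of _ "\<lambda>p. 0"], rule exI[of _ "\<lambda>p. 0"], rule exI[of _ "\<lambda>p. 1"]) (intro conjI ballI sm.sm_const *)
next
  case (sm_add f g)
  from sm_add.IH(1) obtain fz fs ft where f: "sm U fz" "sm U fs" "sm U ft"
    "\<forall>p\<in>U. (f has_derivative tri (fz p) (fs p) (ft p)) (at p)" by blast
  from sm_add.IH(2) obtain gz gs gt where g: "sm U gz" "sm U gs" "sm U gt"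
    "\<forall>p\<in>U. (g has_derivative tri (gz p) (gs p) (gt p)) (at p)" by blast
  note h = f(1-3) g(1-3)
  note d = bspec[OF f(4)] bspec[OF g(4)]
  have "((\<lambda>p. f p + g p) has_derivative tri (fz p + gz p) (fs p + gs p) (ft p + gt p)) (at p)" if "p \<in> U" for p
    by (rule has_derivative_eq_rhs[OF has_derivative_add[OF d(1)[OF that] d(2)[OF that]]]) (auto simp: tri_def algebra_simps)
  note * = this
  show ?case
    by (rule exI[of _ "\<lambda>p. fz p + gz p"], rule exI[of _ "\<lambda>p. fs p + gs p"], rule exI[of _ "\<lambda>p. ft p + gt p"])
       (intro conjI ballI * h sm.sm_add)
next
  case (sm_mult f g)
  from sm_mult.IH(1) obtain fz fs ft where f: "sm U fz" "sm U fs" "sm U ft"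
    "\<forall>p\<in>U. (f has_derivative tri (fz p) (fs p) (ft p)) (at p)" by blast
  from sm_mult.IH(2) obtain gz gs gt where g: "sm U gz" "sm U gs" "sm U gt"
    "\<forall>p\<in>U. (g has_derivative tri (gz p) (gs p) (gt p)) (at p)" by blast
  note h = f(1-3) g(1-3)
  note d = bspec[OF f(4)] bspec[OF g(4)]
  have "((\<lambda>p. f p * g p) has_derivative tri (f p * gz p + fz p * g p) (f p * gs p + fs p * g p) (f p * gt p + ft p * g p)) (at p)" if "p \<in> U" for p
    by (rule has_derivative_eq_rhs[OF has_derivative_mult[OF d(1)[OF that] d(2)[OF that]]]) (auto simp: tri_def algebra_simps)
  note * = this
  show ?case
    by (rule exI[of _ "\<lambda>p. f p * gz p + fz p * g p"], rule exI[of _ "\<lambda>p. f p * gs p + fs p * g p"], rule exI[of _ "\<lambda>p. f p * gt p + ft p * g p"])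
       (intro conjI ballI * h sm_mult.hyps sm.sm_add sm.sm_mult)
next
  case (sm_inverse f)
  from sm_inverse.IH obtain fz fs ft where h: "sm U fz" "sm U fs" "sm U ft"
    and d0: "\<forall>p\<in>U. (f has_derivative tri (fz p) (fs p) (ft p)) (at p)" by blast
  note d = bspec[OF d0]
  have nz: "f p \<noteq> 0" if "p \<in> U" for p using sm_inverse that by blast
  let ?i = "\<lambda>p. -1 * (inverse (f p) * inverse (f p))"
  have d1: "((\<lambda>p. inverse (f p)) has_derivative tri (?i p * fz p) (?i p * fs p) (?i p * ft p)) (at p)" if "p \<in> U" for p
    by (rule has_derivative_eq_rhs[OF Deriv.has_derivative_inverse[OF nz[OF that] d[OF that]]]) (auto simp: tri_def algebra_simps)
  have d2: "sm U ?i" using sm_inverse.hyps nz by (intro sm.sm_mult sm.sm_const sm.sm_inverse)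
  note * = d1 d2
  show ?case
    by (rule exI[of _ "\<lambda>p. ?i p * fz p"], rule exI[of _ "\<lambda>p. ?i p * fs p"], rule exI[of _ "\<lambda>p. ?i p * ft p"])
       (intro conjI ballI sm.sm_mult[OF *(2)] h *(1))
next
  case (sm_exp f)
  from sm_exp.IH obtain fz fs ft where h: "sm U fz" "sm U fs" "sm U ft"
    and d0: "\<forall>p\<in>U. (f has_derivative tri (fz p) (fs p) (ft p)) (at p)" by blast
  note d = bspec[OF d0]
  have "((\<lambda>p. exp (f p)) has_derivative tri (exp (f p) * fz p) (exp (f p) * fs p) (exp (f p) * ft p)) (at p)" if "p \<in> U" for p
  proof -
    have "(exp has_derivative (*) (exp (f p))) (at (f p))" using DERIV_exp[of "f p"] by (simp add: has_field_derivative_def)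
    from has_derivative_compose[OF d[OF that] this] show ?thesis
      by (rule has_derivative_eq_rhs) (auto simp: tri_def algebra_simps)
  qed
  note * = this
  show ?case
    by (rule exI[of _ "\<lambda>p. exp (f p) * fz p"], rule exI[of _ "\<lambda>p. exp (f p) * fs p"], rule exI[of _ "\<lambda>p. exp (f p) * ft p"])
       (intro conjI ballI * h sm_exp.hyps sm.sm_mult sm.sm_exp)
qed

lemma sm_isCont: "sm U f \<Longrightarrow> p \<in> U \<Longrightarrow> isCont f p"
  using sm_deriv has_derivative_continuous by blast

lemma sm_mono: "sm U f \<Longrightarrow> V \<subseteq> U \<Longrightarrow> sm V f"
proof (induction rule: sm.induct)
  case (sm_inverse f)
  then show ?case by (intro sm.sm_inverse) auto
qed (simp_all add: sm.sm_const sm.sm_z sm.sm_s sm.sm_t sm.sm_add sm.sm_mult sm.sm_exp)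

lemma sm_minus: "sm U f \<Longrightarrow> sm U g \<Longrightarrow> sm U (\<lambda>p. f p - g p)"
  using sm_add[of U f "\<lambda>p. (-1) * g p"] sm_mult[OF sm_const, of U g "-1"] by simp

lemma sm_sum: "(\<And>i. i \<in> I \<Longrightarrow> sm U (f i)) \<Longrightarrow> sm U (\<lambda>p. \<Sum>i\<in>I. f i p)"
  by (induction I rule: infinite_finite_induct) (auto intro: sm_const sm_add)

lemma sm_prod: "(\<And>i. i \<in> I \<Longrightarrow> sm U (f i)) \<Longrightarrow> sm U (\<lambda>p. \<Prod>i\<in>I. f i p)"
  by (induction I rule: infinite_finite_induct) (auto intro: sm_const sm_mult)

lemma sm_det:
  assumes M: "\<And>p. M p \<in> carrier_mat n n" and e: "\<And>i j. i < n \<Longrightarrow> j < n \<Longrightarrow> sm U (\<lambda>p. M p $$ (i,j))"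
  shows "sm U (\<lambda>p. det (M p))"
  unfolding det_def'[OF M]
proof (intro sm_sum sm_mult sm_const sm_prod)
  fix q i assume "q \<in> {q. q permutes {0..<n}}" "i \<in> {0..<n}"
  then have "i < n" "q i < n" using permutes_in_image[of q "{0..<n}" i] by auto
  then show "sm U (\<lambda>p. M p $$ (i, q i))" by (rule e)
qed

text \<open>Entries of the adjugate are signed minors. Together with \<open>sm_det\<close>, Cramer's
  rule keeps solutions of linear systems inside the class wherever the determinant does not
  vanish.\<close>

lemma sm_adj_mat:
  assumes M: "\<And>p. M p \<in> carrier_mat n n" and e: "\<And>i j. i < n \<Longrightarrow> j < n \<Longrightarrow> sm U (\<lambda>p. M p $$ (i,j))"
    and ij: "i < n" "j < n"
  shows "sm U (\<lambda>p. adj_mat (M p) $$ (i,j))"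
proof -
  have "sm U (\<lambda>p. (-1) ^ (j + i) * det (mat_delete (M p) j i))"
  proof (intro sm_mult sm_const sm_det[of _ "n - 1"] mat_delete_carrier M)
    fix a b assume ab: "a < n - 1" "b < n - 1"
    define a' b' where "a' = (if a < j then a else Suc a)" and "b' = (if b < i then b else Suc b)"
    have "a' < n" "b' < n" using ab by (auto simp: a'_def b'_def)
    moreover have "mat_delete (M p) j i $$ (a,b) = M p $$ (a',b')" for p
      using ab carrier_matD[OF M[of p]] by (simp add: mat_delete_def a'_def b'_def)
    ultimately show "sm U (\<lambda>p. mat_delete (M p) j i $$ (a,b))" using e by simp
  qed
  moreover have "adj_mat (M p) $$ (i,j) = (-1) ^ (j + i) * det (mat_delete (M p) j i)" for p
    using ij carrier_matD[OF M[of p]] by (simp add: adj_mat_def cofactor_def)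
  ultimately show ?thesis by simp
qed

text \<open>First derivatives a, b in s and t at the origin and the mixed derivative c, obtained by
  differentiating in t first.\<close>
definition jet :: "(real \<Rightarrow> real \<Rightarrow> complex) \<Rightarrow> complex \<Rightarrow> complex \<Rightarrow> complex \<Rightarrow> bool" where
  "jet f a b c \<longleftrightarrow> ((\<lambda>s. f s 0) has_vector_derivative a) (at 0) \<and>
     (\<exists>g. (\<forall>\<^sub>F s in nhds 0. ((\<lambda>t. f s t) has_vector_derivative g s) (at 0)) \<and> g 0 = b \<and>
       (g has_vector_derivative c) (at 0))"

lemma isCont_eventually: "isCont f x \<Longrightarrow> open S \<Longrightarrow> f x \<in> S \<Longrightarrow> \<forall>\<^sub>F y in nhds x. f y \<in> S"
  unfolding isCont_def tendsto_at_iff_tendsto_nhds by (rule topological_tendstoD)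

lemma jet_const: "jet (\<lambda>s t. k) 0 0 0"
  unfolding jet_def by (intro conjI exI[of _ "\<lambda>s. 0"]) auto

lemma jet_add:
  assumes "jet f a b c" "jet f' a' b' c'"
  shows "jet (\<lambda>s t. f s t + f' s t) (a + a') (b + b') (c + c')"
proof -
  obtain g g' where g: "\<forall>\<^sub>F s in nhds 0. ((\<lambda>t. f s t) has_vector_derivative g s) (at 0)" "g 0 = b" "(g has_vector_derivative c) (at 0)"
    "\<forall>\<^sub>F s in nhds 0. ((\<lambda>t. f' s t) has_vector_derivative g' s) (at 0)" "g' 0 = b'" "(g' has_vector_derivative c') (at 0)"
    using assms unfolding jet_def by blast
  have "\<forall>\<^sub>F s in nhds 0. ((\<lambda>t. f s t + f' s t) has_vector_derivative (g s + g' s)) (at 0)"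
    using g(1,4) by eventually_elim (rule has_vector_derivative_add)
  then show ?thesis using assms g unfolding jet_def
    by (intro conjI exI[of _ "\<lambda>s. g s + g' s"]) (auto intro: has_vector_derivative_add)
qed

lemma jet_mult:
  assumes "jet f a b c" "jet f' a' b' c'"
  shows "jet (\<lambda>s t. f s t * f' s t) (f 0 0 * a' + a * f' 0 0) (f 0 0 * b' + b * f' 0 0)
    (f 0 0 * c' + a * b' + b * a' + c * f' 0 0)"
proof -
  obtain g g' where g: "\<forall>\<^sub>F s in nhds 0. ((\<lambda>t. f s t) has_vector_derivative g s) (at 0)" "g 0 = b" "(g has_vector_derivative c) (at 0)"
    "\<forall>\<^sub>F s in nhds 0. ((\<lambda>t. f' s t) has_vector_derivative g' s) (at 0)" "g' 0 = b'" "(g' has_vector_derivative c') (at 0)"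
    and f: "((\<lambda>s. f s 0) has_vector_derivative a) (at 0)" "((\<lambda>s. f' s 0) has_vector_derivative a') (at 0)"
    using assms unfolding jet_def by blast
  have 1: "\<forall>\<^sub>F s in nhds 0. ((\<lambda>t. f s t * f' s t) has_vector_derivative (f s 0 * g' s + g s * f' s 0)) (at 0)"
    using g(1,4) by eventually_elim (rule has_vector_derivative_mult)
  have 2: "((\<lambda>s. f s 0 * g' s + g s * f' s 0) has_vector_derivative (f 0 0 * c' + a * g' 0 + (g 0 * a' + c * f' 0 0))) (at 0)"
    by (intro has_vector_derivative_add has_vector_derivative_mult g f)
  show ?thesis unfolding jet_def
    using has_vector_derivative_mult[OF f] 1 2 g(2,5)
    by (intro conjI exI[of _ "\<lambda>s. f s 0 * g' s + g s * f' s 0"]) (auto simp: add.assoc)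
qed

lemma jet_sum:
  "(\<And>i. i \<in> I \<Longrightarrow> jet (f i) (a i) (b i) (c i)) \<Longrightarrow> jet (\<lambda>s t. \<Sum>i\<in>I. f i s t) (\<Sum>i\<in>I. a i) (\<Sum>i\<in>I. b i) (\<Sum>i\<in>I. c i)"
  by (induction I rule: infinite_finite_induct) (auto intro: jet_const jet_add)

lemma has_vector_derivative_ev:
  assumes "(f has_vector_derivative D) (at x)" "\<forall>\<^sub>F y in nhds x. f y = g y"
  shows "(g has_vector_derivative D) (at x)"
proof -
  obtain S where S: "open S" "x \<in> S" "\<And>y. y \<in> S \<Longrightarrow> f y = g y" using assms(2) by (auto simp: eventually_nhds)
  show ?thesis by (rule has_vector_derivative_transform_within_open[OF assms(1) S(1,2)]) (use S in auto)
qed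

text \<open>With \<open>jet_cong\<close> this permits comparing coefficients: an identity that holds
  near the origin becomes three identities between derivatives. The perturbation equations of the
  eigenvalue are extracted in this way.\<close>

lemma jet_unique:
  assumes "jet f a b c" "jet f a' b' c'"
  shows "a = a'" "b = b'" "c = c'"
proof -
  obtain g g' where g: "\<forall>\<^sub>F s in nhds 0. ((\<lambda>t. f s t) has_vector_derivative g s) (at 0)" "g 0 = b" "(g has_vector_derivative c) (at 0)"
    "\<forall>\<^sub>F s in nhds 0. ((\<lambda>t. f s t) has_vector_derivative g' s) (at 0)" "g' 0 = b'" "(g' has_vector_derivative c') (at 0)"
    using assms unfolding jet_def by blast
  have e: "\<forall>\<^sub>F s in nhds 0. g s = g' s"
    using g(1,4) by eventually_elim (rule vector_derivative_unique_at)
  show "a = a'" using assms unfolding jet_def by (blast intro: vector_derivative_unique_at)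
  show "b = b'" using eventually_nhds_x_imp_x[OF e] g by simp
  have "(g' has_vector_derivative c) (at 0)"
    by (rule has_vector_derivative_ev[OF g(3) e])
  then show "c = c'" using g(6) by (rule vector_derivative_unique_at)
qed

text \<open>A joint neighbourhood contains a product of neighbourhoods; the nested form is the one
  in which \<open>jet\<close> asks for the \<open>t\<close>-derivative.\<close>

lemma eventually_nhds_pair:
  assumes "\<forall>\<^sub>F p in nhds (a::'a::topological_space,b::'b::topological_space). P p"
  shows "\<forall>\<^sub>F s in nhds a. \<forall>\<^sub>F t in nhds b. P (s,t)"
proof -
  obtain S where S: "open S" "(a,b) \<in> S" "\<And>p. p \<in> S \<Longrightarrow> P p" using assms by (auto simp: eventually_nhds)
  obtain A B where AB: "open A" "open B" "(a,b) \<in> A \<times> B" "A \<times> B \<subseteq> S" using open_prod_elim[OF S(1,2)] by metis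
  have "\<forall>\<^sub>F t in nhds b. P (s,t)" if "s \<in> A" for s
    using AB S(3) that by (auto simp: eventually_nhds intro!: exI[of _ B])
  then show ?thesis using AB by (auto simp: eventually_nhds[of _ a] intro!: exI[of _ A])
qed

lemma jet_cong:
  assumes "jet f a b c" and ev: "\<forall>\<^sub>F p in nhds (0,0). f (fst p) (snd p) = f' (fst p) (snd p)"
  shows "jet f' a b c"
proof -
  obtain g where g: "\<forall>\<^sub>F s in nhds 0. ((\<lambda>t. f s t) has_vector_derivative g s) (at 0)" "g 0 = b" "(g has_vector_derivative c) (at 0)"
    and f: "((\<lambda>s. f s 0) has_vector_derivative a) (at 0)"
    using assms(1) unfolding jet_def by blast
  have e: "\<forall>\<^sub>F s in nhds 0. \<forall>\<^sub>F t in nhds 0. f s t = f' s t" using eventually_nhds_pair[OF ev] by simp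
  have "\<forall>\<^sub>F s in nhds 0. f s 0 = f' s 0" using e by eventually_elim (rule eventually_nhds_x_imp_x)
  then have "((\<lambda>s. f' s 0) has_vector_derivative a) (at 0)" by (rule has_vector_derivative_ev[OF f])
  moreover have "\<forall>\<^sub>F s in nhds 0. ((\<lambda>t. f' s t) has_vector_derivative g s) (at 0)"
    using g(1) e by eventually_elim (rule has_vector_derivative_ev)
  ultimately show ?thesis unfolding jet_def using g by blast
qed

section \<open>The chain rule and the implicit function theorem for jets\<close>

lemma sm_along:
  assumes "(f has_derivative tri a b c) (at (z t, s t, u t))"
    and "(z has_real_derivative z') (at t)" "(s has_real_derivative s') (at t)" "(u has_real_derivative u') (at t)"
  shows "((\<lambda>t. f (z t, s t, u t)) has_vector_derivative (of_real z' * a + of_real s' * b + of_real u' * c)) (at t)"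
proof -
  have "((\<lambda>t. (z t, s t, u t)) has_derivative (\<lambda>h. (z' * h, s' * h, u' * h))) (at t)"
    using assms(2-4) unfolding has_field_derivative_def by (intro has_derivative_Pair) auto
  from has_derivative_compose[OF this assms(1)] show ?thesis
    unfolding has_vector_derivative_def
    by (rule has_derivative_eq_rhs) (auto simp: tri_def scaleR_conv_of_real algebra_simps)
qed

text \<open>Real counterpart of \<open>jet\<close> that records only the existence of the
  derivatives; their values are found later by comparing coefficients.\<close>

definition rjet :: "(real \<Rightarrow> real \<Rightarrow> real) \<Rightarrow> bool" where
  "rjet l \<longleftrightarrow> (\<exists>a. ((\<lambda>s. l s 0) has_real_derivative a) (at 0)) \<and>
     (\<exists>g c. (\<forall>\<^sub>F s in nhds 0. ((\<lambda>t. l s t) has_real_derivative g s) (at 0)) \<and> (g has_real_derivative c) (at 0))"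

text \<open>For fixed \<open>s\<close> the chain rule gives the \<open>t\<close>-derivative
  \<open>l_t * f_z + f_t\<close> at \<open>(l s 0, s, 0)\<close>. The partial derivatives of
  \<open>f\<close> are again \<open>sm\<close>, so this expression is differentiable in
  \<open>s\<close> by the same rule.\<close>

lemma jet_of_sm:
  assumes U: "open U" "(l 0 0, 0, 0) \<in> U" and f: "sm U f" and l: "rjet l"
  shows "\<exists>a b c. jet (\<lambda>s t. f (l s t, s, t)) a b c"
proof -
  obtain la g c where la: "((\<lambda>s. l s 0) has_real_derivative la) (at 0)"
    and g: "\<forall>\<^sub>F s in nhds 0. ((\<lambda>t. l s t) has_real_derivative g s) (at 0)" "(g has_real_derivative c) (at 0)"
    using l unfolding rjet_def by blast
  obtain fz fs ft where h: "sm U fz" "sm U fs" "sm U ft"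
    and d: "\<And>p. p \<in> U \<Longrightarrow> (f has_derivative tri (fz p) (fs p) (ft p)) (at p)" using sm_deriv[OF f] by blast
  have along0: "\<exists>D. ((\<lambda>s. k (l s 0, s, 0)) has_vector_derivative D) (at 0)" if k: "sm U k" for k
  proof -
    obtain kz ks kt where "\<And>p. p \<in> U \<Longrightarrow> (k has_derivative tri (kz p) (ks p) (kt p)) (at p)" using sm_deriv[OF k] by blast
    from sm_along[OF this[OF U(2)] la DERIV_ident DERIV_const] show ?thesis by blast
  qed
  have inU: "\<forall>\<^sub>F s in nhds 0. (l s 0, s, 0) \<in> U"
  proof -
    have "isCont (\<lambda>s. (l s 0, s, 0::real)) 0" using DERIV_isCont[OF la] by (intro continuous_intros) auto
    then show ?thesis using U by (rule isCont_eventually)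
  qed
  define G where "G s = of_real (g s) * fz (l s 0, s, 0) + ft (l s 0, s, 0)" for s
  have 1: "\<forall>\<^sub>F s in nhds 0. ((\<lambda>t. f (l s t, s, t)) has_vector_derivative G s) (at 0)"
    using g(1) inU
  proof eventually_elim
    case (elim s)
    show ?case using sm_along[OF d[OF elim(2)] elim(1) DERIV_const DERIV_ident] by (simp add: G_def)
  qed
  obtain D1 where D1: "((\<lambda>s. fz (l s 0, s, 0)) has_vector_derivative D1) (at 0)" using along0[OF h(1)] by blast
  obtain D2 where D2: "((\<lambda>s. ft (l s 0, s, 0)) has_vector_derivative D2) (at 0)" using along0[OF h(3)] by blast
  obtain D3 where D3: "((\<lambda>s. f (l s 0, s, 0)) has_vector_derivative D3) (at 0)" using along0[OF f] by blast
  note D = D1 D2 D3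
  have gv: "((\<lambda>s. complex_of_real (g s)) has_vector_derivative of_real c) (at 0)"
    using g(2) by (intro has_vector_derivative_of_real) (simp add: has_real_derivative_iff_has_vector_derivative)
  have "(G has_vector_derivative (of_real (g 0) * D1 + of_real c * fz (l 0 0, 0, 0) + D2)) (at 0)"
    unfolding G_def by (intro has_vector_derivative_add has_vector_derivative_mult gv D)
  then show ?thesis using 1 D(3) unfolding jet_def by blast
qed

text \<open>The inverse function theorem for \<open>(z,s,t) \<mapsto> (Re c, s, t)\<close> solves
  \<open>c = 1\<close> for \<open>z\<close>. It is used for the first derivatives of
  \<open>l\<close>; the second one is obtained from the quotient formula for the
  \<open>t\<close>-derivative. Solving for the real part suffices because \<open>c\<close> is real
  on \<open>U\<close>.\<close>

lemma implicit_jet: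
  assumes U: "open U" "(1,0,0) \<in> U" and c: "sm U c" and real: "\<And>p. p \<in> U \<Longrightarrow> Im (c p) = 0" and c1: "c (1,0,0) = 1"
    and cz: "((\<lambda>z. c (z,0,0)) has_vector_derivative k) (at 1)" and k: "k \<noteq> 0"
  shows "\<exists>l. l 0 0 = 1 \<and> rjet l \<and> isCont (\<lambda>p. l (fst p) (snd p)) (0,0) \<and>
     (\<forall>\<^sub>F p in nhds (0,0). (l (fst p) (snd p), fst p, snd p) \<in> U \<and> c (l (fst p) (snd p), fst p, snd p) = 1)"
proof -
  obtain fz fs ft where h: "sm U fz" "sm U fs" "sm U ft"
    and d: "\<And>p. p \<in> U \<Longrightarrow> (c has_derivative tri (fz p) (fs p) (ft p)) (at p)" using sm_deriv[OF c] by blast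
  have "k = fz (1,0,0)"
    using vector_derivative_unique_at[OF cz sm_along[OF d[OF U(2)] DERIV_ident DERIV_const DERIV_const]] by simp
  have dR: "((\<lambda>p. Re (c p)) has_derivative (\<lambda>h. fst h * Re (fz p) + fst (snd h) * Re (fs p) + snd (snd h) * Re (ft p))) (at p)" if "p \<in> U" for p
    by (rule has_derivative_eq_rhs[OF bounded_linear.has_derivative[OF bounded_linear_Re d[OF that]]]) (auto simp: tri_def)
  have dI: "((\<lambda>p. Im (c p)) has_derivative (\<lambda>h. fst h * Im (fz p) + fst (snd h) * Im (fs p) + snd (snd h) * Im (ft p))) (at p)" if "p \<in> U" for p
    by (rule has_derivative_eq_rhs[OF bounded_linear.has_derivative[OF bounded_linear_Im d[OF that]]]) (auto simp: tri_def)
  have "Im (fz p) = 0" if "p \<in> U" for p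
  proof -
    have "((\<lambda>p. Im (c p)) has_derivative (\<lambda>h. 0)) (at p)"
      by (rule has_derivative_transform_within_open[OF has_derivative_const U(1) that, of 0]) (simp add: real)
    from has_derivative_unique[OF this dI[OF that]] have "(0::real) = (\<lambda>h. fst h * Im (fz p) + fst (snd h) * Im (fs p) + snd (snd h) * Im (ft p)) (1,0,0)" by metis
    then show ?thesis by simp
  qed
  \<comment> \<open>\<open>c\<close> is real on the open set \<open>U\<close>, so its
    \<open>z\<close>-derivative is real as well, and \<open>k \<noteq> 0\<close> becomes a statement
    about the real part.\<close>
  then have kR: "Re (fz (1,0,0)) \<noteq> 0" using k \<open>k = fz (1,0,0)\<close> U(2) by (metis complex_eq_iff zero_complex.simps)
  \<comment> \<open>The part of \<open>U\<close> on which the quotient \<open>gl'\<close> below has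
    a nonzero denominator.\<close>
  define U0 where "U0 = U \<inter> {p. p \<in> U \<longrightarrow> Re (fz p) \<noteq> 0}"
  have oU0: "open U0"
  proof -
    have co: "continuous_on U (\<lambda>p. Re (fz p))"
      using sm_isCont[OF h(1)] by (intro continuous_on_Re continuous_at_imp_continuous_on) auto
    have "U0 = (\<lambda>p. Re (fz p)) -` (- {0}) \<inter> U" by (auto simp: U0_def)
    then show ?thesis using continuous_open_preimage[OF co U(1), of "- {0}"] by (simp add: Int_commute open_Compl)
  qed
  have U0: "(1,0,0) \<in> U0" "U0 \<subseteq> U" "\<And>p. p \<in> U0 \<Longrightarrow> Re (fz p) \<noteq> 0" using U kR by (auto simp: U0_def)
  \<comment> \<open>The derivative of \<open>G\<close> is assembled from fixed bounded linear maps
    with continuous coefficients, so that its continuity in \<open>p\<close> is immediate.\<close>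
  define B1 B2 B3 B0 :: "(real \<times> real \<times> real) \<Rightarrow>\<^sub>L (real \<times> real \<times> real)"
    where "B1 = Blinfun (\<lambda>h. (fst h, 0, 0))" and "B2 = Blinfun (\<lambda>h. (fst (snd h), 0, 0))"
      and "B3 = Blinfun (\<lambda>h. (snd (snd h), 0, 0))" and "B0 = Blinfun (\<lambda>h. (0, snd h))"
  have bl: "bounded_linear (\<lambda>h::real \<times> real \<times> real. (fst h, 0::real, 0::real))" "bounded_linear (\<lambda>h::real \<times> real \<times> real. (fst (snd h), 0::real, 0::real))"
    "bounded_linear (\<lambda>h::real \<times> real \<times> real. (snd (snd h), 0::real, 0::real))" "bounded_linear (\<lambda>h::real \<times> real \<times> real. (0::real, snd h))"
    by (auto intro!: bounded_linear_Pair bounded_linear_zero bounded_linear_compose[OF bounded_linear_fst] bounded_linear_compose[OF bounded_linear_snd]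
        bounded_linear_fst bounded_linear_snd)
  have Bap: "blinfun_apply B1 h = (fst h, 0, 0)" "blinfun_apply B2 h = (fst (snd h), 0, 0)" "blinfun_apply B3 h = (snd (snd h), 0, 0)"
    "blinfun_apply B0 h = (0, snd h)" for h
    unfolding B1_def B2_def B3_def B0_def using bl by (simp_all add: bounded_linear_Blinfun_apply)
  define G where "G p = (Re (c p), snd p)" for p
  define G' where "G' p = Re (fz p) *\<^sub>R B1 + Re (fs p) *\<^sub>R B2 + Re (ft p) *\<^sub>R B3 + B0" for p
  have G'ap: "blinfun_apply (G' p) h = (fst h * Re (fz p) + fst (snd h) * Re (fs p) + snd (snd h) * Re (ft p), snd h)" for p h
    by (cases h) (auto simp: G'_def Bap blinfun.add_left blinfun.scaleR_left algebra_simps)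
  have dG: "(G has_derivative blinfun_apply (G' p)) (at p)" if "p \<in> U0" for p
  proof -
    have "(G has_derivative (\<lambda>h. (fst h * Re (fz p) + fst (snd h) * Re (fs p) + snd (snd h) * Re (ft p), snd h))) (at p)"
      unfolding G_def using that U0 by (intro has_derivative_Pair dR has_derivative_snd has_derivative_ident) auto
    then show ?thesis by (rule has_derivative_eq_rhs) (auto simp: G'ap)
  qed
  have cG: "continuous_on U0 G'"
    unfolding G'_def using sm_isCont[OF h(1)] sm_isCont[OF h(2)] sm_isCont[OF h(3)] U0(2)
    by (intro continuous_intros continuous_on_Re continuous_at_imp_continuous_on) auto
  define K where "K = Re (fz (1,0,0))"
  \<comment> \<open>Inverse of the triangular derivative at \<open>(1,0,0)\<close>: the first
    component is solved for the increment of \<open>z\<close>, the other two are kept.\<close>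
  define iv where "iv = Blinfun (\<lambda>h. ((fst h - fst (snd h) * Re (fs (1,0,0)) - snd (snd h) * Re (ft (1,0,0))) / K, snd h))"
  have blinv: "bounded_linear (\<lambda>h::real \<times> real \<times> real. ((fst h - fst (snd h) * Re (fs (1,0,0)) - snd (snd h) * Re (ft (1,0,0))) / K, snd h))"
    by (auto intro!: bounded_linear_Pair bounded_linear_sub bounded_linear_compose[OF bounded_linear_divide]
       bounded_linear_compose[OF bounded_linear_mult_left] bounded_linear_compose[OF bounded_linear_fst] bounded_linear_compose[OF bounded_linear_snd]
        bounded_linear_fst bounded_linear_snd)
  have invap: "blinfun_apply iv h = ((fst h - fst (snd h) * Re (fs (1,0,0)) - snd (snd h) * Re (ft (1,0,0))) / K, snd h)" for h
    unfolding iv_def bounded_linear_Blinfun_apply[OF blinv] ..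
  have invG: "iv o\<^sub>L G' (1,0,0) = id_blinfun"
    by (rule blinfun_eqI) (use kR in \<open>auto simp: invap G'ap K_def\<close>)
  obtain U' V g g' where ift: "open U'" "U' \<subseteq> U0" "(1,0,0) \<in> U'" "open V" "G (1,0,0) \<in> V" "homeomorphism U' V G g"
    "\<And>y. y \<in> V \<Longrightarrow> (g has_derivative (g' y)) (at y)"
    using inverse_function_theorem[OF oU0 dG cG U0(1) invG] by metis
  define l where "l s t = fst (g (1, s, t))" for s t :: real
  have G1: "G (1,0,0) = (1,0,0)" by (simp add: G_def c1)
  have V0: "(1,0,0) \<in> V" using ift(5) G1 by simp
  have gG: "g (G p) = p" if "p \<in> U'" for p using ift(6) that by (auto simp: homeomorphism_def)
  have Gg: "G (g y) = y" "g y \<in> U'" if "y \<in> V" for y using ift(6) that by (auto simp: homeomorphism_def)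
  have l0: "l 0 0 = 1" using gG[OF ift(3)] G1 by (simp add: l_def)
  have gl: "g (1, s, t) = (l s t, s, t)" "(l s t, s, t) \<in> U0" "c (l s t, s, t) = 1" if "(1,s,t) \<in> V" for s t
  proof -
    have "snd (g (1,s,t)) = (s,t)" using Gg(1)[OF that] by (simp add: G_def)
    then show e: "g (1, s, t) = (l s t, s, t)" by (simp add: l_def prod_eq_iff)
    then show u: "(l s t, s, t) \<in> U0" using Gg(2)[OF that] ift(2) by auto
    have "Re (c (l s t, s, t)) = 1" using Gg(1)[OF that] by (simp add: G_def e)
    then show "c (l s t, s, t) = 1" using real u U0(2) by (auto simp: complex_eq_iff)
  qed
  have opV: "\<forall>\<^sub>F p in nhds (0,0). (1, fst p, snd p) \<in> V"
  proof -
    have "isCont (\<lambda>p::real \<times> real. (1::real, fst p, snd p)) (0,0)" by (intro continuous_intros)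
    then show ?thesis using ift(4) V0 by (intro isCont_eventually) auto
  qed
  have dl: "((\<lambda>p. l (fst p) (snd p)) has_derivative (\<lambda>h. fst (g' (1,s,t) (0, fst h, snd h)))) (at (s,t))" if "(1,s,t) \<in> V" for s t
  proof -
    have p: "((\<lambda>p::real \<times> real. (1::real, fst p, snd p)) has_derivative (\<lambda>h. (0, fst h, snd h))) (at (s,t))"
      by (intro has_derivative_Pair has_derivative_const has_derivative_fst has_derivative_snd has_derivative_ident)
    have "(g has_derivative g' (1,s,t)) (at (1, fst (s,t), snd (s,t)))" using ift(7)[OF that] by simp
    from has_derivative_fst[OF has_derivative_compose[OF p this]] show ?thesis by (simp add: l_def)
  qed
  have ls: "((\<lambda>s. l s 0) has_real_derivative fst (g' (1,0,0) (0,1,0))) (at 0)"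
  proof -
    have p: "((\<lambda>s::real. (s, 0::real)) has_derivative (\<lambda>h. (h, 0))) (at 0)"
      by (intro has_derivative_Pair has_derivative_const has_derivative_ident)
    have D: "((\<lambda>s. l s 0) has_derivative (\<lambda>h. fst (g' (1,0,0) (0, h, 0)))) (at 0)"
      using has_derivative_compose[OF p dl[OF V0]] by simp
    then have e: "fst (g' (1,0,0) (0, h, 0)) = h * fst (g' (1,0,0) (0,1,0))" for h
      using linear_cmul[OF has_derivative_linear[OF D], of h 1] by simp
    show ?thesis unfolding has_field_derivative_def
      by (rule has_derivative_eq_rhs[OF D]) (rule ext, subst e, rule mult.commute)
  qed
  have inV: "\<forall>\<^sub>F s in nhds 0. (1, s, 0) \<in> V"
    using eventually_nhds_pair[OF opV] by eventually_elim (use eventually_nhds_x_imp_x in fastforce)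
  \<comment> \<open>Implicit differentiation of \<open>c (l s t, s, t) = 1\<close> in
    \<open>t\<close>. Unlike the derivative supplied by the inverse function theorem, this quotient
    is visibly differentiable in \<open>s\<close>.\<close>
  define gl' where "gl' s = - Re (ft (l s 0, s, 0)) / Re (fz (l s 0, s, 0))" for s
  have lt: "\<forall>\<^sub>F s in nhds 0. ((\<lambda>t. l s t) has_real_derivative gl' s) (at 0)"
    using eventually_nhds_pair[OF opV] inV
  proof eventually_elim
    case (elim s)
    have p: "((\<lambda>t::real. (s, t)) has_derivative (\<lambda>h. (0, h))) (at 0)"
      by (intro has_derivative_Pair has_derivative_const has_derivative_ident)
    have D: "((\<lambda>t. l s t) has_derivative (\<lambda>h. fst (g' (1,s,0) (0, 0, h)))) (at 0)"
      using has_derivative_compose[OF p dl[OF elim(2)]] by simp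
    then have e: "fst (g' (1,s,0) (0, 0, h)) = h * fst (g' (1,s,0) (0,0,1))" for h
      using linear_cmul[OF has_derivative_linear[OF D], of h 1] by simp
    have D': "((\<lambda>t. l s t) has_real_derivative fst (g' (1,s,0) (0,0,1))) (at 0)"
      unfolding has_field_derivative_def
      by (rule has_derivative_eq_rhs[OF D]) (rule ext, subst e, rule mult.commute)
    define x where "x = fst (g' (1,s,0) (0,0,1))"
    have u: "(l s 0, s, 0) \<in> U0" using gl(2)[OF elim(2)] .
    have "((\<lambda>t. c (l s t, s, t)) has_vector_derivative (of_real x * fz (l s 0, s, 0) + ft (l s 0, s, 0))) (at 0)"
      using sm_along[OF d D' DERIV_const DERIV_ident] u U0(2) by (auto simp: x_def)
    moreover have "((\<lambda>t. c (l s t, s, t)) has_vector_derivative 0) (at 0)"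
    proof (rule has_vector_derivative_ev[OF has_vector_derivative_const])
      show "\<forall>\<^sub>F t in nhds 0. 1 = c (l s t, s, t)" using elim(1) by eventually_elim (use gl(3) in simp)
    qed
    ultimately have "of_real x * fz (l s 0, s, 0) + ft (l s 0, s, 0) = 0" by (rule vector_derivative_unique_at)
    from arg_cong[OF this, of Re] have "x * Re (fz (l s 0, s, 0)) + Re (ft (l s 0, s, 0)) = 0" by simp
    then have "x = gl' s" using U0(3)[OF u] by (simp add: gl'_def field_simps)
    then show ?case using D' by (simp add: x_def)
  qed
  have "\<exists>D. (gl' has_real_derivative D) (at 0)"
  proof -
    have ex: "\<exists>D. ((\<lambda>s. Re (k (l s 0, s, 0))) has_real_derivative D) (at 0)" if k: "sm U k" for k
    proof -
      obtain kz ks kt where "\<And>p. p \<in> U \<Longrightarrow> (k has_derivative tri (kz p) (ks p) (kt p)) (at p)" using sm_deriv[OF k] by blast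
      moreover have "(l 0 0, 0, 0) \<in> U" using U(2) l0 by simp
      ultimately have "((\<lambda>s. k (l s 0, s, 0)) has_vector_derivative
          (of_real (fst (g' (1,0,0) (0,1,0))) * kz (l 0 0,0,0) + of_real 1 * ks (l 0 0,0,0) + of_real 0 * kt (l 0 0,0,0))) (at 0)"
        using sm_along[OF _ ls DERIV_ident DERIV_const] by blast
      from bounded_linear.has_vector_derivative[OF bounded_linear_Re this] show ?thesis
        unfolding has_real_derivative_iff_has_vector_derivative by blast
    qed
    obtain D1 D2 where D: "((\<lambda>s. Re (ft (l s 0, s, 0))) has_real_derivative D1) (at 0)" "((\<lambda>s. Re (fz (l s 0, s, 0))) has_real_derivative D2) (at 0)"
      using ex h by blast
    have "Re (fz (l 0 0, 0, 0)) \<noteq> 0" using kR l0 by simp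
    from DERIV_divide[OF DERIV_minus[OF D(1)] D(2) this] show ?thesis unfolding gl'_def by blast
  qed
  then have "rjet l" unfolding rjet_def using ls lt by blast
  moreover have "isCont (\<lambda>p. l (fst p) (snd p)) (0,0)" using has_derivative_continuous[OF dl[OF V0]] .
  moreover have "\<forall>\<^sub>F p in nhds (0,0). (l (fst p) (snd p), fst p, snd p) \<in> U \<and> c (l (fst p) (snd p), fst p, snd p) = 1"
    using opV by eventually_elim (use gl U0(2) in auto)
  ultimately show ?thesis using l0 by blast
qed

abbreviation munit :: "nat \<Rightarrow> nat \<Rightarrow> nat \<Rightarrow> complex mat" where
  "munit d a b \<equiv> mat d d (\<lambda>ij. if ij = (a,b) then 1 else 0)"

section \<open>Perturbation of the spectral radius\<close>

definition vecm :: "nat \<Rightarrow> complex mat \<Rightarrow> complex Matrix.vec" where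
  "vecm d X = Matrix.vec (d*d) (\<lambda>k. X $$ (k div d, k mod d))"

definition unvecm :: "nat \<Rightarrow> complex Matrix.vec \<Rightarrow> complex mat" where
  "unvecm d v = mat d d (\<lambda>(i,j). v $ (i*d+j))"

text \<open>The matrix of a superoperator in the basis of matrix units, with the same row-major
  index as \<open>kron\<close>. It makes determinants and the eigenvalue theory of matrices
  available for maps.\<close>

definition supmat :: "nat \<Rightarrow> (complex mat \<Rightarrow> complex mat) \<Rightarrow> complex mat" where
  "supmat d A = mat (d*d) (d*d) (\<lambda>(k,l). A (munit d (l div d) (l mod d)) $$ (k div d, k mod d))"

lemma vecm_carrier [simp]: "vecm d X \<in> carrier_vec (d*d)"
  by (simp add: vecm_def)

lemma unvecm_carrier [simp]: "unvecm d v \<in> carrier_mat d d"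
  by (simp add: unvecm_def)

lemma supmat_carrier [simp]: "supmat d A \<in> carrier_mat (d*d) (d*d)"
  by (simp add: supmat_def)

lemma vecm_unvecm: "v \<in> carrier_vec (d*d) \<Longrightarrow> vecm d (unvecm d v) = v"
  by (intro eq_vecI) (auto simp: vecm_def unvecm_def div_lt mod_lt)

lemma unvecm_vecm: "X \<in> carrier_mat d d \<Longrightarrow> unvecm d (vecm d X) = X"
  by (intro eq_matI) (auto simp: vecm_def unvecm_def idx_lt)

lemma supmat_mult:
  assumes A: "linmap d A" and X: "X \<in> carrier_mat d d"
  shows "supmat d A *\<^sub>v vecm d X = vecm d (A X)"
proof (rule eq_vecI)
  fix k assume "k < dim_vec (vecm d (A X))"
  then have k: "k < d*d" by (simp add: vecm_def)
  have "(supmat d A *\<^sub>v vecm d X) $ k = (\<Sum>l<d*d. supmat d A $$ (k,l) * vecm d X $ l)"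
    using k by (simp add: supmat_def vecm_def scalar_prod_def atLeast0LessThan)
  also have "\<dots> = (\<Sum>a<d. \<Sum>b<d. X $$ (a,b) * A (munit d a b) $$ (k div d, k mod d))"
    unfolding sum_kron using k by (intro sum.cong refl) (auto simp: supmat_def vecm_def idx_lt)
  also have "\<dots> = vecm d (A X) $ k"
    using linmap_expand[OF A X div_lt[OF k] mod_lt[OF k]] k by (simp add: vecm_def)
  finally show "(supmat d A *\<^sub>v vecm d X) $ k = vecm d (A X) $ k" .
qed (simp add: supmat_def vecm_def)

lemma vecm_smult: "X \<in> carrier_mat d d \<Longrightarrow> vecm d (c \<cdot>\<^sub>m X) = c \<cdot>\<^sub>v vecm d X"
  by (intro eq_vecI) (auto simp: vecm_def div_lt mod_lt)

text \<open>\<open>spec_rad\<close> is a \<open>Max\<close> and hence meaningful over a finite set;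
  the eigenvalues of the map lie in the spectrum of \<open>supmat\<close>.\<close>

lemma finite_eigenvalues:
  assumes A: "linmap d A"
  shows "finite {l. \<exists>X \<in> carrier_mat d d. X \<noteq> 0\<^sub>m d d \<and> A X = l \<cdot>\<^sub>m X}"
proof (rule finite_subset)
  show "{l. \<exists>X \<in> carrier_mat d d. X \<noteq> 0\<^sub>m d d \<and> A X = l \<cdot>\<^sub>m X} \<subseteq> spectrum (supmat d A)"
  proof
    fix l assume "l \<in> {l. \<exists>X \<in> carrier_mat d d. X \<noteq> 0\<^sub>m d d \<and> A X = l \<cdot>\<^sub>m X}"
    then obtain X where X: "X \<in> carrier_mat d d" "X \<noteq> 0\<^sub>m d d" "A X = l \<cdot>\<^sub>m X" by blast
    have "vecm d X \<noteq> 0\<^sub>v (d*d)"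
    proof
      assume "vecm d X = 0\<^sub>v (d*d)"
      then have "X = unvecm d (0\<^sub>v (d*d))" using unvecm_vecm[OF X(1)] by simp
      also have "\<dots> = 0\<^sub>m d d" by (intro eq_matI) (auto simp: unvecm_def idx_lt)
      finally show False using X(2) by simp
    qed
    moreover have "supmat d A *\<^sub>v vecm d X = l \<cdot>\<^sub>v vecm d X"
      using supmat_mult[OF A X(1)] X by (simp add: vecm_smult)
    ultimately have "eigenvalue (supmat d A) l"
      unfolding eigenvalue_def eigenvector_def using carrier_matD[OF supmat_carrier] by (intro exI[of _ "vecm d X"]) simp
    then show "l \<in> spectrum (supmat d A)" by (simp add: spectrum_def)
  qed
  show "finite (spectrum (supmat d A))" by (rule card_finite_spectrum[OF supmat_carrier])
qed

lemma smult_smult_mat: "a \<cdot>\<^sub>m (b \<cdot>\<^sub>m X) = (a * b :: complex) \<cdot>\<^sub>m X"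
  by (intro eq_matI) auto

lemma cmod_unit_phase: "\<exists>v. cmod v = 1 \<and> v * m = complex_of_real (cmod m) * u" if "cmod u = 1"
proof (cases "m = 0")
  case False
  then show ?thesis
    using that by (intro exI[of _ "complex_of_real (cmod m) * u / m"]) (auto simp: norm_mult norm_divide)
qed (intro exI[of _ 1]; simp)

text \<open>Perron-Frobenius comparison: if |m| exceeded the eigenvalue of the positive eigenvector x,
  then every Hermitian part of an eigenvector for m would be at most q^n x with q < 1.\<close>
lemma positive_eigenvector_bound:
  assumes A: "posmap d A" and x: "psd d (x - complex_of_real (1/2) \<cdot>\<^sub>m 1\<^sub>m d)" "x \<in> carrier_mat d d"
    and ev: "A x = complex_of_real l \<cdot>\<^sub>m x" and l: "l > 0"
    and Y: "Y \<in> carrier_mat d d" "Y \<noteq> 0\<^sub>m d d" "A Y = m \<cdot>\<^sub>m Y"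
  shows "cmod m \<le> l"
proof (rule ccontr)
  assume "\<not> cmod m \<le> l"
  then have lm: "l < cmod m" by simp
  note lin = posmap_linmap[OF A]
  \<comment> \<open>Twice the Hermitian part of \<open>u * Y\<close>. Since \<open>A\<close>
    preserves adjoints, it sends \<open>H u\<close> to \<open>H (u * m)\<close>, so the complex
    eigenvalue acts by rotating and dilating \<open>u\<close>.\<close>
  define H where "H u = u \<cdot>\<^sub>m Y + cnj u \<cdot>\<^sub>m adj Y" for u
  have aY: "adj Y \<in> carrier_mat d d" using Y by simp
  have Hc: "H u \<in> carrier_mat d d" for u using Y by (simp add: H_def)
  have Hh: "hermitian_mat d (H u)" for u
    using Y Hc unfolding hermitian_mat_def H_def by (auto simp: adj_add[of _ d d] adj_smult intro!: eq_matI)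
  have AaY: "A (adj Y) = cnj m \<cdot>\<^sub>m adj Y" using A Y by (simp add: posmap_def adj_smult)
  have AH: "A (H u) = H (u * m)" for u
    unfolding H_def using Y aY AaY lin by (simp add: linmap_add linmap_smult smult_smult_mat mult.commute)
  have AHn: "(A ^^ n) (H u) = H (u * m ^ n)" for n u by (induction n) (auto simp: AH mult_ac)
  have Axn: "(A ^^ n) x = complex_of_real (l ^ n) \<cdot>\<^sub>m x" for n
    by (induction n) (use x ev lin in \<open>auto simp: linmap_smult smult_smult_mat mult_ac\<close>)
  obtain c1 where c1: "c1 > 0" "psd d (complex_of_real c1 \<cdot>\<^sub>m 1\<^sub>m d - H 1)" "psd d (H 1 - complex_of_real (-c1) \<cdot>\<^sub>m 1\<^sub>m d)"
    using hermitian_bounded[OF Hh] .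
  obtain c2 where c2: "c2 > 0" "psd d (complex_of_real c2 \<cdot>\<^sub>m 1\<^sub>m d - H \<i>)" "psd d (H \<i> - complex_of_real (-c2) \<cdot>\<^sub>m 1\<^sub>m d)"
    using hermitian_bounded[OF Hh] .
  \<comment> \<open>Twice the sum of the bounds for \<open>H 1\<close> and \<open>H \<i>\<close>,
    because \<open>x\<close> is known to dominate half of the identity. The constant serves all
    \<open>u\<close> of modulus 1.\<close>
  define C where "C = 2 * (c1 + c2)"
  have HR: "H u = complex_of_real (Re u) \<cdot>\<^sub>m H 1 + complex_of_real (Im u) \<cdot>\<^sub>m H \<i>" for u
    using Y unfolding H_def by (intro eq_matI) (auto simp: complex_eq_iff algebra_simps)
  define nq where "nq v = (\<Sum>i<d. (cmod (v i))\<^sup>2)" for v :: "nat \<Rightarrow> complex"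
  have nq0: "nq v \<ge> 0" for v by (simp add: nq_def sum_nonneg)
  have bound1: "\<bar>Re (qf d (H 1) v)\<bar> \<le> c1 * nq v" for v
  proof -
    have "Re (qf d (complex_of_real c1 \<cdot>\<^sub>m 1\<^sub>m d - H 1) v) \<ge> 0" "Re (qf d (H 1 - complex_of_real (-c1) \<cdot>\<^sub>m 1\<^sub>m d) v) \<ge> 0"
      using c1(2,3) by (simp_all only: psd_def)
    then show ?thesis using Hc[of 1] by (simp add: qf_minus qf_smult qf_one nq_def abs_le_iff)
  qed
  have bound2: "\<bar>Re (qf d (H \<i>) v)\<bar> \<le> c2 * nq v" for v
  proof -
    have "Re (qf d (complex_of_real c2 \<cdot>\<^sub>m 1\<^sub>m d - H \<i>) v) \<ge> 0" "Re (qf d (H \<i> - complex_of_real (-c2) \<cdot>\<^sub>m 1\<^sub>m d) v) \<ge> 0"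
      using c2(2,3) by (simp_all only: psd_def)
    then show ?thesis using Hc[of \<i>] by (simp add: qf_minus qf_smult qf_one nq_def abs_le_iff)
  qed
  have xq: "Re (qf d x v) \<ge> nq v / 2" for v
    using x unfolding psd_def by (auto simp: qf_minus qf_smult qf_one nq_def)
  have xh: "hermitian_mat d x"
  proof -
    have "x = (x - complex_of_real (1/2) \<cdot>\<^sub>m 1\<^sub>m d) + complex_of_real (1/2) \<cdot>\<^sub>m 1\<^sub>m d" using x(2) by (intro eq_matI) auto
    moreover have "hermitian_mat d ((x - complex_of_real (1/2) \<cdot>\<^sub>m 1\<^sub>m d) + complex_of_real (1/2) \<cdot>\<^sub>m 1\<^sub>m d)"
      using x by (intro hermitian_add hermitian_smult) (auto simp: psd_def)
    ultimately show ?thesis by simp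
  qed
  have dom: "psd d (complex_of_real C \<cdot>\<^sub>m x - H u)" if u: "cmod u = 1" for u
    unfolding psd_def
  proof (intro conjI allI)
    show "hermitian_mat d (complex_of_real C \<cdot>\<^sub>m x - H u)" by (intro hermitian_minus hermitian_smult xh Hh)
    fix v
    have "Re (qf d (H u) v) = Re u * Re (qf d (H 1) v) + Im u * Re (qf d (H \<i>) v)"
      unfolding HR[of u] using Hc by (simp add: qf_add qf_smult)
    moreover have "Re u * Re (qf d (H 1) v) \<le> c1 * nq v"
    proof -
      have "\<bar>Re u * Re (qf d (H 1) v)\<bar> \<le> 1 * (c1 * nq v)"
        unfolding abs_mult using abs_Re_le_cmod[of u] u bound1 by (intro mult_mono) auto
      then show ?thesis by linarith
    qed
    moreover have "Im u * Re (qf d (H \<i>) v) \<le> c2 * nq v"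
    proof -
      have "\<bar>Im u * Re (qf d (H \<i>) v)\<bar> \<le> 1 * (c2 * nq v)"
        unfolding abs_mult using abs_Im_le_cmod[of u] u bound2 by (intro mult_mono) auto
      then show ?thesis by linarith
    qed
    moreover have "C * Re (qf d x v) \<ge> C * (nq v / 2)" using xq[of v] c1(1) c2(1) by (intro mult_left_mono) (auto simp: C_def)
    ultimately show "Re (qf d (complex_of_real C \<cdot>\<^sub>m x - H u) v) \<ge> 0"
      using x Hc by (simp add: qf_minus qf_smult C_def algebra_simps)
  qed
  have Hneg: "Re (qf d (H u) v) \<le> 0" if u: "cmod u = 1" for u v
  proof -
    have n: "Re (qf d (H u) v) \<le> C * Re (qf d x v) * (l / cmod m) ^ n" for n
    proof -
      \<comment> \<open>The phase of \<open>m ^ n\<close> is compensated in advance, so that the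
        iterate lands on the fixed direction \<open>u\<close> for every \<open>n\<close>.\<close>
      obtain w where w: "cmod w = 1" "w * m ^ n = complex_of_real (cmod (m ^ n)) * u" using cmod_unit_phase[OF u] by blast
      have "psd d ((A ^^ n) (complex_of_real C \<cdot>\<^sub>m x - H w))"
        by (rule posmap_psd[OF posmap_funpow[OF A] dom[OF w(1)]])
      also have "(A ^^ n) (complex_of_real C \<cdot>\<^sub>m x - H w) = complex_of_real (C * l ^ n) \<cdot>\<^sub>m x - H (w * m ^ n)"
        using x Hc linmap_funpow[OF lin, of n] by (simp add: linmap_minus linmap_smult AHn Axn smult_smult_mat)
      also have "H (w * m ^ n) = complex_of_real (cmod m ^ n) \<cdot>\<^sub>m H u"
        unfolding w(2) H_def using Y by (intro eq_matI) (auto simp: norm_power algebra_simps)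
      finally have "Re (qf d (complex_of_real (C * l ^ n) \<cdot>\<^sub>m x - complex_of_real (cmod m ^ n) \<cdot>\<^sub>m H u) v) \<ge> 0"
        by (simp only: psd_def)
      then have "cmod m ^ n * Re (qf d (H u) v) \<le> C * l ^ n * Re (qf d x v)"
        using x Hc[of u] by (simp add: qf_minus[of _ d] qf_smult[of _ d] del: of_real_mult of_real_power)
      moreover have "cmod m ^ n > 0" using lm l by (intro zero_less_power) linarith
      ultimately show ?thesis by (simp add: power_divide pos_le_divide_eq mult_ac)
    qed
    have "(\<lambda>n. C * Re (qf d x v) * (l / cmod m) ^ n) \<longlonglongrightarrow> C * Re (qf d x v) * 0"
      using lm l by (intro tendsto_mult tendsto_const LIMSEQ_power_zero) (auto simp: divide_less_eq)
    then show ?thesis using n by (intro LIMSEQ_le_const[of _ "C * Re (qf d x v) * 0", simplified]) auto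
  qed
  \<comment> \<open>The inequalities for \<open>u\<close> and for \<open>- u\<close> together force
    \<open>H u = 0\<close>; \<open>u = 1\<close> and \<open>u = \<i>\<close> then determine every
    entry of \<open>Y\<close>.\<close>
  have Hz: "H u = 0\<^sub>m d d" if u: "cmod u = 1" for u
  proof (rule psd_antisym)
    have neg: "H (- u) = - 1 \<cdot>\<^sub>m H u" for u using Y unfolding H_def by (intro eq_matI) auto
    have *: "psd d (- 1 \<cdot>\<^sub>m H w)" if "cmod w = 1" for w
      unfolding psd_def using Hneg[OF that] Hc Hh[of "-w"] by (auto simp: qf_smult neg)
    have one: "1 \<cdot>\<^sub>m H u = H u" using Hc[of u] by (intro eq_matI) auto
    from * [OF u] *[of "-u"] u neg[of u] show "psd d (- 1 \<cdot>\<^sub>m H u)" "psd d (H u)"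
      using one by (auto simp: smult_smult_mat)
  qed
  have "Y = 0\<^sub>m d d"
  proof (rule eq_matI)
    fix i j assume "i < dim_row (0\<^sub>m d d :: complex mat)" "j < dim_col (0\<^sub>m d d :: complex mat)"
    then have ij: "i < d" "j < d" by auto
    have "H 1 $$ (i,j) = 0" "H \<i> $$ (i,j) = 0" using Hz[of 1] Hz[of \<i>] ij by auto
    then have "Y $$ (i,j) + cnj (Y $$ (j,i)) = 0" "\<i> * Y $$ (i,j) - \<i> * cnj (Y $$ (j,i)) = 0"
      using Y ij unfolding H_def by (auto simp: algebra_simps)
    then have "Y $$ (i,j) = 0" by (simp add: complex_eq_iff)
    then show "Y $$ (i,j) = 0\<^sub>m d d $$ (i,j)" using ij by simp
  qed (use Y in auto)
  then show False using Y by simp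
qed

text \<open>\<open>l\<close> is an eigenvalue through \<open>x\<close>, and
  \<open>positive_eigenvector_bound\<close> caps the modulus of all others.\<close>

lemma spec_rad_eq:
  assumes d: "d > 0" and A: "posmap d A" and x: "psd d (x - complex_of_real (1/2) \<cdot>\<^sub>m 1\<^sub>m d)" "x \<in> carrier_mat d d"
    and ev: "A x = complex_of_real l \<cdot>\<^sub>m x" and l: "l > 0"
  shows "spec_rad d A = l"
proof -
  let ?S = "{l. \<exists>X \<in> carrier_mat d d. X \<noteq> 0\<^sub>m d d \<and> A X = l \<cdot>\<^sub>m X}"
  have S: "{cmod l | l. \<exists>X \<in> carrier_mat d d. X \<noteq> 0\<^sub>m d d \<and> A X = l \<cdot>\<^sub>m X} = cmod ` ?S" by auto
  have "x \<noteq> 0\<^sub>m d d"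
  proof
    assume x0: "x = 0\<^sub>m d d"
    have "Re (mtrace (x - complex_of_real (1/2) \<cdot>\<^sub>m 1\<^sub>m d)) \<ge> 0" using psd_trace[OF x(1)] by simp
    then show False using d unfolding x0 by (simp add: mtrace_def)
  qed
  then have "complex_of_real l \<in> ?S" using x ev by blast
  then have mem: "l \<in> cmod ` ?S" using l by (intro image_eqI[of _ _ "complex_of_real l"]) auto
  have "y \<le> l" if "y \<in> cmod ` ?S" for y
    using that positive_eigenvector_bound[OF A x ev l] by blast
  then show ?thesis unfolding spec_rad_def S
    using mem finite_eigenvalues[OF posmap_linmap[OF A]] by (intro Max_eqI) auto
qed

text \<open>\<open>z - A\<close> plus a rank-one map onto the identity. At \<open>z = 1\<close> the
  extra term removes the kernel spanned by the identity, and a solution of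
  \<open>rsv d \<rho> A z X = 1\<^sub>m d\<close> satisfies \<open>A X = z X\<close> as soon as
  \<open>mtrace (\<rho> * X) = 1\<close>.\<close>

definition rsv :: "nat \<Rightarrow> complex mat \<Rightarrow> (complex mat \<Rightarrow> complex mat) \<Rightarrow> real \<Rightarrow> complex mat \<Rightarrow> complex mat" where
  "rsv d \<rho> A z Y = complex_of_real z \<cdot>\<^sub>m Y - A Y + mtrace (\<rho> * Y) \<cdot>\<^sub>m 1\<^sub>m d"

lemma mtrace_mult_add: "R \<in> carrier_mat d d \<Longrightarrow> X \<in> carrier_mat d d \<Longrightarrow> Y \<in> carrier_mat d d \<Longrightarrow>
   mtrace (R * (X + Y)) = mtrace (R * X) + mtrace (R * Y)"
  by (simp add: mult_add_distrib_mat[of R d d] mtrace_add[of _ d])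

lemma mtrace_mult_minus: "R \<in> carrier_mat d d \<Longrightarrow> X \<in> carrier_mat d d \<Longrightarrow> Y \<in> carrier_mat d d \<Longrightarrow>
   mtrace (R * (X - Y)) = mtrace (R * X) - mtrace (R * Y)"
  by (simp add: mult_minus_distrib_mat[of R d d] mtrace_minus[of _ d])

lemma mtrace_mult_smult: "R \<in> carrier_mat d d \<Longrightarrow> X \<in> carrier_mat d d \<Longrightarrow>
   mtrace (R * (c \<cdot>\<^sub>m X)) = c * mtrace (R * X)"
  by (simp add: mult_smult_distrib[of R d d] mtrace_smult[of _ d])

lemma mtrace_mult_index:
  "R \<in> carrier_mat d d \<Longrightarrow> X \<in> carrier_mat d d \<Longrightarrow> mtrace (R * X) = (\<Sum>i<d. \<Sum>k<d. R $$ (i,k) * X $$ (k,i))"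
  by (simp add: mtrace_def mmul_index[of R d d X d])

lemma rsv_linmap: "linmap d A \<Longrightarrow> \<rho> \<in> carrier_mat d d \<Longrightarrow> linmap d (rsv d \<rho> A z)"
  unfolding linmap_def[of d "rsv d \<rho> A z"]
proof (intro conjI ballI allI)
  assume A: "linmap d A" and r: "\<rho> \<in> carrier_mat d d"
  fix X Y :: "complex mat" and c assume X: "X \<in> carrier_mat d d"
  note cX = carrier_matD[OF linmap_carrier[OF A X]]
  show "rsv d \<rho> A z X \<in> carrier_mat d d" using A X by (simp add: rsv_def)
  show "rsv d \<rho> A z (c \<cdot>\<^sub>m X) = c \<cdot>\<^sub>m rsv d \<rho> A z X"
    using A X r cX unfolding rsv_def by (intro eq_matI) (auto simp: linmap_smult mtrace_mult_smult algebra_simps)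
  assume Y: "Y \<in> carrier_mat d d"
  note cY = carrier_matD[OF linmap_carrier[OF A Y]]
  show "rsv d \<rho> A z (X + Y) = rsv d \<rho> A z X + rsv d \<rho> A z Y"
    using A X Y r cX cY unfolding rsv_def linmap_add[OF A X Y] mtrace_mult_add[OF r X Y]
    by (intro eq_matI) (auto simp: distrib_left distrib_right)
qed

text \<open>Cramer's rule for the \<open>supmat\<close> of \<open>rsv\<close>: the solution is
  \<open>sm\<close> on the open set where the determinant is nonzero. Uniqueness is part of the
  conclusion because hermiticity of the solution and its value at \<open>s = t = 0\<close> are
  derived from it.\<close>

lemma resolvent_solution:
  assumes lin: "\<And>s t. linmap d (A s t)" and r: "\<rho> \<in> carrier_mat d d"
    and smooth: "\<And>a b i j. i < d \<Longrightarrow> j < d \<Longrightarrow> sm UNIV (\<lambda>p. A (fst (snd p)) (snd (snd p)) (munit d a b) $$ (i,j))"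
    and inj: "\<And>Y. Y \<in> carrier_mat d d \<Longrightarrow> rsv d \<rho> (A 0 0) 1 Y = 0\<^sub>m d d \<Longrightarrow> Y = 0\<^sub>m d d"
  shows "\<exists>U X. open U \<and> (1,0,0) \<in> U \<and> (\<forall>i<d. \<forall>j<d. sm U (\<lambda>p. X p $$ (i,j))) \<and> (\<forall>p. X p \<in> carrier_mat d d) \<and>
     (\<forall>z s t. (z,s,t) \<in> U \<longrightarrow> rsv d \<rho> (A s t) z (X (z,s,t)) = 1\<^sub>m d \<and>
        (\<forall>Y \<in> carrier_mat d d. rsv d \<rho> (A s t) z Y = 1\<^sub>m d \<longrightarrow> Y = X (z,s,t)))"
proof -
  define R where "R p = rsv d \<rho> (A (fst (snd p)) (snd (snd p))) (fst p)" for p :: "real \<times> real \<times> real"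
  have Rl: "linmap d (R p)" for p unfolding R_def using lin r by (intro rsv_linmap)
  define M where "M p = supmat d (R p)" for p
  have Mc: "M p \<in> carrier_mat (d*d) (d*d)" for p by (simp add: M_def)
  have Msm: "sm UNIV (\<lambda>p. M p $$ (k,l))" if kl: "k < d*d" "l < d*d" for k l
  proof -
    let ?E = "munit d (l div d) (l mod d)"
    have "M p $$ (k,l) = complex_of_real (fst p) * ?E $$ (k div d, k mod d)
        - A (fst (snd p)) (snd (snd p)) ?E $$ (k div d, k mod d) + mtrace (\<rho> * ?E) * 1\<^sub>m d $$ (k div d, k mod d)" for p
      using kl div_lt[OF kl(1)] mod_lt[OF kl(1)] carrier_matD[OF linmap_carrier[OF lin, of ?E "fst (snd p)" "snd (snd p)"]]
      by (simp add: M_def supmat_def R_def rsv_def)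
    moreover have "sm UNIV (\<lambda>p. complex_of_real (fst p) * ?E $$ (k div d, k mod d)
        - A (fst (snd p)) (snd (snd p)) ?E $$ (k div d, k mod d) + mtrace (\<rho> * ?E) * 1\<^sub>m d $$ (k div d, k mod d))"
      by (intro sm_add sm_minus sm_mult sm_const sm_z smooth div_lt[OF kl(1)] mod_lt[OF kl(1)])
    ultimately show ?thesis by simp
  qed
  define U where "U = {p. det (M p) \<noteq> 0}"
  have dsm: "sm UNIV (\<lambda>p. det (M p))" by (rule sm_det[OF Mc Msm])
  have oU: "open U"
  proof -
    have "continuous_on UNIV (\<lambda>p. det (M p))" using sm_isCont[OF dsm] by (intro continuous_at_imp_continuous_on) auto
    then have "open ((\<lambda>p. det (M p)) -` (- {0}))" by (intro open_vimage) (auto simp: open_Compl)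
    moreover have "U = (\<lambda>p. det (M p)) -` (- {0})" by (auto simp: U_def)
    ultimately show ?thesis by simp
  qed
  have inU: "(1,0,0) \<in> U"
  proof (rule ccontr)
    assume "(1,0,0) \<notin> U"
    then have "det (M (1,0,0)) = 0" by (simp add: U_def)
    then obtain v where v: "v \<in> carrier_vec (d*d)" "v \<noteq> 0\<^sub>v (d*d)" "M (1,0,0) *\<^sub>v v = 0\<^sub>v (d*d)"
      using det_0_iff_vec_prod_zero[OF Mc] by blast
    let ?Y = "unvecm d v"
    have RY: "R (1,0,0) ?Y \<in> carrier_mat d d" by (rule linmap_carrier[OF Rl]) simp
    have "vecm d (R (1,0,0) ?Y) = 0\<^sub>v (d*d)"
      using supmat_mult[OF Rl, of ?Y "(1,0,0)"] v by (simp add: M_def vecm_unvecm)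
    then have "R (1,0,0) ?Y = unvecm d (0\<^sub>v (d*d))" using unvecm_vecm[OF RY] by simp
    also have "\<dots> = 0\<^sub>m d d" by (intro eq_matI) (auto simp: unvecm_def idx_lt)
    finally have "rsv d \<rho> (A 0 0) 1 ?Y = 0\<^sub>m d d" by (simp only: R_def fst_conv snd_conv)
    from inj[OF unvecm_carrier this] have "?Y = 0\<^sub>m d d" .
    then have "vecm d ?Y = 0\<^sub>v (d*d)" by (intro eq_vecI) (auto simp: vecm_def div_lt mod_lt)
    then show False using v by (simp add: vecm_unvecm)
  qed
  define w where "w = vecm d (1\<^sub>m d)"
  have wc: "w \<in> carrier_vec (d*d)" by (simp add: w_def)
  define xv where "xv p = inverse (det (M p)) \<cdot>\<^sub>v (adj_mat (M p) *\<^sub>v w)" for p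
  have aM: "adj_mat (M p) \<in> carrier_mat (d*d) (d*d)" for p by (rule adj_mat(1)[OF Mc])
  have xvc: "xv p \<in> carrier_vec (d*d)" for p using aM[of p] wc by (simp add: xv_def mult_mat_vec_carrier[of _ "d*d" "d*d"])
  have Mx: "M p *\<^sub>v xv p = w" if "p \<in> U" for p
  proof -
    have "M p *\<^sub>v xv p = inverse (det (M p)) \<cdot>\<^sub>v (M p *\<^sub>v (adj_mat (M p) *\<^sub>v w))"
      unfolding xv_def using Mc[of p] aM[of p] wc by (intro mult_mat_vec[of _ "d*d" "d*d"]) (auto intro: mult_mat_vec_carrier[of _ "d*d" "d*d"])
    also have "M p *\<^sub>v (adj_mat (M p) *\<^sub>v w) = (M p * adj_mat (M p)) *\<^sub>v w"
      using Mc[of p] aM[of p] wc by (intro assoc_mult_mat_vec[symmetric]) auto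
    also have "\<dots> = det (M p) \<cdot>\<^sub>v w"
      unfolding adj_mat(2)[OF Mc] using wc by (intro eq_vecI) auto
    finally show ?thesis using that wc by (simp add: U_def smult_smult_assoc)
  qed
  have uniq: "v = v'" if "p \<in> U" "M p *\<^sub>v v = M p *\<^sub>v v'" "v \<in> carrier_vec (d*d)" "v' \<in> carrier_vec (d*d)" for p v v'
  proof -
    have e: "adj_mat (M p) *\<^sub>v (M p *\<^sub>v y) = det (M p) \<cdot>\<^sub>v y" if y: "y \<in> carrier_vec (d*d)" for y
    proof -
      have "adj_mat (M p) *\<^sub>v (M p *\<^sub>v y) = (adj_mat (M p) * M p) *\<^sub>v y"
        using Mc[of p] aM[of p] y by (intro assoc_mult_mat_vec[symmetric]) auto
      also have "\<dots> = det (M p) \<cdot>\<^sub>v y" unfolding adj_mat(3)[OF Mc] using y by (intro eq_vecI) auto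
      finally show ?thesis .
    qed
    have de: "det (M p) \<cdot>\<^sub>v v = det (M p) \<cdot>\<^sub>v v'" using e[OF that(3)] e[OF that(4)] that(2) by simp
    have nz: "det (M p) \<noteq> 0" using that(1) by (simp add: U_def)
    show ?thesis
    proof (rule eq_vecI)
      fix i assume "i < dim_vec v'"
      then have "i < d*d" using that by simp
      then have "det (M p) * v $ i = det (M p) * v' $ i" using arg_cong[OF de, of "\<lambda>x. x $ i"] that(3,4) by simp
      then show "v $ i = v' $ i" using nz by simp
    qed (use that in auto)
  qed
  define X where "X p = unvecm d (xv p)" for p
  have Xc: "X p \<in> carrier_mat d d" for p by (simp add: X_def)
  have "sm U (\<lambda>p. X p $$ (i,j))" if ij: "i < d" "j < d" for i j
  proof -
    have "X p $$ (i,j) = inverse (det (M p)) * (\<Sum>l<d*d. adj_mat (M p) $$ (i*d+j, l) * w $ l)" for p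
      using ij idx_lt[OF ij] aM[of p] wc by (auto simp: X_def unvecm_def xv_def scalar_prod_def atLeast0LessThan intro!: sum.cong)
    moreover have "sm U (\<lambda>p. inverse (det (M p)) * (\<Sum>l<d*d. adj_mat (M p) $$ (i*d+j, l) * w $ l))"
    proof (intro sm_mult sm_inverse sm_sum sm_const sm_mono[OF dsm])
      fix l assume l: "l \<in> {..<d*d}"
      have Msm': "sm U (\<lambda>p. M p $$ (k,l))" if "k < d*d" "l < d*d" for k l by (rule sm_mono[OF Msm[OF that]]) simp
      show "sm U (\<lambda>p. adj_mat (M p) $$ (i*d+j, l))"
        by (rule sm_adj_mat[OF Mc Msm' idx_lt[OF ij]]) (use l in auto)
    qed (auto simp: U_def)
    ultimately show ?thesis by simp
  qed
  moreover have "rsv d \<rho> (A s t) z (X (z,s,t)) = 1\<^sub>m d \<and> (\<forall>Y \<in> carrier_mat d d. rsv d \<rho> (A s t) z Y = 1\<^sub>m d \<longrightarrow> Y = X (z,s,t))"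
    if p: "(z,s,t) \<in> U" for z s t
  proof -
    have Rp: "R (z,s,t) = rsv d \<rho> (A s t) z" by (simp add: R_def)
    have RX: "R (z,s,t) (X (z,s,t)) \<in> carrier_mat d d" by (rule linmap_carrier[OF Rl Xc])
    have "vecm d (R (z,s,t) (X (z,s,t))) = w"
      using supmat_mult[OF Rl Xc, of "(z,s,t)" "(z,s,t)"] Mx[OF p] vecm_unvecm[OF xvc] by (simp add: M_def X_def)
    then have "unvecm d (vecm d (R (z,s,t) (X (z,s,t)))) = unvecm d (vecm d (1\<^sub>m d))" by (simp add: w_def)
    then have 1: "R (z,s,t) (X (z,s,t)) = 1\<^sub>m d" by (simp only: unvecm_vecm[OF RX] unvecm_vecm[OF one_carrier_mat])
    have "Y = X (z,s,t)" if Y: "Y \<in> carrier_mat d d" "R (z,s,t) Y = 1\<^sub>m d" for Y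
    proof -
      have "M (z,s,t) *\<^sub>v vecm d Y = w" using supmat_mult[OF Rl Y(1), of "(z,s,t)"] Y by (simp add: M_def w_def)
      then have "M (z,s,t) *\<^sub>v vecm d Y = M (z,s,t) *\<^sub>v xv (z,s,t)" unfolding Mx[OF p] .
      from uniq[OF p this vecm_carrier xvc] have "unvecm d (vecm d Y) = X (z,s,t)" unfolding X_def by (rule arg_cong)
      then show ?thesis by (simp only: unvecm_vecm[OF Y(1)])
    qed
    then show ?thesis using 1 unfolding Rp by blast
  qed
  ultimately show ?thesis using oU inU Xc by blast
qed

lemma linmap_munit_sum:
  assumes "linmap d B" "Y \<in> carrier_mat d d" "k < d" "m < d" and "\<And>i j. i < d \<Longrightarrow> j < d \<Longrightarrow> y i j = Y $$ (i,j)"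
  shows "(\<Sum>i<d. \<Sum>j<d. y i j * B (munit d i j) $$ (k,m)) = B Y $$ (k,m)"
  unfolding linmap_expand[OF assms(1-4)] using assms(5) by (intro sum.cong refl) auto

text \<open>Entrywise convergence is enough, since a linear functional is a finite combination of
  entries.\<close>

lemma tendsto_trace_linmap:
  assumes B: "linmap d B" and r: "\<rho> \<in> carrier_mat d d" and Y: "\<And>N. Y N \<in> carrier_mat d d" and L: "L \<in> carrier_mat d d"
    and lim: "\<And>i j. i < d \<Longrightarrow> j < d \<Longrightarrow> (\<lambda>N. Y N $$ (i,j)) \<longlonglongrightarrow> L $$ (i,j)"
  shows "(\<lambda>N. mtrace (\<rho> * B (Y N))) \<longlonglongrightarrow> mtrace (\<rho> * B L)"
proof -
  have e: "mtrace (\<rho> * B Z) = (\<Sum>a<d. \<Sum>b<d. Z $$ (a,b) * mtrace (\<rho> * B (munit d a b)))" if "Z \<in> carrier_mat d d" for Z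
    by (rule functional_expand[where F = "\<lambda>Z. mtrace (\<rho> * B Z)"])
       (use B r that in \<open>auto simp: linmap_add linmap_smult mtrace_mult_add mtrace_mult_smult\<close>)
  show ?thesis unfolding e[OF Y] e[OF L] by (intro tendsto_sum tendsto_mult tendsto_const lim) auto
qed

lemma rjet_jet:
  assumes "rjet l"
  shows "\<exists>a b c g. jet (\<lambda>s t. complex_of_real (l s t)) (complex_of_real a) (complex_of_real b) (complex_of_real c)
     \<and> (\<forall>\<^sub>F s in nhds 0. ((\<lambda>t. l s t) has_real_derivative g s) (at 0)) \<and> g 0 = b \<and> (g has_real_derivative c) (at 0)"
proof -
  obtain a g c where a: "((\<lambda>s. l s 0) has_real_derivative a) (at 0)"
    and g: "\<forall>\<^sub>F s in nhds 0. ((\<lambda>t. l s t) has_real_derivative g s) (at 0)" "(g has_real_derivative c) (at 0)"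
    using assms unfolding rjet_def by blast
  have ov: "(f has_real_derivative D) (at 0) \<Longrightarrow> ((\<lambda>x. complex_of_real (f x)) has_vector_derivative complex_of_real D) (at 0)" for f D
    by (intro has_vector_derivative_of_real) (simp add: has_real_derivative_iff_has_vector_derivative)
  have "\<forall>\<^sub>F s in nhds 0. ((\<lambda>t. complex_of_real (l s t)) has_vector_derivative complex_of_real (g s)) (at 0)"
    using g(1) by eventually_elim (rule ov)
  then have "jet (\<lambda>s t. complex_of_real (l s t)) (complex_of_real a) (complex_of_real (g 0)) (complex_of_real c)"
    unfolding jet_def using ov[OF a] ov[OF g(2)] by (intro conjI exI[of _ "\<lambda>s. complex_of_real (g s)"]) auto
  then show ?thesis using g by blast
qed

text \<open>Pairing the equation with \<open>\<rho>\<close> leaves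
  \<open>mtrace (\<rho> * Y) = 0\<close>, so \<open>L Y = Y\<close>. The iterates are then constant
  and converge to \<open>mtrace (\<rho> * Y)\<close> times the identity, that is, to 0.\<close>

lemma rsv_inj:
  assumes Llin: "linmap d L" and r: "\<rho> \<in> carrier_mat d d" and tr1: "mtrace (\<rho> * 1\<^sub>m d) = 1"
    and inv: "\<And>Y. Y \<in> carrier_mat d d \<Longrightarrow> mtrace (\<rho> * L Y) = mtrace (\<rho> * Y)"
    and lim: "\<And>Y i j. Y \<in> carrier_mat d d \<Longrightarrow> i < d \<Longrightarrow> j < d \<Longrightarrow>
       (\<lambda>N. (L ^^ N) Y $$ (i,j)) \<longlonglongrightarrow> mtrace (\<rho> * Y) * 1\<^sub>m d $$ (i,j)"
    and Y: "Y \<in> carrier_mat d d" and R: "rsv d \<rho> L 1 Y = 0\<^sub>m d d"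
  shows "Y = 0\<^sub>m d d"
proof -
  have LY: "L Y \<in> carrier_mat d d" using Llin Y by simp
  have "mtrace (\<rho> * rsv d \<rho> L 1 Y) = mtrace (\<rho> * Y)"
  proof -
    have "mtrace (\<rho> * rsv d \<rho> L 1 Y) = mtrace (\<rho> * (complex_of_real 1 \<cdot>\<^sub>m Y - L Y)) + mtrace (\<rho> * (mtrace (\<rho> * Y) \<cdot>\<^sub>m 1\<^sub>m d))"
      unfolding rsv_def using Y LY by (intro mtrace_mult_add[OF r]) auto
    also have "\<dots> = mtrace (\<rho> * Y)"
      using Y LY by (simp add: mtrace_mult_minus[OF r] mtrace_mult_smult[OF r] inv tr1 del: of_real_1)
    finally show ?thesis .
  qed
  moreover have "mtrace (\<rho> * 0\<^sub>m d d) = 0" using r by (simp add: mtrace_def)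
  ultimately have t0: "mtrace (\<rho> * Y) = 0" using R by simp
  have fx: "L Y = Y"
  proof (rule eq_matI)
    fix i j assume "i < dim_row Y" "j < dim_col Y"
    then have ij: "i < d" "j < d" using Y by auto
    have "rsv d \<rho> L 1 Y $$ (i,j) = 0" using R ij by simp
    then show "L Y $$ (i,j) = Y $$ (i,j)" using ij Y LY t0 by (simp add: rsv_def)
  qed (use Y LY in auto)
  have fN: "(L ^^ N) Y = Y" for N by (induction N) (auto simp: fx)
  have "Y $$ (i,j) = 0" if "i < d" "j < d" for i j
    using lim[OF Y that] by (simp add: fN t0 LIMSEQ_const_iff)
  then show ?thesis using Y by (intro eq_matI) auto
qed

text \<open>The partial sums of the matrices telescope to \<open>Y - (L ^^ N) Y\<close>, and the
  iterates of a centred \<open>Y\<close> tend to 0; this replaces a norm estimate for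
  \<open>L\<close>.\<close>

lemma neumann_series:
  assumes Llin: "linmap d L" and r: "\<rho> \<in> carrier_mat d d"
    and lim: "\<And>Y i j. Y \<in> carrier_mat d d \<Longrightarrow> i < d \<Longrightarrow> j < d \<Longrightarrow>
       (\<lambda>N. (L ^^ N) Y $$ (i,j)) \<longlonglongrightarrow> mtrace (\<rho> * Y) * 1\<^sub>m d $$ (i,j)"
    and B: "linmap d B" and Y: "Y \<in> carrier_mat d d" "mtrace (\<rho> * Y) = 0" and Z: "Z = Y - L Y"
  shows "(\<lambda>n. mtrace (\<rho> * B ((L ^^ n) Z))) sums mtrace (\<rho> * B Y)"
proof -
  have LN: "linmap d (L ^^ n)" for n by (rule linmap_funpow[OF Llin])
  have LY: "(L ^^ n) Y \<in> carrier_mat d d" for n using LN Y by simp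
  have f: "mtrace (\<rho> * B ((L ^^ n) Z)) = mtrace (\<rho> * B ((L ^^ n) Y)) - mtrace (\<rho> * B ((L ^^ Suc n) Y))" for n
  proof -
    have "(L ^^ n) Z = (L ^^ n) Y - (L ^^ Suc n) Y"
      unfolding Z linmap_minus[OF LN Y(1) linmap_carrier[OF Llin Y(1)]] by (simp add: funpow_swap1)
    then show ?thesis using B LY[of n] LY[of "Suc n"] r by (simp only: linmap_minus[OF B LY LY] mtrace_mult_minus[OF r] linmap_carrier)
  qed
  have "(\<lambda>n. mtrace (\<rho> * B ((L ^^ n) Y))) \<longlonglongrightarrow> mtrace (\<rho> * B (0\<^sub>m d d))"
    by (rule tendsto_trace_linmap[OF B r LY]) (use lim[OF Y(1)] Y(2) in auto)
  moreover have "mtrace (\<rho> * B (0\<^sub>m d d)) = 0"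
  proof -
    have "B (0 \<cdot>\<^sub>m 0\<^sub>m d d) = 0 \<cdot>\<^sub>m B (0\<^sub>m d d)" by (rule linmap_smult[OF B]) simp
    moreover have "(0::complex) \<cdot>\<^sub>m 0\<^sub>m d d = 0\<^sub>m d d" by (intro eq_matI) auto
    ultimately have "mtrace (\<rho> * B (0\<^sub>m d d)) = 0 * mtrace (\<rho> * B (0\<^sub>m d d))"
      using mtrace_mult_smult[OF r linmap_carrier[OF B zero_carrier_mat], of 0] by simp
    then show ?thesis by simp
  qed
  ultimately show ?thesis unfolding f using telescope_sums'[of "\<lambda>n. mtrace (\<rho> * B ((L ^^ n) Y))" 0] by simp
qed

text \<open>Injectivity makes the determinant of \<open>supmat\<close> nonzero, and the preimage is
  written down with the adjugate.\<close>

lemma linmap_inj_surj: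
  assumes R: "linmap d R" and inj: "\<And>Y. Y \<in> carrier_mat d d \<Longrightarrow> R Y = 0\<^sub>m d d \<Longrightarrow> Y = 0\<^sub>m d d"
    and Z: "Z \<in> carrier_mat d d"
  shows "\<exists>Y\<in>carrier_mat d d. R Y = Z"
proof -
  let ?M = "supmat d R"
  have "det ?M \<noteq> 0"
  proof
    assume "det ?M = 0"
    then obtain v where v: "v \<in> carrier_vec (d*d)" "v \<noteq> 0\<^sub>v (d*d)" "?M *\<^sub>v v = 0\<^sub>v (d*d)"
      using det_0_iff_vec_prod_zero[OF supmat_carrier] by blast
    have RY: "R (unvecm d v) \<in> carrier_mat d d" by (rule linmap_carrier[OF R]) simp
    have "vecm d (R (unvecm d v)) = 0\<^sub>v (d*d)"
      using supmat_mult[OF R, of "unvecm d v"] v by (simp add: vecm_unvecm)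
    then have "R (unvecm d v) = unvecm d (0\<^sub>v (d*d))" using unvecm_vecm[OF RY] by simp
    also have "\<dots> = 0\<^sub>m d d" by (intro eq_matI) (auto simp: unvecm_def idx_lt)
    finally have "unvecm d v = 0\<^sub>m d d" by (rule inj[OF unvecm_carrier])
    then have "vecm d (unvecm d v) = 0\<^sub>v (d*d)" by (intro eq_vecI) (auto simp: vecm_def div_lt mod_lt)
    then show False using v by (simp add: vecm_unvecm)
  qed
  have aM: "adj_mat ?M \<in> carrier_mat (d*d) (d*d)" by (rule adj_mat(1)[OF supmat_carrier])
  define y where "y = adj_mat ?M *\<^sub>v vecm d Z"
  have y: "y \<in> carrier_vec (d*d)" unfolding y_def using aM by (rule mult_mat_vec_carrier) simp
  have "?M *\<^sub>v y = (?M * adj_mat ?M) *\<^sub>v vecm d Z"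
    unfolding y_def by (rule assoc_mult_mat_vec[OF supmat_carrier aM vecm_carrier, symmetric])
  also have "\<dots> = det ?M \<cdot>\<^sub>v vecm d Z"
    unfolding adj_mat(2)[OF supmat_carrier] by (intro eq_vecI) (auto simp: vecm_def)
  finally have My: "?M *\<^sub>v y = det ?M \<cdot>\<^sub>v vecm d Z" .
  let ?Y = "inverse (det ?M) \<cdot>\<^sub>m unvecm d y"
  have RY: "R (unvecm d y) \<in> carrier_mat d d" by (rule linmap_carrier[OF R]) simp
  have "vecm d (R (unvecm d y)) = vecm d (det ?M \<cdot>\<^sub>m Z)"
    using supmat_mult[OF R, of "unvecm d y"] My Z y by (simp add: vecm_unvecm vecm_smult)
  then have "unvecm d (vecm d (R (unvecm d y))) = unvecm d (vecm d (det ?M \<cdot>\<^sub>m Z))" by simp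
  then have "R (unvecm d y) = det ?M \<cdot>\<^sub>m Z" using Z by (simp add: unvecm_vecm[OF RY] unvecm_vecm)
  then have "R ?Y = Z"
    unfolding linmap_smult[OF R unvecm_carrier] using \<open>det ?M \<noteq> 0\<close> Z by (auto simp: smult_smult_mat intro!: eq_matI)
  then show ?thesis by (intro bexI[of _ ?Y]) auto
qed

text \<open>\<open>rsv\<close> is bijective at \<open>z = 1\<close>, so a centred \<open>Z\<close>
  has the form \<open>Y - L Y\<close> with \<open>Y\<close> centred, and
  \<open>neumann_series\<close> applies. Summability is thus known for every centred
  \<open>Z\<close>, independently of any perturbation.\<close>

lemma poisson_summable:
  assumes Llin: "linmap d L" and one: "L (1\<^sub>m d) = 1\<^sub>m d" and st: "is_state d \<rho>"
    and inv: "\<And>Y. Y \<in> carrier_mat d d \<Longrightarrow> mtrace (\<rho> * L Y) = mtrace (\<rho> * Y)"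
    and lim: "\<And>Y i j. Y \<in> carrier_mat d d \<Longrightarrow> i < d \<Longrightarrow> j < d \<Longrightarrow>
       (\<lambda>N. (L ^^ N) Y $$ (i,j)) \<longlonglongrightarrow> mtrace (\<rho> * Y) * 1\<^sub>m d $$ (i,j)"
    and B: "linmap d B" and Z: "Z \<in> carrier_mat d d" "mtrace (\<rho> * Z) = 0"
  shows "summable (\<lambda>n. mtrace (\<rho> * B ((L ^^ n) Z)))"
proof -
  have r: "\<rho> \<in> carrier_mat d d" and tr: "mtrace \<rho> = 1" using st by (auto simp: is_state_iff)
  have tr1: "mtrace (\<rho> * 1\<^sub>m d) = 1" unfolding right_mult_one_mat[OF r] by (rule tr)
  have "\<exists>Y\<in>carrier_mat d d. rsv d \<rho> L 1 Y = Z"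
    by (rule linmap_inj_surj[OF rsv_linmap[OF Llin r] _ Z(1)]) (rule rsv_inj[OF Llin r tr1 inv lim])
  then obtain Y where Y: "Y \<in> carrier_mat d d" and RY: "rsv d \<rho> L 1 Y = Z" by blast
  have LY: "L Y \<in> carrier_mat d d" using Llin Y by simp
  have "mtrace (\<rho> * Z) = mtrace (\<rho> * (complex_of_real 1 \<cdot>\<^sub>m Y - L Y)) + mtrace (\<rho> * (mtrace (\<rho> * Y) \<cdot>\<^sub>m 1\<^sub>m d))"
    unfolding RY[symmetric] rsv_def using Y LY by (intro mtrace_mult_add[OF r]) auto
  also have "\<dots> = mtrace (\<rho> * Y)"
    using Y LY by (simp add: mtrace_mult_minus[OF r] mtrace_mult_smult[OF r] inv tr1 del: of_real_1)
  finally have t0: "mtrace (\<rho> * Y) = 0" using Z(2) by simp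
  have "Z = Y - L Y" unfolding RY[symmetric] rsv_def t0 using Y LY by (intro eq_matI) auto
  have "(\<lambda>n. mtrace (\<rho> * B ((L ^^ n) Z))) sums mtrace (\<rho> * B Y)"
    by (rule neumann_series[OF Llin r _ B Y t0 \<open>Z = Y - L Y\<close>]) (rule lim)
  then show ?thesis by (rule sums_summable)
qed

text \<open>The eigenvalue 1 of A 0 0 continues to a simple eigenvalue with eigenvector x near 1, and
  positivity makes it the spectral radius. Differentiating A x = l x under the normalisation
  tr (\<rho> x) = 1 gives the formulas; the first-order corrections of x solve a Poisson equation,
  whose solution is the Neumann series.\<close>
theorem spectral_radius_jet:
  fixes A :: "real \<Rightarrow> real \<Rightarrow> complex mat \<Rightarrow> complex mat"
  assumes d: "d > 0" and pos: "\<And>s t. posmap d (A s t)"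
    and smooth: "\<And>a b i j. i < d \<Longrightarrow> j < d \<Longrightarrow> sm UNIV (\<lambda>p. A (fst (snd p)) (snd (snd p)) (munit d a b) $$ (i,j))"
    and L: "A 0 0 = L" and one: "L (1\<^sub>m d) = 1\<^sub>m d" and st: "is_state d \<rho>"
    and inv: "\<And>Y. Y \<in> carrier_mat d d \<Longrightarrow> mtrace (\<rho> * L Y) = mtrace (\<rho> * Y)"
    and lim: "\<And>Y i j. Y \<in> carrier_mat d d \<Longrightarrow> i < d \<Longrightarrow> j < d \<Longrightarrow>
       (\<lambda>N. (L ^^ N) Y $$ (i,j)) \<longlonglongrightarrow> mtrace (\<rho> * Y) * 1\<^sub>m d $$ (i,j)"
    and J: "\<And>Y i j. Y \<in> carrier_mat d d \<Longrightarrow> i < d \<Longrightarrow> j < d \<Longrightarrow>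
       jet (\<lambda>s t. A s t Y $$ (i,j)) (As Y $$ (i,j)) (At Y $$ (i,j)) (Ast Y $$ (i,j))"
    and Alin: "linmap d As" "linmap d At" "linmap d Ast"
  shows "\<exists>D. ((\<lambda>t. spec_rad d (A 0 t)) has_real_derivative D) (at 0) \<and> complex_of_real D = mtrace (\<rho> * At (1\<^sub>m d))"
    and "\<forall>\<^sub>F s in nhds 0. (\<lambda>t. spec_rad d (A s t)) differentiable (at 0)"
    and "\<exists>D \<Sigma>. ((\<lambda>s. deriv (\<lambda>t. spec_rad d (A s t)) 0) has_real_derivative D) (at 0) \<and>
       (\<lambda>n. mtrace (\<rho> * (At ((L ^^ n) (As (1\<^sub>m d) - mtrace (\<rho> * As (1\<^sub>m d)) \<cdot>\<^sub>m 1\<^sub>m d))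
           + As ((L ^^ n) (At (1\<^sub>m d) - mtrace (\<rho> * At (1\<^sub>m d)) \<cdot>\<^sub>m 1\<^sub>m d))))) sums \<Sigma> \<and>
       complex_of_real D = \<Sigma> + mtrace (\<rho> * Ast (1\<^sub>m d))"
proof -
  have lin: "linmap d (A s t)" for s t by (rule posmap_linmap[OF pos])
  have Llin: "linmap d L" using lin[of 0 0] L by simp
  have LN: "linmap d (L ^^ n)" for n by (rule linmap_funpow[OF Llin])
  have \<rho>p: "psd d \<rho>" "mtrace \<rho> = 1" using st by (auto simp: is_state_iff)
  have r: "\<rho> \<in> carrier_mat d d" using \<rho>p by simp
  have tr1: "mtrace (\<rho> * 1\<^sub>m d) = 1" unfolding right_mult_one_mat[OF r] by (rule \<rho>p(2))
  have inj: "Y = 0\<^sub>m d d" if "Y \<in> carrier_mat d d" "rsv d \<rho> (A 0 0) 1 Y = 0\<^sub>m d d" for Y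
    using rsv_inj[OF Llin r tr1 inv lim that(1)] that(2) by (simp add: L)
  have "\<exists>U X. open U \<and> (1,0,0) \<in> U \<and> (\<forall>i<d. \<forall>j<d. sm U (\<lambda>p. X p $$ (i,j))) \<and> (\<forall>p. X p \<in> carrier_mat d d) \<and>
     (\<forall>z s t. (z,s,t) \<in> U \<longrightarrow> rsv d \<rho> (A s t) z (X (z,s,t)) = 1\<^sub>m d \<and>
        (\<forall>Y \<in> carrier_mat d d. rsv d \<rho> (A s t) z Y = 1\<^sub>m d \<longrightarrow> Y = X (z,s,t)))"
    by (rule resolvent_solution) (rule lin, rule r, erule (1) smooth, erule (1) inj)
  then obtain U X where U: "open U" "(1,0,0) \<in> U"
    and Xsm0: "\<forall>i<d. \<forall>j<d. sm U (\<lambda>p. X p $$ (i,j))" and Xc0: "\<forall>p. X p \<in> carrier_mat d d"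
    and X0: "\<forall>z s t. (z,s,t) \<in> U \<longrightarrow> rsv d \<rho> (A s t) z (X (z,s,t)) = 1\<^sub>m d \<and>
        (\<forall>Y \<in> carrier_mat d d. rsv d \<rho> (A s t) z Y = 1\<^sub>m d \<longrightarrow> Y = X (z,s,t))"
    by (elim exE conjE)
  have Xsm: "sm U (\<lambda>p. X p $$ (i,j))" if "i < d" "j < d" for i j using Xsm0 that by blast
  have Xc: "X p \<in> carrier_mat d d" for p using Xc0 by blast
  have XR: "rsv d \<rho> (A s t) z (X (z,s,t)) = 1\<^sub>m d" if "(z,s,t) \<in> U" for z s t using X0 that by blast
  have Xu: "Y = X (z,s,t)" if "(z,s,t) \<in> U" "Y \<in> carrier_mat d d" "rsv d \<rho> (A s t) z Y = 1\<^sub>m d" for z s t Y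
    using X0 that by blast
  \<comment> \<open>\<open>A s t\<close> preserves adjoints and \<open>z\<close> is real, so the
    adjoint of the solution solves the same equation; uniqueness makes the solution
    Hermitian.\<close>
  have Xh: "hermitian_mat d (X p)" if p: "p \<in> U" for p
  proof -
    obtain z s t where pe: "p = (z,s,t)" by (cases p) auto
    have AX: "A s t (X p) \<in> carrier_mat d d" using lin Xc by simp
    have tra: "mtrace (\<rho> * adj (X p)) = cnj (mtrace (\<rho> * X p))"
    proof -
      have "adj \<rho> = \<rho>" using \<rho>p(1) by (simp add: psd_def hermitian_mat_def)
      then have "mtrace (\<rho> * adj (X p)) = mtrace (adj \<rho> * adj (X p))" by (simp only:)
      also have "\<dots> = mtrace (adj (X p * \<rho>))" using adj_mult[OF Xc r] by simp
      also have "\<dots> = cnj (mtrace (X p * \<rho>))" using Xc r by (intro mtrace_adj[of _ d]) simp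
      also have "mtrace (X p * \<rho>) = mtrace (\<rho> * X p)" by (rule mtrace_cyc[OF Xc r])
      finally show ?thesis .
    qed
    have "rsv d \<rho> (A s t) z (adj (X p)) = adj (rsv d \<rho> (A s t) z (X p))"
    proof -
      have Aa: "A s t (adj (X p)) = adj (A s t (X p))" using pos Xc by (simp add: posmap_def)
      show ?thesis unfolding rsv_def Aa tra using AX Xc[of p] by (intro eq_matI) auto
    qed
    also have "\<dots> = 1\<^sub>m d" using XR p by (simp add: pe)
    finally have "adj (X p) = X p" using Xu p Xc by (simp add: pe)
    then show ?thesis using Xc by (simp add: hermitian_mat_def)
  qed
  \<comment> \<open>On \<open>U\<close>, \<open>c p = 1\<close> is the condition for
    \<open>X p\<close> to be an eigenvector whose eigenvalue is the first component of
    \<open>p\<close>; it takes the place of a characteristic equation.\<close>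
  define c where "c p = mtrace (\<rho> * X p)" for p
  have csm: "sm U c"
  proof -
    have "sm U (\<lambda>p. \<Sum>i<d. \<Sum>k<d. \<rho> $$ (i,k) * X p $$ (k,i))"
      by (intro sm_sum sm_mult sm_const Xsm) auto
    moreover have "c = (\<lambda>p. \<Sum>i<d. \<Sum>k<d. \<rho> $$ (i,k) * X p $$ (k,i))"
      using mtrace_mult_index[OF r Xc] by (intro ext) (simp add: c_def)
    ultimately show ?thesis by simp
  qed
  have creal: "Im (c p) = 0" if p: "p \<in> U" for p
  proof -
    have "cnj (c p) = mtrace (adj (\<rho> * X p))" using r Xc by (simp add: c_def mtrace_adj[of _ d])
    also have "\<dots> = mtrace (X p * \<rho>)"
      using adj_mult[OF r Xc] Xh[OF p] \<rho>p(1) by (simp add: psd_def hermitian_mat_def)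
    also have "\<dots> = c p" unfolding c_def by (rule mtrace_cyc[OF Xc r])
    finally show ?thesis by (simp add: complex_eq_iff)
  qed
  \<comment> \<open>\<open>L\<close> fixes the identity, so the undeformed solution is explicit and
    \<open>c (z,0,0) = 1/z\<close>. Its slope \<open>-1\<close> at \<open>z = 1\<close> is the
    nondegeneracy required by \<open>implicit_jet\<close>.\<close>
  have Xz: "X (z,0,0) = complex_of_real (1/z) \<cdot>\<^sub>m 1\<^sub>m d" if "(z,0,0) \<in> U" "z \<noteq> 0" for z
  proof (rule Xu[OF that(1), symmetric])
    have "L (complex_of_real (1/z) \<cdot>\<^sub>m 1\<^sub>m d) = complex_of_real (1/z) \<cdot>\<^sub>m 1\<^sub>m d" using Llin one by (simp add: linmap_smult)
    then show "rsv d \<rho> (A 0 0) z (complex_of_real (1/z) \<cdot>\<^sub>m 1\<^sub>m d) = 1\<^sub>m d"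
      unfolding rsv_def L mtrace_mult_smult[OF r one_carrier_mat] tr1 using that(2) by (intro eq_matI) auto
  qed simp
  have cz: "c (z,0,0) = complex_of_real (1/z)" if "(z,0,0) \<in> U" "z \<noteq> 0" for z
    unfolding c_def Xz[OF that] mtrace_mult_smult[OF r one_carrier_mat] tr1 by simp
  have c1: "c (1,0,0) = 1" using cz[OF U(2)] by simp
  have cdz: "((\<lambda>z. c (z,0,0)) has_vector_derivative complex_of_real (-1)) (at 1)"
  proof (rule has_vector_derivative_ev)
    have "((\<lambda>z::real. 1/z) has_real_derivative -1) (at 1)" by (auto intro!: derivative_eq_intros)
    then show "((\<lambda>z. complex_of_real (1/z)) has_vector_derivative complex_of_real (-1)) (at 1)"
      by (intro has_vector_derivative_of_real) (simp add: has_real_derivative_iff_has_vector_derivative)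
    have "isCont (\<lambda>z::real. (z,0::real,0::real)) 1" by (intro continuous_intros)
    then have "\<forall>\<^sub>F z in nhds 1. (z,0,0) \<in> U" using U by (rule isCont_eventually)
    moreover have "\<forall>\<^sub>F z in nhds (1::real). z \<in> -{0}"
      by (rule eventually_nhds_in_open) (auto simp: open_Compl)
    ultimately show "\<forall>\<^sub>F z in nhds 1. complex_of_real (1/z) = c (z,0,0)"
      by eventually_elim (use cz in auto)
  qed
  obtain l where l0: "l 0 0 = 1" and rj: "rjet l" and lcont: "isCont (\<lambda>p. l (fst p) (snd p)) (0,0)"
    and lU: "\<forall>\<^sub>F p in nhds (0,0). (l (fst p) (snd p), fst p, snd p) \<in> U \<and> c (l (fst p) (snd p), fst p, snd p) = 1"
    using implicit_jet[OF U csm creal c1 cdz] by auto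
  define x where "x s t = X (l s t, s, t)" for s t
  have xc: "x s t \<in> carrier_mat d d" for s t by (simp add: x_def Xc)
  have x00: "x 0 0 = 1\<^sub>m d"
  proof -
    have "x 0 0 = complex_of_real 1 \<cdot>\<^sub>m 1\<^sub>m d" using Xz[OF U(2)] l0 by (simp add: x_def)
    then show ?thesis by (auto intro!: eq_matI)
  qed
  have xe: "A s t (x s t) = complex_of_real (l s t) \<cdot>\<^sub>m x s t" "mtrace (\<rho> * x s t) = 1" "hermitian_mat d (x s t)"
    if "(l s t, s, t) \<in> U" "c (l s t, s, t) = 1" for s t
  proof -
    show h: "hermitian_mat d (x s t)" using Xh[OF that(1)] by (simp add: x_def)
    show t: "mtrace (\<rho> * x s t) = 1" using that(2) by (simp add: c_def x_def)
    have R: "rsv d \<rho> (A s t) (l s t) (x s t) = 1\<^sub>m d" using XR[OF that(1)] by (simp add: x_def)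
    have Ax: "A s t (x s t) \<in> carrier_mat d d" using lin xc by simp
    show "A s t (x s t) = complex_of_real (l s t) \<cdot>\<^sub>m x s t"
    proof (rule eq_matI)
      fix i j assume "i < dim_row (complex_of_real (l s t) \<cdot>\<^sub>m x s t)" "j < dim_col (complex_of_real (l s t) \<cdot>\<^sub>m x s t)"
      then have ij: "i < d" "j < d" using xc[of s t] by auto
      have "rsv d \<rho> (A s t) (l s t) (x s t) $$ (i,j) = 1\<^sub>m d $$ (i,j)" using R by simp
      then show "A s t (x s t) $$ (i,j) = (complex_of_real (l s t) \<cdot>\<^sub>m x s t) $$ (i,j)"
        using ij Ax xc[of s t] t by (simp add: rsv_def)
    qed (use Ax xc[of s t] in auto)
  qed
  \<comment> \<open>The threshold \<open>1 / (2 * real d)\<close> is the one for which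
    \<open>near_one_psd\<close> yields that \<open>x\<close> dominates half of the identity.\<close>
  have near: "\<forall>\<^sub>F p in nhds (0,0). \<forall>i\<in>{..<d}. \<forall>j\<in>{..<d}. cmod (x (fst p) (snd p) $$ (i,j) - 1\<^sub>m d $$ (i,j)) < 1 / (2 * real d)"
  proof (intro eventually_ball_finite ballI finite_lessThan)
    fix i j assume ij: "i \<in> {..<d}" "j \<in> {..<d}"
    have "isCont (\<lambda>p::real \<times> real. (l (fst p) (snd p), fst p, snd p)) (0,0)" by (intro continuous_intros lcont)
    moreover have "isCont (\<lambda>q. X q $$ (i,j)) (l (fst (0,0)) (snd (0,0)), fst (0,0), snd (0,0))"
      using sm_isCont[OF Xsm U(2)] ij l0 by simp
    ultimately have "isCont (\<lambda>p. X (l (fst p) (snd p), fst p, snd p) $$ (i,j)) (0,0)" by (rule isCont_o2)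
    then have "\<forall>\<^sub>F p in nhds (0,0). X (l (fst p) (snd p), fst p, snd p) $$ (i,j) \<in> ball (1\<^sub>m d $$ (i,j)) (1 / (2 * real d))"
      using x00 d by (intro isCont_eventually) (auto simp: x_def)
    then show "\<forall>\<^sub>F p in nhds (0,0). cmod (x (fst p) (snd p) $$ (i,j) - 1\<^sub>m d $$ (i,j)) < 1 / (2 * real d)"
      by eventually_elim (simp add: x_def dist_norm norm_minus_commute)
  qed
  have lpos: "\<forall>\<^sub>F p in nhds (0,0). l (fst p) (snd p) \<in> {0<..}"
    by (rule isCont_eventually[OF lcont]) (auto simp: l0)
  have sr: "\<forall>\<^sub>F p in nhds (0,0). l (fst p) (snd p) = spec_rad d (A (fst p) (snd p))"
    using near lpos lU
  proof eventually_elim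
    case (elim p)
    note e = xe[of "fst p" "snd p", OF conjunct1[OF elim(3)] conjunct2[OF elim(3)]]
    have "psd d (x (fst p) (snd p) - complex_of_real (1/2) \<cdot>\<^sub>m 1\<^sub>m d)"
    proof (rule near_one_psd[OF e(3)])
      show "cmod (x (fst p) (snd p) $$ (i,j) - 1\<^sub>m d $$ (i,j)) \<le> 1 / (2 * real d)" if "i < d" "j < d" for i j
        using elim(1) that by (meson lessThan_iff less_imp_le)
      show "1 / (2 * real d) * real d \<le> 1 / 2" using d by simp
    qed
    from spec_rad_eq[OF d pos this xc e(1)] elim(2) show ?case by simp
  qed
  have sr1: "\<forall>\<^sub>F s in nhds 0. \<forall>\<^sub>F t in nhds 0. l s t = spec_rad d (A s t)" using eventually_nhds_pair[OF sr] by simp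
  have sr0: "\<forall>\<^sub>F t in nhds 0. l 0 t = spec_rad d (A 0 t)" using eventually_nhds_x_imp_x[OF sr1] .
  obtain la lt lst g where lj: "jet (\<lambda>s t. complex_of_real (l s t)) (complex_of_real la) (complex_of_real lt) (complex_of_real lst)"
    and g: "\<forall>\<^sub>F s in nhds 0. ((\<lambda>t. l s t) has_real_derivative g s) (at 0)" "g 0 = lt" "(g has_real_derivative lst) (at 0)"
    using rjet_jet[OF rj] by blast
  \<comment> \<open>The three coefficients of an entry are packed into one triple, so that a single
    application of choice yields the coefficient matrices.\<close>
  have "\<forall>ij. \<exists>abc. fst ij < d \<and> snd ij < d \<longrightarrow> jet (\<lambda>s t. x s t $$ ij) (fst abc) (fst (snd abc)) (snd (snd abc))"
  proof
    fix ij :: "nat \<times> nat"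
    show "\<exists>abc. fst ij < d \<and> snd ij < d \<longrightarrow> jet (\<lambda>s t. x s t $$ ij) (fst abc) (fst (snd abc)) (snd (snd abc))"
    proof (cases "fst ij < d \<and> snd ij < d")
      case True
      have "(l 0 0, 0, 0) \<in> U" using U l0 by simp
      from jet_of_sm[OF U(1) this Xsm rj, of "fst ij" "snd ij"] True
      obtain a b c where "jet (\<lambda>s t. x s t $$ ij) a b c" by (auto simp: x_def)
      then show ?thesis by (intro exI[of _ "(a,b,c)"]) simp
    qed auto
  qed
  then have "\<exists>w. \<forall>ij. fst ij < d \<and> snd ij < d \<longrightarrow> jet (\<lambda>s t. x s t $$ ij) (fst (w ij)) (fst (snd (w ij))) (snd (snd (w ij)))"
    by (rule choice)
  then obtain w where w: "\<And>i j. i < d \<Longrightarrow> j < d \<Longrightarrow> jet (\<lambda>s t. x s t $$ (i,j)) (fst (w (i,j))) (fst (snd (w (i,j)))) (snd (snd (w (i,j))))"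
    by auto
  define Xs where "Xs = mat d d (\<lambda>ij. fst (w ij))"
  define Xt where "Xt = mat d d (\<lambda>ij. fst (snd (w ij)))"
  define Xst where "Xst = mat d d (\<lambda>ij. snd (snd (w ij)))"
  have C: "Xs \<in> carrier_mat d d" "Xt \<in> carrier_mat d d" "Xst \<in> carrier_mat d d" by (simp_all add: Xs_def Xt_def Xst_def)
  have xj: "jet (\<lambda>s t. x s t $$ (i,j)) (Xs $$ (i,j)) (Xt $$ (i,j)) (Xst $$ (i,j))" if "i < d" "j < d" for i j
    using w[OF that] that by (simp add: Xs_def Xt_def Xst_def)
  \<comment> \<open>The normalisation \<open>mtrace (\<rho> * x) = 1\<close> is constant near the
    origin, so all derivatives of \<open>x\<close> are centred. This singles out one solution of
    each Poisson equation.\<close>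
  have nrm: "mtrace (\<rho> * Xs) = 0" "mtrace (\<rho> * Xt) = 0" "mtrace (\<rho> * Xst) = 0"
  proof -
    have "jet (\<lambda>s t. \<Sum>i<d. \<Sum>k<d. \<rho> $$ (i,k) * x s t $$ (k,i))
      (\<Sum>i<d. \<Sum>k<d. \<rho> $$ (i,k) * Xs $$ (k,i) + 0 * x 0 0 $$ (k,i))
      (\<Sum>i<d. \<Sum>k<d. \<rho> $$ (i,k) * Xt $$ (k,i) + 0 * x 0 0 $$ (k,i))
      (\<Sum>i<d. \<Sum>k<d. \<rho> $$ (i,k) * Xst $$ (k,i) + 0 * Xt $$ (k,i) + 0 * Xs $$ (k,i) + 0 * x 0 0 $$ (k,i))"
      by (intro jet_sum jet_mult[OF jet_const] xj) auto
    moreover have "(\<Sum>i<d. \<Sum>k<d. \<rho> $$ (i,k) * x s t $$ (k,i)) = mtrace (\<rho> * x s t)" for s t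
      by (rule mtrace_mult_index[OF r xc, symmetric])
    ultimately have j: "jet (\<lambda>s t. mtrace (\<rho> * x s t)) (mtrace (\<rho> * Xs)) (mtrace (\<rho> * Xt)) (mtrace (\<rho> * Xst))"
      by (simp add: mtrace_mult_index[OF r C(1)] mtrace_mult_index[OF r C(2)] mtrace_mult_index[OF r C(3)])
    have "\<forall>\<^sub>F p in nhds (0,0). mtrace (\<rho> * x (fst p) (snd p)) = (\<lambda>s t. 1) (fst p) (snd p)"
      using lU by eventually_elim (simp add: xe)
    from jet_unique[OF jet_cong[OF j this] jet_const]
    show "mtrace (\<rho> * Xs) = 0" "mtrace (\<rho> * Xt) = 0" "mtrace (\<rho> * Xst) = 0" by auto
  qed
  have ent: "x 0 0 $$ (i,j) = 1\<^sub>m d $$ (i,j)" for i j by (simp add: x00)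
  have A00: "A 0 0 Y $$ ij = L Y $$ ij" for Y ij by (simp add: L)
  \<comment> \<open>The coefficients of \<open>A x = l x\<close> in \<open>s\<close>, in
    \<open>t\<close> and in the mixed order. Both factors vary on either side, so both sides are
    expanded as jets of products.\<close>
  have eqs: "complex_of_real la * 1\<^sub>m d $$ (k,m) + Xs $$ (k,m) = As (1\<^sub>m d) $$ (k,m) + L Xs $$ (k,m)"
    "complex_of_real lt * 1\<^sub>m d $$ (k,m) + Xt $$ (k,m) = At (1\<^sub>m d) $$ (k,m) + L Xt $$ (k,m)"
    "Xst $$ (k,m) + complex_of_real la * Xt $$ (k,m) + complex_of_real lt * Xs $$ (k,m) + complex_of_real lst * 1\<^sub>m d $$ (k,m)
      = Ast (1\<^sub>m d) $$ (k,m) + At Xs $$ (k,m) + As Xt $$ (k,m) + L Xst $$ (k,m)"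
    if km: "k < d" "m < d" for k m
  proof -
    let ?E = "\<lambda>i j. munit d i j"
    have j1: "jet (\<lambda>s t. \<Sum>i<d. \<Sum>j<d. x s t $$ (i,j) * A s t (?E i j) $$ (k,m))
      (\<Sum>i<d. \<Sum>j<d. x 0 0 $$ (i,j) * As (?E i j) $$ (k,m) + Xs $$ (i,j) * A 0 0 (?E i j) $$ (k,m))
      (\<Sum>i<d. \<Sum>j<d. x 0 0 $$ (i,j) * At (?E i j) $$ (k,m) + Xt $$ (i,j) * A 0 0 (?E i j) $$ (k,m))
      (\<Sum>i<d. \<Sum>j<d. x 0 0 $$ (i,j) * Ast (?E i j) $$ (k,m) + Xs $$ (i,j) * At (?E i j) $$ (k,m)
         + Xt $$ (i,j) * As (?E i j) $$ (k,m) + Xst $$ (i,j) * A 0 0 (?E i j) $$ (k,m))"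
      by (intro jet_sum jet_mult xj J km) auto
    have j2: "jet (\<lambda>s t. complex_of_real (l s t) * x s t $$ (k,m))
      (complex_of_real (l 0 0) * Xs $$ (k,m) + complex_of_real la * x 0 0 $$ (k,m))
      (complex_of_real (l 0 0) * Xt $$ (k,m) + complex_of_real lt * x 0 0 $$ (k,m))
      (complex_of_real (l 0 0) * Xst $$ (k,m) + complex_of_real la * Xt $$ (k,m) + complex_of_real lt * Xs $$ (k,m) + complex_of_real lst * x 0 0 $$ (k,m))"
      by (intro jet_mult lj xj km)
    have ev: "\<forall>\<^sub>F p in nhds (0,0). (\<Sum>i<d. \<Sum>j<d. x (fst p) (snd p) $$ (i,j) * A (fst p) (snd p) (?E i j) $$ (k,m))
       = complex_of_real (l (fst p) (snd p)) * x (fst p) (snd p) $$ (k,m)"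
      using lU
    proof eventually_elim
      case (elim p)
      have "(\<Sum>i<d. \<Sum>j<d. x (fst p) (snd p) $$ (i,j) * A (fst p) (snd p) (?E i j) $$ (k,m)) = A (fst p) (snd p) (x (fst p) (snd p)) $$ (k,m)"
        by (rule linmap_expand[OF lin xc km, symmetric])
      also have "\<dots> = complex_of_real (l (fst p) (snd p)) * x (fst p) (snd p) $$ (k,m)"
        using elim xc[of "fst p" "snd p"] km by (simp add: xe)
      finally show ?case .
    qed
    note q = jet_unique[OF jet_cong[OF j1 ev] j2, unfolded sum.distrib ent l0 L]
    show "complex_of_real la * 1\<^sub>m d $$ (k,m) + Xs $$ (k,m) = As (1\<^sub>m d) $$ (k,m) + L Xs $$ (k,m)"
      using q(1) unfolding linmap_munit_sum[OF Alin(1) one_carrier_mat km refl] linmap_munit_sum[OF Llin C(1) km refl] by simp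
    show "complex_of_real lt * 1\<^sub>m d $$ (k,m) + Xt $$ (k,m) = At (1\<^sub>m d) $$ (k,m) + L Xt $$ (k,m)"
      using q(2) unfolding linmap_munit_sum[OF Alin(2) one_carrier_mat km refl] linmap_munit_sum[OF Llin C(2) km refl] by simp
    show "Xst $$ (k,m) + complex_of_real la * Xt $$ (k,m) + complex_of_real lt * Xs $$ (k,m) + complex_of_real lst * 1\<^sub>m d $$ (k,m)
      = Ast (1\<^sub>m d) $$ (k,m) + At Xs $$ (k,m) + As Xt $$ (k,m) + L Xst $$ (k,m)"
      using q(3) unfolding linmap_munit_sum[OF Alin(3) one_carrier_mat km refl] linmap_munit_sum[OF Alin(2) C(1) km refl]
        linmap_munit_sum[OF Alin(1) C(2) km refl] linmap_munit_sum[OF Llin C(3) km refl] by simp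
  qed
  have A1: "As (1\<^sub>m d) \<in> carrier_mat d d" "At (1\<^sub>m d) \<in> carrier_mat d d" "Ast (1\<^sub>m d) \<in> carrier_mat d d"
    "At Xs \<in> carrier_mat d d" "As Xt \<in> carrier_mat d d" "L Xs \<in> carrier_mat d d" "L Xt \<in> carrier_mat d d" "L Xst \<in> carrier_mat d d"
    using Alin Llin C by simp_all
  have M1: "complex_of_real la \<cdot>\<^sub>m 1\<^sub>m d + Xs = As (1\<^sub>m d) + L Xs"
    using eqs(1) A1 C by (intro eq_matI) auto
  have M2: "complex_of_real lt \<cdot>\<^sub>m 1\<^sub>m d + Xt = At (1\<^sub>m d) + L Xt"
    using eqs(2) A1 C by (intro eq_matI) auto
  have M3: "Xst + complex_of_real la \<cdot>\<^sub>m Xt + complex_of_real lt \<cdot>\<^sub>m Xs + complex_of_real lst \<cdot>\<^sub>m 1\<^sub>m d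
      = Ast (1\<^sub>m d) + At Xs + As Xt + L Xst"
  proof (rule eq_matI)
    fix i j assume "i < dim_row (Ast (1\<^sub>m d) + At Xs + As Xt + L Xst)" "j < dim_col (Ast (1\<^sub>m d) + At Xs + As Xt + L Xst)"
    then have ij: "i < d" "j < d" using A1 by auto
    show "(Xst + complex_of_real la \<cdot>\<^sub>m Xt + complex_of_real lt \<cdot>\<^sub>m Xs + complex_of_real lst \<cdot>\<^sub>m 1\<^sub>m d) $$ (i,j)
        = (Ast (1\<^sub>m d) + At Xs + As Xt + L Xst) $$ (i,j)"
      using eqs(3)[OF ij] A1 C ij by (cases "i = j") (simp_all add: add.assoc)
  qed (use A1 C in auto)
  note trs = mtrace_mult_add[OF r] mtrace_mult_smult[OF r]
  have las: "complex_of_real la = mtrace (\<rho> * As (1\<^sub>m d))"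
    using arg_cong[OF M1, of "\<lambda>Z. mtrace (\<rho> * Z)"] A1 C nrm by (simp add: trs tr1 inv \<rho>p(2))
  have lts: "complex_of_real lt = mtrace (\<rho> * At (1\<^sub>m d))"
    using arg_cong[OF M2, of "\<lambda>Z. mtrace (\<rho> * Z)"] A1 C nrm by (simp add: trs tr1 inv \<rho>p(2))
  \<comment> \<open>Pairing with \<open>\<rho>\<close> removes \<open>Xst\<close> and
    \<open>L Xst\<close> by invariance and the terms with \<open>la\<close> and \<open>lt\<close> by
    centring, so the second-order correction of the eigenvector never has to be computed.\<close>
  have lsts: "complex_of_real lst = mtrace (\<rho> * Ast (1\<^sub>m d)) + mtrace (\<rho> * At Xs) + mtrace (\<rho> * As Xt)"
    using arg_cong[OF M3, of "\<lambda>Z. mtrace (\<rho> * Z)"] A1 C nrm by (simp add: trs tr1 inv \<rho>p(2))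
  have series: "(\<lambda>n. mtrace (\<rho> * B ((L ^^ n) Z))) sums mtrace (\<rho> * B Y)"
    if "linmap d B" "Y \<in> carrier_mat d d" "mtrace (\<rho> * Y) = 0" "Z = Y - L Y" for B Y Z
    by (rule neumann_series[OF Llin r _ that]) (rule lim)
  have Zs: "As (1\<^sub>m d) - mtrace (\<rho> * As (1\<^sub>m d)) \<cdot>\<^sub>m 1\<^sub>m d = Xs - L Xs"
  proof (rule eq_matI)
    fix i j assume "i < dim_row (Xs - L Xs)" "j < dim_col (Xs - L Xs)"
    then have ij: "i < d" "j < d" using A1 C by auto
    show "(As (1\<^sub>m d) - mtrace (\<rho> * As (1\<^sub>m d)) \<cdot>\<^sub>m 1\<^sub>m d) $$ (i,j) = (Xs - L Xs) $$ (i,j)"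
      using eqs(1)[OF ij] A1 C ij by (simp add: las algebra_simps)
  qed (use A1 C in auto)
  have Zt: "At (1\<^sub>m d) - mtrace (\<rho> * At (1\<^sub>m d)) \<cdot>\<^sub>m 1\<^sub>m d = Xt - L Xt"
  proof (rule eq_matI)
    fix i j assume "i < dim_row (Xt - L Xt)" "j < dim_col (Xt - L Xt)"
    then have ij: "i < d" "j < d" using A1 C by auto
    show "(At (1\<^sub>m d) - mtrace (\<rho> * At (1\<^sub>m d)) \<cdot>\<^sub>m 1\<^sub>m d) $$ (i,j) = (Xt - L Xt) $$ (i,j)"
      using eqs(2)[OF ij] A1 C ij by (simp add: lts algebra_simps)
  qed (use A1 C in auto)
  have ev_deriv: "(f has_real_derivative D) (at 0) \<Longrightarrow> \<forall>\<^sub>F y in nhds 0. f y = h y \<Longrightarrow> (h has_real_derivative D) (at 0)" for f h :: "real \<Rightarrow> real" and D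
    unfolding has_real_derivative_iff_has_vector_derivative by (rule has_vector_derivative_ev)
  have rd: "\<forall>\<^sub>F s in nhds 0. ((\<lambda>t. spec_rad d (A s t)) has_real_derivative g s) (at 0)"
    using g(1) sr1 by eventually_elim (rule ev_deriv)
  show "\<exists>D. ((\<lambda>t. spec_rad d (A 0 t)) has_real_derivative D) (at 0) \<and> complex_of_real D = mtrace (\<rho> * At (1\<^sub>m d))"
    using eventually_nhds_x_imp_x[OF rd] g(2) lts by (intro exI[of _ lt]) simp
  show "\<forall>\<^sub>F s in nhds 0. (\<lambda>t. spec_rad d (A s t)) differentiable (at 0)"
    using rd by eventually_elim (auto simp: real_differentiable_def)
  have "\<forall>\<^sub>F s in nhds 0. g s = deriv (\<lambda>t. spec_rad d (A s t)) 0"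
    using rd by eventually_elim (rule DERIV_imp_deriv[symmetric])
  then have "((\<lambda>s. deriv (\<lambda>t. spec_rad d (A s t)) 0) has_real_derivative lst) (at 0)" by (rule ev_deriv[OF g(3)])
  moreover have "(\<lambda>n. mtrace (\<rho> * (At ((L ^^ n) (As (1\<^sub>m d) - mtrace (\<rho> * As (1\<^sub>m d)) \<cdot>\<^sub>m 1\<^sub>m d))
           + As ((L ^^ n) (At (1\<^sub>m d) - mtrace (\<rho> * At (1\<^sub>m d)) \<cdot>\<^sub>m 1\<^sub>m d))))) sums (mtrace (\<rho> * At Xs) + mtrace (\<rho> * As Xt))"
  proof -
    have "mtrace (\<rho> * (At ((L ^^ n) (Xs - L Xs)) + As ((L ^^ n) (Xt - L Xt))))
       = mtrace (\<rho> * At ((L ^^ n) (Xs - L Xs))) + mtrace (\<rho> * As ((L ^^ n) (Xt - L Xt)))" for n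
    proof (rule mtrace_mult_add[OF r])
      have "Xs - L Xs \<in> carrier_mat d d" "Xt - L Xt \<in> carrier_mat d d" using A1 by (auto simp: minus_carrier_mat)
      then show "At ((L ^^ n) (Xs - L Xs)) \<in> carrier_mat d d" "As ((L ^^ n) (Xt - L Xt)) \<in> carrier_mat d d"
        using Alin LN by simp_all
    qed
    then show ?thesis
      unfolding Zs Zt using sums_add[OF series[OF Alin(2) C(1) nrm(1) refl] series[OF Alin(1) C(2) nrm(2) refl]] by simp
  qed
  ultimately show "\<exists>D \<Sigma>. ((\<lambda>s. deriv (\<lambda>t. spec_rad d (A s t)) 0) has_real_derivative D) (at 0) \<and>
       (\<lambda>n. mtrace (\<rho> * (At ((L ^^ n) (As (1\<^sub>m d) - mtrace (\<rho> * As (1\<^sub>m d)) \<cdot>\<^sub>m 1\<^sub>m d))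
           + As ((L ^^ n) (At (1\<^sub>m d) - mtrace (\<rho> * At (1\<^sub>m d)) \<cdot>\<^sub>m 1\<^sub>m d))))) sums \<Sigma> \<and>
       complex_of_real D = \<Sigma> + mtrace (\<rho> * Ast (1\<^sub>m d))"
    using lsts by (intro exI conjI) auto
qed

section \<open>Repeated interactions\<close>

text \<open>Covers the dual map (\<open>R\<close> the Gibbs state, \<open>Y\<close> the identity)
  and its deformation (\<open>R\<close> and \<open>Y\<close> complementary powers of the Gibbs
  state) at once.\<close>

definition pmap :: "nat \<Rightarrow> nat \<Rightarrow> complex mat \<Rightarrow> complex mat \<Rightarrow> complex mat \<Rightarrow> complex mat \<Rightarrow> complex mat" where
  "pmap d e U R Y X = ptrace2 e (kron (1\<^sub>m d) R * adj U * kron X Y * U)"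

lemma pmap_alt:
  assumes "U \<in> carrier_mat (d*e) (d*e)" "R \<in> carrier_mat e e" "Y \<in> carrier_mat e e" "X \<in> carrier_mat d d"
  shows "pmap d e U R Y X = ptrace2 e (kron (1\<^sub>m d) R * (adj U * kron X Y * U))"
proof -
  have k: "kron (1\<^sub>m d) R \<in> carrier_mat (d*e) (d*e)" "kron X Y \<in> carrier_mat (d*e) (d*e)" using assms by auto
  show ?thesis unfolding pmap_def using assms(1) k
    by (simp add: assoc_mult_mat[of _ "d*e" "d*e" _ "d*e" _ "d*e"])
qed

lemma pmap_carrier:
  assumes "e > 0" "U \<in> carrier_mat (d*e) (d*e)" "R \<in> carrier_mat e e" "Y \<in> carrier_mat e e" "X \<in> carrier_mat d d"
  shows "pmap d e U R Y X \<in> carrier_mat d d"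
proof -
  have k: "kron (1\<^sub>m d) R \<in> carrier_mat (d*e) (d*e)" "kron X Y \<in> carrier_mat (d*e) (d*e)" using assms by auto
  show ?thesis unfolding pmap_def using assms(1,2) k by (intro ptrace2_carrier[of _ d e d]) auto
qed

lemma pmap_linmap:
  assumes e: "e > 0" and U: "U \<in> carrier_mat (d*e) (d*e)" and R: "R \<in> carrier_mat e e" and Y: "Y \<in> carrier_mat e e"
  shows "linmap d (pmap d e U R Y)"
  unfolding linmap_def
proof (intro conjI ballI allI)
  let ?n = "d*e"
  fix X X' :: "complex mat" and c assume X: "X \<in> carrier_mat d d"
  have k: "kron (1\<^sub>m d) R * adj U \<in> carrier_mat ?n ?n" "kron X Y \<in> carrier_mat ?n ?n"
    using U R X Y by (auto intro!: sq_mult_carrier)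
  show "pmap d e U R Y X \<in> carrier_mat d d" by (rule pmap_carrier[OF assms X])
  have "kron (1\<^sub>m d) R * adj U * (c \<cdot>\<^sub>m kron X Y) * U = c \<cdot>\<^sub>m (kron (1\<^sub>m d) R * adj U * kron X Y * U)"
    using k U by (simp add: mult_smult_distrib[of _ ?n ?n] mult_smult_assoc_mat[of _ ?n ?n])
  then show "pmap d e U R Y (c \<cdot>\<^sub>m X) = c \<cdot>\<^sub>m pmap d e U R Y X"
    unfolding pmap_def kron_smult_left[OF X Y] using k U ptrace2_smult[of "kron (1\<^sub>m d) R * adj U * kron X Y * U" d e d c] e by simp
  assume X': "X' \<in> carrier_mat d d"
  then have k': "kron X' Y \<in> carrier_mat ?n ?n" using Y by auto
  have "kron (1\<^sub>m d) R * adj U * (kron X Y + kron X' Y) * U = kron (1\<^sub>m d) R * adj U * kron X Y * U + kron (1\<^sub>m d) R * adj U * kron X' Y * U"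
    using k k' U by (simp add: mult_add_distrib_mat[of _ ?n ?n] add_mult_distrib_mat[of _ ?n ?n])
  then show "pmap d e U R Y (X + X') = pmap d e U R Y X + pmap d e U R Y X'"
    unfolding pmap_def kron_add_left[OF X X' Y]
    using k k' U e ptrace2_add[of "kron (1\<^sub>m d) R * adj U * kron X Y * U" d e d "kron (1\<^sub>m d) R * adj U * kron X' Y * U"] by simp
qed

text \<open>Cyclicity of the partial trace moves a square root of R to the right of U* (X (x) Y) U.\<close>
lemma pmap_posmap:
  assumes e: "e > 0" and U: "U \<in> carrier_mat (d*e) (d*e)" and R: "psd e R" and Y: "psd e Y"
  shows "posmap d (pmap d e U R Y)"
  unfolding posmap_def
proof (intro conjI ballI allI impI)
  let ?n = "d*e"
  have Rc: "R \<in> carrier_mat e e" and Yc: "Y \<in> carrier_mat e e" using R Y by auto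
  have aR: "adj R = R" and aY: "adj Y = Y" using R Y by (auto simp: psd_def hermitian_mat_def)
  show "linmap d (pmap d e U R Y)" by (rule pmap_linmap[OF e U Rc Yc])
  {
    fix X :: "complex mat" assume X: "X \<in> carrier_mat d d"
    define Z where "Z X = adj U * kron X Y * U" for X
    have Zc: "Z X \<in> carrier_mat ?n ?n" "Z (adj X) \<in> carrier_mat ?n ?n" "kron (1\<^sub>m d) R \<in> carrier_mat ?n ?n"
      unfolding Z_def using U X Yc Rc by (auto intro!: sq_mult_carrier)
    have kX: "kron X Y \<in> carrier_mat ?n ?n" using X Yc by auto
    have aZ: "adj (Z X) = Z (adj X)"
      unfolding Z_def using U kX
      by (simp add: adj_mult[of _ ?n ?n _ ?n] adj_kron aY assoc_mult_mat[of _ ?n ?n _ ?n _ ?n])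
    have "adj (pmap d e U R Y X) = ptrace2 e (adj (kron (1\<^sub>m d) R * Z X))"
      unfolding pmap_alt[OF U Rc Yc X] Z_def[symmetric] using Zc e by (intro adj_ptrace2[of _ d e d]) auto
    also have "adj (kron (1\<^sub>m d) R * Z X) = Z (adj X) * kron (1\<^sub>m d) R"
      using Zc by (simp add: adj_mult[of _ ?n ?n _ ?n] adj_kron aR aZ)
    also have "ptrace2 e (Z (adj X) * kron (1\<^sub>m d) R) = ptrace2 e (kron (1\<^sub>m d) R * Z (adj X))"
      by (rule ptrace2_cyc[OF Rc Zc(2) e, symmetric])
    also have "\<dots> = pmap d e U R Y (adj X)" using X by (simp add: pmap_alt[OF U Rc Yc] Z_def)
    finally show "pmap d e U R Y (adj X) = adj (pmap d e U R Y X)" by simp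
  }
  fix X assume X: "psd d X"
  obtain B where B: "hermitian_mat e B" "R = B * B" using psd_root[OF R] .
  have Bc: "B \<in> carrier_mat e e" and aB: "adj B = B" using B by (auto simp: hermitian_mat_def)
  define Z where "Z = adj U * kron X Y * U"
  define K where "K = kron (1\<^sub>m d) B"
  have Zp: "psd ?n Z" unfolding Z_def by (rule psd_conj[OF psd_kron[OF X Y] U])
  have c: "K \<in> carrier_mat ?n ?n" "Z \<in> carrier_mat ?n ?n" using Bc Zp by (auto simp: K_def)
  have KK: "kron (1\<^sub>m d) R = K * K" unfolding K_def B(2) using Bc by (subst kron_mult[of _ d d _ e e _ d _ e]) auto
  have "pmap d e U R Y X = ptrace2 e (K * (K * Z))"
    unfolding pmap_alt[OF U Rc Yc psd_carrier[OF X]] Z_def[symmetric] KK using c by (simp add: assoc_mult_mat[of _ ?n ?n _ ?n _ ?n])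
  also have "\<dots> = ptrace2 e (K * Z * K)"
    unfolding K_def using c by (intro ptrace2_cyc[OF Bc _ e]) (auto simp: K_def)
  also have "K * Z * K = adj K * Z * K" by (simp add: K_def adj_kron aB)
  finally show "psd d (pmap d e U R Y X)" using psd_ptrace2[OF psd_conj[OF Zp c(1)] e] by simp
qed

text \<open>With \<open>pmap_posmap\<close>, this linearity in the environment state turns an order
  relation between Gibbs states into domination of the maps.\<close>

lemma pmap_diff:
  assumes e: "e > 0" and U: "U \<in> carrier_mat (d*e) (d*e)" and R: "R \<in> carrier_mat e e" and R': "R' \<in> carrier_mat e e"
    and Y: "Y \<in> carrier_mat e e" and X: "X \<in> carrier_mat d d"
  shows "pmap d e U (R - c \<cdot>\<^sub>m R') Y X = pmap d e U R Y X - c \<cdot>\<^sub>m pmap d e U R' Y X"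
proof -
  let ?n = "d*e"
  let ?Z = "adj U * kron X Y * U"
  have k: "kron (1\<^sub>m d) R \<in> carrier_mat ?n ?n" "kron (1\<^sub>m d) R' \<in> carrier_mat ?n ?n" "?Z \<in> carrier_mat ?n ?n"
    using U R R' X Y by (auto intro!: sq_mult_carrier)
  have cR: "c \<cdot>\<^sub>m R' \<in> carrier_mat e e" "R - c \<cdot>\<^sub>m R' \<in> carrier_mat e e" using R R' by (auto simp: minus_carrier_mat)
  have "kron (1\<^sub>m d) (R - c \<cdot>\<^sub>m R') * ?Z = kron (1\<^sub>m d) R * ?Z - c \<cdot>\<^sub>m (kron (1\<^sub>m d) R' * ?Z)"
    unfolding kron_minus_right[OF one_carrier_mat R cR(1)] kron_smult_right[OF one_carrier_mat R']
    using k by (simp add: minus_mult_distrib_mat[of _ ?n ?n] mult_smult_assoc_mat[of _ ?n ?n])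
  then show ?thesis
    unfolding pmap_alt[OF U cR(2) Y X] pmap_alt[OF U R Y X] pmap_alt[OF U R' Y X]
    using k e by (simp add: ptrace2_minus[of _ d e d] ptrace2_smult[of _ d e d])
qed

lemma pmap_one:
  assumes e: "e > 0" and U: "unitary_mat (d*e) U" and R: "R \<in> carrier_mat e e" "mtrace R = 1"
  shows "pmap d e U R (1\<^sub>m e) (1\<^sub>m d) = 1\<^sub>m d"
proof -
  have Uc: "U \<in> carrier_mat (d*e) (d*e)" and UU: "adj U * U = 1\<^sub>m (d*e)" using U by (auto simp: unitary_mat_def)
  have k: "kron (1\<^sub>m d) R \<in> carrier_mat (d*e) (d*e)" using R by auto
  have aU: "adj U \<in> carrier_mat (d*e) (d*e)" using Uc by simp
  have "adj U * 1\<^sub>m (d*e) * U = 1\<^sub>m (d*e)" unfolding right_mult_one_mat[OF aU] by (rule UU)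
  then have "pmap d e U R (1\<^sub>m e) (1\<^sub>m d) = ptrace2 e (kron (1\<^sub>m d) R)"
    unfolding pmap_alt[OF Uc R(1) one_carrier_mat one_carrier_mat] kron_one by (simp only: right_mult_one_mat[OF k])
  then show ?thesis using ptrace2_kron[OF one_carrier_mat R(1) e] R(2) by auto
qed

text \<open>Factor \<open>kron X R\<close> into its system part and its environment part. Cyclicity
  of the full trace moves \<open>U\<close> around, and tracing out the environment first isolates
  \<open>X\<close>.\<close>

lemma pmap_dual:
  assumes e: "e > 0" and U: "U \<in> carrier_mat (d*e) (d*e)" and R: "R \<in> carrier_mat e e"
  shows "trace_dual d (\<lambda>X. ptrace2 e (U * kron X R * adj U)) (pmap d e U R (1\<^sub>m e))"
  unfolding trace_dual_def
proof (intro conjI ballI)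
  let ?n = "d*e"
  note as = assoc_mult_mat[of _ ?n ?n _ ?n _ ?n]
  fix X Y :: "complex mat" assume X: "X \<in> carrier_mat d d"
  have kX: "kron X R \<in> carrier_mat ?n ?n" using X R by auto
  have aU: "adj U \<in> carrier_mat ?n ?n" using U by simp
  have UX: "U * kron X R * adj U \<in> carrier_mat ?n ?n" using U kX by simp
  show "ptrace2 e (U * kron X R * adj U) \<in> carrier_mat d d" using UX e by (rule ptrace2_carrier)
  assume Y: "Y \<in> carrier_mat d d"
  have k: "kron Y (1\<^sub>m e) \<in> carrier_mat ?n ?n" "kron X (1\<^sub>m e) \<in> carrier_mat ?n ?n" "kron (1\<^sub>m d) R \<in> carrier_mat ?n ?n"
    using X Y R by auto
  define Z where "Z = adj U * kron Y (1\<^sub>m e) * U"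
  have Z: "Z \<in> carrier_mat ?n ?n" using U k by (simp add: Z_def)
  have "mtrace (ptrace2 e (U * kron X R * adj U) * Y) = mtrace (U * kron X R * adj U * kron Y (1\<^sub>m e))"
    unfolding ptrace2_mult_right[OF Y UX e, symmetric] using UX k e by (intro mtrace_ptrace2[of _ d]) auto
  also have "\<dots> = mtrace (U * (kron X R * adj U * kron Y (1\<^sub>m e)))" using U kX k by (simp add: as)
  also have "\<dots> = mtrace (kron X R * adj U * kron Y (1\<^sub>m e) * U)" using U kX k by (intro mtrace_cyc[of _ ?n ?n]) auto
  also have "kron X R * adj U * kron Y (1\<^sub>m e) * U = kron X R * Z" unfolding Z_def using U kX k by (simp add: as)
  also have "mtrace (kron X R * Z) = mtrace (kron X (1\<^sub>m e) * (kron (1\<^sub>m d) R * Z))"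
  proof -
    have "kron X R = kron X (1\<^sub>m e) * kron (1\<^sub>m d) R"
      using X R kron_mult[of X d d "1\<^sub>m e" e e "1\<^sub>m d" d R e] by simp
    then show ?thesis using k Z by (simp add: as)
  qed
  also have "\<dots> = mtrace (ptrace2 e (kron X (1\<^sub>m e) * (kron (1\<^sub>m d) R * Z)))" using k Z e by (intro mtrace_ptrace2[of _ d, symmetric]) auto
  also have "\<dots> = mtrace (X * pmap d e U R (1\<^sub>m e) Y)"
    unfolding pmap_alt[OF U R one_carrier_mat Y] Z_def[symmetric] using k Z by (subst ptrace2_mult_left[of X d d _ e d]) (use X e in auto)
  finally show "mtrace (ptrace2 e (U * kron X R * adj U) * Y) = mtrace (X * pmap d e U R (1\<^sub>m e) Y)" .
qed

text \<open>The partition function is moved into the exponent as \<open>- ln Z\<close>, so that the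
  eigenvalues are exponentials of reals and \<open>matlog_sdf\<close> and
  \<open>mat_rpow_sdf\<close> apply as they stand.\<close>

lemma gibbs_sdf:
  assumes Q: "unitary_mat e Q" and e: "e > 0"
  shows "gibbs \<beta> (sdf e Q (\<lambda>i. complex_of_real (f i)))
    = sdf e Q (\<lambda>i. complex_of_real (exp (- \<beta> * f i - ln (\<Sum>k<e. exp (- \<beta> * f k)))))"
proof -
  define Z where "Z = (\<Sum>k<e. exp (- \<beta> * f k))"
  have Z: "Z > 0" unfolding Z_def using e by (intro sum_pos) auto
  have m: "matexp (complex_of_real (-\<beta>) \<cdot>\<^sub>m sdf e Q (\<lambda>i. complex_of_real (f i))) = sdf e Q (\<lambda>i. complex_of_real (exp (- \<beta> * f i)))"
    unfolding sdf_smult[OF Q] matexp_sdf[OF Q] by (intro sdf_cong[OF Q]) (simp add: exp_of_real flip: of_real_mult of_real_minus)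
  have t: "mtrace (sdf e Q (\<lambda>i. complex_of_real (exp (- \<beta> * f i)))) = complex_of_real Z"
    by (simp add: mtrace_sdf[OF Q] Z_def)
  show ?thesis unfolding gibbs_def m t unfolding sdf_smult[OF Q] Z_def[symmetric]
    using Z by (intro sdf_cong[OF Q]) (simp add: exp_diff)
qed

lemma mtrace_gibbs:
  assumes Q: "unitary_mat e Q" and e: "e > 0"
  shows "mtrace (gibbs \<beta> (sdf e Q (\<lambda>i. complex_of_real (f i)))) = 1"
proof -
  define Z where "Z = (\<Sum>k<e. exp (- \<beta> * f k))"
  have Z: "Z > 0" unfolding Z_def using e by (intro sum_pos) auto
  have "(\<Sum>i<e. exp (- \<beta> * f i - ln Z)) = 1"
    using Z by (simp add: exp_diff Z_def flip: sum_divide_distrib)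
  then show ?thesis unfolding gibbs_sdf[OF assms] mtrace_sdf[OF Q] Z_def[symmetric] by (metis of_real_1 of_real_sum)
qed

lemma mat_rpow_sdf:
  assumes Q: "unitary_mat e Q"
  shows "mat_rpow e (sdf e Q (\<lambda>i. complex_of_real (exp (f i)))) a = sdf e Q (\<lambda>i. complex_of_real (exp (a * f i)))"
  unfolding mat_rpow_def matlog_sdf[OF Q] sdf_smult[OF Q] matexp_sdf[OF Q]
  by (intro sdf_cong[OF Q]) (simp add: exp_of_real flip: of_real_mult)

lemma hermitian_kron:
  "hermitian_mat n A \<Longrightarrow> hermitian_mat m B \<Longrightarrow> hermitian_mat (n*m) (kron A B)"
  by (auto simp: hermitian_mat_def adj_kron)

section \<open>The interaction maps of a well-formed system, and consequences of (NE)\<close>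

lemma wf_env:
  assumes "well_formed S" "j \<in> {1..nenv S}"
  shows "edim S j > 0" "hermitian_mat (edim S j) (hamE S j)" "sdim S > 0" "tau S j > 0"
    "hermitian_mat (sdim S) (hamS S)" "hermitian_mat (sdim S * edim S j) (coupl S j)" "beta_ref S > 0"
  using assms by (auto simp: well_formed_def)

lemma hamE_spectral:
  assumes "well_formed S" "j \<in> {1..nenv S}"
  obtains Q f where "unitary_mat (edim S j) Q" "hamE S j = sdf (edim S j) Q (\<lambda>i. complex_of_real (f i))"
  using spectral_hermitian[OF wf_env(2)[OF assms]] by blast

text \<open>The generator is Hermitian, so in its eigenbasis \<open>Uj\<close> is diagonal with
  entries \<open>exp (- \<i> \<tau> k)\<close> of modulus 1.\<close>

lemma Uj_unitary:
  assumes "well_formed S" "j \<in> {1..nenv S}"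
  shows "unitary_mat (sdim S * edim S j) (Uj S j)"
proof -
  let ?n = "sdim S * edim S j"
  let ?K = "kron (hamS S) (1\<^sub>m (edim S j)) + kron (1\<^sub>m (sdim S)) (hamE S j) + coupl S j"
  have "hermitian_mat ?n ?K" using wf_env[OF assms] by (intro hermitian_add hermitian_kron) auto
  then obtain P k where P: "unitary_mat ?n P" and K: "?K = sdf ?n P (\<lambda>i. complex_of_real (k i))" using spectral_hermitian by blast
  let ?u = "\<lambda>i. cis (- (tau S j * k i))"
  have U: "Uj S j = sdf ?n P ?u"
    unfolding Uj_def K sdf_smult[OF P] matexp_sdf[OF P] by (intro sdf_cong[OF P]) (simp add: cis_conv_exp mult.assoc)
  have cu: "cnj (?u i) * ?u i = 1" "?u i * cnj (?u i) = 1" for i by (simp_all add: cis_cnj cis_mult)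
  have "adj (Uj S j) * Uj S j = 1\<^sub>m ?n"
    unfolding U adj_sdf[OF P] sdf_mult[OF P] cu by (rule sdf_one[OF P])
  moreover have "Uj S j * adj (Uj S j) = 1\<^sub>m ?n"
    unfolding U adj_sdf[OF P] sdf_mult[OF P] cu by (rule sdf_one[OF P])
  moreover have "Uj S j \<in> carrier_mat ?n ?n" unfolding U by (rule sdf_carrier[OF P])
  ultimately show ?thesis by (simp add: unitary_mat_def)
qed

lemma rhoE_facts:
  assumes "well_formed S" "j \<in> {1..nenv S}"
  shows "psd (edim S j) (rhoE S \<zeta> j)" "mtrace (rhoE S \<zeta> j) = 1"
    "mat_rpow (edim S j) (rhoE S \<zeta> j) 1 = rhoE S \<zeta> j" "mat_rpow (edim S j) (rhoE S \<zeta> j) 0 = 1\<^sub>m (edim S j)"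
    "psd (edim S j) (mat_rpow (edim S j) (rhoE S \<zeta> j) a)"
proof -
  obtain Q f where Q: "unitary_mat (edim S j) Q" "hamE S j = sdf (edim S j) Q (\<lambda>i. complex_of_real (f i))"
    using hamE_spectral[OF assms] by blast
  note e = wf_env(1)[OF assms]
  note r = gibbs_sdf[OF Q(1) e, of "betaj S \<zeta> j" f]
  show "psd (edim S j) (rhoE S \<zeta> j)" unfolding rhoE_def Q(2) r by (rule sdf_psd[OF Q(1)]) simp
  show "mtrace (rhoE S \<zeta> j) = 1" unfolding rhoE_def Q(2) by (rule mtrace_gibbs[OF Q(1) e])
  show "mat_rpow (edim S j) (rhoE S \<zeta> j) 1 = rhoE S \<zeta> j" unfolding rhoE_def Q(2) r mat_rpow_sdf[OF Q(1)] by simp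
  show "mat_rpow (edim S j) (rhoE S \<zeta> j) 0 = 1\<^sub>m (edim S j)"
    unfolding rhoE_def Q(2) r mat_rpow_sdf[OF Q(1)] using sdf_one[OF Q(1)] by simp
  show "psd (edim S j) (mat_rpow (edim S j) (rhoE S \<zeta> j) a)"
    unfolding rhoE_def Q(2) r mat_rpow_sdf[OF Q(1)] by (rule sdf_psd[OF Q(1)]) simp
qed

lemma Ljd_pmap: "Ljd S \<zeta> j = pmap (sdim S) (edim S j) (Uj S j) (rhoE S \<zeta> j) (1\<^sub>m (edim S j))"
  by (intro ext) (simp add: Ljd_def pmap_def)

lemma Ljd_def_pmap: "Ljd_def S \<zeta> a j = pmap (sdim S) (edim S j) (Uj S j)
    (mat_rpow (edim S j) (rhoE S \<zeta> j) (1 - a)) (mat_rpow (edim S j) (rhoE S \<zeta> j) a)"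
  by (intro ext) (simp add: Ljd_def_def pmap_def)

lemma Ljd_posmap:
  assumes "well_formed S" "j \<in> {1..nenv S}" shows "posmap (sdim S) (Ljd S \<zeta> j)"
  unfolding Ljd_pmap using assms Uj_unitary[OF assms] wf_env(1)[OF assms] rhoE_facts(1)[OF assms] by (intro pmap_posmap) auto

lemma Ljd_def_posmap:
  assumes "well_formed S" "j \<in> {1..nenv S}" shows "posmap (sdim S) (Ljd_def S \<zeta> a j)"
  unfolding Ljd_def_pmap using assms Uj_unitary[OF assms] wf_env(1)[OF assms] rhoE_facts(5)[OF assms] by (intro pmap_posmap) auto

lemma Ljd_def_0:
  assumes "well_formed S" "j \<in> {1..nenv S}" shows "Ljd_def S \<zeta> 0 j = Ljd S \<zeta> j"
  unfolding Ljd_def_pmap Ljd_pmap using rhoE_facts(3,4)[OF assms] by simp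

lemma Ljd_one:
  assumes "well_formed S" "j \<in> {1..nenv S}" shows "Ljd S \<zeta> j (1\<^sub>m (sdim S)) = 1\<^sub>m (sdim S)"
  unfolding Ljd_pmap using wf_env(1)[OF assms] Uj_unitary[OF assms] rhoE_facts(1,2)[OF assms] by (intro pmap_one) auto

lemma Lj_dual:
  assumes "well_formed S" "j \<in> {1..nenv S}" shows "trace_dual (sdim S) (Lj S \<zeta> j) (Ljd S \<zeta> j)"
proof -
  have "Lj S \<zeta> j = (\<lambda>X. ptrace2 (edim S j) (Uj S j * kron X (rhoE S \<zeta> j) * adj (Uj S j)))" by (intro ext) (simp add: Lj_def)
  then show ?thesis unfolding Ljd_pmap
    using pmap_dual[OF wf_env(1)[OF assms] unitary_carrier[OF Uj_unitary[OF assms]] psd_carrier[OF rhoE_facts(1)[OF assms]]] by simp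
qed

text \<open>Gibbs states at two temperatures are functions of the same Hamiltonian. \<open>D\<close>
  bounds the differences of their logarithmic eigenvalues, so one state is at least
  \<open>exp (-D)\<close> times the other, and positivity of \<open>pmap\<close> in its state
  argument carries this over to the maps.\<close>

lemma Ljd_dominates:
  assumes "well_formed S" "j \<in> {1..nenv S}"
  shows "\<exists>k>0. dominates (sdim S) k (Ljd S \<zeta> j) (Ljd S \<zeta>' j)"
proof -
  obtain Q f where Q: "unitary_mat (edim S j) Q" "hamE S j = sdf (edim S j) Q (\<lambda>i. complex_of_real (f i))"
    using hamE_spectral[OF assms] by blast
  note e = wf_env(1)[OF assms]
  define x where "x z i = - betaj S z j * f i - ln (\<Sum>k<edim S j. exp (- betaj S z j * f k))" for z i
  have r: "rhoE S z j = sdf (edim S j) Q (\<lambda>i. complex_of_real (exp (x z i)))" for z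
    unfolding rhoE_def Q(2) gibbs_sdf[OF Q(1) e] x_def ..
  define D where "D = (\<Sum>i<edim S j. \<bar>x \<zeta> i - x \<zeta>' i\<bar>)"
  have "exp (x \<zeta> i) - exp (-D) * exp (x \<zeta>' i) \<ge> 0" if "i < edim S j" for i
  proof -
    have "\<bar>x \<zeta> i - x \<zeta>' i\<bar> \<le> D" unfolding D_def using that by (intro member_le_sum) auto
    then have "exp (-D + x \<zeta>' i) \<le> exp (x \<zeta> i)" by simp
    then show ?thesis by (simp only: exp_add diff_ge_0_iff_ge)
  qed
  then have "psd (edim S j) (sdf (edim S j) Q (\<lambda>i. complex_of_real (exp (x \<zeta> i) - exp (-D) * exp (x \<zeta>' i))))"
    by (intro sdf_psd[OF Q(1)])
  then have p: "psd (edim S j) (rhoE S \<zeta> j - complex_of_real (exp (-D)) \<cdot>\<^sub>m rhoE S \<zeta>' j)"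
    unfolding r sdf_smult[OF Q(1)] sdf_minus[OF Q(1)] by simp
  have "dominates (sdim S) (exp (-D)) (Ljd S \<zeta> j) (Ljd S \<zeta>' j)"
    unfolding dominates_def
  proof (intro allI impI)
    fix X assume X: "psd (sdim S) X"
    note U = unitary_carrier[OF Uj_unitary[OF assms]]
    let ?D = "rhoE S \<zeta> j - complex_of_real (exp (-D)) \<cdot>\<^sub>m rhoE S \<zeta>' j"
    have "posmap (sdim S) (pmap (sdim S) (edim S j) (Uj S j) ?D (1\<^sub>m (edim S j)))"
      by (rule pmap_posmap[OF e U p psd_one])
    from posmap_psd[OF this X] have "psd (sdim S) (pmap (sdim S) (edim S j) (Uj S j) ?D (1\<^sub>m (edim S j)) X)" .
    also have "pmap (sdim S) (edim S j) (Uj S j) ?D (1\<^sub>m (edim S j)) X = Ljd S \<zeta> j X - complex_of_real (exp (-D)) \<cdot>\<^sub>m Ljd S \<zeta>' j X"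
      unfolding Ljd_pmap by (rule pmap_diff[OF e U]) (use X rhoE_facts(1)[OF assms] in auto)
    finally show "psd (sdim S) (Ljd S \<zeta> j X - complex_of_real (exp (-D)) \<cdot>\<^sub>m Ljd S \<zeta>' j X)" .
  qed
  then show ?thesis by (intro exI[of _ "exp (-D)"]) simp
qed

text \<open>Writing the eigenvalues of \<open>\<rho>p 0\<close> as exponentials builds in that this
  state has full rank, and makes the numbers \<open>h i\<close> the eigenvalues of
  \<open>H'\<close>.\<close>

locale ne_model =
  fixes S :: qsys and \<rho>p :: "real \<Rightarrow> complex mat" and P :: "complex mat" and h :: "nat \<Rightarrow> real"
  assumes wf: "well_formed S" and ne: "NE S \<rho>p" and P: "unitary_mat (sdim S) P"
    and rho0: "\<rho>p 0 = sdf (sdim S) P (\<lambda>i. complex_of_real (exp (- beta_ref S * h i)))"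
begin

abbreviation "d \<equiv> sdim S"
abbreviation "H \<equiv> Hprime S \<rho>p"

text \<open>The one-parameter group \<open>exp (x H')\<close>, by \<open>H_sdf\<close>
  below.\<close>

definition W :: "real \<Rightarrow> complex mat" where
  "W x = sdf d P (\<lambda>i. complex_of_real (exp (x * h i)))"

lemma H_sdf: "H = sdf d P (\<lambda>i. complex_of_real (h i))"
proof -
  have b: "beta_ref S > 0" using wf by (simp add: well_formed_def)
  have "H = sdf d P (\<lambda>i. complex_of_real (- 1 / beta_ref S) * complex_of_real (- beta_ref S * h i))"
    unfolding Hprime_def rho0 matlog_sdf[OF P] sdf_smult[OF P] ..
  also have "\<dots> = sdf d P (\<lambda>i. complex_of_real (h i))"
  proof (rule sdf_cong[OF P])
    fix i
    have "- 1 / beta_ref S * (- beta_ref S * h i) = h i" using b by simp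
    then show "complex_of_real (- 1 / beta_ref S) * complex_of_real (- beta_ref S * h i) = complex_of_real (h i)"
      by (simp only: of_real_mult[symmetric])
  qed
  finally show ?thesis .
qed

lemma H_carrier [simp]: "H \<in> carrier_mat d d"
  unfolding H_sdf by (rule sdf_carrier[OF P])

lemma one_H [simp]: "1\<^sub>m d * H = H" "H * 1\<^sub>m d = H"
  by (rule left_mult_one_mat[OF H_carrier], rule right_mult_one_mat[OF H_carrier])

lemma adj_H: "adj H = H"
  unfolding H_sdf adj_sdf[OF P] by simp

lemma W_carrier [simp]: "W x \<in> carrier_mat d d"
  unfolding W_def by (rule sdf_carrier[OF P])

lemma W_inverse: "W x * W (- x) = 1\<^sub>m d"
  unfolding W_def sdf_mult[OF P] using sdf_one[OF P] by (simp flip: of_real_mult exp_add)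

text \<open>(NE) at \<open>z = 0\<close> says that \<open>U\<close> commutes with the product of
  \<open>\<rho>p 0\<close> and the Gibbs state at \<open>beta_ref\<close>, which is a strictly
  monotone function of \<open>H' + H_E\<close>. By \<open>sdf_intertwine\<close>, \<open>U\<close>
  then commutes with every function of that sum, and so the other temperatures can be reached as
  well.\<close>

lemma U_comm:
  assumes j: "j \<in> {1..nenv S}" and Q: "unitary_mat (edim S j) Q" and hE: "hamE S j = sdf (edim S j) Q (\<lambda>i. complex_of_real (f i))"
  shows "Uj S j * sdf (d * edim S j) (kron P Q) (\<lambda>k. g (h (k div edim S j) + f (k mod edim S j)))
       = sdf (d * edim S j) (kron P Q) (\<lambda>k. g (h (k div edim S j) + f (k mod edim S j))) * Uj S j"
proof -
  let ?e = "edim S j" and ?U = "Uj S j"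
  let ?n = "d * ?e"
  note e = wf_env(1)[OF wf j]
  have b: "beta_ref S > 0" using wf by (simp add: well_formed_def)
  have U: "?U \<in> carrier_mat ?n ?n" "adj ?U * ?U = 1\<^sub>m ?n" using Uj_unitary[OF wf j] by (auto simp: unitary_mat_def)
  define K where "K = kron (\<rho>p 0) (gibbs (beta_ref S) (hamE S j))"
  define z where "z = ln (\<Sum>k<?e. exp (- beta_ref S * f k))"
  have K: "K = sdf ?n (kron P Q) (\<lambda>k. complex_of_real (exp (- beta_ref S * h (k div ?e))) * complex_of_real (exp (- beta_ref S * f (k mod ?e) - z)))"
    unfolding K_def rho0 hE gibbs_sdf[OF Q e] z_def kron_sdf(2)[OF P Q] ..
  have Kc: "K \<in> carrier_mat ?n ?n" unfolding K by (rule sdf_carrier[OF kron_sdf(1)[OF P Q]])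
  have "?U * K * adj ?U = K" using ne[unfolded NE_def, rule_format, of 0] j by (simp add: K_def)
  then have "?U * K * adj ?U * ?U = K * ?U" by simp
  moreover have "?U * K * adj ?U * ?U = ?U * K"
    using U Kc by (simp add: assoc_mult_mat[of _ ?n ?n _ ?n _ ?n])
  ultimately have "?U * K = K * ?U" by simp
  then show ?thesis unfolding K
  proof (rule sdf_intertwine[OF kron_sdf(1)[OF P Q] U(1)])
    fix i k
    assume "complex_of_real (exp (- beta_ref S * h (i div ?e))) * complex_of_real (exp (- beta_ref S * f (i mod ?e) - z))
      = complex_of_real (exp (- beta_ref S * h (k div ?e))) * complex_of_real (exp (- beta_ref S * f (k mod ?e) - z))"
    then have "exp (- beta_ref S * h (i div ?e) + (- beta_ref S * f (i mod ?e) - z)) = exp (- beta_ref S * h (k div ?e) + (- beta_ref S * f (k mod ?e) - z))"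
      by (simp only: exp_add of_real_mult[symmetric] of_real_eq_iff)
    then have "beta_ref S * (h (i div ?e) + f (i mod ?e)) = beta_ref S * (h (k div ?e) + f (k mod ?e))"
      by (simp add: algebra_simps)
    then show "g (h (i div ?e) + f (i mod ?e)) = g (h (k div ?e) + f (k mod ?e))" using b by simp
  qed
qed

text \<open>The deformation is a similarity-type twist: U commutes with exp(-x H') (x) exp(-x H_E),
  so the power of the Gibbs state can be traded for powers of exp H' on the system.\<close>
lemma deform_formula:
  assumes j: "j \<in> {1..nenv S}" and X: "X \<in> carrier_mat d d"
  shows "Ljd_def S \<zeta> a j X = Ljd S \<zeta> j (X * W (a * betaj S \<zeta> j)) * W (- (a * betaj S \<zeta> j))"
proof -
  let ?e = "edim S j" and ?U = "Uj S j"
  let ?n = "d * ?e"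
  note e = wf_env(1)[OF wf j]
  note as = assoc_mult_mat[of _ ?n ?n _ ?n _ ?n]
  obtain Q f where Q: "unitary_mat ?e Q" and hE: "hamE S j = sdf ?e Q (\<lambda>i. complex_of_real (f i))"
    using hamE_spectral[OF wf j] by blast
  define b where "b = betaj S \<zeta> j"
  define x where "x = a * b"
  define z where "z = ln (\<Sum>k<?e. exp (- b * f k))"
  have U: "?U \<in> carrier_mat ?n ?n" "adj ?U \<in> carrier_mat ?n ?n" using Uj_unitary[OF wf j] by auto
  have \<rho>: "rhoE S \<zeta> j = sdf ?e Q (\<lambda>i. complex_of_real (exp (- b * f i - z)))"
    unfolding rhoE_def hE gibbs_sdf[OF Q e] b_def z_def ..
  define R where "R c = mat_rpow ?e (rhoE S \<zeta> j) c" for c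
  have R: "R c = sdf ?e Q (\<lambda>i. complex_of_real (exp (c * (- b * f i - z))))" for c
    unfolding R_def \<rho> mat_rpow_sdf[OF Q] ..
  have Rc: "R c \<in> carrier_mat ?e ?e" for c unfolding R by (rule sdf_carrier[OF Q])
  have RR: "R a * R (1 - a) = rhoE S \<zeta> j"
    unfolding R \<rho> sdf_mult[OF Q] by (intro sdf_cong[OF Q]) (simp add: algebra_simps flip: of_real_mult exp_add)
  have \<rho>c: "rhoE S \<zeta> j \<in> carrier_mat ?e ?e" unfolding \<rho> by (rule sdf_carrier[OF Q])
  \<comment> \<open>The exponents \<open>- x h\<close> and \<open>a * (- b f - z)\<close> combine to
    \<open>- x (h + f) - a z\<close> precisely for \<open>x = a * b\<close>; only then does the
    product depend on the sum \<open>h + f\<close> alone.\<close>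
  have WR: "kron (W (-x)) (R a) = sdf ?n (kron P Q) (\<lambda>k. (\<lambda>y. complex_of_real (exp (- x * y - a * z))) (h (k div ?e) + f (k mod ?e)))"
    unfolding W_def R kron_sdf(2)[OF P Q]
    by (intro sdf_cong[OF kron_sdf(1)[OF P Q]]) (simp add: x_def algebra_simps flip: of_real_mult exp_add)
  have comm: "?U * kron (W (-x)) (R a) = kron (W (-x)) (R a) * ?U"
    unfolding WR by (rule U_comm[OF j Q hE])
  \<comment> \<open>Splitting \<open>X\<close> as \<open>Y * W (-x)\<close> supplies the factor that
    \<open>R a\<close> needs in order to commute with \<open>U\<close>.\<close>
  define Y where "Y = X * W x"
  have Yc: "Y \<in> carrier_mat d d" using X by (simp add: Y_def)
  have YW: "Y * W (-x) = X"
  proof -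
    have "Y * W (-x) = X * (W x * W (-x))" unfolding Y_def by (rule assoc_mult_mat[OF X W_carrier W_carrier])
    then show ?thesis using X by (simp add: W_inverse)
  qed
  have k: "kron Y (1\<^sub>m ?e) \<in> carrier_mat ?n ?n" "kron (W (-x)) (R a) \<in> carrier_mat ?n ?n" "kron (1\<^sub>m d) (R c) \<in> carrier_mat ?n ?n"
    "kron (W (-x)) (1\<^sub>m ?e) \<in> carrier_mat ?n ?n" for c
    using Yc Rc by (auto intro!: kron_carrier)
  have k1: "kron X (R a) = kron Y (1\<^sub>m ?e) * kron (W (-x)) (R a)"
    unfolding kron_mult[OF Yc one_carrier_mat W_carrier Rc] YW left_mult_one_mat[OF Rc] ..
  have k2: "kron (W (-x)) (R a) = kron (1\<^sub>m d) (R a) * kron (W (-x)) (1\<^sub>m ?e)"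
    unfolding kron_mult[OF one_carrier_mat Rc W_carrier one_carrier_mat] right_mult_one_mat[OF Rc] left_mult_one_mat[OF W_carrier] ..
  define Z where "Z = adj ?U * kron Y (1\<^sub>m ?e) * ?U"
  have Z: "Z \<in> carrier_mat ?n ?n" using U k by (simp add: Z_def)
  have "adj ?U * kron X (R a) * ?U = adj ?U * (kron Y (1\<^sub>m ?e) * (kron (W (-x)) (R a) * ?U))"
    unfolding k1 using U k by (simp add: as)
  also have "\<dots> = Z * kron (W (-x)) (R a)"
    unfolding comm[symmetric] Z_def using U k by (simp add: as)
  also have "\<dots> = Z * kron (1\<^sub>m d) (R a) * kron (W (-x)) (1\<^sub>m ?e)"
    unfolding k2 using Z k by (simp add: as)
  finally have m: "adj ?U * kron X (R a) * ?U = Z * kron (1\<^sub>m d) (R a) * kron (W (-x)) (1\<^sub>m ?e)" .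
  have "Ljd_def S \<zeta> a j X = ptrace2 ?e (kron (1\<^sub>m d) (R (1-a)) * (adj ?U * kron X (R a) * ?U))"
    unfolding Ljd_def_pmap R_def[symmetric] by (rule pmap_alt[OF U(1) Rc Rc X])
  also have "\<dots> = ptrace2 ?e ((kron (1\<^sub>m d) (R (1-a)) * Z * kron (1\<^sub>m d) (R a)) * kron (W (-x)) (1\<^sub>m ?e))"
    unfolding m using Z k by (simp add: as)
  also have "\<dots> = ptrace2 ?e (kron (1\<^sub>m d) (R (1-a)) * Z * kron (1\<^sub>m d) (R a)) * W (-x)"
    using Z k by (intro ptrace2_mult_right[OF W_carrier _ e]) (auto intro!: sq_mult_carrier)
  \<comment> \<open>Cyclicity on the environment brings \<open>R a\<close> to the front, where it
    merges with \<open>R (1-a)\<close> into the undeformed Gibbs state.\<close>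
  also have "ptrace2 ?e (kron (1\<^sub>m d) (R (1-a)) * Z * kron (1\<^sub>m d) (R a)) = ptrace2 ?e (kron (1\<^sub>m d) (R a) * (kron (1\<^sub>m d) (R (1-a)) * Z))"
    using Z k by (intro ptrace2_cyc[OF Rc _ e, symmetric]) (auto intro!: sq_mult_carrier)
  also have "kron (1\<^sub>m d) (R a) * (kron (1\<^sub>m d) (R (1-a)) * Z) = kron (1\<^sub>m d) (rhoE S \<zeta> j) * Z"
  proof -
    have "kron (1\<^sub>m d) (R a) * kron (1\<^sub>m d) (R (1-a)) = kron (1\<^sub>m d) (rhoE S \<zeta> j)"
      unfolding kron_mult[OF one_carrier_mat Rc one_carrier_mat Rc] RR left_mult_one_mat[OF one_carrier_mat] ..
    then show ?thesis using assoc_mult_mat[OF k(3) k(3) Z, of a "1-a"] by simp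
  qed
  also have "ptrace2 ?e (kron (1\<^sub>m d) (rhoE S \<zeta> j) * Z) = Ljd S \<zeta> j Y"
    unfolding Ljd_pmap Z_def using pmap_alt[OF U(1) \<rho>c one_carrier_mat Yc] by simp
  finally show ?thesis by (simp add: Y_def x_def b_def)
qed

text \<open>Both parts express that \<open>U\<close> conserves \<open>A + B\<close>, which is
  \<open>H' + H_E\<close>. What the environment loses is gained in \<open>H'\<close>, so the flux is
  an increment of \<open>H'\<close>. Conservation also makes the averaged \<open>H'\<close> commute
  with \<open>H'\<close>, which is needed where the dissipation and the second derivative of the
  twist order their factors differently.\<close>

lemma generator_facts:
  assumes j: "j \<in> {1..nenv S}"
  shows "Phi S \<zeta> j = complex_of_real (1 / Ttot S) \<cdot>\<^sub>m (Ljd S \<zeta> j H - H)"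
    and "H * Ljd S \<zeta> j H = Ljd S \<zeta> j H * H"
proof -
  let ?e = "edim S j" and ?U = "Uj S j"
  let ?n = "d * ?e"
  note e = wf_env(1)[OF wf j]
  note as = assoc_mult_mat[of _ ?n ?n _ ?n _ ?n]
  obtain Q f where Q: "unitary_mat ?e Q" and hE: "hamE S j = sdf ?e Q (\<lambda>i. complex_of_real (f i))"
    using hamE_spectral[OF wf j] by blast
  have U: "?U \<in> carrier_mat ?n ?n" "adj ?U \<in> carrier_mat ?n ?n" "adj ?U * ?U = 1\<^sub>m ?n"
    using Uj_unitary[OF wf j] by (auto simp: unitary_mat_def)
  define \<rho> where "\<rho> = rhoE S \<zeta> j"
  have \<rho>c: "\<rho> \<in> carrier_mat ?e ?e" using rhoE_facts(1)[OF wf j] by (simp add: \<rho>_def)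
  have tr: "mtrace \<rho> = 1" using rhoE_facts(2)[OF wf j] by (simp add: \<rho>_def)
  have hc: "hamE S j \<in> carrier_mat ?e ?e" unfolding hE by (rule sdf_carrier[OF Q])
  define A B where "A = kron H (1\<^sub>m ?e)" and "B = kron (1\<^sub>m d) (hamE S j)"
  define K where "K = kron (1\<^sub>m d) \<rho>"
  have c: "A \<in> carrier_mat ?n ?n" "B \<in> carrier_mat ?n ?n" "K \<in> carrier_mat ?n ?n"
    using hc \<rho>c by (auto simp: A_def B_def K_def)
  have AB: "A + B = sdf ?n (kron P Q) (\<lambda>k. complex_of_real (h (k div ?e) + f (k mod ?e)))"
  proof -
    have "A = sdf ?n (kron P Q) (\<lambda>k. complex_of_real (h (k div ?e)) * 1)"
      unfolding A_def H_sdf sdf_one[OF Q, symmetric] kron_sdf(2)[OF P Q] ..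
    moreover have "B = sdf ?n (kron P Q) (\<lambda>k. 1 * complex_of_real (f (k mod ?e)))"
      unfolding B_def hE sdf_one[OF P, symmetric] kron_sdf(2)[OF P Q] ..
    ultimately show ?thesis by (simp add: sdf_add[OF kron_sdf(1)[OF P Q]])
  qed
  have comm: "?U * (A + B) = (A + B) * ?U" unfolding AB by (rule U_comm[OF j Q hE])
  have G: "A + B \<in> carrier_mat ?n ?n" using c by simp
  have conj: "adj ?U * (A + B) * ?U = A + B"
  proof -
    have "adj ?U * (A + B) * ?U = adj ?U * ((A + B) * ?U)" using U(1,2) G by (simp only: as)
    also have "\<dots> = adj ?U * (?U * (A + B))" unfolding comm ..
    also have "\<dots> = (adj ?U * ?U) * (A + B)" using U(1,2) G by (simp only: as)
    finally show ?thesis unfolding U(3) left_mult_one_mat[OF G] .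
  qed
  define A' B' where "A' = adj ?U * A * ?U" and "B' = adj ?U * B * ?U"
  have c': "A' \<in> carrier_mat ?n ?n" "B' \<in> carrier_mat ?n ?n" using c U by (auto simp: A'_def B'_def)
  have sum: "A' + B' = A + B"
  proof -
    have "adj ?U * (A + B) * ?U = A' + B'"
      unfolding A'_def B'_def using c U
      by (simp add: mult_add_distrib_mat[OF U(2) c(1,2)] add_mult_distrib_mat[of _ ?n ?n])
    then show ?thesis using conj by simp
  qed
  \<comment> \<open>The conservation law rearranged: the change of \<open>B\<close> under
    \<open>U\<close> is opposite to the change of \<open>A\<close>.\<close>
  have diff: "B' - B = A - A'"
  proof (rule eq_matI)
    fix i k assume "i < dim_row (A - A')" "k < dim_col (A - A')"
    then have ik: "i < ?n" "k < ?n" using c' by auto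
    have "(A' + B') $$ (i,k) = (A + B) $$ (i,k)" using sum by simp
    then have "A' $$ (i,k) + B' $$ (i,k) = A $$ (i,k) + B $$ (i,k)" using ik c c' by simp
    then show "(B' - B) $$ (i,k) = (A - A') $$ (i,k)" using ik c c' by (simp add: algebra_simps)
  qed (use c c' in auto)
  have LH: "Ljd S \<zeta> j H = ptrace2 ?e (K * A')"
    unfolding Ljd_pmap pmap_alt[OF U(1) \<rho>c[unfolded \<rho>_def] one_carrier_mat H_carrier] K_def A'_def A_def \<rho>_def ..
  have KA: "ptrace2 ?e (K * A) = H"
  proof -
    have "K * A = kron H \<rho>" unfolding K_def A_def
      using kron_mult[OF one_carrier_mat \<rho>c H_carrier one_carrier_mat] \<rho>c by simp
    then show ?thesis using ptrace2_kron[OF H_carrier \<rho>c e] tr by (auto intro!: eq_matI)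
  qed
  have "ptrace2 ?e (K * (B' - B)) = H - Ljd S \<zeta> j H"
  proof -
    have "K * (B' - B) = K * A - K * A'" unfolding diff by (rule mult_minus_distrib_mat[OF c(3,1) c'(1)])
    then show ?thesis using ptrace2_minus[of "K * A" d ?e d "K * A'"] c c' e KA LH by simp
  qed
  then have "Phi S \<zeta> j = complex_of_real (- 1 / Ttot S) \<cdot>\<^sub>m (H - Ljd S \<zeta> j H)"
    unfolding Phi_def \<rho>_def[symmetric] K_def[symmetric] B_def[symmetric] B'_def[symmetric] by simp
  moreover have LHc: "Ljd S \<zeta> j H \<in> carrier_mat d d" using posmap_linmap[OF Ljd_posmap[OF wf j]] by simp
  ultimately show "Phi S \<zeta> j = complex_of_real (1 / Ttot S) \<cdot>\<^sub>m (Ljd S \<zeta> j H - H)"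
    by (intro eq_matI) (use LHc carrier_matD[OF H_carrier] in \<open>auto simp: diff_divide_distrib\<close>)
  have \<rho>h: "\<rho> * hamE S j = hamE S j * \<rho>"
    unfolding \<rho>_def rhoE_def hE gibbs_sdf[OF Q e] sdf_mult[OF Q] by (intro sdf_cong[OF Q]) simp
  have KA': "K * A = A * K" unfolding K_def A_def
    using kron_mult[OF one_carrier_mat \<rho>c H_carrier one_carrier_mat] kron_mult[OF H_carrier one_carrier_mat one_carrier_mat \<rho>c] \<rho>c by simp
  have KB: "K * B = B * K" unfolding K_def B_def
    using kron_mult[OF one_carrier_mat \<rho>c one_carrier_mat hc] kron_mult[OF one_carrier_mat hc one_carrier_mat \<rho>c] \<rho>h by simp
  have ABc: "A * B = B * A" unfolding A_def B_def
    using kron_mult[OF one_carrier_mat hc H_carrier one_carrier_mat] kron_mult[OF H_carrier one_carrier_mat one_carrier_mat hc] hc by simp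
  have GA: "(A + B) * A = A * (A + B)"
    using c ABc by (simp add: add_mult_distrib_mat[OF c(1,2,1)] mult_add_distrib_mat[OF c(1,1,2)])
  have GK: "(A + B) * K = K * (A + B)"
    using c KA' KB by (simp add: add_mult_distrib_mat[OF c(1,2,3)] mult_add_distrib_mat[OF c(3,1,2)])
  have aG: "adj (A + B) = A + B" unfolding AB adj_sdf[OF kron_sdf(1)[OF P Q]] by simp
  have comm': "(A + B) * adj ?U = adj ?U * (A + B)"
  proof -
    have "adj (?U * (A + B)) = adj ((A + B) * ?U)" using comm by simp
    then show ?thesis by (simp only: adj_mult[OF U(1) G] adj_mult[OF G U(1)] aG)
  qed
  define M where "M = K * A'"
  have Mc: "M \<in> carrier_mat ?n ?n" using c c' by (simp add: M_def)
  \<comment> \<open>\<open>A + B\<close> commutes with \<open>K\<close>, with \<open>A\<close>, with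
    \<open>U\<close> and with its adjoint, hence with the product \<open>M\<close> of these.\<close>
  have GM: "(A + B) * M = M * (A + B)"
  proof -
    have "(A + B) * M = ((A + B) * K) * A'" unfolding M_def using G c c' by (simp only: as)
    also have "\<dots> = K * ((A + B) * A')" unfolding GK using G c c' by (simp only: as)
    also have "(A + B) * A' = ((A + B) * adj ?U) * (A * ?U)" unfolding A'_def using G U c by (simp only: as sq_mult_carrier)
    also have "\<dots> = adj ?U * (((A + B) * A) * ?U)" unfolding comm' using G U c by (simp only: as sq_mult_carrier)
    also have "\<dots> = adj ?U * (A * ((A + B) * ?U))" unfolding GA using G U c by (simp only: as sq_mult_carrier)
    also have "\<dots> = A' * (A + B)" unfolding comm[symmetric] A'_def using G U c by (simp only: as sq_mult_carrier)
    finally show ?thesis unfolding M_def using G c c' by (simp only: as sq_mult_carrier)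
  qed
  \<comment> \<open>Partial trace of \<open>(A + B) * M = M * (A + B)\<close>: the \<open>A\<close>
    terms come out as factors \<open>H\<close>, and the \<open>B\<close> terms will cancel by
    \<open>ptrace2_cyc\<close>.\<close>
  have "H * ptrace2 ?e M + ptrace2 ?e (B * M) = ptrace2 ?e M * H + ptrace2 ?e (M * B)"
  proof -
    have "ptrace2 ?e ((A + B) * M) = H * ptrace2 ?e M + ptrace2 ?e (B * M)"
      unfolding add_mult_distrib_mat[OF c(1,2) Mc] using c Mc e ptrace2_mult_left[OF H_carrier Mc e]
      by (simp add: ptrace2_add[of _ d ?e d] A_def)
    moreover have "ptrace2 ?e (M * (A + B)) = ptrace2 ?e M * H + ptrace2 ?e (M * B)"
      unfolding mult_add_distrib_mat[OF Mc c(1,2)] using c Mc e ptrace2_mult_right[OF H_carrier Mc e]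
      by (simp add: ptrace2_add[of _ d ?e d] A_def)
    ultimately show ?thesis using GM by simp
  qed
  moreover have "ptrace2 ?e (B * M) = ptrace2 ?e (M * B)" unfolding B_def by (rule ptrace2_cyc[OF hc Mc e])
  ultimately have e1: "H * ptrace2 ?e M + ptrace2 ?e (M * B) = ptrace2 ?e M * H + ptrace2 ?e (M * B)" by simp
  have p: "ptrace2 ?e M \<in> carrier_mat d d" "ptrace2 ?e (M * B) \<in> carrier_mat d d" using Mc c e by (auto intro!: ptrace2_carrier[of _ d ?e d])
  have "H * ptrace2 ?e M = ptrace2 ?e M * H"
  proof (rule eq_matI)
    fix i k assume "i < dim_row (ptrace2 ?e M * H)" "k < dim_col (ptrace2 ?e M * H)"
    then have ik: "i < d" "k < d" using p carrier_matD[OF H_carrier] by auto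
    have "(H * ptrace2 ?e M + ptrace2 ?e (M * B)) $$ (i,k) = (ptrace2 ?e M * H + ptrace2 ?e (M * B)) $$ (i,k)" using e1 by simp
    then show "(H * ptrace2 ?e M) $$ (i,k) = (ptrace2 ?e M * H) $$ (i,k)"
      using ik p carrier_matD[OF H_carrier] by simp
  qed (use p carrier_matD[OF H_carrier] in auto)
  then show "H * Ljd S \<zeta> j H = Ljd S \<zeta> j H * H" unfolding LH M_def .
qed

end

section \<open>Sums, averages and compositions of maps\<close>

lemma linmap_comp': "linmap d A \<Longrightarrow> linmap d B \<Longrightarrow> linmap d (\<lambda>X. A (B X))"
  using linmap_comp[of d A B] by (simp add: comp_def)

lemma linmap_mult_left: "Y \<in> carrier_mat d d \<Longrightarrow> linmap d (\<lambda>Z. Y * Z)"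
  by (auto simp: linmap_def mult_add_distrib_mat[of _ d d] mult_smult_distrib[of _ d d])

lemma linmap_mult_right: "Y \<in> carrier_mat d d \<Longrightarrow> linmap d (\<lambda>Z. Z * Y)"
  by (auto simp: linmap_def add_mult_distrib_mat[of _ d d] mult_smult_assoc_mat[of _ d d])

lemma linmap_scale: "linmap d A \<Longrightarrow> linmap d (\<lambda>X. c \<cdot>\<^sub>m A X)"
  by (auto simp: linmap_def add_smult_distrib_left_mat[of _ d d] smult_smult_mat mult.commute)

lemma linmap_sub:
  assumes A: "linmap d A" and B: "linmap d B" shows "linmap d (\<lambda>X. A X - B X)"
  unfolding linmap_def
proof (intro conjI ballI allI)
  fix X Y :: "complex mat" and c assume X: "X \<in> carrier_mat d d"
  note cX = carrier_matD[OF linmap_carrier[OF A X]] carrier_matD[OF linmap_carrier[OF B X]]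
  show "A X - B X \<in> carrier_mat d d" using A B X by (simp add: minus_carrier_mat)
  show "A (c \<cdot>\<^sub>m X) - B (c \<cdot>\<^sub>m X) = c \<cdot>\<^sub>m (A X - B X)"
    unfolding linmap_smult[OF A X] linmap_smult[OF B X] using cX by (intro eq_matI) (auto simp: algebra_simps)
  assume Y: "Y \<in> carrier_mat d d"
  note cY = carrier_matD[OF linmap_carrier[OF A Y]] carrier_matD[OF linmap_carrier[OF B Y]]
  show "A (X + Y) - B (X + Y) = A X - B X + (A Y - B Y)"
    unfolding linmap_add[OF A X Y] linmap_add[OF B X Y] using cX cY by (intro eq_matI) auto
qed

lemma linmap_plus:
  assumes A: "linmap d A" and B: "linmap d B" shows "linmap d (\<lambda>X. A X + B X)"
proof -
  have "linmap d (\<lambda>X. A X - (-1) \<cdot>\<^sub>m B X)" by (intro linmap_sub linmap_scale A B)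
  moreover have "A X + B X = A X - (-1) \<cdot>\<^sub>m B X" if "X \<in> carrier_mat d d" for X
    using carrier_matD[OF linmap_carrier[OF A that]] carrier_matD[OF linmap_carrier[OF B that]] by (intro eq_matI) auto
  ultimately show ?thesis unfolding linmap_def by auto
qed

lemma msum_Cons: "msum d F (j # js) = F j + msum d F js"
  by (simp add: msum_def)

lemma msum_Nil: "msum d F [] = 0\<^sub>m d d"
  by (simp add: msum_def)

lemma msum_carrier: "(\<And>j. j \<in> set js \<Longrightarrow> F j \<in> carrier_mat d d) \<Longrightarrow> msum d F js \<in> carrier_mat d d"
  by (induction js) (auto simp: msum_Cons msum_Nil)

lemma msum_index:
  "(\<And>j. j \<in> set js \<Longrightarrow> F j \<in> carrier_mat d d) \<Longrightarrow> distinct js \<Longrightarrow> p < d \<Longrightarrow> q < d \<Longrightarrow>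
    msum d F js $$ (p,q) = (\<Sum>j\<in>set js. F j $$ (p,q))"
proof (induction js)
  case (Cons a js)
  have "msum d F js \<in> carrier_mat d d" "F a \<in> carrier_mat d d" using Cons.prems by (auto intro: msum_carrier)
  then show ?case using Cons by (simp add: msum_Cons)
qed (simp add: msum_Nil)

definition avg :: "nat \<Rightarrow> real \<Rightarrow> (nat \<Rightarrow> complex mat \<Rightarrow> complex mat) \<Rightarrow> nat list \<Rightarrow> complex mat \<Rightarrow> complex mat" where
  "avg d c G js X = complex_of_real c \<cdot>\<^sub>m msum d (\<lambda>i. G i X) js"

lemma avg_linmap: "(\<And>i. i \<in> set js \<Longrightarrow> linmap d (G i)) \<Longrightarrow> linmap d (avg d c G js)"
  unfolding avg_def
proof (intro linmap_scale)
  assume "\<And>i. i \<in> set js \<Longrightarrow> linmap d (G i)"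
  then show "linmap d (\<lambda>X. msum d (\<lambda>i. G i X) js)"
  proof (induction js)
    case Nil
    show ?case by (auto simp: linmap_def msum_Nil)
  next
    case (Cons a js)
    then show ?case unfolding msum_Cons by (intro linmap_plus) auto
  qed
qed

lemma avg_posmap:
  assumes G: "\<And>i. i \<in> set js \<Longrightarrow> posmap d (G i)" and c: "c \<ge> 0"
  shows "posmap d (avg d c G js)"
  unfolding posmap_def
proof (intro conjI ballI allI impI)
  show "linmap d (avg d c G js)" using G by (intro avg_linmap posmap_linmap)
  fix X :: "complex mat"
  { assume X: "X \<in> carrier_mat d d"
    have "msum d (\<lambda>i. G i (adj X)) js = adj (msum d (\<lambda>i. G i X) js)"
      using G
    proof (induction js)
      case (Cons a js)
      have c: "G a X \<in> carrier_mat d d" "msum d (\<lambda>i. G i X) js \<in> carrier_mat d d"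
      proof -
        have l: "linmap d (G i)" if "i \<in> set (a # js)" for i by (rule posmap_linmap[OF Cons.prems[OF that]])
        show "G a X \<in> carrier_mat d d" by (rule linmap_carrier[OF l X]) simp
        show "msum d (\<lambda>i. G i X) js \<in> carrier_mat d d" by (rule msum_carrier, rule linmap_carrier[OF l X]) simp
      qed
      have "G a (adj X) = adj (G a X)" using Cons.prems[of a] X by (simp add: posmap_def)
      then show ?case using Cons unfolding msum_Cons adj_add[OF c] by simp
    qed (simp add: msum_Nil)
    then show "avg d c G js (adj X) = adj (avg d c G js X)" by (simp add: avg_def adj_smult) }
  assume X: "psd d X"
  have "psd d (msum d (\<lambda>i. G i X) js)" using G
  proof (induction js)
    case (Cons a js)
    have "psd d (G a X)" by (rule posmap_psd[OF Cons.prems X]) simp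
    then show ?case unfolding msum_Cons using Cons by (intro psd_add) auto
  qed (simp add: msum_Nil)
  then show "psd d (avg d c G js X)" unfolding avg_def using c by (rule psd_smult)
qed

lemma avg_dual:
  assumes "\<And>i. i \<in> set js \<Longrightarrow> trace_dual d (F i) (G i)" and "\<And>i. i \<in> set js \<Longrightarrow> linmap d (G i)"
  shows "trace_dual d (avg d c F js) (avg d c G js)"
proof -
  have m: "msum d (\<lambda>i. F i X) js \<in> carrier_mat d d \<and> mtrace (msum d (\<lambda>i. F i X) js * Y) = mtrace (X * msum d (\<lambda>i. G i Y) js)"
    if X: "X \<in> carrier_mat d d" and Y: "Y \<in> carrier_mat d d" for X Y
    using assms
  proof (induction js)
    case Nil
    then show ?case using X Y by (simp add: msum_Nil)
  next
    case (Cons a js)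
    have c: "F a X \<in> carrier_mat d d" "G a Y \<in> carrier_mat d d" "msum d (\<lambda>i. G i Y) js \<in> carrier_mat d d"
      using Cons.prems X Y by (auto simp: trace_dual_def intro!: msum_carrier)
    have i: "msum d (\<lambda>i. F i X) js \<in> carrier_mat d d" "mtrace (msum d (\<lambda>i. F i X) js * Y) = mtrace (X * msum d (\<lambda>i. G i Y) js)"
      using Cons by auto
    have "mtrace (F a X * Y) = mtrace (X * G a Y)" using Cons.prems(1)[of a] X Y by (simp add: trace_dual_def)
    then show ?case unfolding msum_Cons add_mult_distrib_mat[OF c(1) i(1) Y] mult_add_distrib_mat[OF X c(2,3)]
      using c i X Y by (simp add: mtrace_add[of _ d])
  qed
  have cG: "msum d (\<lambda>i. G i Y) js \<in> carrier_mat d d" if "Y \<in> carrier_mat d d" for Y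
    using assms(2) that by (auto intro!: msum_carrier)
  show ?thesis unfolding trace_dual_def avg_def
  proof (intro conjI ballI)
    fix X Y :: "complex mat" assume X: "X \<in> carrier_mat d d"
    show "complex_of_real c \<cdot>\<^sub>m msum d (\<lambda>i. F i X) js \<in> carrier_mat d d" using m[OF X X] by simp
    assume Y: "Y \<in> carrier_mat d d"
    have "mtrace (complex_of_real c \<cdot>\<^sub>m msum d (\<lambda>i. F i X) js * Y) = complex_of_real c * mtrace (msum d (\<lambda>i. F i X) js * Y)"
      using m[OF X Y] Y by (simp add: mult_smult_assoc_mat[of _ d d] mtrace_smult[of _ d])
    then show "mtrace (complex_of_real c \<cdot>\<^sub>m msum d (\<lambda>i. F i X) js * Y) = mtrace (X * (complex_of_real c \<cdot>\<^sub>m msum d (\<lambda>i. G i Y) js))"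
      using m[OF X Y] mtrace_mult_smult[OF X cG[OF Y]] by simp
  qed
qed

lemma dominates_weaken:
  assumes D: "dominates d k A B" and B: "posmap d B" and A: "linmap d A" and k: "k' \<le> k"
  shows "dominates d k' A B"
  unfolding dominates_def
proof (intro allI impI)
  fix X assume X: "psd d X"
  have BX: "psd d (B X)" by (rule posmap_psd[OF B X])
  have AX: "A X \<in> carrier_mat d d" using A X by simp
  have "psd d (A X - complex_of_real k \<cdot>\<^sub>m B X + complex_of_real (k - k') \<cdot>\<^sub>m B X)"
    using D X BX k by (intro psd_add psd_smult) (auto simp: dominates_def)
  also have "A X - complex_of_real k \<cdot>\<^sub>m B X + complex_of_real (k - k') \<cdot>\<^sub>m B X = A X - complex_of_real k' \<cdot>\<^sub>m B X"
    using AX psd_carrier[OF BX] by (intro eq_matI) (auto simp: algebra_simps)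
  finally show "psd d (A X - complex_of_real k' \<cdot>\<^sub>m B X)" .
qed

text \<open>The finitely many constants are replaced by a common smaller one, which
  \<open>dominates_weaken\<close> allows.\<close>

lemma avg_dominates:
  assumes "\<And>i. i \<in> set js \<Longrightarrow> \<exists>k>0. dominates d k (A i) (B i)"
    and "\<And>i. i \<in> set js \<Longrightarrow> posmap d (A i)" "\<And>i. i \<in> set js \<Longrightarrow> posmap d (B i)" and c: "c \<ge> 0"
  shows "\<exists>k>0. dominates d k (avg d c A js) (avg d c B js)"
proof -
  have "\<exists>k>0. \<forall>i\<in>set js. dominates d k (A i) (B i)" using assms(1-3)
  proof (induction js)
    case Nil
    show ?case by (intro exI[of _ 1]) simp
  next
    case (Cons a js)
    then obtain k where k: "k > 0" "\<forall>i\<in>set js. dominates d k (A i) (B i)" by auto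
    obtain k' where k': "k' > 0" "dominates d k' (A a) (B a)" using Cons.prems(1)[of a] by auto
    have "dominates d (min k k') (A i) (B i)" if "i \<in> set (a # js)" for i
    proof (cases "i = a")
      case True
      then show ?thesis using dominates_weaken[OF k'(2)] Cons.prems(2,3)[of a] posmap_linmap by auto
    next
      case False
      then show ?thesis using that k(2) dominates_weaken[of d k "A i" "B i" "min k k'"] Cons.prems(2,3)[of i] posmap_linmap by auto
    qed
    then show ?case using k k' by (intro exI[of _ "min k k'"]) auto
  qed
  then obtain k where k: "k > 0" "\<forall>i\<in>set js. dominates d k (A i) (B i)" by blast
  have cA: "A i X \<in> carrier_mat d d" "B i X \<in> carrier_mat d d" if "i \<in> set js" "psd d X" for i X
    using psd_carrier[OF posmap_psd[OF assms(2)[OF that(1)] that(2)]] psd_carrier[OF posmap_psd[OF assms(3)[OF that(1)] that(2)]] by auto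
  have "psd d (msum d (\<lambda>i. A i X) js - complex_of_real k \<cdot>\<^sub>m msum d (\<lambda>i. B i X) js)" if X: "psd d X" for X
    using k(2) cA[OF _ X]
  proof (induction js)
    case Nil
    have z: "0\<^sub>m d d - complex_of_real k \<cdot>\<^sub>m 0\<^sub>m d d = 0\<^sub>m d d" by (intro eq_matI) auto
    show ?case unfolding msum_Nil z by (rule psd_zero)
  next
    case (Cons a js)
    have c: "A a X \<in> carrier_mat d d" "B a X \<in> carrier_mat d d" "msum d (\<lambda>i. A i X) js \<in> carrier_mat d d" "msum d (\<lambda>i. B i X) js \<in> carrier_mat d d"
      using Cons.prems by (auto intro!: msum_carrier)
    have "psd d ((A a X - complex_of_real k \<cdot>\<^sub>m B a X) + (msum d (\<lambda>i. A i X) js - complex_of_real k \<cdot>\<^sub>m msum d (\<lambda>i. B i X) js))"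
      using Cons X by (intro psd_add) (auto simp: dominates_def)
    also have "(A a X - complex_of_real k \<cdot>\<^sub>m B a X) + (msum d (\<lambda>i. A i X) js - complex_of_real k \<cdot>\<^sub>m msum d (\<lambda>i. B i X) js)
      = msum d (\<lambda>i. A i X) (a # js) - complex_of_real k \<cdot>\<^sub>m msum d (\<lambda>i. B i X) (a # js)"
      unfolding msum_Cons using c by (intro eq_matI) (auto simp: algebra_simps)
    finally show ?case .
  qed
  note m = this
  have "dominates d k (avg d c A js) (avg d c B js)"
    unfolding dominates_def
  proof (intro allI impI)
    fix X assume X: "psd d X"
    have cs: "msum d (\<lambda>i. A i X) js \<in> carrier_mat d d" "msum d (\<lambda>i. B i X) js \<in> carrier_mat d d"
      using cA[OF _ X] by (auto intro!: msum_carrier)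
    have "psd d (complex_of_real c \<cdot>\<^sub>m (msum d (\<lambda>i. A i X) js - complex_of_real k \<cdot>\<^sub>m msum d (\<lambda>i. B i X) js))"
      by (rule psd_smult[OF m[OF X] c])
    also have "complex_of_real c \<cdot>\<^sub>m (msum d (\<lambda>i. A i X) js - complex_of_real k \<cdot>\<^sub>m msum d (\<lambda>i. B i X) js) = avg d c A js X - complex_of_real k \<cdot>\<^sub>m avg d c B js X"
      unfolding avg_def using cs by (intro eq_matI) (auto simp: algebra_simps)
    finally show "psd d (avg d c A js X - complex_of_real k \<cdot>\<^sub>m avg d c B js X)" .
  qed
  then show ?thesis using k(1) by blast
qed

text \<open>The head of the list is applied last, as in the dual cycle map.\<close>

definition chain :: "(nat \<Rightarrow> complex mat \<Rightarrow> complex mat) \<Rightarrow> nat list \<Rightarrow> complex mat \<Rightarrow> complex mat" where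
  "chain G js = foldr (\<lambda>j g. G j \<circ> g) js id"

lemma chain_simps: "chain G [] = id" "chain G (j # js) = G j \<circ> chain G js"
  by (simp_all add: chain_def)

lemma chain_cong: "(\<And>j. j \<in> set js \<Longrightarrow> F j = G j) \<Longrightarrow> chain F js = chain G js"
  by (induction js) (auto simp: chain_simps)

lemma chain_posmap: "(\<And>j. j \<in> set js \<Longrightarrow> posmap d (G j)) \<Longrightarrow> posmap d (chain G js)"
  by (induction js) (auto simp: chain_simps intro!: posmap_comp)

lemma chain_linmap: "(\<And>j. j \<in> set js \<Longrightarrow> linmap d (G j)) \<Longrightarrow> linmap d (chain G js)"
  by (induction js) (auto simp: chain_simps intro!: linmap_comp)

lemma chain_fix: "(\<And>j. j \<in> set js \<Longrightarrow> G j X = X) \<Longrightarrow> chain G js X = X"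
  by (induction js) (auto simp: chain_simps)

text \<open>Duality reverses compositions, which is why the fold on the state side uses
  \<open>g \<circ> F j\<close>.\<close>

lemma chain_dual:
  assumes "\<And>j. j \<in> set js \<Longrightarrow> trace_dual d (F j) (G j)" "\<And>j. j \<in> set js \<Longrightarrow> linmap d (G j)"
  shows "trace_dual d (foldr (\<lambda>j g. g \<circ> F j) js id) (chain G js)"
  using assms
proof (induction js)
  case Nil
  then show ?case by (simp add: chain_simps trace_dual_def)
next
  case (Cons a js)
  have l: "linmap d (chain G js)" using Cons.prems by (intro chain_linmap) auto
  define R where "R = foldr (\<lambda>j g. g \<circ> F j) js id"
  have i: "trace_dual d R (chain G js)"
    unfolding R_def by (rule Cons.IH) (rule Cons.prems, simp)+
  have a: "trace_dual d (F a) (G a)" by (rule Cons.prems(1)) simp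
  have e: "foldr (\<lambda>j g. g \<circ> F j) (a # js) id = R \<circ> F a" by (simp only: foldr.simps comp_apply R_def)
  have "trace_dual d (\<lambda>X. R (F a X)) (\<lambda>X. G a (chain G js X))"
    using i a linmap_carrier[OF l] by (auto simp: trace_dual_def)
  moreover have "R \<circ> F a = (\<lambda>X. R (F a X))" "G a \<circ> chain G js = (\<lambda>X. G a (chain G js X))" by auto
  ultimately show ?case by (simp only: e chain_simps(2))
qed

lemma chain_dominates:
  assumes "\<And>i. i \<in> set js \<Longrightarrow> \<exists>k>0. dominates d k (A i) (B i)"
    and "\<And>i. i \<in> set js \<Longrightarrow> posmap d (A i)" "\<And>i. i \<in> set js \<Longrightarrow> posmap d (B i)"
  shows "\<exists>k>0. dominates d k (chain A js) (chain B js)"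
  using assms
proof (induction js)
  case Nil
  have "psd d (X - 1 \<cdot>\<^sub>m X)" if "psd d X" for X
  proof -
    have "X - 1 \<cdot>\<^sub>m X = 0\<^sub>m d d" using psd_carrier[OF that] by (intro eq_matI) auto
    then show ?thesis by simp
  qed
  then have "dominates d 1 (\<lambda>X. X) (\<lambda>X. X)" by (simp add: dominates_def)
  then show ?case unfolding chain_simps by (intro exI[of _ "1::real"]) simp_all
next
  case (Cons a js)
  obtain k where k: "k > 0" "dominates d k (chain A js) (chain B js)" using Cons by auto
  obtain k' where k': "k' > 0" "dominates d k' (A a) (B a)" using Cons.prems(1)[of a] by auto
  have p: "posmap d (chain A js)" "posmap d (chain B js)" using Cons.prems by (auto intro!: chain_posmap)
  have "dominates d (k' * k) (A a \<circ> chain A js) (B a \<circ> chain B js)"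
    by (rule dominates_comp[OF k'(2) k(2) p(1) _ _ p(2)]) (use Cons.prems k' in auto)
  then show ?case unfolding chain_simps using k(1) k'(1) by (intro exI[of _ "k' * k"] conjI mult_pos_pos)
qed

definition msm :: "nat \<Rightarrow> (real \<times> real \<times> real \<Rightarrow> complex mat) \<Rightarrow> bool" where
  "msm d X \<longleftrightarrow> (\<forall>p. X p \<in> carrier_mat d d) \<and> (\<forall>i<d. \<forall>j<d. sm UNIV (\<lambda>p. X p $$ (i,j)))"

text \<open>Both the map and its argument depend on the parameters; expanding the argument in matrix
  units separates the two dependences.\<close>

lemma msm_linmap:
  assumes lin: "\<And>p. linmap d (B p)" and X: "msm d X"
    and B: "\<And>a b i j. i < d \<Longrightarrow> j < d \<Longrightarrow> sm UNIV (\<lambda>p. B p (munit d a b) $$ (i,j))"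
  shows "msm d (\<lambda>p. B p (X p))"
proof -
  have Xc: "X p \<in> carrier_mat d d" for p using X unfolding msm_def by blast
  have "sm UNIV (\<lambda>p. B p (X p) $$ (i,j))" if ij: "i < d" "j < d" for i j
    unfolding linmap_expand[OF lin Xc ij]
    using X B ij by (intro sm_sum sm_mult) (auto simp: msm_def)
  then show ?thesis using lin Xc by (auto simp: msm_def)
qed

lemma msm_chain:
  assumes "\<And>p j. j \<in> set js \<Longrightarrow> linmap d (B p j)" and X: "msm d X"
    and "\<And>a b i j k. k \<in> set js \<Longrightarrow> i < d \<Longrightarrow> j < d \<Longrightarrow> sm UNIV (\<lambda>p. B p k (munit d a b) $$ (i,j))"
  shows "msm d (\<lambda>p. chain (B p) js (X p))"
  using assms(1,3)
proof (induction js)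
  case Nil
  then show ?case using X by (simp add: chain_simps)
next
  case (Cons k js)
  have "msm d (\<lambda>p. B p k (chain (B p) js (X p)))"
  proof (rule msm_linmap[where B = "\<lambda>p. B p k" and X = "\<lambda>p. chain (B p) js (X p)"])
    show "linmap d (B p k)" for p by (rule Cons.prems) simp
    show "msm d (\<lambda>p. chain (B p) js (X p))" by (rule Cons.IH) (use Cons.prems in simp_all)
    show "sm UNIV (\<lambda>p. B p k (munit d a b) $$ (i,j))" if "i < d" "j < d" for a b i j
      by (rule Cons.prems(2)) (use that in simp_all)
  qed
  then show ?case unfolding chain_simps comp_apply .
qed

lemma jet_exp:
  "jet (\<lambda>s t. complex_of_real (exp ((a * s + b * t) * g))) (complex_of_real (a * g)) (complex_of_real (b * g)) (complex_of_real (a * b * g\<^sup>2))"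
proof -
  have ov: "(f has_real_derivative D) (at x) \<Longrightarrow> ((\<lambda>x. complex_of_real (f x)) has_vector_derivative complex_of_real D) (at x)" for f D x
    by (intro has_vector_derivative_of_real) (simp add: has_real_derivative_iff_has_vector_derivative)
  have 1: "((\<lambda>s. exp ((a * s + b * 0) * g)) has_real_derivative (a * g)) (at 0)"
    by (auto intro!: derivative_eq_intros)
  have 2: "((\<lambda>t. exp ((a * s + b * t) * g)) has_real_derivative (b * g * exp (a * s * g))) (at 0)" for s
    by (auto intro!: derivative_eq_intros)
  have 3: "((\<lambda>s. b * g * exp (a * s * g)) has_real_derivative (a * b * g\<^sup>2)) (at 0)"
    by (auto intro!: derivative_eq_intros simp: power2_eq_square)
  show ?thesis unfolding jet_def using ov[OF 1] ov[OF 2] ov[OF 3]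
    by (intro conjI exI[of _ "\<lambda>s. complex_of_real (b * g * exp (a * s * g))"]) auto
qed

lemma jet_scale: "jet f a b c \<Longrightarrow> jet (\<lambda>s t. k * f s t) (k * a) (k * b) (k * c)"
  using jet_mult[OF jet_const, of f a b c k] by simp

section \<open>The twisted map of one interaction and its derivatives\<close>

context ne_model
begin

text \<open>Expansion along the spectral projections of \<open>H'\<close>, which separates the
  function \<open>a\<close> from the map \<open>G\<close>.\<close>

lemma functional_sdf:
  assumes G: "linmap d G" and pq: "p < d" "q < d"
  shows "G (sdf d P a) $$ (p,q) = (\<Sum>m<d. a m * G (sdf d P (\<lambda>i. if i = m then 1 else 0)) $$ (p,q))"
proof -
  let ?Pi = "\<lambda>m. sdf d P (\<lambda>i. if i = m then 1 else 0)"
  note Gc = carrier_matD[OF linmap_carrier[OF G sdf_carrier[OF P]]]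
  have *: "G (sdf d P (\<lambda>i. if i \<in> T then a i else 0)) $$ (p,q) = (\<Sum>m\<in>T. a m * G (?Pi m) $$ (p,q))" if "finite T" for T
    using that
  proof (induction T)
    case empty
    have "sdf d P (\<lambda>i. 0) = 0 \<cdot>\<^sub>m sdf d P (\<lambda>i. 0)" by (simp add: sdf_smult[OF P])
    then have "G (sdf d P (\<lambda>i. 0)) = 0 \<cdot>\<^sub>m G (sdf d P (\<lambda>i. 0))" using linmap_smult[OF G sdf_carrier[OF P]] by metis
    then have "G (sdf d P (\<lambda>i. 0)) $$ (p,q) = (0 \<cdot>\<^sub>m G (sdf d P (\<lambda>i. 0))) $$ (p,q)" by simp
    also have "\<dots> = 0" using Gc pq by simp
    finally show ?case by simp
  next
    case (insert m T)
    have "sdf d P (\<lambda>i. if i \<in> insert m T then a i else 0) = a m \<cdot>\<^sub>m ?Pi m + sdf d P (\<lambda>i. if i \<in> T then a i else 0)"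
      unfolding sdf_smult[OF P] sdf_add[OF P] using insert.hyps by (intro sdf_cong[OF P]) auto
    then have "G (sdf d P (\<lambda>i. if i \<in> insert m T then a i else 0)) = a m \<cdot>\<^sub>m G (?Pi m) + G (sdf d P (\<lambda>i. if i \<in> T then a i else 0))"
      using linmap_add[OF G] linmap_smult[OF G] sdf_carrier[OF P] by simp
    then show ?case using insert Gc pq by simp
  qed
  have "sdf d P a = sdf d P (\<lambda>i. if i \<in> {..<d} then a i else 0)" by (intro sdf_cong[OF P]) auto
  then show ?thesis using *[of "{..<d}"] by simp
qed

text \<open>By \<open>deform_formula\<close> this is the deformed map once
  \<open>x = a * betaj S \<zeta> j\<close>.\<close>

definition Tw :: "(nat \<Rightarrow> real) \<Rightarrow> nat \<Rightarrow> real \<Rightarrow> complex mat \<Rightarrow> complex mat" where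
  "Tw \<zeta> j x X = Ljd S \<zeta> j (X * W x) * W (- x)"

text \<open>The derivative of \<open>Tw\<close> in \<open>x\<close> at 0, equal to
  \<open>Ttot S\<close> times \<open>phij\<close>.\<close>

definition B1 :: "(nat \<Rightarrow> real) \<Rightarrow> nat \<Rightarrow> complex mat \<Rightarrow> complex mat" where
  "B1 \<zeta> j X = Ljd S \<zeta> j (X * H) - Ljd S \<zeta> j X * H"

text \<open>The second derivative of \<open>Tw\<close> in \<open>x\<close> at 0. The twist acts on
  the right on both occasions, so the two cross terms of the Leibniz rule coincide.\<close>

definition B2 :: "(nat \<Rightarrow> real) \<Rightarrow> nat \<Rightarrow> complex mat \<Rightarrow> complex mat" where
  "B2 \<zeta> j X = Ljd S \<zeta> j (X * (H * H)) - 2 \<cdot>\<^sub>m (Ljd S \<zeta> j (X * H) * H) + Ljd S \<zeta> j X * (H * H)"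

lemma Ljd_linmap: "j \<in> {1..nenv S} \<Longrightarrow> linmap d (Ljd S \<zeta> j)"
  by (rule posmap_linmap[OF Ljd_posmap[OF wf]])

lemma Tw_linmap: "j \<in> {1..nenv S} \<Longrightarrow> linmap d (Tw \<zeta> j x)"
  unfolding Tw_def by (intro linmap_comp'[OF linmap_mult_right[of "W (-x)"]] linmap_comp'[OF Ljd_linmap] linmap_mult_right W_carrier)

lemma B1_linmap: "j \<in> {1..nenv S} \<Longrightarrow> linmap d (B1 \<zeta> j)"
  unfolding B1_def by (intro linmap_sub linmap_comp'[OF linmap_mult_right[of H]] linmap_comp'[OF Ljd_linmap] linmap_mult_right H_carrier Ljd_linmap)

lemma B2_linmap: "j \<in> {1..nenv S} \<Longrightarrow> linmap d (B2 \<zeta> j)"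
  unfolding B2_def
  by (intro linmap_plus linmap_sub linmap_scale linmap_comp'[OF linmap_mult_right[of "H*H"]] linmap_comp'[OF linmap_mult_right[of H]]
      linmap_comp'[OF Ljd_linmap] linmap_mult_right H_carrier sq_mult_carrier Ljd_linmap)

text \<open>The expression is bilinear in the two spectral functions, so one expansion handles all
  powers of \<open>H'\<close> on either side; special choices of \<open>a\<close> and
  \<open>b\<close> give every term of \<open>B1\<close> and \<open>B2\<close>.\<close>

lemma twist_entry:
  assumes j: "j \<in> {1..nenv S}" and X: "X \<in> carrier_mat d d" and pq: "p < d" "q < d"
  shows "(Ljd S \<zeta> j (X * sdf d P a) * sdf d P b) $$ (p,q) = (\<Sum>m<d. \<Sum>n<d. a m * b n *
    (Ljd S \<zeta> j (X * sdf d P (\<lambda>i. if i = m then 1 else 0)) * sdf d P (\<lambda>i. if i = n then 1 else 0)) $$ (p,q))"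
proof -
  let ?Pi = "\<lambda>m. sdf d P (\<lambda>i. if i = m then 1 else 0)"
  have l1: "linmap d (\<lambda>Z. Ljd S \<zeta> j (X * Z) * sdf d P b)"
    by (intro linmap_comp'[OF linmap_mult_right[of "sdf d P b"]] linmap_comp'[OF Ljd_linmap[OF j]] linmap_mult_left X sdf_carrier[OF P])
  have l2: "linmap d (\<lambda>Z. Ljd S \<zeta> j (X * ?Pi m) * Z)" for m
    by (intro linmap_mult_left linmap_carrier[OF Ljd_linmap[OF j]] sq_mult_carrier X sdf_carrier[OF P])
  have "(Ljd S \<zeta> j (X * sdf d P a) * sdf d P b) $$ (p,q) = (\<Sum>m<d. a m * (Ljd S \<zeta> j (X * ?Pi m) * sdf d P b) $$ (p,q))"
    by (rule functional_sdf[OF l1 pq])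
  also have "\<dots> = (\<Sum>m<d. a m * (\<Sum>n<d. b n * (Ljd S \<zeta> j (X * ?Pi m) * ?Pi n) $$ (p,q)))"
    by (intro sum.cong refl arg_cong2[of _ _ _ _ "(*)"] functional_sdf[OF l2 pq])
  finally show ?thesis by (simp only: sum_distrib_left mult.assoc)
qed

text \<open>In the eigenbasis of \<open>H'\<close> the twist multiplies each pair of spectral
  components by \<open>exp (x * (h m - h n))\<close>. An entry is thus a finite sum of exponentials,
  from which smoothness and all derivatives can be read off.\<close>

lemma Tw_entry:
  assumes j: "j \<in> {1..nenv S}" and X: "X \<in> carrier_mat d d" and pq: "p < d" "q < d"
  shows "Tw \<zeta> j x X $$ (p,q) = (\<Sum>m<d. \<Sum>n<d. 
    (Ljd S \<zeta> j (X * sdf d P (\<lambda>i. if i = m then 1 else 0)) * sdf d P (\<lambda>i. if i = n then 1 else 0)) $$ (p,q) * complex_of_real (exp (x * (h m - h n))))"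
proof -
  have "complex_of_real (exp (x * h m)) * complex_of_real (exp (- x * h n)) = complex_of_real (exp (x * (h m - h n)))" for m n
    by (simp only: of_real_mult[symmetric] exp_add[symmetric]) (simp add: algebra_simps)
  moreover have "Tw \<zeta> j x X $$ (p,q) = (\<Sum>m<d. \<Sum>n<d. complex_of_real (exp (x * h m)) * complex_of_real (exp (- x * h n)) *
    (Ljd S \<zeta> j (X * sdf d P (\<lambda>i. if i = m then 1 else 0)) * sdf d P (\<lambda>i. if i = n then 1 else 0)) $$ (p,q))"
    unfolding Tw_def W_def by (rule twist_entry[OF j X pq])
  ultimately show ?thesis by (simp only: mult.commute)
qed

text \<open>The first and second moments of \<open>h m - h n\<close> against the coefficients
  \<open>C m n\<close> are the entries of \<open>B1\<close> and \<open>B2\<close>; expanding the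
  square gives the three terms of \<open>B2\<close>.\<close>

lemma Tw_jet:
  assumes j: "j \<in> {1..nenv S}" and X: "X \<in> carrier_mat d d" and pq: "p < d" "q < d"
  shows "jet (\<lambda>s t. Tw \<zeta> j (a * s + b * t) X $$ (p,q)) (complex_of_real a * B1 \<zeta> j X $$ (p,q))
     (complex_of_real b * B1 \<zeta> j X $$ (p,q)) (complex_of_real (a * b) * B2 \<zeta> j X $$ (p,q))"
proof -
  define C where "C m n = (Ljd S \<zeta> j (X * sdf d P (\<lambda>i. if i = m then 1 else 0)) * sdf d P (\<lambda>i. if i = n then 1 else 0)) $$ (p,q)" for m n
  let ?h = "\<lambda>i. complex_of_real (h i)"
  have LX: "Ljd S \<zeta> j X \<in> carrier_mat d d" and LXH: "Ljd S \<zeta> j (X * H) \<in> carrier_mat d d" and LXHH: "Ljd S \<zeta> j (X * (H * H)) \<in> carrier_mat d d"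
    using Ljd_linmap[OF j] X by auto
  note te = twist_entry[OF j X pq, of \<zeta>, folded C_def]
  have HH: "H * H = sdf d P (\<lambda>i. ?h i * ?h i)" unfolding H_sdf sdf_mult[OF P] ..
  have X1: "X * sdf d P (\<lambda>i. 1) = X" unfolding sdf_one[OF P] by (rule right_mult_one_mat[OF X])
  have e10: "Ljd S \<zeta> j (X * H) $$ (p,q) = (\<Sum>m<d. \<Sum>n<d. ?h m * 1 * C m n)"
    using te[of ?h "\<lambda>i. 1"] unfolding sdf_one[OF P] H_sdf[symmetric] right_mult_one_mat[OF LXH] .
  have e01: "(Ljd S \<zeta> j X * H) $$ (p,q) = (\<Sum>m<d. \<Sum>n<d. 1 * ?h n * C m n)"
    using te[of "\<lambda>i. 1" ?h] unfolding X1 H_sdf[symmetric] .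
  have e20: "Ljd S \<zeta> j (X * (H * H)) $$ (p,q) = (\<Sum>m<d. \<Sum>n<d. (?h m * ?h m) * 1 * C m n)"
    using te[of "\<lambda>i. ?h i * ?h i" "\<lambda>i. 1"] unfolding sdf_one[OF P] HH[symmetric] right_mult_one_mat[OF LXHH] .
  have e11: "(Ljd S \<zeta> j (X * H) * H) $$ (p,q) = (\<Sum>m<d. \<Sum>n<d. ?h m * ?h n * C m n)"
    using te[of ?h ?h] unfolding H_sdf[symmetric] .
  have e02: "(Ljd S \<zeta> j X * (H * H)) $$ (p,q) = (\<Sum>m<d. \<Sum>n<d. 1 * (?h n * ?h n) * C m n)"
    using te[of "\<lambda>i. 1" "\<lambda>i. ?h i * ?h i"] unfolding X1 HH[symmetric] .
  have b1: "B1 \<zeta> j X $$ (p,q) = (\<Sum>m<d. \<Sum>n<d. C m n * complex_of_real (h m - h n))"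
  proof -
    have "B1 \<zeta> j X $$ (p,q) = Ljd S \<zeta> j (X * H) $$ (p,q) - (Ljd S \<zeta> j X * H) $$ (p,q)"
      unfolding B1_def using LX LXH pq carrier_matD[OF H_carrier] by (intro index_minus_mat) auto
    then show ?thesis unfolding e10 e01 sum_subtractf[symmetric] by (simp add: algebra_simps)
  qed
  have b2: "B2 \<zeta> j X $$ (p,q) = (\<Sum>m<d. \<Sum>n<d. C m n * complex_of_real ((h m - h n)\<^sup>2))"
  proof -
    have "B2 \<zeta> j X $$ (p,q) = Ljd S \<zeta> j (X * (H * H)) $$ (p,q) - 2 * (Ljd S \<zeta> j (X * H) * H) $$ (p,q) + (Ljd S \<zeta> j X * (H * H)) $$ (p,q)"
      unfolding B2_def using LX LXH LXHH pq carrier_matD[OF H_carrier] by simp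
    then show ?thesis unfolding e20 e11 e02 sum_distrib_left sum_subtractf[symmetric] sum.distrib[symmetric]
      by (simp add: algebra_simps power2_eq_square)
  qed
  have "jet (\<lambda>s t. \<Sum>m<d. \<Sum>n<d. C m n * complex_of_real (exp ((a * s + b * t) * (h m - h n))))
     (\<Sum>m<d. \<Sum>n<d. C m n * complex_of_real (a * (h m - h n))) (\<Sum>m<d. \<Sum>n<d. C m n * complex_of_real (b * (h m - h n)))
     (\<Sum>m<d. \<Sum>n<d. C m n * complex_of_real (a * b * (h m - h n)\<^sup>2))"
    by (intro jet_sum jet_scale jet_exp)
  moreover have sc: "(\<Sum>m<d. \<Sum>n<d. C m n * complex_of_real (k * g m n)) = complex_of_real k * (\<Sum>m<d. \<Sum>n<d. C m n * complex_of_real (g m n))" for k g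
    unfolding sum_distrib_left by (intro sum.cong refl) simp
  ultimately show ?thesis unfolding Tw_entry[OF j X pq] C_def[symmetric] b1 b2 by (simp only: sc)
qed

lemma Tw_sm:
  assumes j: "j \<in> {1..nenv S}" and X: "X \<in> carrier_mat d d" and pq: "p < d" "q < d"
  shows "sm UNIV (\<lambda>r. Tw \<zeta> j (a * fst (snd r) + b * snd (snd r)) X $$ (p,q))"
proof -
  have "sm UNIV (\<lambda>r. complex_of_real (exp ((a * fst (snd r) + b * snd (snd r)) * g)))" for g
  proof -
    have "sm UNIV (\<lambda>r. exp ((complex_of_real a * complex_of_real (fst (snd r)) + complex_of_real b * complex_of_real (snd (snd r))) * complex_of_real g))"
      by (intro sm_exp sm_mult sm_add sm_const sm_s sm_t)
    then show ?thesis by (simp flip: exp_of_real)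
  qed
  then show ?thesis unfolding Tw_entry[OF j X pq] by (intro sm_sum sm_mult sm_const)
qed

text \<open>A product rule for a twist applied to a moving argument: the argument is expanded in
  matrix units and the jets are multiplied entrywise. It is the induction step for
  compositions.\<close>

lemma Tw_jet_comp:
  assumes j: "j \<in> {1..nenv S}" and F: "\<And>s t. F s t \<in> carrier_mat d d" and m: "m1 \<in> carrier_mat d d" "m2 \<in> carrier_mat d d" "m3 \<in> carrier_mat d d"
    and J: "\<And>p q. p < d \<Longrightarrow> q < d \<Longrightarrow> jet (\<lambda>s t. F s t $$ (p,q)) (m1 $$ (p,q)) (m2 $$ (p,q)) (m3 $$ (p,q))"
    and pq: "p < d" "q < d"
  shows "jet (\<lambda>s t. Tw \<zeta> j (a * s + b * t) (F s t) $$ (p,q))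
    (Tw \<zeta> j 0 m1 $$ (p,q) + complex_of_real a * B1 \<zeta> j (F 0 0) $$ (p,q))
    (Tw \<zeta> j 0 m2 $$ (p,q) + complex_of_real b * B1 \<zeta> j (F 0 0) $$ (p,q))
    (complex_of_real (a * b) * B2 \<zeta> j (F 0 0) $$ (p,q) + complex_of_real b * B1 \<zeta> j m1 $$ (p,q) + complex_of_real a * B1 \<zeta> j m2 $$ (p,q) + Tw \<zeta> j 0 m3 $$ (p,q))"
proof -
  let ?E = "\<lambda>u v. munit d u v"
  let ?T = "\<lambda>u v. Tw \<zeta> j 0 (?E u v) $$ (p,q)" and ?B1 = "\<lambda>u v. B1 \<zeta> j (?E u v) $$ (p,q)" and ?B2 = "\<lambda>u v. B2 \<zeta> j (?E u v) $$ (p,q)"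
  have "jet (\<lambda>s t. \<Sum>u<d. \<Sum>v<d. F s t $$ (u,v) * Tw \<zeta> j (a * s + b * t) (?E u v) $$ (p,q))
    (\<Sum>u<d. \<Sum>v<d. F 0 0 $$ (u,v) * (complex_of_real a * ?B1 u v) + m1 $$ (u,v) * Tw \<zeta> j (a * 0 + b * 0) (?E u v) $$ (p,q))
    (\<Sum>u<d. \<Sum>v<d. F 0 0 $$ (u,v) * (complex_of_real b * ?B1 u v) + m2 $$ (u,v) * Tw \<zeta> j (a * 0 + b * 0) (?E u v) $$ (p,q))
    (\<Sum>u<d. \<Sum>v<d. F 0 0 $$ (u,v) * (complex_of_real (a * b) * ?B2 u v) + m1 $$ (u,v) * (complex_of_real b * ?B1 u v)
       + m2 $$ (u,v) * (complex_of_real a * ?B1 u v) + m3 $$ (u,v) * Tw \<zeta> j (a * 0 + b * 0) (?E u v) $$ (p,q))"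
    by (intro jet_sum jet_mult J Tw_jet[OF j] pq) auto
  moreover have "(\<Sum>u<d. \<Sum>v<d. Y $$ (u,v) * (k * G (?E u v) $$ (p,q))) = k * G Y $$ (p,q)" if "linmap d G" "Y \<in> carrier_mat d d" for Y k G
    unfolding linmap_expand[OF that pq] sum_distrib_left by (intro sum.cong refl) (simp only: mult.left_commute)
  moreover have "(\<Sum>u<d. \<Sum>v<d. Y $$ (u,v) * G (?E u v) $$ (p,q)) = G Y $$ (p,q)" if "linmap d G" "Y \<in> carrier_mat d d" for Y G
    unfolding linmap_expand[OF that pq] ..
  ultimately show ?thesis
    using F m B1_linmap[OF j] B2_linmap[OF j] Tw_linmap[OF j]
    unfolding linmap_expand[OF Tw_linmap[OF j] F pq] by (simp add: sum.distrib add.commute)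
qed

lemma W_0: "W 0 = 1\<^sub>m d"
  unfolding W_def using sdf_one[OF P] by simp

lemma Tw_0: "j \<in> {1..nenv S} \<Longrightarrow> X \<in> carrier_mat d d \<Longrightarrow> Tw \<zeta> j 0 X = Ljd S \<zeta> j X"
  using right_mult_one_mat[OF linmap_carrier[OF Ljd_linmap]] by (simp add: Tw_def W_0)

end

lemma linmap_zero: "linmap d G \<Longrightarrow> G (0\<^sub>m d d) = 0\<^sub>m d d"
proof -
  assume G: "linmap d G"
  have "(0::complex) \<cdot>\<^sub>m 0\<^sub>m d d = 0\<^sub>m d d" by (intro eq_matI) auto
  then have "G (0\<^sub>m d d) = 0 \<cdot>\<^sub>m G (0\<^sub>m d d)" using linmap_smult[OF G zero_carrier_mat, of 0] by simp
  also have "\<dots> = 0\<^sub>m d d" using linmap_carrier[OF G zero_carrier_mat] by (intro eq_matI) auto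
  finally show ?thesis .
qed

section \<open>Response formulas\<close>

text \<open>Pulls the scalar factors out of \<open>spectral_radius_jet\<close>. If
  \<open>bj * bk = 0\<close>, the scaled series says nothing about the unscaled one, so convergence
  of the latter is taken from \<open>poisson_summable\<close>.\<close>

theorem response_formulas:
  fixes A :: "real \<Rightarrow> real \<Rightarrow> complex mat \<Rightarrow> complex mat"
  assumes d: "d > 0" and pos: "\<And>s t. posmap d (A s t)"
    and smooth: "\<And>a b i j. i < d \<Longrightarrow> j < d \<Longrightarrow> sm UNIV (\<lambda>p. A (fst (snd p)) (snd (snd p)) (munit d a b) $$ (i,j))"
    and L: "A 0 0 = L" and one: "L (1\<^sub>m d) = 1\<^sub>m d" and st: "is_state d \<rho>"
    and inv: "\<And>Y. Y \<in> carrier_mat d d \<Longrightarrow> mtrace (\<rho> * L Y) = mtrace (\<rho> * Y)"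
    and lim: "\<And>Y i j. Y \<in> carrier_mat d d \<Longrightarrow> i < d \<Longrightarrow> j < d \<Longrightarrow>
       (\<lambda>N. (L ^^ N) Y $$ (i,j)) \<longlonglongrightarrow> mtrace (\<rho> * Y) * 1\<^sub>m d $$ (i,j)"
    and Jt: "\<And>Y i j. Y \<in> carrier_mat d d \<Longrightarrow> i < d \<Longrightarrow> j < d \<Longrightarrow>
       jet (\<lambda>s t. A s t Y $$ (i,j)) ((complex_of_real bk \<cdot>\<^sub>m K Y) $$ (i,j)) ((complex_of_real bj \<cdot>\<^sub>m J Y) $$ (i,j)) (Ast Y $$ (i,j))"
    and lin: "linmap d K" "linmap d J" "linmap d Ast"
  shows "\<exists>D. ((\<lambda>t. spec_rad d (A 0 t)) has_real_derivative D) (at 0) \<and> complex_of_real D = complex_of_real bj * mtrace (\<rho> * J (1\<^sub>m d))"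
    and "\<forall>\<^sub>F s in nhds 0. (\<lambda>t. spec_rad d (A s t)) differentiable (at 0)"
    and "\<exists>D \<Sigma>. ((\<lambda>s. deriv (\<lambda>t. spec_rad d (A s t)) 0) has_real_derivative D) (at 0) \<and>
       (\<lambda>n. mtrace (\<rho> * (J ((L ^^ n) (K (1\<^sub>m d) - mtrace (\<rho> * K (1\<^sub>m d)) \<cdot>\<^sub>m 1\<^sub>m d))
           + K ((L ^^ n) (J (1\<^sub>m d) - mtrace (\<rho> * J (1\<^sub>m d)) \<cdot>\<^sub>m 1\<^sub>m d))))) sums \<Sigma> \<and>
       complex_of_real D = complex_of_real (bj * bk) * \<Sigma> + mtrace (\<rho> * Ast (1\<^sub>m d))"
proof -
  let ?As = "\<lambda>Y. complex_of_real bk \<cdot>\<^sub>m K Y" and ?At = "\<lambda>Y. complex_of_real bj \<cdot>\<^sub>m J Y"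
  have lAs: "linmap d ?As" and lAt: "linmap d ?At" using lin by (auto intro: linmap_scale)
  have r: "\<rho> \<in> carrier_mat d d" and tr: "mtrace \<rho> = 1" using st by (auto simp: is_state_iff)
  have Llin: "linmap d L" using posmap_linmap[OF pos[of 0 0]] by (simp add: L)
  have LN: "linmap d (L ^^ n)" for n by (rule linmap_funpow[OF Llin])
  have K1: "K (1\<^sub>m d) \<in> carrier_mat d d" and J1: "J (1\<^sub>m d) \<in> carrier_mat d d" using lin by auto
  have g1: "\<exists>D. ((\<lambda>t. spec_rad d (A 0 t)) has_real_derivative D) (at 0) \<and> complex_of_real D = mtrace (\<rho> * ?At (1\<^sub>m d))"
    by (rule spectral_radius_jet(1)[where A = A and As = ?As and At = ?At and Ast = Ast and L = L])
       (fact d pos L one st lAs lAt lin(3) | erule (1) smooth | erule inv | erule (2) lim | erule (2) Jt)+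
  have g2: "\<forall>\<^sub>F s in nhds 0. (\<lambda>t. spec_rad d (A s t)) differentiable (at 0)"
    by (rule spectral_radius_jet(2)[where A = A and As = ?As and At = ?At and Ast = Ast and L = L])
       (fact d pos L one st lAs lAt lin(3) | erule (1) smooth | erule inv | erule (2) lim | erule (2) Jt)+
  have g3: "\<exists>D \<Sigma>. ((\<lambda>s. deriv (\<lambda>t. spec_rad d (A s t)) 0) has_real_derivative D) (at 0) \<and>
       (\<lambda>n. mtrace (\<rho> * (?At ((L ^^ n) (?As (1\<^sub>m d) - mtrace (\<rho> * ?As (1\<^sub>m d)) \<cdot>\<^sub>m 1\<^sub>m d))
           + ?As ((L ^^ n) (?At (1\<^sub>m d) - mtrace (\<rho> * ?At (1\<^sub>m d)) \<cdot>\<^sub>m 1\<^sub>m d))))) sums \<Sigma> \<and>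
       complex_of_real D = \<Sigma> + mtrace (\<rho> * Ast (1\<^sub>m d))"
    by (rule spectral_radius_jet(3)[where A = A and As = ?As and At = ?At and Ast = Ast and L = L])
       (fact d pos L one st lAs lAt lin(3) | erule (1) smooth | erule inv | erule (2) lim | erule (2) Jt)+
  show "\<exists>D. ((\<lambda>t. spec_rad d (A 0 t)) has_real_derivative D) (at 0) \<and> complex_of_real D = complex_of_real bj * mtrace (\<rho> * J (1\<^sub>m d))"
    using g1 unfolding mtrace_mult_smult[OF r J1] .
  show "\<forall>\<^sub>F s in nhds 0. (\<lambda>t. spec_rad d (A s t)) differentiable (at 0)" by (rule g2)
  define ZK where "ZK = K (1\<^sub>m d) - mtrace (\<rho> * K (1\<^sub>m d)) \<cdot>\<^sub>m 1\<^sub>m d"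
  define ZJ where "ZJ = J (1\<^sub>m d) - mtrace (\<rho> * J (1\<^sub>m d)) \<cdot>\<^sub>m 1\<^sub>m d"
  have Z: "ZK \<in> carrier_mat d d" "ZJ \<in> carrier_mat d d" unfolding ZK_def ZJ_def by (auto simp: minus_carrier_mat)
  have tZ: "mtrace (\<rho> * ZK) = 0" "mtrace (\<rho> * ZJ) = 0"
    unfolding ZK_def ZJ_def mtrace_mult_minus[OF r K1 smult_carrier_mat[OF one_carrier_mat]] mtrace_mult_minus[OF r J1 smult_carrier_mat[OF one_carrier_mat]]
      mtrace_mult_smult[OF r one_carrier_mat] right_mult_one_mat[OF r] tr by simp_all
  have sK: "summable (\<lambda>n. mtrace (\<rho> * J ((L ^^ n) ZK)))"
    by (rule poisson_summable[OF Llin one st _ _ lin(2) Z(1) tZ(1)]) (erule inv | erule (2) lim)+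
  have sJ: "summable (\<lambda>n. mtrace (\<rho> * K ((L ^^ n) ZJ)))"
    by (rule poisson_summable[OF Llin one st _ _ lin(1) Z(2) tZ(2)]) (erule inv | erule (2) lim)+
  have cZ: "J ((L ^^ n) ZK) \<in> carrier_mat d d" "K ((L ^^ n) ZJ) \<in> carrier_mat d d" for n
    using LN lin Z by auto
  define f where "f n = mtrace (\<rho> * (J ((L ^^ n) ZK) + K ((L ^^ n) ZJ)))" for n
  have "f = (\<lambda>n. mtrace (\<rho> * J ((L ^^ n) ZK)) + mtrace (\<rho> * K ((L ^^ n) ZJ)))"
    unfolding f_def using mtrace_mult_add[OF r cZ] by (intro ext)
  then have sf: "summable f" using summable_add[OF sK sJ] by simp
  have sAs: "?As (1\<^sub>m d) - mtrace (\<rho> * ?As (1\<^sub>m d)) \<cdot>\<^sub>m 1\<^sub>m d = complex_of_real bk \<cdot>\<^sub>m ZK"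
    unfolding mtrace_mult_smult[OF r K1] ZK_def using K1 by (intro eq_matI) (auto simp: algebra_simps)
  have sAt: "?At (1\<^sub>m d) - mtrace (\<rho> * ?At (1\<^sub>m d)) \<cdot>\<^sub>m 1\<^sub>m d = complex_of_real bj \<cdot>\<^sub>m ZJ"
    unfolding mtrace_mult_smult[OF r J1] ZJ_def using J1 by (intro eq_matI) (auto simp: algebra_simps)
  have trm: "mtrace (\<rho> * (?At ((L ^^ n) (complex_of_real bk \<cdot>\<^sub>m ZK)) + ?As ((L ^^ n) (complex_of_real bj \<cdot>\<^sub>m ZJ))))
     = complex_of_real (bj * bk) * f n" for n
  proof -
    have "?At ((L ^^ n) (complex_of_real bk \<cdot>\<^sub>m ZK)) = complex_of_real (bj * bk) \<cdot>\<^sub>m J ((L ^^ n) ZK)"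
      unfolding linmap_smult[OF LN Z(1)] linmap_smult[OF lin(2) linmap_carrier[OF LN Z(1)]] smult_smult_mat by simp
    moreover have "?As ((L ^^ n) (complex_of_real bj \<cdot>\<^sub>m ZJ)) = complex_of_real (bj * bk) \<cdot>\<^sub>m K ((L ^^ n) ZJ)"
      unfolding linmap_smult[OF LN Z(2)] linmap_smult[OF lin(1) linmap_carrier[OF LN Z(2)]] smult_smult_mat by (simp add: mult.commute)
    moreover have "complex_of_real (bj * bk) \<cdot>\<^sub>m J ((L ^^ n) ZK) + complex_of_real (bj * bk) \<cdot>\<^sub>m K ((L ^^ n) ZJ)
       = complex_of_real (bj * bk) \<cdot>\<^sub>m (J ((L ^^ n) ZK) + K ((L ^^ n) ZJ))"
      by (rule add_smult_distrib_left_mat[OF cZ, symmetric])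
    moreover have "J ((L ^^ n) ZK) + K ((L ^^ n) ZJ) \<in> carrier_mat d d" using cZ by simp
    ultimately show ?thesis unfolding f_def using mtrace_mult_smult[OF r] by simp
  qed
  obtain D \<Sigma> where D: "((\<lambda>s. deriv (\<lambda>t. spec_rad d (A s t)) 0) has_real_derivative D) (at 0)"
    and \<Sigma>: "(\<lambda>n. complex_of_real (bj * bk) * f n) sums \<Sigma>" and D2: "complex_of_real D = \<Sigma> + mtrace (\<rho> * Ast (1\<^sub>m d))"
    using g3 unfolding sAs sAt trm by blast
  have "(\<lambda>n. complex_of_real (bj * bk) * f n) sums (complex_of_real (bj * bk) * suminf f)"
    by (intro sums_mult summable_sums sf)
  then have "\<Sigma> = complex_of_real (bj * bk) * suminf f" using \<Sigma> sums_unique2 by blast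
  then have D3: "complex_of_real D = complex_of_real (bj * bk) * suminf f + mtrace (\<rho> * Ast (1\<^sub>m d))" using D2 by simp
  show "\<exists>D \<Sigma>. ((\<lambda>s. deriv (\<lambda>t. spec_rad d (A s t)) 0) has_real_derivative D) (at 0) \<and>
       (\<lambda>n. mtrace (\<rho> * (J ((L ^^ n) (K (1\<^sub>m d) - mtrace (\<rho> * K (1\<^sub>m d)) \<cdot>\<^sub>m 1\<^sub>m d))
           + K ((L ^^ n) (J (1\<^sub>m d) - mtrace (\<rho> * J (1\<^sub>m d)) \<cdot>\<^sub>m 1\<^sub>m d))))) sums \<Sigma> \<and>
       complex_of_real D = complex_of_real (bj * bk) * \<Sigma> + mtrace (\<rho> * Ast (1\<^sub>m d))"
    unfolding ZK_def[symmetric] ZJ_def[symmetric] f_def[symmetric]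
    using D summable_sums[OF sf] D3 by blast
qed

section \<open>The cyclic and the random dynamics\<close>

lemma compL_chain: "compL S \<zeta> a b = chain (Ljd S \<zeta>) [a..<b]"
  by (simp add: compL_def chain_def)

lemma Lcy_dual_chain: "Lcy_dual S \<zeta> = chain (Ljd S \<zeta>) [1..<nenv S + 1]"
  by (simp only: Lcy_dual_def compL_chain)

lemma Lcy_deform_chain: "Lcy_deform S \<zeta> \<alpha> = chain (\<lambda>i. Ljd_def S \<zeta> (\<alpha> i) i) [1..<nenv S + 1]"
  by (simp only: Lcy_deform_def chain_def)

lemma Lra_avg: "Lra S \<zeta> = avg (sdim S) (1 / real (nenv S)) (Lj S \<zeta>) [1..<nenv S + 1]"
  by (intro ext) (simp add: Lra_def avg_def)

lemma Lra_dual_avg: "Lra_dual S \<zeta> = avg (sdim S) (1 / real (nenv S)) (Ljd S \<zeta>) [1..<nenv S + 1]"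
  by (intro ext) (simp add: Lra_dual_def avg_def)

lemma Lra_deform_avg: "Lra_deform S \<zeta> \<alpha> = avg (sdim S) (1 / real (nenv S)) (\<lambda>i. Ljd_def S \<zeta> (\<alpha> i) i) [1..<nenv S + 1]"
  by (intro ext) (simp add: Lra_deform_def avg_def)

lemma env_set_eq: "set [1..<nenv S + 1] = {1..nenv S}"
  by (auto simp del: upt_Suc)

lemma env_set: "i \<in> set [1..<nenv S + 1] \<Longrightarrow> i \<in> {1..nenv S}"
  by auto

lemma nenv_pos: "well_formed S \<Longrightarrow> nenv S > 0"
  by (auto simp: well_formed_def)

lemma Ttot_pos: "well_formed S \<Longrightarrow> Ttot S > 0"
  unfolding Ttot_def well_formed_def by (intro sum_pos) auto

lemma cy_facts:
  assumes wf: "well_formed S"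
  shows "posmap (sdim S) (Lcy_dual S \<zeta>)" "Lcy_dual S \<zeta> (1\<^sub>m (sdim S)) = 1\<^sub>m (sdim S)"
    "trace_dual (sdim S) (Lcy S \<zeta>) (Lcy_dual S \<zeta>)"
    "\<exists>k>0. dominates (sdim S) k (Lcy_dual S \<zeta>) (Lcy_dual S \<zeta>')"
    "posmap (sdim S) (Lcy_deform S \<zeta> \<alpha>)" "Lcy_deform S \<zeta> (\<lambda>i. 0) = Lcy_dual S \<zeta>"
proof -
  show "posmap (sdim S) (Lcy_dual S \<zeta>)" unfolding Lcy_dual_chain
    by (rule chain_posmap) (rule Ljd_posmap[OF wf env_set])
  show "Lcy_dual S \<zeta> (1\<^sub>m (sdim S)) = 1\<^sub>m (sdim S)" unfolding Lcy_dual_chain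
    by (rule chain_fix) (rule Ljd_one[OF wf env_set])
  show "trace_dual (sdim S) (Lcy S \<zeta>) (Lcy_dual S \<zeta>)" unfolding Lcy_dual_chain Lcy_def
    by (rule chain_dual) (rule Lj_dual[OF wf env_set] posmap_linmap[OF Ljd_posmap[OF wf env_set]], assumption)+
  show "\<exists>k>0. dominates (sdim S) k (Lcy_dual S \<zeta>) (Lcy_dual S \<zeta>')" unfolding Lcy_dual_chain
    by (rule chain_dominates) (rule Ljd_dominates[OF wf env_set] Ljd_posmap[OF wf env_set], assumption)+
  show "posmap (sdim S) (Lcy_deform S \<zeta> \<alpha>)" unfolding Lcy_deform_chain
    by (rule chain_posmap) (rule Ljd_def_posmap[OF wf env_set])
  show "Lcy_deform S \<zeta> (\<lambda>i. 0) = Lcy_dual S \<zeta>" unfolding Lcy_deform_chain Lcy_dual_chain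
    by (rule chain_cong) (rule Ljd_def_0[OF wf env_set])
qed

lemma ra_facts:
  assumes wf: "well_formed S"
  shows "posmap (sdim S) (Lra_dual S \<zeta>)" "Lra_dual S \<zeta> (1\<^sub>m (sdim S)) = 1\<^sub>m (sdim S)"
    "trace_dual (sdim S) (Lra S \<zeta>) (Lra_dual S \<zeta>)"
    "\<exists>k>0. dominates (sdim S) k (Lra_dual S \<zeta>) (Lra_dual S \<zeta>')"
    "posmap (sdim S) (Lra_deform S \<zeta> \<alpha>)" "Lra_deform S \<zeta> (\<lambda>i. 0) = Lra_dual S \<zeta>"
proof -
  have c: "1 / real (nenv S) \<ge> 0" by simp
  show "posmap (sdim S) (Lra_dual S \<zeta>)" unfolding Lra_dual_avg
    by (rule avg_posmap[OF _ c]) (rule Ljd_posmap[OF wf env_set])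
  show "trace_dual (sdim S) (Lra S \<zeta>) (Lra_dual S \<zeta>)" unfolding Lra_dual_avg Lra_avg
    by (rule avg_dual) (rule Lj_dual[OF wf env_set] posmap_linmap[OF Ljd_posmap[OF wf env_set]], assumption)+
  show "\<exists>k>0. dominates (sdim S) k (Lra_dual S \<zeta>) (Lra_dual S \<zeta>')" unfolding Lra_dual_avg
    by (rule avg_dominates[OF _ _ _ c]) (rule Ljd_dominates[OF wf env_set] Ljd_posmap[OF wf env_set], assumption)+
  show "posmap (sdim S) (Lra_deform S \<zeta> \<alpha>)" unfolding Lra_deform_avg
    by (rule avg_posmap[OF _ c]) (rule Ljd_def_posmap[OF wf env_set])
  show "Lra_deform S \<zeta> (\<lambda>i. 0) = Lra_dual S \<zeta>"
  proof -
    have "msum (sdim S) (\<lambda>i. Ljd_def S \<zeta> 0 i X) js = msum (sdim S) (\<lambda>i. Ljd S \<zeta> i X) js" if "set js \<subseteq> {1..nenv S}" for js X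
      using that by (induction js) (auto simp: msum_Nil msum_Cons Ljd_def_0[OF wf])
    from this[of "[1..<nenv S + 1]"] have "msum (sdim S) (\<lambda>i. Ljd_def S \<zeta> 0 i X) [1..<nenv S + 1] = msum (sdim S) (\<lambda>i. Ljd S \<zeta> i X) [1..<nenv S + 1]" for X
      unfolding env_set_eq by blast
    then show ?thesis unfolding Lra_deform_avg Lra_dual_avg avg_def by (intro ext) (simp only:)
  qed
  have one: "Ljd S \<zeta> i (1\<^sub>m (sdim S)) = 1\<^sub>m (sdim S)" if "i \<in> set [1..<nenv S + 1]" for i by (rule Ljd_one[OF wf env_set[OF that]])
  show "Lra_dual S \<zeta> (1\<^sub>m (sdim S)) = 1\<^sub>m (sdim S)"
  proof (rule eq_matI)
    fix p q assume "p < dim_row (1\<^sub>m (sdim S) :: complex mat)" "q < dim_col (1\<^sub>m (sdim S) :: complex mat)"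
    then have pq: "p < sdim S" "q < sdim S" by auto
    have c1: "Ljd S \<zeta> i (1\<^sub>m (sdim S)) \<in> carrier_mat (sdim S) (sdim S)" if "i \<in> set [1..<nenv S + 1]" for i
      unfolding one[OF that] by simp
    have ms: "msum (sdim S) (\<lambda>i. Ljd S \<zeta> i (1\<^sub>m (sdim S))) [1..<nenv S + 1] \<in> carrier_mat (sdim S) (sdim S)" by (rule msum_carrier[OF c1])
    have "msum (sdim S) (\<lambda>i. Ljd S \<zeta> i (1\<^sub>m (sdim S))) [1..<nenv S + 1] $$ (p,q) = (\<Sum>i\<in>set [1..<nenv S + 1]. Ljd S \<zeta> i (1\<^sub>m (sdim S)) $$ (p,q))"
      by (rule msum_index[OF c1 _ pq]) auto
    also have "\<dots> = of_nat (nenv S) * 1\<^sub>m (sdim S) $$ (p,q)" using one unfolding env_set_eq by simp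
    finally show "Lra_dual S \<zeta> (1\<^sub>m (sdim S)) $$ (p,q) = 1\<^sub>m (sdim S) $$ (p,q)"
      unfolding Lra_dual_avg avg_def using ms pq nenv_pos[OF wf] by simp
  next
    have c1: "Ljd S \<zeta> i (1\<^sub>m (sdim S)) \<in> carrier_mat (sdim S) (sdim S)" if "i \<in> set [1..<nenv S + 1]" for i
      unfolding one[OF that] by simp
    have ms: "msum (sdim S) (\<lambda>i. Ljd S \<zeta> i (1\<^sub>m (sdim S))) [1..<nenv S + 1] \<in> carrier_mat (sdim S) (sdim S)" by (rule msum_carrier[OF c1])
    show "dim_row (Lra_dual S \<zeta> (1\<^sub>m (sdim S))) = dim_row (1\<^sub>m (sdim S) :: complex mat)"
      "dim_col (Lra_dual S \<zeta> (1\<^sub>m (sdim S))) = dim_col (1\<^sub>m (sdim S) :: complex mat)"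
      unfolding Lra_dual_avg avg_def using ms by auto
  qed
qed

lemma doeblin_cy:
  assumes wf: "well_formed S" and er: "ER_cy S"
  shows "\<exists>n e. e > 0 \<and> (\<forall>Y. psd (sdim S) Y \<longrightarrow> psd (sdim S) ((Lcy_dual S \<zeta> ^^ n) Y - (complex_of_real e * mtrace Y) \<cdot>\<^sub>m 1\<^sub>m (sdim S)))"
proof -
  obtain \<zeta>' where "primitive (sdim S) (Lcy S \<zeta>')" using er by (auto simp: ER_cy_def)
  from primitive_doeblin[OF this cy_facts(3)[OF wf] cy_facts(1)[OF wf]]
  obtain n e where D: "e > 0 \<and> (\<forall>Y. psd (sdim S) Y \<longrightarrow> psd (sdim S) ((Lcy_dual S \<zeta>' ^^ n) Y - (complex_of_real e * mtrace Y) \<cdot>\<^sub>m 1\<^sub>m (sdim S)))" by blast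
  obtain k where k: "k > 0" "dominates (sdim S) k (Lcy_dual S \<zeta>) (Lcy_dual S \<zeta>')" using cy_facts(4)[OF wf] by blast
  show ?thesis by (rule doeblin_transfer[OF D k(2) cy_facts(1)[OF wf] cy_facts(1)[OF wf] k(1)])
qed

lemma doeblin_ra:
  assumes wf: "well_formed S" and er: "ER_ra S"
  shows "\<exists>n e. e > 0 \<and> (\<forall>Y. psd (sdim S) Y \<longrightarrow> psd (sdim S) ((Lra_dual S \<zeta> ^^ n) Y - (complex_of_real e * mtrace Y) \<cdot>\<^sub>m 1\<^sub>m (sdim S)))"
proof -
  obtain \<zeta>' where "primitive (sdim S) (Lra S \<zeta>')" using er by (auto simp: ER_ra_def)
  from primitive_doeblin[OF this ra_facts(3)[OF wf] ra_facts(1)[OF wf]]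
  obtain n e where D: "e > 0 \<and> (\<forall>Y. psd (sdim S) Y \<longrightarrow> psd (sdim S) ((Lra_dual S \<zeta>' ^^ n) Y - (complex_of_real e * mtrace Y) \<cdot>\<^sub>m 1\<^sub>m (sdim S)))" by blast
  obtain k where k: "k > 0" "dominates (sdim S) k (Lra_dual S \<zeta>) (Lra_dual S \<zeta>')" using ra_facts(4)[OF wf] by blast
  show ?thesis by (rule doeblin_transfer[OF D k(2) ra_facts(1)[OF wf] ra_facts(1)[OF wf] k(1)])
qed

text \<open>Trace out the environment in (NE) at \<open>z = 0\<close>, where every environment is at
  \<open>beta_ref\<close>.\<close>

lemma NE_invariant:
  assumes wf: "well_formed S" and ne: "NE S \<rho>p" and j: "j \<in> {1..nenv S}"
  shows "Lj S (\<lambda>_. 0) j (\<rho>p 0) = \<rho>p 0"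
proof -
  have st: "is_state (sdim S) (\<rho>p 0)" and U: "Uj S j * kron (\<rho>p 0) (gibbs (beta_ref S - 0) (hamE S j)) * adj (Uj S j) = kron (\<rho>p 0) (gibbs (beta_ref S - 0) (hamE S j))"
    using ne[unfolded NE_def, rule_format, of 0] j by auto
  have \<rho>: "\<rho>p 0 \<in> carrier_mat (sdim S) (sdim S)" using st by (simp add: is_state_iff)
  have g: "gibbs (beta_ref S - 0) (hamE S j) = rhoE S (\<lambda>_. 0) j" by (simp add: rhoE_def betaj_def)
  have "Lj S (\<lambda>_. 0) j (\<rho>p 0) = ptrace2 (edim S j) (kron (\<rho>p 0) (rhoE S (\<lambda>_. 0) j))"
    using U unfolding g Lj_def by simp
  also have "\<dots> = mtrace (rhoE S (\<lambda>_. 0) j) \<cdot>\<^sub>m \<rho>p 0"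
    by (rule ptrace2_kron[OF \<rho> psd_carrier[OF rhoE_facts(1)[OF wf j]] wf_env(1)[OF wf j]])
  also have "\<dots> = \<rho>p 0" unfolding rhoE_facts(2)[OF wf j] using \<rho> by (intro eq_matI) auto
  finally show ?thesis .
qed

text \<open>At \<open>\<zeta> = 0\<close> the state \<open>\<rho>p 0\<close> is invariant under each
  interaction, hence under the cycle and under the average. Either ergodicity hypothesis then gives
  it full rank through \<open>invariant_state_faithful\<close>, and this is what the logarithm in
  \<open>Hprime\<close> requires.\<close>

lemma NE_faithful:
  assumes wf: "well_formed S" and ne: "NE S \<rho>p" and er: "ER_cy S \<or> ER_ra S"
  shows "\<exists>P h. ne_model S \<rho>p P h"
proof -
  let ?d = "sdim S" and ?z = "\<lambda>_::nat. 0::real"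
  have st: "is_state ?d (\<rho>p 0)" using ne by (auto simp: NE_def)
  have \<rho>: "\<rho>p 0 \<in> carrier_mat ?d ?d" using st by (simp add: is_state_iff)
  have "\<exists>e>0. \<forall>v. e * (\<Sum>i<?d. (cmod (v i))\<^sup>2) \<le> Re (qf ?d (\<rho>p 0) v)"
    using er
  proof
    assume er: "ER_cy S"
    have "foldr (\<lambda>j g. g \<circ> Lj S ?z j) js id (\<rho>p 0) = \<rho>p 0" if "set js \<subseteq> {1..nenv S}" for js
      using that by (induction js) (auto simp: NE_invariant[OF wf ne])
    from this[of "[1..<nenv S + 1]"] have "Lcy S ?z (\<rho>p 0) = \<rho>p 0" unfolding Lcy_def env_set_eq by blast
    then show ?thesis
      using invariant_state_faithful[OF doeblin_cy[OF wf er] cy_facts(3)[OF wf] posmap_linmap[OF cy_facts(1)[OF wf]] st] by blast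
  next
    assume er: "ER_ra S"
    have "Lra S ?z (\<rho>p 0) = \<rho>p 0"
    proof (rule eq_matI)
      have c1: "Lj S ?z i (\<rho>p 0) \<in> carrier_mat ?d ?d" if "i \<in> set [1..<nenv S + 1]" for i
        unfolding NE_invariant[OF wf ne env_set[OF that]] by (rule \<rho>)
      have ms: "msum ?d (\<lambda>i. Lj S ?z i (\<rho>p 0)) [1..<nenv S + 1] \<in> carrier_mat ?d ?d" by (rule msum_carrier[OF c1])
      fix p q assume "p < dim_row (\<rho>p 0)" "q < dim_col (\<rho>p 0)"
      then have pq: "p < ?d" "q < ?d" using \<rho> by auto
      have "msum ?d (\<lambda>i. Lj S ?z i (\<rho>p 0)) [1..<nenv S + 1] $$ (p,q) = (\<Sum>i\<in>set [1..<nenv S + 1]. Lj S ?z i (\<rho>p 0) $$ (p,q))"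
        by (rule msum_index[OF c1 _ pq]) auto
      also have "\<dots> = of_nat (nenv S) * \<rho>p 0 $$ (p,q)" unfolding env_set_eq using NE_invariant[OF wf ne] by simp
      finally show "Lra S ?z (\<rho>p 0) $$ (p,q) = \<rho>p 0 $$ (p,q)"
        unfolding Lra_avg avg_def using ms pq nenv_pos[OF wf] by simp
    next
      have c1: "Lj S ?z i (\<rho>p 0) \<in> carrier_mat ?d ?d" if "i \<in> set [1..<nenv S + 1]" for i
        unfolding NE_invariant[OF wf ne env_set[OF that]] by (rule \<rho>)
      have ms: "msum ?d (\<lambda>i. Lj S ?z i (\<rho>p 0)) [1..<nenv S + 1] \<in> carrier_mat ?d ?d" by (rule msum_carrier[OF c1])
      show "dim_row (Lra S ?z (\<rho>p 0)) = dim_row (\<rho>p 0)" "dim_col (Lra S ?z (\<rho>p 0)) = dim_col (\<rho>p 0)"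
        unfolding Lra_avg avg_def using ms \<rho> by auto
    qed
    then show ?thesis
      using invariant_state_faithful[OF doeblin_ra[OF wf er] ra_facts(3)[OF wf] posmap_linmap[OF ra_facts(1)[OF wf]] st] by blast
  qed
  then obtain e where e: "e > 0" "\<And>v. e * (\<Sum>i<?d. (cmod (v i))\<^sup>2) \<le> Re (qf ?d (\<rho>p 0) v)" by blast
  have "psd ?d (\<rho>p 0)" using st by (simp add: is_state_iff)
  then obtain P f where P: "unitary_mat ?d P" "\<rho>p 0 = sdf ?d P (\<lambda>i. complex_of_real (f i))" using psd_spectral by blast
  \<comment> \<open>The quadratic form at the unit eigenvector with index \<open>k\<close> is
    \<open>f k\<close>, and faithfulness bounds it below by \<open>e\<close>.\<close>
  have f: "f k > 0" if k: "k < ?d" for k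
  proof -
    have "complex_of_real (\<Sum>i<?d. (cmod (P $$ (i,k)))\<^sup>2) = 1"
      using qf_sdf_column[OF P(1) k, of "\<lambda>i. 1"] unfolding sdf_one[OF P(1)] qf_one .
    then have "(\<Sum>i<?d. (cmod (P $$ (i,k)))\<^sup>2) = 1" by (metis of_real_eq_1_iff)
    then have "e \<le> Re (qf ?d (\<rho>p 0) (\<lambda>i. P $$ (i,k)))" using e(2)[of "\<lambda>i. P $$ (i,k)"] by simp
    also have "\<dots> = f k" unfolding P(2) qf_sdf_column[OF P(1) k] by simp
    finally show ?thesis using e(1) by simp
  qed
  have b: "beta_ref S > 0" using wf by (simp add: well_formed_def)
  \<comment> \<open>The witness \<open>h i = - ln (f i) / beta_ref S\<close> solves
    \<open>f i = exp (- beta_ref S * h i)\<close>.\<close>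
  have "\<rho>p 0 = sdf ?d P (\<lambda>i. complex_of_real (exp (- beta_ref S * (- ln (f i) / beta_ref S))))"
    unfolding P(2) using f b by (intro sdf_cong[OF P(1)]) simp
  then have "ne_model S \<rho>p P (\<lambda>i. - ln (f i) / beta_ref S)" unfolding ne_model_def using wf ne P(1) by simp
  then show ?thesis by blast
qed

section \<open>Derivatives of the cycle, and the response of both dynamics\<close>

context ne_model
begin

text \<open>Chain-rule weight: moving \<open>\<alpha>\<close> along direction \<open>k\<close> at
  unit speed changes the twist parameter of site \<open>i\<close> at this rate, which is
  \<open>betaj S \<zeta> k\<close> for \<open>i = k\<close> and 0 elsewhere.\<close>

abbreviation bw :: "(nat \<Rightarrow> real) \<Rightarrow> nat \<Rightarrow> nat \<Rightarrow> real" where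
  "bw \<zeta> k \<equiv> \<lambda>i. unitv k i * betaj S \<zeta> i"

abbreviation env :: "nat list" where
  "env \<equiv> [1..<nenv S + 1]"

lemma Ljd_def_Tw:
  assumes "i \<in> {1..nenv S}" "X \<in> carrier_mat d d"
  shows "Ljd_def S \<zeta> (s * unitv k i + t * unitv j i) i X = Tw \<zeta> i (bw \<zeta> k i * s + bw \<zeta> j i * t) X"
proof -
  have "(s * unitv k i + t * unitv j i) * betaj S \<zeta> i = bw \<zeta> k i * s + bw \<zeta> j i * t" by (simp add: algebra_simps)
  then show ?thesis unfolding deform_formula[OF assms] Tw_def by simp
qed

lemma chain_Ljd_carrier: "set js \<subseteq> {1..nenv S} \<Longrightarrow> X \<in> carrier_mat d d \<Longrightarrow> chain (Ljd S \<zeta>) js X \<in> carrier_mat d d"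
  using linmap_carrier[OF chain_linmap] Ljd_linmap by (metis subsetD)

lemma chain_Tw_linmap: "set js \<subseteq> {1..nenv S} \<Longrightarrow> linmap d (chain (\<lambda>i. Tw \<zeta> i (x i)) js)"
  by (rule chain_linmap) (rule Tw_linmap, blast)

lemma chain_Ljd_linmap: "set js \<subseteq> {1..nenv S} \<Longrightarrow> linmap d (chain (Ljd S \<zeta>) js)"
  by (rule chain_linmap) (rule Ljd_linmap, blast)

lemma chain_Tw_0: "set js \<subseteq> {1..nenv S} \<Longrightarrow> X \<in> carrier_mat d d \<Longrightarrow> chain (\<lambda>i. Tw \<zeta> i 0) js X = chain (Ljd S \<zeta>) js X"
  using chain_Ljd_carrier by (induction js) (auto simp: chain_simps Tw_0)

lemma chain_def_Tw:
  assumes "set js \<subseteq> {1..nenv S}" "X \<in> carrier_mat d d"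
  shows "chain (\<lambda>i. Ljd_def S \<zeta> (s * unitv k i + t * unitv j i) i) js X = chain (\<lambda>i. Tw \<zeta> i (bw \<zeta> k i * s + bw \<zeta> j i * t)) js X"
  using assms
proof (induction js)
  case (Cons i js)
  have "chain (\<lambda>i. Tw \<zeta> i (bw \<zeta> k i * s + bw \<zeta> j i * t)) js X \<in> carrier_mat d d"
    using Cons.prems by (intro linmap_carrier[OF chain_Tw_linmap]) auto
  then show ?case using Cons Ljd_def_Tw[of i] by (simp add: chain_simps)
qed (simp add: chain_simps)

text \<open>The first and mixed second derivatives at 0 of the composition of the maps
  \<open>Tw \<zeta> i (u i * s + v i * t)\<close> with respect to \<open>s\<close> and \<open>t\<close>.\<close>

primrec C1 :: "(nat \<Rightarrow> real) \<Rightarrow> (nat \<Rightarrow> real) \<Rightarrow> nat list \<Rightarrow> complex mat \<Rightarrow> complex mat" where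
  "C1 \<zeta> u [] X = 0\<^sub>m d d"
| "C1 \<zeta> u (i # js) X = Ljd S \<zeta> i (C1 \<zeta> u js X) + complex_of_real (u i) \<cdot>\<^sub>m B1 \<zeta> i (chain (Ljd S \<zeta>) js X)"

primrec C2 :: "(nat \<Rightarrow> real) \<Rightarrow> (nat \<Rightarrow> real) \<Rightarrow> (nat \<Rightarrow> real) \<Rightarrow> nat list \<Rightarrow> complex mat \<Rightarrow> complex mat" where
  "C2 \<zeta> u v [] X = 0\<^sub>m d d"
| "C2 \<zeta> u v (i # js) X = complex_of_real (u i * v i) \<cdot>\<^sub>m B2 \<zeta> i (chain (Ljd S \<zeta>) js X)
     + complex_of_real (v i) \<cdot>\<^sub>m B1 \<zeta> i (C1 \<zeta> u js X) + complex_of_real (u i) \<cdot>\<^sub>m B1 \<zeta> i (C1 \<zeta> v js X)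
     + Ljd S \<zeta> i (C2 \<zeta> u v js X)"

lemma linmap_zero_fun: "linmap n (\<lambda>X. 0\<^sub>m n n)"
  by (auto simp: linmap_def)

lemma C1_linmap: "set js \<subseteq> {1..nenv S} \<Longrightarrow> linmap d (C1 \<zeta> u js)"
proof (induction js)
  case Nil
  show ?case using linmap_zero_fun by (simp add: linmap_def)
next
  case (Cons i js)
  then have "linmap d (\<lambda>X. C1 \<zeta> u (i # js) X)" unfolding C1.simps
    by (intro linmap_plus linmap_scale linmap_comp'[OF Ljd_linmap] linmap_comp'[OF B1_linmap] chain_Ljd_linmap) auto
  then show ?case .
qed

lemma C2_linmap: "set js \<subseteq> {1..nenv S} \<Longrightarrow> linmap d (C2 \<zeta> u v js)"
proof (induction js)
  case Nil
  show ?case using linmap_zero_fun by (simp add: linmap_def)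
next
  case (Cons i js)
  then have "linmap d (\<lambda>X. C2 \<zeta> u v (i # js) X)" unfolding C2.simps
    by (intro linmap_plus linmap_scale linmap_comp'[OF Ljd_linmap] linmap_comp'[OF B1_linmap] linmap_comp'[OF B2_linmap]
        C1_linmap chain_Ljd_linmap) auto
  then show ?case .
qed

text \<open>Induction along the composition; the recursions of \<open>C1\<close> and
  \<open>C2\<close> are the coefficients produced by \<open>Tw_jet_comp\<close>.\<close>

lemma chain_jet:
  assumes js: "set js \<subseteq> {1..nenv S}" and X: "X \<in> carrier_mat d d" and pq: "p < d" "q < d"
  shows "jet (\<lambda>s t. chain (\<lambda>i. Tw \<zeta> i (u i * s + v i * t)) js X $$ (p,q))
     (C1 \<zeta> u js X $$ (p,q)) (C1 \<zeta> v js X $$ (p,q)) (C2 \<zeta> u v js X $$ (p,q))"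
  using js pq
proof (induction js arbitrary: p q)
  case Nil
  then show ?case using jet_const[of "X $$ (p,q)"] by (simp add: chain_simps)
next
  case (Cons i js)
  have i: "i \<in> {1..nenv S}" and js: "set js \<subseteq> {1..nenv S}" using Cons.prems by auto
  define F where "F s t = chain (\<lambda>i. Tw \<zeta> i (u i * s + v i * t)) js X" for s t
  have F: "F s t \<in> carrier_mat d d" for s t unfolding F_def by (rule linmap_carrier[OF chain_Tw_linmap[OF js] X])
  have F0: "F 0 0 = chain (Ljd S \<zeta>) js X" unfolding F_def using chain_Tw_0[OF js X] by simp
  have c: "C1 \<zeta> u js X \<in> carrier_mat d d" "C1 \<zeta> v js X \<in> carrier_mat d d" "C2 \<zeta> u v js X \<in> carrier_mat d d"
    using C1_linmap[OF js] C2_linmap[OF js] X by auto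
  have cL: "chain (Ljd S \<zeta>) js X \<in> carrier_mat d d" by (rule chain_Ljd_carrier[OF js X])
  have cc: "Ljd S \<zeta> i Z \<in> carrier_mat d d" "B1 \<zeta> i Z \<in> carrier_mat d d" "B2 \<zeta> i Z \<in> carrier_mat d d" if "Z \<in> carrier_mat d d" for Z
    using Ljd_linmap[OF i] B1_linmap[OF i] B2_linmap[OF i] that by auto
  have J: "jet (\<lambda>s t. F s t $$ (p,q)) (C1 \<zeta> u js X $$ (p,q)) (C1 \<zeta> v js X $$ (p,q)) (C2 \<zeta> u v js X $$ (p,q))" if "p < d" "q < d" for p q
    unfolding F_def by (rule Cons.IH[OF js that])
  note T = Tw_jet_comp[where \<zeta> = \<zeta> and F = F, OF i F c J Cons.prems(2,3), where a = "u i" and b = "v i"]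
  show ?case
    using T cc[OF cL] cc[OF c(1)] cc[OF c(2)] cc[OF c(3)] Cons.prems(2,3)
    unfolding chain_simps comp_apply F_def[symmetric] F0 Tw_0[OF i c(1)] Tw_0[OF i c(2)] Tw_0[OF i c(3)] C1.simps C2.simps
    by simp
qed

lemma zero_smult: "Z \<in> carrier_mat n n \<Longrightarrow> (0::complex) \<cdot>\<^sub>m Z = 0\<^sub>m n n"
  by (intro eq_matI) auto

lemma C1_0:
  assumes "set js \<subseteq> {1..nenv S}" "\<And>i. i \<in> set js \<Longrightarrow> u i = 0" "X \<in> carrier_mat d d"
  shows "C1 \<zeta> u js X = 0\<^sub>m d d"
  using assms
proof (induction js)
  case (Cons i js)
  have i: "i \<in> {1..nenv S}" and js: "set js \<subseteq> {1..nenv S}" using Cons.prems by auto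
  have "B1 \<zeta> i (chain (Ljd S \<zeta>) js X) \<in> carrier_mat d d"
    by (rule linmap_carrier[OF B1_linmap[OF i] chain_Ljd_carrier[OF js Cons.prems(3)]])
  then show ?case using Cons linmap_zero[OF Ljd_linmap[OF i]] by (simp add: zero_smult)
qed simp

lemma C1_skip:
  assumes "set xs \<subseteq> {1..nenv S}" "set ys \<subseteq> {1..nenv S}" "\<And>i. i \<in> set xs \<Longrightarrow> u i = 0" "X \<in> carrier_mat d d"
  shows "C1 \<zeta> u (xs @ ys) X = chain (Ljd S \<zeta>) xs (C1 \<zeta> u ys X)"
  using assms
proof (induction xs)
  case (Cons i js)
  have i: "i \<in> {1..nenv S}" and js: "set js \<subseteq> {1..nenv S}" using Cons.prems by auto
  have "B1 \<zeta> i (chain (Ljd S \<zeta>) (js @ ys) X) \<in> carrier_mat d d"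
    using js Cons.prems(2) by (intro linmap_carrier[OF B1_linmap[OF i] chain_Ljd_carrier] Cons.prems(4)) auto
  moreover have "Ljd S \<zeta> i (chain (Ljd S \<zeta>) js (C1 \<zeta> u ys X)) \<in> carrier_mat d d"
    by (rule linmap_carrier[OF Ljd_linmap[OF i] chain_Ljd_carrier[OF js linmap_carrier[OF C1_linmap[OF Cons.prems(2)] Cons.prems(4)]]])
  ultimately show ?case using Cons by (simp add: zero_smult chain_simps)
qed (simp add: chain_simps)

lemma C2_0:
  assumes "set js \<subseteq> {1..nenv S}" "\<And>i. i \<in> set js \<Longrightarrow> u i = 0" "X \<in> carrier_mat d d"
  shows "C2 \<zeta> u v js X = 0\<^sub>m d d"
  using assms
proof (induction js)
  case (Cons i js)
  have i: "i \<in> {1..nenv S}" and js: "set js \<subseteq> {1..nenv S}" using Cons.prems by auto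
  have "B2 \<zeta> i (chain (Ljd S \<zeta>) js X) \<in> carrier_mat d d" "B1 \<zeta> i (C1 \<zeta> v js X) \<in> carrier_mat d d"
    by (rule linmap_carrier[OF B2_linmap[OF i] chain_Ljd_carrier[OF js Cons.prems(3)]]
      linmap_carrier[OF B1_linmap[OF i] linmap_carrier[OF C1_linmap[OF js] Cons.prems(3)]])+
  moreover have "C1 \<zeta> u js X = 0\<^sub>m d d" by (rule C1_0[OF js]) (use Cons.prems in auto)
  moreover have "complex_of_real (v i) \<cdot>\<^sub>m 0\<^sub>m d d = 0\<^sub>m d d" by (intro eq_matI) auto
  ultimately show ?case using Cons linmap_zero[OF Ljd_linmap[OF i]] linmap_zero[OF B1_linmap[OF i]] by (simp add: zero_smult)
qed simp

text \<open>The recursion treats the two weights alike. This serves the case \<open>j < k\<close>,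
  because \<open>C2_env_off\<close> expects the earlier site as its first weight.\<close>

lemma C2_commute:
  assumes "set js \<subseteq> {1..nenv S}" "X \<in> carrier_mat d d"
  shows "C2 \<zeta> u v js X = C2 \<zeta> v u js X"
  using assms
proof (induction js)
  case (Cons i js)
  have i: "i \<in> {1..nenv S}" and js: "set js \<subseteq> {1..nenv S}" using Cons.prems by auto
  have c: "B2 \<zeta> i (chain (Ljd S \<zeta>) js X) \<in> carrier_mat d d" "B1 \<zeta> i (C1 \<zeta> w js X) \<in> carrier_mat d d" 
    "Ljd S \<zeta> i (C2 \<zeta> v u js X) \<in> carrier_mat d d" for w
    by (rule linmap_carrier[OF B2_linmap[OF i] chain_Ljd_carrier[OF js Cons.prems(2)]]
      linmap_carrier[OF B1_linmap[OF i] linmap_carrier[OF C1_linmap[OF js] Cons.prems(2)]]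
      linmap_carrier[OF Ljd_linmap[OF i] linmap_carrier[OF C2_linmap[OF js] Cons.prems(2)]])+
  show ?case using Cons c(1) c(2)[of u] c(2)[of v] c(3) by (intro eq_matI) (auto simp: mult.commute)
qed simp

lemma C2_skip:
  assumes "set xs \<subseteq> {1..nenv S}" "set ys \<subseteq> {1..nenv S}" "\<And>i. i \<in> set xs \<Longrightarrow> u i = 0" "\<And>i. i \<in> set xs \<Longrightarrow> v i = 0" "X \<in> carrier_mat d d"
  shows "C2 \<zeta> u v (xs @ ys) X = chain (Ljd S \<zeta>) xs (C2 \<zeta> u v ys X)"
  using assms
proof (induction xs)
  case (Cons i js)
  have i: "i \<in> {1..nenv S}" and js: "set js \<subseteq> {1..nenv S}" using Cons.prems by auto
  have jy: "set (js @ ys) \<subseteq> {1..nenv S}" using js Cons.prems(2) by simp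
  have c: "B2 \<zeta> i (chain (Ljd S \<zeta>) (js @ ys) X) \<in> carrier_mat d d" "B1 \<zeta> i (C1 \<zeta> w (js @ ys) X) \<in> carrier_mat d d"
    "Ljd S \<zeta> i (chain (Ljd S \<zeta>) js (C2 \<zeta> u v ys X)) \<in> carrier_mat d d" for w
    by (rule linmap_carrier[OF B2_linmap[OF i] chain_Ljd_carrier[OF jy Cons.prems(5)]]
      linmap_carrier[OF B1_linmap[OF i] linmap_carrier[OF C1_linmap[OF jy] Cons.prems(5)]]
      linmap_carrier[OF Ljd_linmap[OF i] chain_Ljd_carrier[OF js linmap_carrier[OF C2_linmap[OF Cons.prems(2)] Cons.prems(5)]]])+
  show ?case using Cons c(1) c(2)[of u] c(2)[of v] c(3) by (simp add: zero_smult chain_simps)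
qed (simp add: chain_simps)

lemma C1_single:
  assumes "set (xs @ k # ys) \<subseteq> {1..nenv S}" "\<And>i. i \<in> set xs \<union> set ys \<Longrightarrow> u i = 0" "X \<in> carrier_mat d d"
  shows "C1 \<zeta> u (xs @ k # ys) X = complex_of_real (u k) \<cdot>\<^sub>m chain (Ljd S \<zeta>) xs (B1 \<zeta> k (chain (Ljd S \<zeta>) ys X))"
proof -
  have xs: "set xs \<subseteq> {1..nenv S}" and ys: "set ys \<subseteq> {1..nenv S}" and k: "k \<in> {1..nenv S}" using assms by auto
  have c: "B1 \<zeta> k (chain (Ljd S \<zeta>) ys X) \<in> carrier_mat d d"
    by (rule linmap_carrier[OF B1_linmap[OF k] chain_Ljd_carrier[OF ys assms(3)]])
  have z: "C1 \<zeta> u ys X = 0\<^sub>m d d" by (rule C1_0[OF ys]) (use assms in auto)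
  have "C1 \<zeta> u (xs @ k # ys) X = chain (Ljd S \<zeta>) xs (C1 \<zeta> u (k # ys) X)"
    by (rule C1_skip) (use assms in auto)
  also have "C1 \<zeta> u (k # ys) X = complex_of_real (u k) \<cdot>\<^sub>m B1 \<zeta> k (chain (Ljd S \<zeta>) ys X)"
    using c by (simp add: z linmap_zero[OF Ljd_linmap[OF k]])
  finally show ?thesis unfolding linmap_smult[OF chain_Ljd_linmap[OF xs] c] .
qed

lemma C2_single:
  assumes "set (xs @ k # ys) \<subseteq> {1..nenv S}" "\<And>i. i \<in> set xs \<union> set ys \<Longrightarrow> u i = 0" "\<And>i. i \<in> set xs \<union> set ys \<Longrightarrow> v i = 0" "X \<in> carrier_mat d d"
  shows "C2 \<zeta> u v (xs @ k # ys) X = complex_of_real (u k * v k) \<cdot>\<^sub>m chain (Ljd S \<zeta>) xs (B2 \<zeta> k (chain (Ljd S \<zeta>) ys X))"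
proof -
  have xs: "set xs \<subseteq> {1..nenv S}" and ys: "set ys \<subseteq> {1..nenv S}" and k: "k \<in> {1..nenv S}" using assms by auto
  have c: "B2 \<zeta> k (chain (Ljd S \<zeta>) ys X) \<in> carrier_mat d d"
    by (rule linmap_carrier[OF B2_linmap[OF k] chain_Ljd_carrier[OF ys assms(4)]])
  have z: "C1 \<zeta> u ys X = 0\<^sub>m d d" "C1 \<zeta> v ys X = 0\<^sub>m d d" by (rule C1_0[OF ys]; use assms in auto)+
  have z2: "C2 \<zeta> u v ys X = 0\<^sub>m d d" by (rule C2_0[OF ys]) (use assms in auto)
  have zz: "a \<cdot>\<^sub>m 0\<^sub>m d d = (0\<^sub>m d d :: complex mat)" for a by (intro eq_matI) auto
  have "C2 \<zeta> u v (xs @ k # ys) X = chain (Ljd S \<zeta>) xs (C2 \<zeta> u v (k # ys) X)"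
    by (rule C2_skip) (use assms in auto)
  also have "C2 \<zeta> u v (k # ys) X = complex_of_real (u k * v k) \<cdot>\<^sub>m B2 \<zeta> k (chain (Ljd S \<zeta>) ys X)"
    using c by (simp add: z z2 zz linmap_zero[OF Ljd_linmap[OF k]] linmap_zero[OF B1_linmap[OF k]])
  finally show ?thesis unfolding linmap_smult[OF chain_Ljd_linmap[OF xs] c] .
qed

text \<open>One weight lives at \<open>a\<close> and the other at the later \<open>b\<close>. No
  site sees both, so no \<open>B2\<close> survives, and a single cross term of the product rule
  remains.\<close>

lemma C2_double:
  assumes "set (xs @ a # ys @ b # zs) \<subseteq> {1..nenv S}" "\<And>i. i \<in> set xs \<union> set ys \<union> {b} \<union> set zs \<Longrightarrow> u i = 0"
    "\<And>i. i \<in> set xs \<union> set ys \<union> {a} \<union> set zs \<Longrightarrow> v i = 0" "X \<in> carrier_mat d d"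
  shows "C2 \<zeta> u v (xs @ a # ys @ b # zs) X = complex_of_real (u a * v b) \<cdot>\<^sub>m
     chain (Ljd S \<zeta>) xs (B1 \<zeta> a (chain (Ljd S \<zeta>) ys (B1 \<zeta> b (chain (Ljd S \<zeta>) zs X))))"
proof -
  let ?r = "ys @ b # zs"
  have xs: "set xs \<subseteq> {1..nenv S}" and ys: "set ys \<subseteq> {1..nenv S}" and r: "set ?r \<subseteq> {1..nenv S}" and zs: "set zs \<subseteq> {1..nenv S}"
    and a: "a \<in> {1..nenv S}" and b: "b \<in> {1..nenv S}" using assms by auto
  have cb: "chain (Ljd S \<zeta>) ys (B1 \<zeta> b (chain (Ljd S \<zeta>) zs X)) \<in> carrier_mat d d"
    by (rule chain_Ljd_carrier[OF ys linmap_carrier[OF B1_linmap[OF b] chain_Ljd_carrier[OF zs assms(4)]]])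
  have ca: "B1 \<zeta> a (chain (Ljd S \<zeta>) ys (B1 \<zeta> b (chain (Ljd S \<zeta>) zs X))) \<in> carrier_mat d d"
    by (rule linmap_carrier[OF B1_linmap[OF a] cb])
  have c2: "B2 \<zeta> a (chain (Ljd S \<zeta>) ?r X) \<in> carrier_mat d d"
    by (rule linmap_carrier[OF B2_linmap[OF a] chain_Ljd_carrier[OF r assms(4)]])
  have z: "C1 \<zeta> u ?r X = 0\<^sub>m d d" by (rule C1_0[OF r]) (use assms in auto)
  have z2: "C2 \<zeta> u v ?r X = 0\<^sub>m d d" by (rule C2_0[OF r]) (use assms in auto)
  have zz: "a \<cdot>\<^sub>m 0\<^sub>m d d = (0\<^sub>m d d :: complex mat)" for a by (intro eq_matI) auto
  have v: "C1 \<zeta> v ?r X = complex_of_real (v b) \<cdot>\<^sub>m chain (Ljd S \<zeta>) ys (B1 \<zeta> b (chain (Ljd S \<zeta>) zs X))"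
    by (rule C1_single) (use assms in auto)
  have va: "v a = 0" using assms(3) by simp
  have "C2 \<zeta> u v (xs @ a # ?r) X = chain (Ljd S \<zeta>) xs (C2 \<zeta> u v (a # ?r) X)"
    by (rule C2_skip) (use assms in auto)
  also have "C2 \<zeta> u v (a # ?r) X = complex_of_real (u a * v b) \<cdot>\<^sub>m B1 \<zeta> a (chain (Ljd S \<zeta>) ys (B1 \<zeta> b (chain (Ljd S \<zeta>) zs X)))"
    unfolding C2.simps z z2 v va linmap_zero[OF Ljd_linmap[OF a]] linmap_zero[OF B1_linmap[OF a]] linmap_smult[OF B1_linmap[OF a] cb]
    using c2 ca by (simp add: zz zero_smult smult_smult_mat)
  finally show ?thesis unfolding linmap_smult[OF chain_Ljd_linmap[OF xs] ca] .
qed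

lemma env_split:
  assumes "j \<in> {1..nenv S}" shows "env = [1..<j] @ j # [j+1..<nenv S + 1]"
  using assms upt_add_eq_append[of 1 j "nenv S + 1 - j"] upt_conv_Cons[of j "nenv S + 1"] by (simp del: upt_Suc)

lemma env_split2:
  assumes "j \<in> {1..nenv S}" "k \<in> {1..nenv S}" "j < k"
  shows "env = [1..<j] @ j # [j+1..<k] @ k # [k+1..<nenv S + 1]"
  unfolding env_split[OF assms(1)] using assms upt_add_eq_append[of "j+1" k "nenv S + 1 - k"] upt_conv_Cons[of k "nenv S + 1"]
  by (simp del: upt_Suc)

lemma B1_phij: "B1 \<zeta> j X = complex_of_real (Ttot S) \<cdot>\<^sub>m phij S \<zeta> H j X"
  unfolding phij_def B1_def smult_smult_mat using Ttot_pos[OF wf] by (intro eq_matI) (auto simp flip: of_real_mult)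

lemma phij_linmap: "j \<in> {1..nenv S} \<Longrightarrow> linmap d (phij S \<zeta> H j)"
proof -
  assume j: "j \<in> {1..nenv S}"
  have "linmap d (\<lambda>X. complex_of_real (1 / Ttot S) \<cdot>\<^sub>m B1 \<zeta> j X)" by (rule linmap_scale[OF B1_linmap[OF j]])
  then show ?thesis by (simp only: phij_def[abs_def] B1_def)
qed

text \<open>At the identity \<open>phij\<close> is the increment of \<open>H'\<close> divided by
  \<open>Ttot S\<close>, which is the flux by \<open>generator_facts\<close>.\<close>

lemma phij_one: "j \<in> {1..nenv S} \<Longrightarrow> phij S \<zeta> H j (1\<^sub>m d) = Phi S \<zeta> j"
  by (simp only: phij_def generator_facts(1) Ljd_one[OF wf] one_H)

text \<open>The commutation in \<open>generator_facts\<close> enters here: it identifies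
  \<open>H * Ljd S \<zeta> j H\<close> in the dissipation with the second copy of the cross term in
  \<open>B2\<close>.\<close>

lemma B2_one:
  assumes j: "j \<in> {1..nenv S}"
  shows "B2 \<zeta> j (1\<^sub>m d) = complex_of_real (Ttot S) \<cdot>\<^sub>m Dj S \<zeta> j H H"
proof -
  have HH: "dim_row (H * H) = d" "dim_col (H * H) = d" "dim_row H = d" "dim_col H = d" using carrier_matD[OF H_carrier] by simp_all
  have c: "Ljd S \<zeta> j (H * H) \<in> carrier_mat d d" "Ljd S \<zeta> j H * H \<in> carrier_mat d d" "H * H \<in> carrier_mat d d"
    using linmap_carrier[OF Ljd_linmap[OF j]] sq_mult_carrier[OF H_carrier H_carrier]
      sq_mult_carrier[OF linmap_carrier[OF Ljd_linmap[OF j] H_carrier] H_carrier] by auto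
  have "complex_of_real (Ttot S) \<cdot>\<^sub>m Dj S \<zeta> j H H = Ljd S \<zeta> j (H * H) - Ljd S \<zeta> j H * H - Ljd S \<zeta> j H * H + H * H"
    unfolding Dj_def adj_H generator_facts(2)[OF j] smult_smult_mat using Ttot_pos[OF wf] c
    by (intro eq_matI) (auto simp flip: of_real_mult)
  also have "\<dots> = B2 \<zeta> j (1\<^sub>m d)"
    unfolding B2_def Ljd_one[OF wf j] left_mult_one_mat[OF c(3)] one_H using c HH by (intro eq_matI) auto
  finally show ?thesis ..
qed

lemma chain_one: "set js \<subseteq> {1..nenv S} \<Longrightarrow> chain (Ljd S \<zeta>) js (1\<^sub>m d) = 1\<^sub>m d"
  by (rule chain_fix) (rule Ljd_one[OF wf], blast)

lemma phij_cy_eq: "phij_cy S \<zeta> H j X = compL S \<zeta> 1 j (phij S \<zeta> H j (compL S \<zeta> (j+1) (nenv S + 1) X))"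
  by (simp add: phij_cy_def)

lemma sub_env: "1 \<le> a \<Longrightarrow> b \<le> nenv S + 1 \<Longrightarrow> set [a..<b] \<subseteq> {1..nenv S}"
  by auto

lemma compL_linmap: "1 \<le> a \<Longrightarrow> b \<le> nenv S + 1 \<Longrightarrow> linmap d (compL S \<zeta> a b)"
  unfolding compL_chain by (rule chain_Ljd_linmap[OF sub_env])

lemma compL_one: "1 \<le> a \<Longrightarrow> b \<le> nenv S + 1 \<Longrightarrow> compL S \<zeta> a b (1\<^sub>m d) = 1\<^sub>m d"
  unfolding compL_chain by (rule chain_one[OF sub_env])

lemma phij_cy_linmap: "j \<in> {1..nenv S} \<Longrightarrow> linmap d (phij_cy S \<zeta> H j)"
  unfolding phij_cy_def by (intro linmap_comp phij_linmap compL_linmap) auto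

lemma phij_cy_one: "j \<in> {1..nenv S} \<Longrightarrow> phij_cy S \<zeta> H j (1\<^sub>m d) = Phi_cy S \<zeta> j"
  unfolding phij_cy_eq Phi_cy_def using compL_one[of "j+1" "nenv S + 1"] phij_one by simp

text \<open>Only site \<open>k\<close> carries weight. \<open>B1\<close> contributes the factor
  \<open>Ttot S\<close> there, and the undeformed maps on both sides of it complete
  \<open>phij_cy\<close>.\<close>

lemma C1_env:
  assumes k: "k \<in> {1..nenv S}" and X: "X \<in> carrier_mat d d"
  shows "C1 \<zeta> (bw \<zeta> k) env X = complex_of_real (betaj S \<zeta> k * Ttot S) \<cdot>\<^sub>m phij_cy S \<zeta> H k X"
proof -
  have e: "set ([1..<k] @ k # [k+1..<nenv S + 1]) \<subseteq> {1..nenv S}" using k by auto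
  have c: "phij S \<zeta> H k (compL S \<zeta> (k+1) (nenv S + 1) X) \<in> carrier_mat d d"
    using k X by (intro linmap_carrier[OF phij_linmap] linmap_carrier[OF compL_linmap]) auto
  have l: "linmap d (compL S \<zeta> 1 k)" using k by (intro compL_linmap) auto
  have "C1 \<zeta> (bw \<zeta> k) ([1..<k] @ k # [k+1..<nenv S + 1]) X = complex_of_real (bw \<zeta> k k) \<cdot>\<^sub>m chain (Ljd S \<zeta>) [1..<k] (B1 \<zeta> k (chain (Ljd S \<zeta>) [k+1..<nenv S + 1] X))"
    by (rule C1_single[OF e _ X]) (auto simp: unitv_def)
  then show ?thesis unfolding env_split[OF k, symmetric] compL_chain[symmetric] B1_phij linmap_smult[OF l c] smult_smult_mat phij_cy_eq
    by (simp add: unitv_def)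
qed

text \<open>The sites after \<open>k\<close> fix the identity, so \<open>B2\<close> is evaluated at
  the identity, where it is a dissipation. A single \<open>Ttot S\<close> appears because
  \<open>Dj\<close> is normalised by it once.\<close>

lemma C2_env_diag:
  assumes k: "k \<in> {1..nenv S}"
  shows "C2 \<zeta> (bw \<zeta> k) (bw \<zeta> k) env (1\<^sub>m d) = complex_of_real ((betaj S \<zeta> k)\<^sup>2 * Ttot S) \<cdot>\<^sub>m compL S \<zeta> 1 k (Dj S \<zeta> k H H)"
proof -
  have e: "set ([1..<k] @ k # [k+1..<nenv S + 1]) \<subseteq> {1..nenv S}" using k by auto
  have c: "Dj S \<zeta> k H H \<in> carrier_mat d d"
    unfolding Dj_def adj_H by (intro smult_carrier_mat add_carrier_mat sq_mult_carrier H_carrier)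
  have l: "linmap d (compL S \<zeta> 1 k)" using k by (intro compL_linmap) auto
  have "C2 \<zeta> (bw \<zeta> k) (bw \<zeta> k) ([1..<k] @ k # [k+1..<nenv S + 1]) (1\<^sub>m d) = complex_of_real (bw \<zeta> k k * bw \<zeta> k k) \<cdot>\<^sub>m
     chain (Ljd S \<zeta>) [1..<k] (B2 \<zeta> k (chain (Ljd S \<zeta>) [k+1..<nenv S + 1] (1\<^sub>m d)))"
    by (rule C2_single[OF e _ _ one_carrier_mat]) (auto simp: unitv_def)
  then show ?thesis unfolding env_split[OF k, symmetric] compL_one[of "k+1" "nenv S + 1", OF le_add2 order_refl]
      compL_chain[symmetric] B2_one[OF k] linmap_smult[OF l c] smult_smult_mat
    by (simp add: unitv_def power2_eq_square)
qed

text \<open>The later site acts on the identity and yields its flux, which the earlier site then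
  meets through \<open>phij\<close>; each of the two contributes a factor
  \<open>Ttot S\<close>.\<close>

lemma C2_env_off:
  assumes j: "j \<in> {1..nenv S}" and k: "k \<in> {1..nenv S}" and jk: "j < k"
  shows "C2 \<zeta> (bw \<zeta> j) (bw \<zeta> k) env (1\<^sub>m d) = complex_of_real (betaj S \<zeta> j * betaj S \<zeta> k * (Ttot S)\<^sup>2) \<cdot>\<^sub>m
     compL S \<zeta> 1 j (phij S \<zeta> H j (compL S \<zeta> (j+1) k (Phi S \<zeta> k)))"
proof -
  have e: "set ([1..<j] @ j # [j+1..<k] @ k # [k+1..<nenv S + 1]) \<subseteq> {1..nenv S}" using j k by auto
  have l1: "linmap d (compL S \<zeta> 1 j)" "linmap d (compL S \<zeta> (j+1) k)" using j k by (auto intro!: compL_linmap)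
  have c1: "Phi S \<zeta> k \<in> carrier_mat d d" using linmap_carrier[OF phij_linmap[OF k] one_carrier_mat] unfolding phij_one[OF k] .
  have c2: "compL S \<zeta> (j+1) k (Phi S \<zeta> k) \<in> carrier_mat d d" by (rule linmap_carrier[OF l1(2) c1])
  have c3: "phij S \<zeta> H j (compL S \<zeta> (j+1) k (Phi S \<zeta> k)) \<in> carrier_mat d d" by (rule linmap_carrier[OF phij_linmap[OF j] c2])
  have "C2 \<zeta> (bw \<zeta> j) (bw \<zeta> k) ([1..<j] @ j # [j+1..<k] @ k # [k+1..<nenv S + 1]) (1\<^sub>m d) = complex_of_real (bw \<zeta> j j * bw \<zeta> k k) \<cdot>\<^sub>m
     chain (Ljd S \<zeta>) [1..<j] (B1 \<zeta> j (chain (Ljd S \<zeta>) [j+1..<k] (B1 \<zeta> k (chain (Ljd S \<zeta>) [k+1..<nenv S + 1] (1\<^sub>m d)))))"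
    by (rule C2_double[OF e _ _ one_carrier_mat]) (use jk in \<open>auto simp: unitv_def\<close>)
  then show ?thesis unfolding env_split2[OF j k jk, symmetric] compL_one[of "k+1" "nenv S + 1", OF le_add2 order_refl]
      compL_chain[symmetric] B1_phij phij_one[OF k] linmap_smult[OF l1(2) c1] B1_phij linmap_smult[OF phij_linmap[OF j] c2]
      smult_smult_mat linmap_smult[OF l1(1) c3]
    by (simp add: unitv_def power2_eq_square mult_ac)
qed

text \<open>The cycle is fed into \<open>response_formulas\<close>. Its mixed coefficient depends on
  which of the two sites comes first, and this produces the three alternative terms after the
  series.\<close>

lemma cy_response:
  fixes \<zeta> :: "nat \<Rightarrow> real"
  assumes er: "ER_cy S" and j: "j \<in> {1..nenv S}" and k: "k \<in> {1..nenv S}"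
  defines "\<rho> \<equiv> inv_state d (Lcy S \<zeta>)" and "\<beta> \<equiv> betaj S \<zeta>" and "T \<equiv> Ttot S"
  shows "\<exists>D. ((\<lambda>t. r_cy S \<zeta> (\<lambda>i. t * unitv j i)) has_real_derivative D) (at 0) \<and>
       complex_of_real D = complex_of_real (\<beta> j * T) * mtrace (\<rho> * Phi_cy S \<zeta> j)"
    and "\<forall>\<^sub>F s in nhds 0. (\<lambda>t. r_cy S \<zeta> (\<lambda>i. s * unitv k i + t * unitv j i)) differentiable (at 0)"
    and "\<exists>D \<Sigma>. ((\<lambda>s. pderiv_at (r_cy S \<zeta>) j (\<lambda>i. s * unitv k i)) has_real_derivative D) (at 0) \<and>
       (\<lambda>n. mtrace (\<rho> *
                 (phij_cy S \<zeta> H j ((Lcy_dual S \<zeta> ^^ n) (Phi_cy S \<zeta> k - mtrace (\<rho> * Phi_cy S \<zeta> k) \<cdot>\<^sub>m 1\<^sub>m d))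
                + phij_cy S \<zeta> H k ((Lcy_dual S \<zeta> ^^ n) (Phi_cy S \<zeta> j - mtrace (\<rho> * Phi_cy S \<zeta> j) \<cdot>\<^sub>m 1\<^sub>m d))))) sums \<Sigma> \<and>
       complex_of_real D = complex_of_real (\<beta> j * \<beta> k * T\<^sup>2) * \<Sigma>
              + (if k > j then complex_of_real (\<beta> j * \<beta> k * T\<^sup>2) *
                   mtrace (\<rho> * compL S \<zeta> 1 j (phij S \<zeta> H j (compL S \<zeta> (j+1) k (Phi S \<zeta> k))))
                 else 0)
              + (if j > k then complex_of_real (\<beta> j * \<beta> k * T\<^sup>2) *
                   mtrace (\<rho> * compL S \<zeta> 1 k (phij S \<zeta> H k (compL S \<zeta> (k+1) j (Phi S \<zeta> j))))
                 else 0)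
              + (if j = k then complex_of_real ((\<beta> j)\<^sup>2 * T) * mtrace (\<rho> * compL S \<zeta> 1 j (Dj S \<zeta> j H H)) else 0)"
proof -
  \<comment> \<open>\<open>s\<close> moves site \<open>k\<close> and \<open>t\<close> moves site
    \<open>j\<close>: the inner derivative taken by \<open>pderiv_at\<close> is in \<open>t\<close>
    and the outer one in \<open>s\<close>, the order used by \<open>jet\<close>.\<close>
  define A where "A s t = Lcy_deform S \<zeta> (\<lambda>i. s * unitv k i + t * unitv j i)" for s t
  have d0: "d > 0" using wf by (simp add: well_formed_def)
  have se: "set env \<subseteq> {1..nenv S}" unfolding env_set_eq by simp
  have AT: "A s t X = chain (\<lambda>i. Tw \<zeta> i (bw \<zeta> k i * s + bw \<zeta> j i * t)) env X" if "X \<in> carrier_mat d d" for s t X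
    unfolding A_def Lcy_deform_chain by (rule chain_def_Tw[OF se that])
  have pos: "posmap d (A s t)" for s t unfolding A_def by (rule cy_facts(5)[OF wf])
  have smooth: "sm UNIV (\<lambda>p. A (fst (snd p)) (snd (snd p)) (munit d a b) $$ (i,l))" if "i < d" "l < d" for a b i l
  proof -
    have "msm d (\<lambda>p. chain (\<lambda>i. Tw \<zeta> i (bw \<zeta> k i * fst (snd p) + bw \<zeta> j i * snd (snd p))) env (munit d a b))"
    proof (rule msm_chain)
      show "linmap d (Tw \<zeta> i (bw \<zeta> k i * fst (snd p) + bw \<zeta> j i * snd (snd p)))" if "i \<in> set env" for i and p :: "real \<times> real \<times> real"
        by (rule Tw_linmap) (use that se in blast)
      show "msm d (\<lambda>p. munit d a b)" unfolding msm_def by (auto intro: sm_const)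
      show "sm UNIV (\<lambda>p. Tw \<zeta> m (bw \<zeta> k m * fst (snd p) + bw \<zeta> j m * snd (snd p)) (munit d a b) $$ (i,l))" if "m \<in> set env" "i < d" "l < d" for a b i l m
        by (rule Tw_sm) (use that se in auto)
    qed
    then show ?thesis using that unfolding msm_def by (simp add: AT)
  qed
  have L: "A 0 0 = Lcy_dual S \<zeta>" unfolding A_def using cy_facts(6)[OF wf] by simp
  note ist = inv_state_ergodic[OF d0 cy_facts(1)[OF wf] cy_facts(2)[OF wf] cy_facts(3)[OF wf] doeblin_cy[OF wf er, where \<zeta> = \<zeta>], folded \<rho>_def]
  have Jt: "jet (\<lambda>s t. A s t Y $$ (i,l)) ((complex_of_real (\<beta> k * T) \<cdot>\<^sub>m phij_cy S \<zeta> H k Y) $$ (i,l))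
     ((complex_of_real (\<beta> j * T) \<cdot>\<^sub>m phij_cy S \<zeta> H j Y) $$ (i,l)) (C2 \<zeta> (bw \<zeta> k) (bw \<zeta> j) env Y $$ (i,l))"
    if "Y \<in> carrier_mat d d" "i < d" "l < d" for Y i l
    unfolding AT[OF that(1)] \<beta>_def T_def C1_env[OF k that(1), symmetric] C1_env[OF j that(1), symmetric]
    by (rule chain_jet[OF se that])
  note R = response_formulas[where A = A and L = "Lcy_dual S \<zeta>" and \<rho> = \<rho> and K = "phij_cy S \<zeta> H k" and J = "phij_cy S \<zeta> H j"
      and Ast = "C2 \<zeta> (bw \<zeta> k) (bw \<zeta> j) env" and bk = "\<beta> k * T" and bj = "\<beta> j * T",
      OF d0 pos smooth L cy_facts(2)[OF wf] ist(1) ist(2) ist(3) Jt phij_cy_linmap[OF k] phij_cy_linmap[OF j] C2_linmap[OF se]]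
  have rA: "spec_rad d (A s t) = r_cy S \<zeta> (\<lambda>i. s * unitv k i + t * unitv j i)" for s t
    by (simp add: A_def r_cy_def)
  show "\<exists>D. ((\<lambda>t. r_cy S \<zeta> (\<lambda>i. t * unitv j i)) has_real_derivative D) (at 0) \<and>
       complex_of_real D = complex_of_real (\<beta> j * T) * mtrace (\<rho> * Phi_cy S \<zeta> j)"
    using R(1) unfolding rA phij_cy_one[OF j] by simp
  show "\<forall>\<^sub>F s in nhds 0. (\<lambda>t. r_cy S \<zeta> (\<lambda>i. s * unitv k i + t * unitv j i)) differentiable (at 0)"
    using R(2) unfolding rA .
  have r: "\<rho> \<in> carrier_mat d d" using ist(1) by (simp add: is_state_iff)
  have c1: "compL S \<zeta> 1 a (phij S \<zeta> H a (compL S \<zeta> (a+1) b (Phi S \<zeta> b))) \<in> carrier_mat d d" if "a \<in> {1..nenv S}" "b \<in> {1..nenv S}" for a b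
    using that linmap_carrier[OF phij_linmap[OF that(2)] one_carrier_mat] unfolding phij_one[OF that(2)]
    by (intro linmap_carrier[OF compL_linmap] linmap_carrier[OF phij_linmap]) auto
  have c2: "compL S \<zeta> 1 j (Dj S \<zeta> j H H) \<in> carrier_mat d d"
    unfolding Dj_def adj_H using j by (intro linmap_carrier[OF compL_linmap] smult_carrier_mat add_carrier_mat sq_mult_carrier H_carrier) auto
  have bb: "\<beta> j * T * (\<beta> k * T) = \<beta> j * \<beta> k * T\<^sup>2" by (simp add: power2_eq_square)
  have tr: "mtrace (\<rho> * C2 \<zeta> (bw \<zeta> k) (bw \<zeta> j) env (1\<^sub>m d)) =
      (if k > j then complex_of_real (\<beta> j * \<beta> k * T\<^sup>2) *
                   mtrace (\<rho> * compL S \<zeta> 1 j (phij S \<zeta> H j (compL S \<zeta> (j+1) k (Phi S \<zeta> k))))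
                 else 0)
              + (if j > k then complex_of_real (\<beta> j * \<beta> k * T\<^sup>2) *
                   mtrace (\<rho> * compL S \<zeta> 1 k (phij S \<zeta> H k (compL S \<zeta> (k+1) j (Phi S \<zeta> j))))
                 else 0)
              + (if j = k then complex_of_real ((\<beta> j)\<^sup>2 * T) * mtrace (\<rho> * compL S \<zeta> 1 j (Dj S \<zeta> j H H)) else 0)"
  proof (cases j k rule: linorder_cases)
    case less
    show ?thesis unfolding C2_commute[OF se one_carrier_mat, of \<zeta> "bw \<zeta> k"] C2_env_off[OF j k less] mtrace_mult_smult[OF r c1[OF j k]]
      using less by (simp add: \<beta>_def T_def)
  next
    case equal
    show ?thesis unfolding equal[symmetric] C2_env_diag[OF j] mtrace_mult_smult[OF r c2] by (simp add: \<beta>_def T_def)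
  next
    case greater
    show ?thesis unfolding C2_env_off[OF k j greater] mtrace_mult_smult[OF r c1[OF k j]]
      using greater by (simp add: \<beta>_def T_def)
  qed
  show "\<exists>D \<Sigma>. ((\<lambda>s. pderiv_at (r_cy S \<zeta>) j (\<lambda>i. s * unitv k i)) has_real_derivative D) (at 0) \<and>
       (\<lambda>n. mtrace (\<rho> *
                 (phij_cy S \<zeta> H j ((Lcy_dual S \<zeta> ^^ n) (Phi_cy S \<zeta> k - mtrace (\<rho> * Phi_cy S \<zeta> k) \<cdot>\<^sub>m 1\<^sub>m d))
                + phij_cy S \<zeta> H k ((Lcy_dual S \<zeta> ^^ n) (Phi_cy S \<zeta> j - mtrace (\<rho> * Phi_cy S \<zeta> j) \<cdot>\<^sub>m 1\<^sub>m d))))) sums \<Sigma> \<and>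
       complex_of_real D = complex_of_real (\<beta> j * \<beta> k * T\<^sup>2) * \<Sigma>
              + (if k > j then complex_of_real (\<beta> j * \<beta> k * T\<^sup>2) *
                   mtrace (\<rho> * compL S \<zeta> 1 j (phij S \<zeta> H j (compL S \<zeta> (j+1) k (Phi S \<zeta> k))))
                 else 0)
              + (if j > k then complex_of_real (\<beta> j * \<beta> k * T\<^sup>2) *
                   mtrace (\<rho> * compL S \<zeta> 1 k (phij S \<zeta> H k (compL S \<zeta> (k+1) j (Phi S \<zeta> j))))
                 else 0)
              + (if j = k then complex_of_real ((\<beta> j)\<^sup>2 * T) * mtrace (\<rho> * compL S \<zeta> 1 j (Dj S \<zeta> j H H)) else 0)"
    using R(3) unfolding rA phij_cy_one[OF j] phij_cy_one[OF k] tr bb pderiv_at_def by (simp only: add.assoc)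
qed

lemma avg_index:
  assumes "\<And>i. i \<in> set js \<Longrightarrow> G i X \<in> carrier_mat n n" "distinct js" "p < n" "q < n"
  shows "avg n c G js X $$ (p,q) = (\<Sum>i\<in>set js. complex_of_real c * G i X $$ (p,q))"
proof -
  have "msum n (\<lambda>i. G i X) js \<in> carrier_mat n n" using assms(1) by (rule msum_carrier)
  then show ?thesis unfolding avg_def using assms msum_index[of js "\<lambda>i. G i X" n p q] by (simp add: sum_distrib_left)
qed

text \<open>An average has no product rule between different sites: the mixed derivative collects
  \<open>B2\<close> from sites that both directions move, that is, from \<open>j\<close> when
  \<open>j = k\<close>. The maps at other sites do not intervene, so \<open>Phi\<close> and
  \<open>phij\<close> appear without conjugating chains.\<close>

lemma ra_response:
  fixes \<zeta> :: "nat \<Rightarrow> real"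
  assumes er: "ER_ra S" and j: "j \<in> {1..nenv S}" and k: "k \<in> {1..nenv S}"
  defines "\<rho> \<equiv> inv_state d (Lra S \<zeta>)" and "\<beta> \<equiv> betaj S \<zeta>" and "T \<equiv> Ttot S" and "M \<equiv> nenv S"
  shows "\<exists>D. ((\<lambda>t. r_ra S \<zeta> (\<lambda>i. t * unitv j i)) has_real_derivative D) (at 0) \<and>
       complex_of_real D = complex_of_real (\<beta> j * T / real M) * mtrace (\<rho> * Phi S \<zeta> j)"
    and "\<forall>\<^sub>F s in nhds 0. (\<lambda>t. r_ra S \<zeta> (\<lambda>i. s * unitv k i + t * unitv j i)) differentiable (at 0)"
    and "\<exists>D \<Sigma>. ((\<lambda>s. pderiv_at (r_ra S \<zeta>) j (\<lambda>i. s * unitv k i)) has_real_derivative D) (at 0) \<and>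
       (\<lambda>n. mtrace (\<rho> *
                 (phij S \<zeta> H j ((Lra_dual S \<zeta> ^^ n) (Phi S \<zeta> k - mtrace (\<rho> * Phi S \<zeta> k) \<cdot>\<^sub>m 1\<^sub>m d))
                + phij S \<zeta> H k ((Lra_dual S \<zeta> ^^ n) (Phi S \<zeta> j - mtrace (\<rho> * Phi S \<zeta> j) \<cdot>\<^sub>m 1\<^sub>m d))))) sums \<Sigma> \<and>
       complex_of_real D = complex_of_real (\<beta> j * \<beta> k * (T / real M)\<^sup>2) * \<Sigma>
              + (if j = k then complex_of_real ((\<beta> j)\<^sup>2 * (T / real M)) * mtrace (\<rho> * Dj S \<zeta> j H H) else 0)"
proof -
  define A where "A s t = Lra_deform S \<zeta> (\<lambda>i. s * unitv k i + t * unitv j i)" for s t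
  let ?c = "1 / real M"
  \<comment> \<open>The weight \<open>1 / M\<close> of the average occurs once here, whereas the
    series receives it twice through the two first derivatives.\<close>
  define Ast where "Ast X = complex_of_real (if j = k then (\<beta> j)\<^sup>2 / real M else 0) \<cdot>\<^sub>m B2 \<zeta> j X" for X
  have Al: "linmap d Ast" unfolding Ast_def by (rule linmap_scale[OF B2_linmap[OF j]])
  have d0: "d > 0" using wf by (simp add: well_formed_def)
  have AT: "A s t X $$ (p,q) = (\<Sum>i\<in>{1..M}. complex_of_real ?c * Tw \<zeta> i (bw \<zeta> k i * s + bw \<zeta> j i * t) X $$ (p,q))"
    if X: "X \<in> carrier_mat d d" and pq: "p < d" "q < d" for s t X p q
  proof -
    have T: "Ljd_def S \<zeta> (s * unitv k i + t * unitv j i) i X = Tw \<zeta> i (bw \<zeta> k i * s + bw \<zeta> j i * t) X" if "i \<in> set env" for i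
      by (rule Ljd_def_Tw[OF env_set[OF that] X])
    have c: "Ljd_def S \<zeta> (s * unitv k i + t * unitv j i) i X \<in> carrier_mat d d" if "i \<in> set env" for i
      unfolding T[OF that] by (rule linmap_carrier[OF Tw_linmap[OF env_set[OF that]] X])
    have "A s t X $$ (p,q) = (\<Sum>i\<in>set env. complex_of_real ?c * Ljd_def S \<zeta> (s * unitv k i + t * unitv j i) i X $$ (p,q))"
      unfolding A_def Lra_deform_avg M_def by (rule avg_index[where G = "\<lambda>i. Ljd_def S \<zeta> (s * unitv k i + t * unitv j i) i", OF c distinct_upt pq])
    also have "\<dots> = (\<Sum>i\<in>set env. complex_of_real ?c * Tw \<zeta> i (bw \<zeta> k i * s + bw \<zeta> j i * t) X $$ (p,q))"
      by (intro sum.cong refl) (simp only: T)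
    finally show ?thesis unfolding env_set_eq M_def .
  qed
  have pos: "posmap d (A s t)" for s t unfolding A_def by (rule ra_facts(5)[OF wf])
  have smooth: "sm UNIV (\<lambda>p. A (fst (snd p)) (snd (snd p)) (munit d a b) $$ (i,l))" if "i < d" "l < d" for a b i l
  proof -
    have "sm UNIV (\<lambda>p. \<Sum>m\<in>{1..M}. complex_of_real ?c * Tw \<zeta> m (bw \<zeta> k m * fst (snd p) + bw \<zeta> j m * snd (snd p)) (munit d a b) $$ (i,l))"
      by (intro sm_sum sm_mult sm_const Tw_sm) (use that in \<open>auto simp: M_def\<close>)
    then show ?thesis using that by (simp add: AT)
  qed
  have L: "A 0 0 = Lra_dual S \<zeta>" unfolding A_def using ra_facts(6)[OF wf] by simp
  note ist = inv_state_ergodic[OF d0 ra_facts(1)[OF wf] ra_facts(2)[OF wf] ra_facts(3)[OF wf] doeblin_ra[OF wf er, where \<zeta> = \<zeta>], folded \<rho>_def]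
  have b1: "(complex_of_real (\<beta> l * T / real M) \<cdot>\<^sub>m phij S \<zeta> H l Y) $$ (p,q)
     = (\<Sum>i\<in>{1..M}. complex_of_real ?c * (complex_of_real (bw \<zeta> l i) * B1 \<zeta> i Y $$ (p,q)))"
    if "Y \<in> carrier_mat d d" "p < d" "q < d" "l \<in> {1..nenv S}" for Y p q l
  proof -
    have c: "phij S \<zeta> H l Y \<in> carrier_mat d d" by (rule linmap_carrier[OF phij_linmap[OF that(4)] that(1)])
    have "(\<Sum>i\<in>{1..M}. complex_of_real ?c * (complex_of_real (bw \<zeta> l i) * B1 \<zeta> i Y $$ (p,q)))
      = (\<Sum>i\<in>{1..M}. if i = l then complex_of_real ?c * (complex_of_real (\<beta> l) * B1 \<zeta> l Y $$ (p,q)) else 0)"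
      by (intro sum.cong refl) (simp add: unitv_def \<beta>_def)
    also have "\<dots> = complex_of_real ?c * (complex_of_real (\<beta> l) * B1 \<zeta> l Y $$ (p,q))"
      using that(4) by (simp add: M_def)
    finally show ?thesis unfolding B1_phij using c that(2,3) by (simp add: T_def)
  qed
  have b2: "Ast Y $$ (p,q) = (\<Sum>i\<in>{1..M}. complex_of_real ?c * (complex_of_real (bw \<zeta> k i * bw \<zeta> j i) * B2 \<zeta> i Y $$ (p,q)))"
    if "Y \<in> carrier_mat d d" "p < d" "q < d" for Y p q
  proof -
    have c: "B2 \<zeta> j Y \<in> carrier_mat d d" by (rule linmap_carrier[OF B2_linmap[OF j] that(1)])
    have "(\<Sum>i\<in>{1..M}. complex_of_real ?c * (complex_of_real (bw \<zeta> k i * bw \<zeta> j i) * B2 \<zeta> i Y $$ (p,q)))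
      = (\<Sum>i\<in>{1..M}. if i = j then (if j = k then complex_of_real ?c * (complex_of_real ((\<beta> j)\<^sup>2) * B2 \<zeta> j Y $$ (p,q)) else 0) else 0)"
      by (intro sum.cong refl) (simp add: unitv_def \<beta>_def power2_eq_square)
    also have "\<dots> = (if j = k then complex_of_real ?c * (complex_of_real ((\<beta> j)\<^sup>2) * B2 \<zeta> j Y $$ (p,q)) else 0)"
      using j by (simp add: M_def)
    finally show ?thesis unfolding Ast_def using c that(2,3) by simp
  qed
  have Jt: "jet (\<lambda>s t. A s t Y $$ (p,q)) ((complex_of_real (\<beta> k * T / real M) \<cdot>\<^sub>m phij S \<zeta> H k Y) $$ (p,q))
     ((complex_of_real (\<beta> j * T / real M) \<cdot>\<^sub>m phij S \<zeta> H j Y) $$ (p,q)) (Ast Y $$ (p,q))"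
    if "Y \<in> carrier_mat d d" "p < d" "q < d" for Y p q
    unfolding AT[OF that] b1[OF that k] b1[OF that j] b2[OF that]
    by (intro jet_sum jet_scale Tw_jet[OF _ that]) (simp add: M_def)
  note R = response_formulas[where A = A and L = "Lra_dual S \<zeta>" and \<rho> = \<rho> and K = "phij S \<zeta> H k" and J = "phij S \<zeta> H j"
      and Ast = Ast and bk = "\<beta> k * T / real M" and bj = "\<beta> j * T / real M",
      OF d0 pos smooth L ra_facts(2)[OF wf] ist(1) ist(2) ist(3) Jt phij_linmap[OF k] phij_linmap[OF j] Al]
  have rA: "spec_rad d (A s t) = r_ra S \<zeta> (\<lambda>i. s * unitv k i + t * unitv j i)" for s t
    by (simp add: A_def r_ra_def)
  show "\<exists>D. ((\<lambda>t. r_ra S \<zeta> (\<lambda>i. t * unitv j i)) has_real_derivative D) (at 0) \<and>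
       complex_of_real D = complex_of_real (\<beta> j * T / real M) * mtrace (\<rho> * Phi S \<zeta> j)"
    using R(1) unfolding rA phij_one[OF j] by simp
  show "\<forall>\<^sub>F s in nhds 0. (\<lambda>t. r_ra S \<zeta> (\<lambda>i. s * unitv k i + t * unitv j i)) differentiable (at 0)"
    using R(2) unfolding rA .
  have r: "\<rho> \<in> carrier_mat d d" using ist(1) by (simp add: is_state_iff)
  have c2: "Dj S \<zeta> j H H \<in> carrier_mat d d"
    unfolding Dj_def adj_H by (intro smult_carrier_mat add_carrier_mat sq_mult_carrier H_carrier)
  have bb: "\<beta> j * T / real M * (\<beta> k * T / real M) = \<beta> j * \<beta> k * (T / real M)\<^sup>2" by (simp add: power2_eq_square)
  have tr: "mtrace (\<rho> * Ast (1\<^sub>m d)) = (if j = k then complex_of_real ((\<beta> j)\<^sup>2 * (T / real M)) * mtrace (\<rho> * Dj S \<zeta> j H H) else 0)"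
    unfolding Ast_def B2_one[OF j] smult_smult_mat mtrace_mult_smult[OF r c2] by (simp add: T_def)
  show "\<exists>D \<Sigma>. ((\<lambda>s. pderiv_at (r_ra S \<zeta>) j (\<lambda>i. s * unitv k i)) has_real_derivative D) (at 0) \<and>
       (\<lambda>n. mtrace (\<rho> *
                 (phij S \<zeta> H j ((Lra_dual S \<zeta> ^^ n) (Phi S \<zeta> k - mtrace (\<rho> * Phi S \<zeta> k) \<cdot>\<^sub>m 1\<^sub>m d))
                + phij S \<zeta> H k ((Lra_dual S \<zeta> ^^ n) (Phi S \<zeta> j - mtrace (\<rho> * Phi S \<zeta> j) \<cdot>\<^sub>m 1\<^sub>m d))))) sums \<Sigma> \<and>
       complex_of_real D = complex_of_real (\<beta> j * \<beta> k * (T / real M)\<^sup>2) * \<Sigma>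
              + (if j = k then complex_of_real ((\<beta> j)\<^sup>2 * (T / real M)) * mtrace (\<rho> * Dj S \<zeta> j H H) else 0)"
    using R(3) unfolding rA phij_one[OF j] phij_one[OF k] tr bb pderiv_at_def .
qed

end

text \<open>Eventual differentiability in \<open>t\<close> guarantees that \<open>pderiv_at\<close>,
  defined through \<open>deriv\<close>, is an actual partial derivative near the point at which it
  is differentiated in \<open>s\<close>. Equating a complex expression with a real \<open>D\<close>
  also asserts that the expression is real.\<close>

theorem mainTheorem3:
  fixes S :: qsys and \<rho>p :: "real \<Rightarrow> complex mat" and \<zeta> :: "nat \<Rightarrow> real"
  assumes wf: "well_formed S"
    and ne: "NE S \<rho>p"
  shows
   "let M = nenv S; d = sdim S; T = Ttot S; \<beta> = betaj S \<zeta>; H' = Hprime S \<rho>p;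
        \<rho>cy = inv_state d (Lcy S \<zeta>); \<rho>ra = inv_state d (Lra S \<zeta>)
    in
    (ER_cy S \<longrightarrow>
      (\<forall>j \<in> {1..M}. \<exists>D.
          ((\<lambda>t. r_cy S \<zeta> (\<lambda>i. t * unitv j i)) has_real_derivative D) (at 0) \<and>
          complex_of_real D = complex_of_real (\<beta> j * T) * mtrace (\<rho>cy * Phi_cy S \<zeta> j)) \<and>
      (\<forall>j \<in> {1..M}. \<forall>k \<in> {1..M}.
          (\<forall>\<^sub>F s in nhds 0. (\<lambda>t. r_cy S \<zeta> (\<lambda>i. s * unitv k i + t * unitv j i)) differentiable (at 0)) \<and>
          (\<exists>D \<Sigma>.
            ((\<lambda>s. pderiv_at (r_cy S \<zeta>) j (\<lambda>i. s * unitv k i)) has_real_derivative D) (at 0) \<and>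
            (\<lambda>n. mtrace (\<rho>cy *
                 (phij_cy S \<zeta> H' j ((Lcy_dual S \<zeta> ^^ n)
                     (Phi_cy S \<zeta> k - mtrace (\<rho>cy * Phi_cy S \<zeta> k) \<cdot>\<^sub>m 1\<^sub>m d))
                + phij_cy S \<zeta> H' k ((Lcy_dual S \<zeta> ^^ n)
                     (Phi_cy S \<zeta> j - mtrace (\<rho>cy * Phi_cy S \<zeta> j) \<cdot>\<^sub>m 1\<^sub>m d))))) sums \<Sigma> \<and>
            complex_of_real D =
              complex_of_real (\<beta> j * \<beta> k * T\<^sup>2) * \<Sigma>
              + (if k > j then complex_of_real (\<beta> j * \<beta> k * T\<^sup>2) *
                   mtrace (\<rho>cy * compL S \<zeta> 1 j (phij S \<zeta> H' j (compL S \<zeta> (j+1) k (Phi S \<zeta> k))))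
                 else 0)
              + (if j > k then complex_of_real (\<beta> j * \<beta> k * T\<^sup>2) *
                   mtrace (\<rho>cy * compL S \<zeta> 1 k (phij S \<zeta> H' k (compL S \<zeta> (k+1) j (Phi S \<zeta> j))))
                 else 0)
              + (if j = k then complex_of_real ((\<beta> j)\<^sup>2 * T) *
                   mtrace (\<rho>cy * compL S \<zeta> 1 j (Dj S \<zeta> j H' H'))
                 else 0))))
    \<and>
    (ER_ra S \<longrightarrow>
      (\<forall>j \<in> {1..M}. \<exists>D.
          ((\<lambda>t. r_ra S \<zeta> (\<lambda>i. t * unitv j i)) has_real_derivative D) (at 0) \<and>
          complex_of_real D = complex_of_real (\<beta> j * T / real M) * mtrace (\<rho>ra * Phi S \<zeta> j)) \<and>
      (\<forall>j \<in> {1..M}. \<forall>k \<in> {1..M}.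
          (\<forall>\<^sub>F s in nhds 0. (\<lambda>t. r_ra S \<zeta> (\<lambda>i. s * unitv k i + t * unitv j i)) differentiable (at 0)) \<and>
          (\<exists>D \<Sigma>.
            ((\<lambda>s. pderiv_at (r_ra S \<zeta>) j (\<lambda>i. s * unitv k i)) has_real_derivative D) (at 0) \<and>
            (\<lambda>n. mtrace (\<rho>ra *
                 (phij S \<zeta> H' j ((Lra_dual S \<zeta> ^^ n)
                     (Phi S \<zeta> k - mtrace (\<rho>ra * Phi S \<zeta> k) \<cdot>\<^sub>m 1\<^sub>m d))
                + phij S \<zeta> H' k ((Lra_dual S \<zeta> ^^ n)
                     (Phi S \<zeta> j - mtrace (\<rho>ra * Phi S \<zeta> j) \<cdot>\<^sub>m 1\<^sub>m d))))) sums \<Sigma> \<and>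
            complex_of_real D =
              complex_of_real (\<beta> j * \<beta> k * (T / real M)\<^sup>2) * \<Sigma>
              + (if j = k then complex_of_real ((\<beta> j)\<^sup>2 * (T / real M)) *
                   mtrace (\<rho>ra * Dj S \<zeta> j H' H')
                 else 0))))"
proof -
  \<comment> \<open>Either hypothesis alone supplies the full rank of \<open>\<rho>p 0\<close>, so
    each half of the statement is proved under its own assumption.\<close>
  have m: "\<exists>P h. ne_model S \<rho>p P h" if "ER_cy S \<or> ER_ra S" by (rule NE_faithful[OF wf ne that])
  show ?thesis
    unfolding Let_def
  proof (rule conjI; rule impI)
    assume er: "ER_cy S"
    then obtain P h where "ne_model S \<rho>p P h" using m by blast
    then interpret ne_model S \<rho>p P h .
    show "(\<forall>j \<in> {1..nenv S}. \<exists>D.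
          ((\<lambda>t. r_cy S \<zeta> (\<lambda>i. t * unitv j i)) has_real_derivative D) (at 0) \<and>
          complex_of_real D = complex_of_real (betaj S \<zeta> j * Ttot S) * mtrace ((inv_state (sdim S) (Lcy S \<zeta>)) * Phi_cy S \<zeta> j)) \<and>
      (\<forall>j \<in> {1..nenv S}. \<forall>k \<in> {1..nenv S}.
          (\<forall>\<^sub>F s in nhds 0. (\<lambda>t. r_cy S \<zeta> (\<lambda>i. s * unitv k i + t * unitv j i)) differentiable (at 0)) \<and>
          (\<exists>D \<Sigma>.
            ((\<lambda>s. pderiv_at (r_cy S \<zeta>) j (\<lambda>i. s * unitv k i)) has_real_derivative D) (at 0) \<and>
            (\<lambda>n. mtrace ((inv_state (sdim S) (Lcy S \<zeta>)) *
                 (phij_cy S \<zeta> (Hprime S \<rho>p) j ((Lcy_dual S \<zeta> ^^ n)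
                     (Phi_cy S \<zeta> k - mtrace ((inv_state (sdim S) (Lcy S \<zeta>)) * Phi_cy S \<zeta> k) \<cdot>\<^sub>m 1\<^sub>m (sdim S)))
                + phij_cy S \<zeta> (Hprime S \<rho>p) k ((Lcy_dual S \<zeta> ^^ n)
                     (Phi_cy S \<zeta> j - mtrace ((inv_state (sdim S) (Lcy S \<zeta>)) * Phi_cy S \<zeta> j) \<cdot>\<^sub>m 1\<^sub>m (sdim S)))))) sums \<Sigma> \<and>
            complex_of_real D =
              complex_of_real (betaj S \<zeta> j * betaj S \<zeta> k * (Ttot S)\<^sup>2) * \<Sigma>
              + (if k > j then complex_of_real (betaj S \<zeta> j * betaj S \<zeta> k * (Ttot S)\<^sup>2) *
                   mtrace ((inv_state (sdim S) (Lcy S \<zeta>)) * compL S \<zeta> 1 j (phij S \<zeta> (Hprime S \<rho>p) j (compL S \<zeta> (j+1) k (Phi S \<zeta> k))))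
                 else 0)
              + (if j > k then complex_of_real (betaj S \<zeta> j * betaj S \<zeta> k * (Ttot S)\<^sup>2) *
                   mtrace ((inv_state (sdim S) (Lcy S \<zeta>)) * compL S \<zeta> 1 k (phij S \<zeta> (Hprime S \<rho>p) k (compL S \<zeta> (k+1) j (Phi S \<zeta> j))))
                 else 0)
              + (if j = k then complex_of_real ((betaj S \<zeta> j)\<^sup>2 * Ttot S) *
                   mtrace ((inv_state (sdim S) (Lcy S \<zeta>)) * compL S \<zeta> 1 j (Dj S \<zeta> j (Hprime S \<rho>p) (Hprime S \<rho>p)))
                 else 0)))"
      by (intro conjI ballI cy_response er)
  next
    assume er: "ER_ra S"
    then obtain P h where "ne_model S \<rho>p P h" using m by blast
    then interpret ne_model S \<rho>p P h .
    show "(\<forall>j \<in> {1..nenv S}. \<exists>D.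
          ((\<lambda>t. r_ra S \<zeta> (\<lambda>i. t * unitv j i)) has_real_derivative D) (at 0) \<and>
          complex_of_real D = complex_of_real (betaj S \<zeta> j * Ttot S / real (nenv S)) * mtrace ((inv_state (sdim S) (Lra S \<zeta>)) * Phi S \<zeta> j)) \<and>
      (\<forall>j \<in> {1..nenv S}. \<forall>k \<in> {1..nenv S}.
          (\<forall>\<^sub>F s in nhds 0. (\<lambda>t. r_ra S \<zeta> (\<lambda>i. s * unitv k i + t * unitv j i)) differentiable (at 0)) \<and>
          (\<exists>D \<Sigma>.
            ((\<lambda>s. pderiv_at (r_ra S \<zeta>) j (\<lambda>i. s * unitv k i)) has_real_derivative D) (at 0) \<and>
            (\<lambda>n. mtrace ((inv_state (sdim S) (Lra S \<zeta>)) *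
                 (phij S \<zeta> (Hprime S \<rho>p) j ((Lra_dual S \<zeta> ^^ n)
                     (Phi S \<zeta> k - mtrace ((inv_state (sdim S) (Lra S \<zeta>)) * Phi S \<zeta> k) \<cdot>\<^sub>m 1\<^sub>m (sdim S)))
                + phij S \<zeta> (Hprime S \<rho>p) k ((Lra_dual S \<zeta> ^^ n)
                     (Phi S \<zeta> j - mtrace ((inv_state (sdim S) (Lra S \<zeta>)) * Phi S \<zeta> j) \<cdot>\<^sub>m 1\<^sub>m (sdim S)))))) sums \<Sigma> \<and>
            complex_of_real D =
              complex_of_real (betaj S \<zeta> j * betaj S \<zeta> k * (Ttot S / real (nenv S))\<^sup>2) * \<Sigma>
              + (if j = k then complex_of_real ((betaj S \<zeta> j)\<^sup>2 * (Ttot S / real (nenv S))) *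
                   mtrace ((inv_state (sdim S) (Lra S \<zeta>)) * Dj S \<zeta> j (Hprime S \<rho>p) (Hprime S \<rho>p))
                 else 0)))"
      by (intro conjI ballI ra_response er)
  qed
qed

end
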